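(* The following are equivalent properties of a finitely complete (locally small) category $\mathcal C$: (1) $\mathcal C$ is $\Phi_{\mathrm{rc}}$-exact; (2) $\mathcal C$ is Barr-exact, and for every reflexive relation $R\rightarrowtail X\times X$ in $\mathcal C$, the chain $R\subseteq RR^oR\subseteq RR^oRR^oR\subseteq\cdots$ of subobjects of $X\times X$ has a pullback-stable colimit; (3) $\mathcal C$ is Barr-exact, and for every reflexive relation $R\rightarrowtail X\times X$ in $\mathcal C$, the chain $R\subseteq RR^oR\subseteq RR^oRR^oR\subseteq\cdots$ of subobjects of $X\times X$ has an effective, pullback-stable union.
   Context: All categories are ordinary locally small categories ($\mathcal V=\mathbf{Set}$); lex means finite-limit-preserving between finitely complete categories. A class of lex-weights $\Phi$ is a collection of functors $\phi:\mathcal K^{op}\to\mathbf{Set}$ with each $\mathcal K$ small and finitely complete. A $\Phi$-lex-colimit is a weighted colimit $\phi\star D$ with $\phi:\mathcal K^{op}\to\mathbf{Set}$ in $\Phi$ and $D$ a lex functor with domain $\mathcal K$. $\mathcal P\mathcal C$ is the category of small presheaves on $\mathcal C$ (presheaves that are left Kan extensions of their restriction to some small full subcategory); it is finitely complete if $\mathcal C$ is. For finitely complete $\mathcal C$, $\Phi_l\mathcal C$ is the smallest full replete subcategory of $\mathcal P\mathcal C$ containing the representables and closed under finite limits and $\Phi$-lex-colimits, and $W:\mathcal C\to\Phi_l\mathcal C$ is the restricted Yoneda embedding. $\mathcal C$ is $\Phi$-exact if it is finitely complete and $W$ has a finite-limit-preserving left adjoint. $\Phi_{\mathrm{rc}}$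 consists of the single functor $\phi:\mathcal K^{op}\to\mathbf{Set}$, where $\mathcal K$ is the free category with finite limits generated by a reflexive pair $(d,c):X\rightrightarrows Y$ (with common splitting $r:Y\to X$, $dr=cr=1$), and $\phi$ is the coequaliser in $[\mathcal K^{op},\mathbf{Set}]$ of $\mathcal K(-,d)$ and $\mathcal K(-,c)$. A finitely complete category is Barr-exact if it is regular (has coequalisers of kernel-pairs, and regular epimorphisms are stable under pullback) and every equivalence relation is a kernel-pair. In a regular category, $R^o$ denotes the opposite of an internal relation $R$ and juxtaposition denotes the usual composition of internal relations. A union of a chain of subobjects is effective if it is the colimit of the chain in $\mathcal C$. "Pullback-stable" means preserved by pullback along every map into the colimit (respectively union). *)

theory Defs
  imports "HOL-Library.FuncSet"
begin

section \<open>Categories, functors, natural transformations\<close>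

record ('o, 'a) cat =
  Ob  :: "'o set"
  Arr :: "'a set"
  Dom :: "'a \<Rightarrow> 'o"
  Cod :: "'a \<Rightarrow> 'o"
  Idt :: "'o \<Rightarrow> 'a"
  Cmp :: "'a \<Rightarrow> 'a \<Rightarrow> 'a"

text \<open>\<open>Cmp C g f\<close> is the composite \<open>g \<circ> f\<close> (first \<open>f\<close>, then \<open>g\<close>).\<close>

definition Hom :: "('o, 'a) cat \<Rightarrow> 'o \<Rightarrow> 'o \<Rightarrow> 'a set" where
  "Hom C x y = {f \<in> Arr C. Dom C f = x \<and> Cod C f = y}"

locale category =
  fixes C :: "('o, 'a) cat"
  assumes Dom_in: "f \<in> Arr C \<Longrightarrow> Dom C f \<in> Ob C"
    and Cod_in: "f \<in> Arr C \<Longrightarrow> Cod C f \<in> Ob C"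
    and Idt_in: "x \<in> Ob C \<Longrightarrow> Idt C x \<in> Hom C x x"
    and Cmp_in: "\<lbrakk>f \<in> Hom C x y; g \<in> Hom C y z\<rbrakk> \<Longrightarrow> Cmp C g f \<in> Hom C x z"
    and Cmp_Idt: "f \<in> Hom C x y \<Longrightarrow> Cmp C f (Idt C x) = f"
    and Idt_Cmp: "f \<in> Hom C x y \<Longrightarrow> Cmp C (Idt C y) f = f"
    and Cmp_assoc: "\<lbrakk>f \<in> Hom C w x; g \<in> Hom C x y; h \<in> Hom C y z\<rbrakk>
      \<Longrightarrow> Cmp C h (Cmp C g f) = Cmp C (Cmp C h g) f"

definition op_cat :: "('o, 'a) cat \<Rightarrow> ('o, 'a) cat" where
  "op_cat C = \<lparr>Ob = Ob C, Arr = Arr C, Dom = Cod C, Cod = Dom C, Idt = Idt C,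
     Cmp = (\<lambda>g f. Cmp C f g)\<rparr>"

definition full_subcat :: "('o, 'a) cat \<Rightarrow> 'o set \<Rightarrow> ('o, 'a) cat" where
  "full_subcat C S = C\<lparr>Ob := Ob C \<inter> S, Arr := {f \<in> Arr C. Dom C f \<in> S \<and> Cod C f \<in> S}\<rparr>"

definition is_inverse_pair :: "('o, 'a) cat \<Rightarrow> 'a \<Rightarrow> 'a \<Rightarrow> bool" where
  "is_inverse_pair C f g \<longleftrightarrow> f \<in> Arr C \<and> g \<in> Hom C (Cod C f) (Dom C f) \<and>
     Cmp C g f = Idt C (Dom C f) \<and> Cmp C f g = Idt C (Cod C f)"

definition is_iso :: "('o, 'a) cat \<Rightarrow> 'a \<Rightarrow> bool" where
  "is_iso C f \<longleftrightarrow> (\<exists>g. is_inverse_pair C f g)"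

record ('o, 'a, 'p, 'b) fctr =
  fob  :: "'o \<Rightarrow> 'p"
  farr :: "'a \<Rightarrow> 'b"

definition is_functor :: "('o, 'a) cat \<Rightarrow> ('p, 'b) cat \<Rightarrow> ('o, 'a, 'p, 'b) fctr \<Rightarrow> bool" where
  "is_functor A B F \<longleftrightarrow> category A \<and> category B \<and>
     (\<forall>x \<in> Ob A. fob F x \<in> Ob B) \<and>
     (\<forall>x y. \<forall>f \<in> Hom A x y. farr F f \<in> Hom B (fob F x) (fob F y)) \<and>
     (\<forall>x \<in> Ob A. farr F (Idt A x) = Idt B (fob F x)) \<and>
     (\<forall>x y z. \<forall>f \<in> Hom A x y. \<forall>g \<in> Hom A y z.
        farr F (Cmp A g f) = Cmp B (farr F g) (farr F f))"

definition id_fctr :: "('o, 'a, 'o, 'a) fctr" where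
  "id_fctr = \<lparr>fob = (\<lambda>x. x), farr = (\<lambda>f. f)\<rparr>"

text \<open>\<open>comp_fctr G F\<close> is \<open>G \<circ> F\<close>. The functor \<open>id_fctr\<close> also serves as the inclusion of any
  subcategory.\<close>

definition comp_fctr :: "('p, 'b, 'q, 'c) fctr \<Rightarrow> ('o, 'a, 'p, 'b) fctr \<Rightarrow> ('o, 'a, 'q, 'c) fctr" where
  "comp_fctr G F = \<lparr>fob = (\<lambda>x. fob G (fob F x)), farr = (\<lambda>f. farr G (farr F f))\<rparr>"

definition nat_trans :: "('o, 'a) cat \<Rightarrow> ('p, 'b) cat \<Rightarrow> ('o, 'a, 'p, 'b) fctr \<Rightarrow>
    ('o, 'a, 'p, 'b) fctr \<Rightarrow> ('o \<Rightarrow> 'b) \<Rightarrow> bool" where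
  "nat_trans A B F G \<alpha> \<longleftrightarrow> is_functor A B F \<and> is_functor A B G \<and>
     \<alpha> \<in> extensional (Ob A) \<and>
     (\<forall>x \<in> Ob A. \<alpha> x \<in> Hom B (fob F x) (fob G x)) \<and>
     (\<forall>x y. \<forall>f \<in> Hom A x y. Cmp B (\<alpha> y) (farr F f) = Cmp B (farr G f) (\<alpha> x))"

text \<open>Natural transformations are extensional, so they are determined by their components on
  objects of \<open>A\<close>. Functors are not normalised outside \<open>A\<close>: two functors that agree on \<open>A\<close> may be
  distinct objects of \<open>functor_cat A B\<close>, but are then isomorphic there by identity components.\<close>

definition functor_cat :: "('o, 'a) cat \<Rightarrow> ('p, 'b) cat \<Rightarrow>
    (('o, 'a, 'p, 'b) fctr,
     ('o, 'a, 'p, 'b) fctr \<times> ('o, 'a, 'p, 'b) fctr \<times> ('o \<Rightarrow> 'b)) cat" where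
  "functor_cat A B =
     \<lparr>Ob = {F. is_functor A B F},
      Arr = {(F, G, \<alpha>). nat_trans A B F G \<alpha>},
      Dom = (\<lambda>t. fst t),
      Cod = (\<lambda>t. fst (snd t)),
      Idt = (\<lambda>F. (F, F, \<lambda>x\<in>Ob A. Idt B (fob F x))),
      Cmp = (\<lambda>t s. (fst s, fst (snd t), \<lambda>x\<in>Ob A. Cmp B (snd (snd t) x) (snd (snd s) x)))\<rparr>"

text \<open>\<open>is_adjunction A B L R \<eta>\<close>: the functor \<open>L : A \<rightarrow> B\<close> is left adjoint to \<open>R : B \<rightarrow> A\<close> with
  unit \<open>\<eta>\<close>.\<close>

definition is_adjunction :: "('o, 'a) cat \<Rightarrow> ('p, 'b) cat \<Rightarrow> ('o, 'a, 'p, 'b) fctr \<Rightarrow>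
    ('p, 'b, 'o, 'a) fctr \<Rightarrow> ('o \<Rightarrow> 'a) \<Rightarrow> bool" where
  "is_adjunction A B L R \<eta> \<longleftrightarrow> is_functor A B L \<and> is_functor B A R \<and>
     nat_trans A A id_fctr (comp_fctr R L) \<eta> \<and>
     (\<forall>x \<in> Ob A. \<forall>y \<in> Ob B. \<forall>f \<in> Hom A x (fob R y).
        \<exists>!g. g \<in> Hom B (fob L x) y \<and> Cmp A (farr R g) (\<eta> x) = f)"

text \<open>\<open>is_left_kan_extension A B E J F L \<eta>\<close>: the functor \<open>L : B \<rightarrow> E\<close> with \<open>\<eta> : F \<Rightarrow> L J\<close> is a left
  Kan extension of \<open>F : A \<rightarrow> E\<close> along \<open>J : A \<rightarrow> B\<close>.\<close>

definition is_left_kan_extension :: "('o, 'a) cat \<Rightarrow> ('p, 'b) cat \<Rightarrow> ('q, 'c) cat \<Rightarrow>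
    ('o, 'a, 'p, 'b) fctr \<Rightarrow> ('o, 'a, 'q, 'c) fctr \<Rightarrow> ('p, 'b, 'q, 'c) fctr \<Rightarrow> ('o \<Rightarrow> 'c) \<Rightarrow> bool" where
  "is_left_kan_extension A B E J F L \<eta> \<longleftrightarrow>
     is_functor A B J \<and> is_functor B E L \<and> nat_trans A E F (comp_fctr L J) \<eta> \<and>
     (\<forall>G \<alpha>. is_functor B E G \<and> nat_trans A E F (comp_fctr G J) \<alpha> \<longrightarrow>
        (\<exists>!\<beta>. nat_trans B E L G \<beta> \<and> (\<forall>a \<in> Ob A. \<alpha> a = Cmp E (\<beta> (fob J a)) (\<eta> a))))"


section \<open>Limits and colimits\<close>

definition is_cone :: "('j, 'k) cat \<Rightarrow> ('o, 'a) cat \<Rightarrow> ('j, 'k, 'o, 'a) fctr \<Rightarrow> 'o \<Rightarrow> ('j \<Rightarrow> 'a) \<Rightarrow> bool" where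
  "is_cone J C F x l \<longleftrightarrow> x \<in> Ob C \<and> (\<forall>j \<in> Ob J. l j \<in> Hom C x (fob F j)) \<and>
     (\<forall>i j. \<forall>f \<in> Hom J i j. Cmp C (farr F f) (l i) = l j)"

definition is_limit :: "('j, 'k) cat \<Rightarrow> ('o, 'a) cat \<Rightarrow> ('j, 'k, 'o, 'a) fctr \<Rightarrow> 'o \<Rightarrow> ('j \<Rightarrow> 'a) \<Rightarrow> bool" where
  "is_limit J C F x l \<longleftrightarrow> is_cone J C F x l \<and>
     (\<forall>y m. is_cone J C F y m \<longrightarrow>
        (\<exists>!h. h \<in> Hom C y x \<and> (\<forall>j \<in> Ob J. Cmp C (l j) h = m j)))"

text \<open>Every finite category is isomorphic to one whose objects and arrows are natural numbers, so
  diagrams of this type account for all finite limits.\<close>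

definition finite_diagram :: "(nat, nat) cat \<Rightarrow> ('o, 'a) cat \<Rightarrow> (nat, nat, 'o, 'a) fctr \<Rightarrow> bool" where
  "finite_diagram J C F \<longleftrightarrow> finite (Ob J) \<and> finite (Arr J) \<and> is_functor J C F"

definition finitely_complete :: "('o, 'a) cat \<Rightarrow> bool" where
  "finitely_complete C \<longleftrightarrow> category C \<and> (\<forall>J F. finite_diagram J C F \<longrightarrow> (\<exists>x l. is_limit J C F x l))"

definition lex_functor :: "('o, 'a) cat \<Rightarrow> ('p, 'b) cat \<Rightarrow> ('o, 'a, 'p, 'b) fctr \<Rightarrow> bool" where
  "lex_functor A B F \<longleftrightarrow> finitely_complete A \<and> finitely_complete B \<and> is_functor A B F \<and>
     (\<forall>J D x l. finite_diagram J A D \<and> is_limit J A D x l \<longrightarrow>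
        is_limit J B (comp_fctr F D) (fob F x) (\<lambda>j. farr F (l j)))"

definition is_product :: "('o, 'a) cat \<Rightarrow> 'o \<Rightarrow> 'o \<Rightarrow> 'o \<Rightarrow> 'a \<Rightarrow> 'a \<Rightarrow> bool" where
  "is_product C X Y P p q \<longleftrightarrow> p \<in> Hom C P X \<and> q \<in> Hom C P Y \<and>
     (\<forall>Z. \<forall>f \<in> Hom C Z X. \<forall>g \<in> Hom C Z Y.
        \<exists>!h. h \<in> Hom C Z P \<and> Cmp C p h = f \<and> Cmp C q h = g)"

definition is_pullback :: "('o, 'a) cat \<Rightarrow> 'a \<Rightarrow> 'a \<Rightarrow> 'a \<Rightarrow> 'a \<Rightarrow> bool" where
  "is_pullback C f g p q \<longleftrightarrow> f \<in> Arr C \<and> g \<in> Arr C \<and> Cod C f = Cod C g \<and>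
     p \<in> Hom C (Dom C p) (Dom C f) \<and> q \<in> Hom C (Dom C p) (Dom C g) \<and>
     Cmp C f p = Cmp C g q \<and>
     (\<forall>Z. \<forall>a \<in> Hom C Z (Dom C f). \<forall>b \<in> Hom C Z (Dom C g). Cmp C f a = Cmp C g b \<longrightarrow>
        (\<exists>!h. h \<in> Hom C Z (Dom C p) \<and> Cmp C p h = a \<and> Cmp C q h = b))"

definition is_coequaliser :: "('o, 'a) cat \<Rightarrow> 'a \<Rightarrow> 'a \<Rightarrow> 'a \<Rightarrow> bool" where
  "is_coequaliser C f g e \<longleftrightarrow> f \<in> Arr C \<and> g \<in> Hom C (Dom C f) (Cod C f) \<and>
     e \<in> Hom C (Cod C f) (Cod C e) \<and> Cmp C e f = Cmp C e g \<and>
     (\<forall>Z. \<forall>h \<in> Hom C (Cod C f) Z. Cmp C h f = Cmp C h g \<longrightarrow>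
        (\<exists>!k. k \<in> Hom C (Cod C e) Z \<and> Cmp C k e = h))"

text \<open>Colimits of \<open>A 0 \<rightarrow> A 1 \<rightarrow> A 2 \<rightarrow> \<dots>\<close> with transition maps \<open>i n : A n \<rightarrow> A (n + 1)\<close>.\<close>

definition is_chain_cocone :: "('o, 'a) cat \<Rightarrow> (nat \<Rightarrow> 'o) \<Rightarrow> (nat \<Rightarrow> 'a) \<Rightarrow> 'o \<Rightarrow> (nat \<Rightarrow> 'a) \<Rightarrow> bool" where
  "is_chain_cocone C A i Q j \<longleftrightarrow> Q \<in> Ob C \<and> (\<forall>n. i n \<in> Hom C (A n) (A (Suc n))) \<and>
     (\<forall>n. j n \<in> Hom C (A n) Q) \<and> (\<forall>n. Cmp C (j (Suc n)) (i n) = j n)"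

definition is_chain_colimit :: "('o, 'a) cat \<Rightarrow> (nat \<Rightarrow> 'o) \<Rightarrow> (nat \<Rightarrow> 'a) \<Rightarrow> 'o \<Rightarrow> (nat \<Rightarrow> 'a) \<Rightarrow> bool" where
  "is_chain_colimit C A i Q j \<longleftrightarrow> is_chain_cocone C A i Q j \<and>
     (\<forall>Z k. is_chain_cocone C A i Z k \<longrightarrow>
        (\<exists>!h. h \<in> Hom C Q Z \<and> (\<forall>n. Cmp C h (j n) = k n)))"

text \<open>In the next definition \<open>b n\<close> is the pullback of \<open>j n\<close> along \<open>g : Z \<rightarrow> Q\<close>, and the \<open>t n\<close> are the
  transition maps induced between these pullbacks.\<close>

definition is_stable_chain_colimit :: "('o, 'a) cat \<Rightarrow> (nat \<Rightarrow> 'o) \<Rightarrow> (nat \<Rightarrow> 'a) \<Rightarrow> 'o \<Rightarrow> (nat \<Rightarrow> 'a) \<Rightarrow> bool" where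
  "is_stable_chain_colimit C A i Q j \<longleftrightarrow> is_chain_colimit C A i Q j \<and>
     (\<forall>Z. \<forall>g \<in> Hom C Z Q. \<forall>b l t.
        (\<forall>n. is_pullback C g (j n) (b n) (l n)) \<and>
        (\<forall>n. t n \<in> Hom C (Dom C (b n)) (Dom C (b (Suc n))) \<and>
             Cmp C (b (Suc n)) (t n) = b n \<and>
             Cmp C (l (Suc n)) (t n) = Cmp C (i n) (l n)) \<longrightarrow>
        is_chain_colimit C (\<lambda>n. Dom C (b n)) t Z b)"


section \<open>Small sets and the category of sets\<close>

text \<open>The small sets are the members of a universe \<open>U\<close> of sets over some type. The closure
  conditions below are satisfied by Grothendieck universes containing an infinite set; closure
  under power sets is omitted, so that such a \<open>U\<close> exists over every infinite type (for example
  \<open>UNIV\<close>, or the countable sets). Binary products of small sets are small up to bijection, as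
  unions of small families.\<close>

definition universe :: "'u set set \<Rightarrow> bool" where
  "universe U \<longleftrightarrow> (\<exists>A \<in> U. infinite A) \<and>
     (\<forall>A \<in> U. \<forall>B. B \<subseteq> A \<longrightarrow> B \<in> U) \<and>
     (\<forall>A \<in> U. \<forall>f. f ` A \<in> U) \<and>
     (\<forall>A \<in> U. \<forall>F. (\<forall>a \<in> A. F a \<in> U) \<longrightarrow> (\<Union>a \<in> A. F a) \<in> U)"

definition small :: "'u set set \<Rightarrow> 'x set \<Rightarrow> bool" where
  "small U S \<longleftrightarrow> (\<exists>e :: 'x \<Rightarrow> 'u. inj_on e S \<and> e ` S \<in> U)"

definition locally_small :: "'u set set \<Rightarrow> ('o, 'a) cat \<Rightarrow> bool" where
  "locally_small U C \<longleftrightarrow> (\<forall>x \<in> Ob C. \<forall>y \<in> Ob C. small U (Hom C x y))"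

type_synonym 'u setmap = "'u set \<times> ('u \<Rightarrow> 'u) \<times> 'u set"

definition ap :: "'u setmap \<Rightarrow> 'u \<Rightarrow> 'u" where
  "ap t = fst (snd t)"

definition Set_cat :: "'u set set \<Rightarrow> ('u set, 'u setmap) cat" where
  "Set_cat U =
     \<lparr>Ob = U,
      Arr = {(A, f, B). A \<in> U \<and> B \<in> U \<and> f \<in> A \<rightarrow>\<^sub>E B},
      Dom = (\<lambda>t. fst t),
      Cod = (\<lambda>t. snd (snd t)),
      Idt = (\<lambda>A. (A, \<lambda>u\<in>A. u, A)),
      Cmp = (\<lambda>t s. (fst s, compose (fst s) (ap t) (ap s), snd (snd t)))\<rparr>"


section \<open>Presheaves\<close>

type_synonym ('o, 'a, 'u) presheaf = "('o, 'a, 'u set, 'u setmap) fctr"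

type_synonym ('o, 'a, 'u) presheaf_map =
  "('o, 'a, 'u) presheaf \<times> ('o, 'a, 'u) presheaf \<times> ('o \<Rightarrow> 'u setmap)"

definition presheaf_cat :: "'u set set \<Rightarrow> ('o, 'a) cat \<Rightarrow>
    (('o, 'a, 'u) presheaf, ('o, 'a, 'u) presheaf_map) cat" where
  "presheaf_cat U C = functor_cat (op_cat C) (Set_cat U)"

definition small_presheaf :: "'u set set \<Rightarrow> ('o, 'a) cat \<Rightarrow> ('o, 'a, 'u) presheaf \<Rightarrow> bool" where
  "small_presheaf U C F \<longleftrightarrow> is_functor (op_cat C) (Set_cat U) F \<and>
     (\<exists>S \<eta>. S \<subseteq> Ob C \<and> small U S \<and>
        is_left_kan_extension (op_cat (full_subcat C S)) (op_cat C) (Set_cat U)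
          id_fctr (comp_fctr F id_fctr) F \<eta>)"

definition P_cat :: "'u set set \<Rightarrow> ('o, 'a) cat \<Rightarrow>
    (('o, 'a, 'u) presheaf, ('o, 'a, 'u) presheaf_map) cat" where
  "P_cat U C = full_subcat (presheaf_cat U C) {F. small_presheaf U C F}"

text \<open>The hom-sets of \<open>C\<close> live in the arrow type of \<open>C\<close>; representables take values in \<open>U\<close> via a
  chosen bijection \<open>code U H\<close> of each small hom-set \<open>H\<close> with a member of \<open>U\<close>. The choice only
  affects representables up to isomorphism.\<close>

definition code :: "'u set set \<Rightarrow> 'x set \<Rightarrow> 'x \<Rightarrow> 'u" where
  "code U H = (SOME e. inj_on e H \<and> e ` H \<in> U)"

definition coded :: "'u set set \<Rightarrow> 'x set \<Rightarrow> 'u set" where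
  "coded U H = code U H ` H"

definition coded_map :: "'u set set \<Rightarrow> 'x set \<Rightarrow> 'x set \<Rightarrow> ('x \<Rightarrow> 'x) \<Rightarrow> 'u setmap" where
  "coded_map U H K f =
     (coded U H, \<lambda>u \<in> coded U H. code U K (f (inv_into H (code U H) u)), coded U K)"

definition representable :: "'u set set \<Rightarrow> ('o, 'a) cat \<Rightarrow> 'o \<Rightarrow> ('o, 'a, 'u) presheaf" where
  "representable U C c =
     \<lparr>fob = (\<lambda>x. coded U (Hom C x c)),
      farr = (\<lambda>f. coded_map U (Hom C (Cod C f) c) (Hom C (Dom C f) c) (\<lambda>h. Cmp C h f))\<rparr>"

definition yoneda :: "'u set set \<Rightarrow> ('o, 'a) cat \<Rightarrow>
    ('o, 'a, ('o, 'a, 'u) presheaf, ('o, 'a, 'u) presheaf_map) fctr" where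
  "yoneda U C =
     \<lparr>fob = representable U C,
      farr = (\<lambda>g. (representable U C (Dom C g), representable U C (Cod C g),
        \<lambda>x\<in>Ob C. coded_map U (Hom C x (Dom C g)) (Hom C x (Cod C g)) (\<lambda>h. Cmp C g h)))\<rparr>"


section \<open>Weighted colimits and exactness\<close>

text \<open>\<open>is_weighted_colimit U K w E D z \<iota>\<close>: the object \<open>z\<close> of \<open>E\<close> is the colimit of \<open>D : K \<rightarrow> E\<close>
  weighted by \<open>w : K\<^sup>o\<^sup>p \<rightarrow> Set\<close>, with unit \<open>\<iota> : w \<Rightarrow> E(D-, z)\<close>; i.e. composing with \<open>\<iota>\<close> is a bijection
  from \<open>E(z, e)\<close> to the set of natural transformations \<open>w \<Rightarrow> E(D-, e)\<close>.\<close>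

definition is_weighted_cocone :: "'u set set \<Rightarrow> ('k, 'l) cat \<Rightarrow> ('k, 'l, 'u) presheaf \<Rightarrow> ('o, 'a) cat \<Rightarrow>
    ('k, 'l, 'o, 'a) fctr \<Rightarrow> 'o \<Rightarrow> ('k \<Rightarrow> 'u \<Rightarrow> 'a) \<Rightarrow> bool" where
  "is_weighted_cocone U K w E D z \<iota> \<longleftrightarrow>
     is_functor (op_cat K) (Set_cat U) w \<and> is_functor K E D \<and> z \<in> Ob E \<and>
     (\<forall>k \<in> Ob K. \<forall>x \<in> fob w k. \<iota> k x \<in> Hom E (fob D k) z) \<and>
     (\<forall>k k'. \<forall>f \<in> Hom K k k'. \<forall>x \<in> fob w k'.
        \<iota> k (ap (farr w f) x) = Cmp E (\<iota> k' x) (farr D f))"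

definition is_weighted_colimit :: "'u set set \<Rightarrow> ('k, 'l) cat \<Rightarrow> ('k, 'l, 'u) presheaf \<Rightarrow> ('o, 'a) cat \<Rightarrow>
    ('k, 'l, 'o, 'a) fctr \<Rightarrow> 'o \<Rightarrow> ('k \<Rightarrow> 'u \<Rightarrow> 'a) \<Rightarrow> bool" where
  "is_weighted_colimit U K w E D z \<iota> \<longleftrightarrow> is_weighted_cocone U K w E D z \<iota> \<and>
     (\<forall>e \<kappa>. is_weighted_cocone U K w E D e \<kappa> \<longrightarrow>
        (\<exists>!h. h \<in> Hom E z e \<and> (\<forall>k \<in> Ob K. \<forall>x \<in> fob w k. Cmp E h (\<iota> k x) = \<kappa> k x)))"

definition small_category :: "'u set set \<Rightarrow> ('u, 'u) cat \<Rightarrow> bool" where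
  "small_category U K \<longleftrightarrow> category K \<and> Ob K \<in> U \<and> Arr K \<in> U"

text \<open>A class of lex-weights is a set of pairs \<open>(K, w)\<close> with \<open>w : K\<^sup>o\<^sup>p \<rightarrow> Set\<close> and \<open>K\<close> small and finitely
  complete. Every small category is isomorphic to one with objects and arrows in \<open>'u\<close>.\<close>

type_synonym 'u weights = "(('u, 'u) cat \<times> ('u, 'u, 'u) presheaf) set"

definition lex_weights :: "'u set set \<Rightarrow> 'u weights \<Rightarrow> bool" where
  "lex_weights U \<Phi> \<longleftrightarrow> (\<forall>(K, w) \<in> \<Phi>. small_category U K \<and> finitely_complete K \<and>
     is_functor (op_cat K) (Set_cat U) w)"

definition Phi_closed :: "'u set set \<Rightarrow> 'u weights \<Rightarrow> ('o, 'a) cat \<Rightarrow> ('o, 'a, 'u) presheaf set \<Rightarrow> bool" where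
  "Phi_closed U \<Phi> C S \<longleftrightarrow> S \<subseteq> Ob (P_cat U C) \<and>
     (\<forall>f. is_iso (P_cat U C) f \<and> Dom (P_cat U C) f \<in> S \<longrightarrow> Cod (P_cat U C) f \<in> S) \<and>
     (\<forall>c \<in> Ob C. representable U C c \<in> S) \<and>
     (\<forall>J F x l. finite_diagram J (P_cat U C) F \<and> fob F ` Ob J \<subseteq> S \<and>
        is_limit J (P_cat U C) F x l \<longrightarrow> x \<in> S) \<and>
     (\<forall>(K, w) \<in> \<Phi>. \<forall>D z \<iota>. lex_functor K (P_cat U C) D \<and> fob D ` Ob K \<subseteq> S \<and>
        is_weighted_colimit U K w (P_cat U C) D z \<iota> \<longrightarrow> z \<in> S)"

definition Phi_l :: "'u set set \<Rightarrow> 'u weights \<Rightarrow> ('o, 'a) cat \<Rightarrow>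
    (('o, 'a, 'u) presheaf, ('o, 'a, 'u) presheaf_map) cat" where
  "Phi_l U \<Phi> C = full_subcat (P_cat U C) (\<Inter>{S. Phi_closed U \<Phi> C S})"

definition Phi_exact :: "'u set set \<Rightarrow> 'u weights \<Rightarrow> ('o, 'a) cat \<Rightarrow> bool" where
  "Phi_exact U \<Phi> C \<longleftrightarrow> finitely_complete C \<and>
     (\<exists>L \<eta>. is_adjunction (Phi_l U \<Phi> C) C L (yoneda U C) \<eta> \<and> lex_functor (Phi_l U \<Phi> C) C L)"


section \<open>The class of weights for reflexive coequalisers\<close>

definition is_reflexive_pair :: "('o, 'a) cat \<Rightarrow> 'o \<Rightarrow> 'o \<Rightarrow> 'a \<Rightarrow> 'a \<Rightarrow> 'a \<Rightarrow> bool" where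
  "is_reflexive_pair E X Y d c r \<longleftrightarrow> d \<in> Hom E X Y \<and> c \<in> Hom E X Y \<and> r \<in> Hom E Y X \<and>
     Cmp E d r = Idt E Y \<and> Cmp E c r = Idt E Y"

text \<open>Freeness is the usual bicategorical universal property: evaluation at \<open>(d, c, r)\<close> is an
  equivalence from lex functors \<open>K \<rightarrow> E\<close> to reflexive pairs in \<open>E\<close>, i.e. it is essentially surjective
  (first clause) and fully faithful (second clause), for every small finitely complete \<open>E\<close>.\<close>

definition free_lex_on_reflexive_pair ::
    "'u set set \<Rightarrow> ('u, 'u) cat \<Rightarrow> 'u \<Rightarrow> 'u \<Rightarrow> 'u \<Rightarrow> 'u \<Rightarrow> 'u \<Rightarrow> bool" where
  "free_lex_on_reflexive_pair U K X Y d c r \<longleftrightarrow>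
     small_category U K \<and> finitely_complete K \<and> is_reflexive_pair K X Y d c r \<and>
     (\<forall>E :: ('u, 'u) cat. small_category U E \<and> finitely_complete E \<longrightarrow>
        (\<forall>X' Y' d' c' r'. is_reflexive_pair E X' Y' d' c' r' \<longrightarrow>
           (\<exists>F a b. lex_functor K E F \<and>
              a \<in> Hom E (fob F X) X' \<and> is_iso E a \<and> b \<in> Hom E (fob F Y) Y' \<and> is_iso E b \<and>
              Cmp E b (farr F d) = Cmp E d' a \<and>
              Cmp E b (farr F c) = Cmp E c' a \<and>
              Cmp E a (farr F r) = Cmp E r' b)) \<and>
        (\<forall>F G a b. lex_functor K E F \<and> lex_functor K E G \<and>
              a \<in> Hom E (fob F X) (fob G X) \<and> b \<in> Hom E (fob F Y) (fob G Y) \<and>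
              Cmp E b (farr F d) = Cmp E (farr G d) a \<and>
              Cmp E b (farr F c) = Cmp E (farr G c) a \<and>
              Cmp E a (farr F r) = Cmp E (farr G r) b \<longrightarrow>
           (\<exists>!\<alpha>. nat_trans K E F G \<alpha> \<and> \<alpha> X = a \<and> \<alpha> Y = b)))"

text \<open>Since \<open>K\<close> and the coequaliser are only determined up to equivalence, this is a predicate: it
  holds of the singleton class given by any choice of them.\<close>

definition is_Phi_rc :: "'u set set \<Rightarrow> 'u weights \<Rightarrow> bool" where
  "is_Phi_rc U \<Phi> \<longleftrightarrow> (\<exists>K X Y d c r e. free_lex_on_reflexive_pair U K X Y d c r \<and>
     is_coequaliser (presheaf_cat U K) (farr (yoneda U K) d) (farr (yoneda U K) c) e \<and>
     \<Phi> = {(K, Cod (presheaf_cat U K) e)})"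


lemma lex_weights_Phi_rc:
  assumes "is_Phi_rc U \<Phi>"
  shows "lex_weights U \<Phi>"
  using assms
  by (auto simp: is_Phi_rc_def lex_weights_def free_lex_on_reflexive_pair_def is_coequaliser_def
      presheaf_cat_def functor_cat_def Hom_def nat_trans_def)


section \<open>Barr-exactness\<close>

definition monic :: "('o, 'a) cat \<Rightarrow> 'a \<Rightarrow> bool" where
  "monic C m \<longleftrightarrow> m \<in> Arr C \<and>
     (\<forall>Z. \<forall>f \<in> Hom C Z (Dom C m). \<forall>g \<in> Hom C Z (Dom C m). Cmp C m f = Cmp C m g \<longrightarrow> f = g)"

definition regular_epi :: "('o, 'a) cat \<Rightarrow> 'a \<Rightarrow> bool" where
  "regular_epi C e \<longleftrightarrow> (\<exists>f g. is_coequaliser C f g e)"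

definition regular_category :: "('o, 'a) cat \<Rightarrow> bool" where
  "regular_category C \<longleftrightarrow> finitely_complete C \<and>
     (\<forall>f k k'. is_pullback C f f k k' \<longrightarrow> (\<exists>e. is_coequaliser C k k' e)) \<and>
     (\<forall>e g p q. regular_epi C e \<and> is_pullback C g e p q \<longrightarrow> regular_epi C p)"

text \<open>\<open>relation_on C X P p q r\<close>: \<open>r\<close> is a monomorphism into the product \<open>(P, p, q)\<close> of \<open>X\<close> with itself.\<close>

definition relation_on :: "('o, 'a) cat \<Rightarrow> 'o \<Rightarrow> 'o \<Rightarrow> 'a \<Rightarrow> 'a \<Rightarrow> 'a \<Rightarrow> bool" where
  "relation_on C X P p q r \<longleftrightarrow> is_product C X X P p q \<and> monic C r \<and> Cod C r = P"

definition reflexive_relation :: "('o, 'a) cat \<Rightarrow> 'o \<Rightarrow> 'o \<Rightarrow> 'a \<Rightarrow> 'a \<Rightarrow> 'a \<Rightarrow> bool" where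
  "reflexive_relation C X P p q r \<longleftrightarrow> relation_on C X P p q r \<and>
     (\<exists>s \<in> Hom C X (Dom C r). Cmp C (Cmp C p r) s = Idt C X \<and> Cmp C (Cmp C q r) s = Idt C X)"

definition symmetric_relation :: "('o, 'a) cat \<Rightarrow> 'o \<Rightarrow> 'o \<Rightarrow> 'a \<Rightarrow> 'a \<Rightarrow> 'a \<Rightarrow> bool" where
  "symmetric_relation C X P p q r \<longleftrightarrow> relation_on C X P p q r \<and>
     (\<exists>s \<in> Hom C (Dom C r) (Dom C r).
        Cmp C (Cmp C p r) s = Cmp C q r \<and> Cmp C (Cmp C q r) s = Cmp C p r)"

definition transitive_relation :: "('o, 'a) cat \<Rightarrow> 'o \<Rightarrow> 'o \<Rightarrow> 'a \<Rightarrow> 'a \<Rightarrow> 'a \<Rightarrow> bool" where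
  "transitive_relation C X P p q r \<longleftrightarrow> relation_on C X P p q r \<and>
     (\<forall>a b. is_pullback C (Cmp C q r) (Cmp C p r) a b \<longrightarrow>
        (\<exists>t \<in> Hom C (Dom C a) (Dom C r).
           Cmp C (Cmp C p r) t = Cmp C (Cmp C p r) a \<and>
           Cmp C (Cmp C q r) t = Cmp C (Cmp C q r) b))"

definition equivalence_relation :: "('o, 'a) cat \<Rightarrow> 'o \<Rightarrow> 'o \<Rightarrow> 'a \<Rightarrow> 'a \<Rightarrow> 'a \<Rightarrow> bool" where
  "equivalence_relation C X P p q r \<longleftrightarrow> reflexive_relation C X P p q r \<and>
     symmetric_relation C X P p q r \<and> transitive_relation C X P p q r"

definition Barr_exact :: "('o, 'a) cat \<Rightarrow> bool" where
  "Barr_exact C \<longleftrightarrow> regular_category C \<and>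
     (\<forall>X P p q r. equivalence_relation C X P p q r \<longrightarrow>
        (\<exists>f. is_pullback C f f (Cmp C p r) (Cmp C q r)))"


section \<open>Zigzag chains of a reflexive relation\<close>

definition opposite_relation :: "('o, 'a) cat \<Rightarrow> 'o \<Rightarrow> 'o \<Rightarrow> 'a \<Rightarrow> 'a \<Rightarrow> 'a \<Rightarrow> 'a \<Rightarrow> bool" where
  "opposite_relation C X P p q r r' \<longleftrightarrow> relation_on C X P p q r \<and> relation_on C X P p q r' \<and>
     Dom C r' = Dom C r \<and> Cmp C p r' = Cmp C q r \<and> Cmp C q r' = Cmp C p r"

text \<open>\<open>t\<close> relates \<open>x\<close> to \<open>z\<close> iff \<open>x r y\<close> and \<open>y s z\<close> for some \<open>y\<close>: it is the image in \<open>X \<times> X\<close> of the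
  pullback of the second leg of \<open>r\<close> and the first leg of \<open>s\<close>. The words \<open>RR\<^sup>oR\<dots>R\<close> below are
  palindromes, so the choice between this and the reverse order of composition is immaterial.\<close>

definition composite_relation :: "('o, 'a) cat \<Rightarrow> 'o \<Rightarrow> 'o \<Rightarrow> 'a \<Rightarrow> 'a \<Rightarrow> 'a \<Rightarrow> 'a \<Rightarrow> 'a \<Rightarrow> bool" where
  "composite_relation C X P p q r s t \<longleftrightarrow>
     relation_on C X P p q r \<and> relation_on C X P p q s \<and> relation_on C X P p q t \<and>
     (\<exists>a b e. is_pullback C (Cmp C q r) (Cmp C p s) a b \<and>
        e \<in> Hom C (Dom C a) (Dom C t) \<and> regular_epi C e \<and>
        Cmp C (Cmp C p t) e = Cmp C (Cmp C p r) a \<and>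
        Cmp C (Cmp C q t) e = Cmp C (Cmp C q s) b)"

text \<open>The \<open>m n\<close> represent the subobjects \<open>R\<close>, \<open>RR\<^sup>oR\<close>, \<open>RR\<^sup>oRR\<^sup>oR\<close>, \<dots> of \<open>P = X \<times> X\<close>.\<close>

definition zigzag_chain :: "('o, 'a) cat \<Rightarrow> 'o \<Rightarrow> 'o \<Rightarrow> 'a \<Rightarrow> 'a \<Rightarrow> 'a \<Rightarrow> (nat \<Rightarrow> 'a) \<Rightarrow> bool" where
  "zigzag_chain C X P p q r m \<longleftrightarrow> m 0 = r \<and>
     (\<exists>r' s. opposite_relation C X P p q r r' \<and> composite_relation C X P p q r r' s \<and>
        (\<forall>n. composite_relation C X P p q s (m n) (m (Suc n))))"

definition subobject_le :: "('o, 'a) cat \<Rightarrow> 'a \<Rightarrow> 'a \<Rightarrow> bool" where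
  "subobject_le C m u \<longleftrightarrow> (\<exists>i \<in> Hom C (Dom C m) (Dom C u). Cmp C u i = m)"

definition inclusion :: "('o, 'a) cat \<Rightarrow> 'a \<Rightarrow> 'a \<Rightarrow> 'a" where
  "inclusion C m u = (THE i. i \<in> Hom C (Dom C m) (Dom C u) \<and> Cmp C u i = m)"

definition transition :: "('o, 'a) cat \<Rightarrow> (nat \<Rightarrow> 'a) \<Rightarrow> nat \<Rightarrow> 'a" where
  "transition C m n = inclusion C (m n) (m (Suc n))"

definition is_union :: "('o, 'a) cat \<Rightarrow> 'o \<Rightarrow> (nat \<Rightarrow> 'a) \<Rightarrow> 'a \<Rightarrow> bool" where
  "is_union C P m u \<longleftrightarrow> monic C u \<and> Cod C u = P \<and> (\<forall>n. subobject_le C (m n) u) \<and>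
     (\<forall>v. monic C v \<and> Cod C v = P \<and> (\<forall>n. subobject_le C (m n) v) \<longrightarrow> subobject_le C u v)"

definition is_effective_union :: "('o, 'a) cat \<Rightarrow> 'o \<Rightarrow> (nat \<Rightarrow> 'a) \<Rightarrow> 'a \<Rightarrow> bool" where
  "is_effective_union C P m u \<longleftrightarrow> is_union C P m u \<and>
     is_chain_colimit C (\<lambda>n. Dom C (m n)) (transition C m) (Dom C u) (\<lambda>n. inclusion C (m n) u)"

text \<open>Pullback along \<open>g : Z \<rightarrow> dom u\<close> takes the union \<open>u\<close> to the maximal subobject of \<open>Z\<close>, which is
  required to be the effective union of the pullbacks \<open>b n\<close> of the \<open>m n\<close>.\<close>

definition is_stable_effective_union :: "('o, 'a) cat \<Rightarrow> 'o \<Rightarrow> (nat \<Rightarrow> 'a) \<Rightarrow> 'a \<Rightarrow> bool" where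
  "is_stable_effective_union C P m u \<longleftrightarrow> is_effective_union C P m u \<and>
     (\<forall>Z. \<forall>g \<in> Hom C Z (Dom C u). \<forall>b l.
        (\<forall>n. is_pullback C g (inclusion C (m n) u) (b n) (l n)) \<longrightarrow>
        is_effective_union C Z b (Idt C Z))"

definition zigzags_have_stable_colimits :: "('o, 'a) cat \<Rightarrow> bool" where
  "zigzags_have_stable_colimits C \<longleftrightarrow>
     (\<forall>X P p q r m. reflexive_relation C X P p q r \<and> zigzag_chain C X P p q r m \<longrightarrow>
        (\<exists>Q j. is_stable_chain_colimit C (\<lambda>n. Dom C (m n)) (transition C m) Q j))"

definition zigzags_have_stable_effective_unions :: "('o, 'a) cat \<Rightarrow> bool" where
  "zigzags_have_stable_effective_unions C \<longleftrightarrow>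
     (\<forall>X P p q r m. reflexive_relation C X P p q r \<and> zigzag_chain C X P p q r m \<longrightarrow>
        (\<exists>u. is_stable_effective_union C P m u))"

end

theory Submission
 imports Defs "HOL-Library.Countable_Set"
begin

text \<open>If \<open>W : C \<rightarrow> \<Phi>\<^sub>l C\<close> has a lex left adjoint, then every presheaf in \<open>\<Phi>\<^sub>l C\<close> has a universal arrow to a
 representable, and these arrows are stable under pullback. Quotients, images and composites of
 relations can therefore be formed pointwise in presheaves and reflected: the reflection of the
 pointwise quotient of a reflexive relation is a coequaliser whose kernel pair is the stable union of
 the zigzag chain.

 Conversely, regular epimorphisms and stable unions of zigzag chains generate a subcanonical
 topology on \<open>C\<close>. The union of the zigzag chain of a reflexive pair is an equivalence relation, hence
 effective, and its quotient is locally the pointwise coequaliser. So the presheaves that are locally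
 isomorphic to a representable are closed under finite limits and reflexive coequalisers. They
 contain \<open>\<Phi>\<^sub>l C\<close>, and sending each to its representable is the lex reflection.\<close>

text \<open>Size governs much of the development. Small presheaves need not form a locally small
  category, while freeness of \<open>K\<close> is tested only against small categories in the
  universe; so it is transferred to presheaves through the countable subcategory that a reflexive
  pair generates. That finite limits and coequalisers of small presheaves are again small rests on
  presenting each presheaf by a small cofiltered family of objects, over which finitely many
  conditions can be met at once. Zigzags enter because a pointwise reflexive coequaliser identifies
  the elements joined by a finite zigzag of steps in \<open>R\<close> and its opposite, and
  reflexivity brings every such zigzag to the shape \<open>R R^o R ... R\<close>. The kernel pair of
  the pointwise quotient is thus the pointwise union of the chain, and a lex reflection carries this
  into \<open>C\<close>. In the converse, sheaf theory is confined to two facts: representables are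
  sheaves, and each presheaf at hand is locally isomorphic to one of them. Together they make the
  arrow to the representable universal.\<close>

no_notation times (infixl "*" 70)
notation (input) iff (infixr "<->" 25)

section \<open>Small sets\<close>

lemma universe_subset: "universe U ==> A:U ==> B <= A ==> B:U"
 and universe_image: "universe U ==> A:U ==> f ` A:U"
 and universe_UN: "universe U ==> A:U ==> (!!a. a:A ==> F a:U) ==> (\<Union>a\<in>A. F a):U"
 unfolding universe_def by blast+

text \<open>Choosing preimages injects \<open>S\<close> into \<open>A\<close>. Smallness is defined
  by injections, but most closure properties are easier through surjections from a member of
  \<open>U\<close>.\<close>

lemma small_of_image:
 assumes "universe U" "A:U" "S <= f ` A"
 shows "small U S"
 unfolding small_def
proof (intro exI conjI)
 show "inj_on (inv_into A f) S" using assms(3) inj_on_inv_into by blast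
 have "inv_into A f ` S <= A" using assms(3) by (meson image_subsetI inv_into_into subsetD)
 thus "inv_into A f ` S:U" using universe_subset[OF assms(1,2)] by blast
qed

lemma small_obtain:
 assumes "small U S" obtains A f where "A:U" "S = f ` A"
proof -
 obtain e where "inj_on e S" "e ` S:U" using assms unfolding small_def by blast
 hence "S = inv_into S e ` (e ` S)" by simp
 thus thesis using that \<open>e ` S:U\<close> by blast
qed

lemma small_image: "universe U ==> small U S ==> small U (f ` S)"
 by (metis equalityD1 image_image small_obtain small_of_image)

lemma small_subset: "universe U ==> small U S ==> T <= S ==> small U T"
 by (metis small_obtain small_of_image)

lemma small_in: "universe U ==> A:U ==> small U A"
 by (rule small_of_image[of U A A id]) auto

lemma small_nat:
 assumes "universe (U :: 'u set set)" shows "small U (S :: nat set)"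
proof -
 obtain A where A: "A:U" "infinite A" using assms unfolding universe_def by (elim conjE bexE)
 have "EX f :: nat => 'u. inj f & range f <= A" using infinite_countable_subset[OF A(2)] .
 then obtain f :: "nat => 'u" where f: "inj f" "range f <= A" by (elim exE conjE)
 have "S <= inv f ` A"
 proof
  fix n show "n:inv f ` A" using f by (intro image_eqI[of _ _ "f n"]) auto
 qed
 thus ?thesis using small_of_image[OF assms A(1)] by blast
qed

lemma small_countable:
 assumes "universe U" "countable S" shows "small U S"
proof -
 have "S = from_nat_into S ` to_nat_on S ` S"
  by (simp add: assms(2) image_image)
 thus ?thesis using small_image[OF assms(1) small_nat[OF assms(1)]] by metis
qed

lemma small_finite: "universe U ==> finite S ==> small U S"
 by (simp add: countable_finite small_countable)

text \<open>The base type is infinite, hence in bijection with its square. Universes are not assumed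
  closed under pairing, so this bijection supplies the codes of pairs.\<close>

lemma universe_pairing:
 assumes "universe (U :: 'u set set)" obtains h :: "'u \<times> 'u => 'u" where "inj h"
proof -
 have "infinite (UNIV :: 'u set)" using assms unfolding universe_def
  by (meson finite_subset subset_UNIV)
 hence "(card_of ((UNIV :: 'u set) \<times> (UNIV :: 'u set)), card_of (UNIV :: 'u set)):ordIso"
  by (rule card_of_Times_same_infinite)
 then obtain h :: "'u \<times> 'u => 'u" where "bij_betw h (UNIV \<times> UNIV) UNIV"
  using card_of_ordIso by blast
 thus thesis using that by (auto simp: bij_betw_def)
qed

lemma small_UN:
 assumes U: "universe (U :: 'u set set)" and I: "small U I" and B: "!!i. i:I ==> small U (B i)"
 shows "small U (\<Union>i\<in>I. B i)"
proof -
 obtain A f where A: "A:U" "I = f ` A" using I small_obtain by blast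
 obtain h :: "'u \<times> 'u => 'u" where h: "inj h" using universe_pairing[OF U] .
 have "EX D g. D:U & B (f a) = g ` D" if "a:A" for a
  using B A(2) that by (metis image_eqI small_obtain)
 then obtain D g where D: "!!a. a:A ==> D a:U & B (f a) = g a ` D a" by metis
 \<comment> \<open>Tagging the elements of \<open>D a\<close> with \<open>a\<close> makes the union
   disjoint, so that one function decodes all of it.\<close>
 let ?V = "\<Union>a\<in>A. (%u. h (a, u)) ` D a"
 have V: "?V:U" by (intro universe_UN[OF U A(1)] universe_image[OF U]) (use D in blast)
 have "(\<Union>i\<in>I. B i) <= (%v. g (fst (inv h v)) (snd (inv h v))) ` ?V"
 proof
  fix x assume "x:(\<Union>i\<in>I. B i)"
  then obtain a u where a: "a:A" "u:D a" "x = g a u" using A(2) D by auto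
  hence "h (a, u):?V" by blast
  thus "x:(%v. g (fst (inv h v)) (snd (inv h v))) ` ?V"
   using a(3) h by (intro image_eqI[of _ _ "h (a, u)"]) auto
 qed
 thus ?thesis using small_of_image[OF U V] by blast
qed

lemma small_Un: "universe U ==> small U S ==> small U T ==> small U (S Un T)"
 using small_UN[of U "{True, False}" "%b. if b then S else T"] small_finite[of U "{True, False}"]
 by (auto simp: Un_commute)

lemma small_Sigma:
 assumes "universe U" "small U I" "!!i. i:I ==> small U (B i)" shows "small U (Sigma I B)"
proof -
 have "Sigma I B = (\<Union>i\<in>I. Pair i ` B i)" by auto
 thus ?thesis by (simp add: assms small_UN small_image)
qed

lemma small_PiE:
 assumes U: "universe U" and "finite I" and B: "!!i. i:I ==> small U (B i)"
 shows "small U (PiE I B)"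
 using assms(2,3)
proof (induction I rule: finite_induct)
 case empty
 thus ?case by (simp add: small_finite[OF U])
next
 case (insert i I)
 have "small U ((%(y, g). g(i := y)) ` (B i \<times> PiE I B))"
  by (intro small_image[OF U] small_Sigma[OF U]) (use insert in auto)
 thus ?case by (simp add: PiE_insert_eq)
qed

lemma code_inj: "small U H ==> inj_on (code U H) H"
 and code_in: "small U H ==> coded U H:U"
 unfolding small_def code_def coded_def by (metis (mono_tags, lifting) someI_ex)+

section \<open>Arrow calculus\<close>

lemma Hom_iff [simp]: "f:Hom C x y <-> f:Arr C & Dom C f = x & Cod C f = y"
 unfolding Hom_def by auto

text \<open>Quantifying over arrows instead of hom-sets leaves domain and codomain as equations,
  which the simplifier then computes.\<close>

lemma all_Hom: "(ALL x y. ALL f:Hom C x y. Q x y f) <-> (ALL f:Arr C. Q (Dom C f) (Cod C f) f)"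
 unfolding Hom_def by auto

lemma all_Hom2: "(ALL x y z. ALL f:Hom C x y. ALL g:Hom C y z. Q f g) <->
  (ALL f:Arr C. ALL g:Arr C. Dom C g = Cod C f --> Q f g)"
 unfolding Hom_def by auto

context category
begin

abbreviation cmp (infixr "*" 70) where "g*f \<equiv> Cmp C g f"
abbreviation arr where "arr f \<equiv> f:Arr C"
abbreviation ob where "ob x \<equiv> x:Ob C"
abbreviation dom where "dom \<equiv> Dom C"
abbreviation cod where "cod \<equiv> Cod C"
abbreviation idt where "idt \<equiv> Idt C"
abbreviation hom where "hom \<equiv> Hom C"

lemma Dom_Ob [simp]: "arr f ==> ob (dom f)" by (rule Dom_in)
lemma Cod_Ob [simp]: "arr f ==> ob (cod f)" by (rule Cod_in)

lemma Idt_simps [simp]: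
 assumes "ob x" shows "arr (idt x)" "dom (idt x) = x" "cod (idt x) = x"
 using Idt_in[OF assms] by auto

lemma Cmp_simps [simp]:
 assumes "arr f" "arr g" "dom g = cod f"
 shows "arr (g*f)" "dom (g*f) = dom f" "cod (g*f) = cod g"
 using Cmp_in[of f "dom f" "cod f" g "cod g"] assms by auto

lemma Cmp_Idt_right [simp]: "arr f ==> dom f = x ==> f*idt x = f"
 using Cmp_Idt[of f x "cod f"] by auto

lemma Cmp_Idt_left [simp]: "arr f ==> cod f = x ==> idt x*f = f"
 using Idt_Cmp[of f "dom f" x] by auto

lemma assoc [simp]:
 assumes "arr f" "arr g" "arr h" "dom g = cod f" "dom h = cod g"
 shows "(h*g)*f = h*g*f"
 using Cmp_assoc[of f "dom f" "cod f" g "cod g" h "cod h"] assms by auto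

lemma Cmp_eqD:
 assumes "g*f = g'*f'" "arr f" "arr g" "arr f'" "arr g'"
  "cod f = dom g" "cod f' = dom g'"
 shows "dom f = dom f'" "cod g = cod g'"
 using Cmp_simps(2,3)[of f g] Cmp_simps(2,3)[of f' g'] assms by simp_all

text \<open>Composites are normalised to the right, so an equation between two of them no longer
  matches inside a longer composite. This rule and the next give its precomposed form.\<close>

lemma Cmp_reassoc:
 assumes "g*f = g'*f'" "arr f" "arr g" "dom g = cod f"
  "arr f'" "arr g'" "dom g' = cod f'" "arr h" "cod h = dom f" "cod h = dom f'"
 shows "g*f*h = g'*f'*h"
 using assms by (metis assoc)

lemma Cmp_reassoc1:
 assumes "g*f = k" "arr f" "arr g" "dom g = cod f" "arr h" "cod h = dom f"
 shows "g*f*h = k*h"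
 using assms by (metis assoc)

lemma pullbackD:
 assumes "is_pullback C f g p q"
 shows "arr f" "arr g" "arr p" "arr q" "cod f = cod g" "dom q = dom p"
  "cod p = dom f" "cod q = dom g" "f*p = g*q"
 using assms unfolding is_pullback_def Hom_iff by blast+

lemma pullback_lift:
 assumes "is_pullback C f g p q" "arr a" "arr b" "dom b = dom a" "cod a = dom f"
  "cod b = dom g" "f*a = g*b"
 obtains h where "arr h" "dom h = dom a" "cod h = dom p" "p*h = a" "q*h = b"
proof -
 have "a:hom (dom a) (dom f)" "b:hom (dom a) (dom g)" using assms by simp_all
 hence "EX h. h:hom (dom a) (dom p) & p*h = a & q*h = b"
  using assms(1,7) unfolding is_pullback_def by blast
 thus thesis using that by auto
qed

lemma pullback_unique:
 assumes "is_pullback C f g p q" "arr h" "arr k" "cod h = dom p" "cod k = dom p"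
  "p*h = p*k" "q*h = q*k"
 shows "h = k"
proof -
 note pb = pullbackD[OF assms(1)]
 have dom: "dom k = dom h" using Cmp_eqD(1)[OF assms(6)] assms(2-5) pb by simp
 have "f*p*h = g*q*h" using Cmp_reassoc[OF pb(9), of h] pb assms by simp
 hence "EX! l. l:hom (dom h) (dom p) & p*l = p*h & q*l = q*h"
  using assms(1) pb assms(2,4) unfolding is_pullback_def by auto
 thus ?thesis using assms dom by (metis Hom_iff)
qed

lemma pullbackI:
 assumes "arr f" "arr g" "arr p" "arr q" "cod f = cod g" "dom q = dom p"
  "cod p = dom f" "cod q = dom g" "f*p = g*q"
  and ex: "!!a b. arr a ==> arr b ==> dom b = dom a ==> cod a = dom f ==>
   cod b = dom g ==> f*a = g*b ==>
   EX h. arr h & dom h = dom a & cod h = dom p & p*h = a & q*h = b"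
  and un: "!!h k. arr h ==> arr k ==> dom h = dom k ==> cod h = dom p ==>
   cod k = dom p ==> p*h = p*k ==> q*h = q*k ==> h = k"
 shows "is_pullback C f g p q"
 unfolding is_pullback_def Hom_iff
proof (intro conjI allI ballI impI)
 fix Z a b assume a: "a:hom Z (dom f)" and b: "b:hom Z (dom g)" and e: "f*a = g*b"
 obtain h where h: "arr h" "dom h = dom a" "cod h = dom p" "p*h = a" "q*h = b"
  using ex[of a b] a b e by auto
 show "EX! h. (arr h & dom h = Z & cod h = dom p) & p*h = a & q*h = b"
  by (rule ex1I[of _ h]) (use h a un in auto)
qed (use assms(1-9) in auto)

lemma coequaliserD:
 assumes "is_coequaliser C f g e"
 shows "arr f" "arr g" "arr e" "dom g = dom f" "cod g = cod f"
  "dom e = cod f" "e*f = e*g"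
 using assms unfolding is_coequaliser_def Hom_iff by auto

lemma coequaliser_factor:
 assumes "is_coequaliser C f g e" "arr h" "dom h = cod f" "h*f = h*g"
 obtains k where "arr k" "dom k = cod e" "cod k = cod h" "k*e = h"
proof -
 have "EX k. k:hom (cod e) (cod h) & k*e = h"
 proof -
  have "h:hom (cod f) (cod h)" using assms by simp
  hence "EX! k. k:hom (cod e) (cod h) & k*e = h"
   using assms(1,4) unfolding is_coequaliser_def by simp
  thus ?thesis by blast
 qed
 thus thesis using that by auto
qed

lemma regular_epi_Arr: "regular_epi C e ==> arr e"
 unfolding regular_epi_def using coequaliserD by blast

lemma regular_epi_cancel:
 assumes "regular_epi C e" "arr h" "arr k" "dom h = cod e" "dom k = cod e"
  "h*e = k*e"
 shows "h = k"
proof -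
 obtain f g where c: "is_coequaliser C f g e" using assms(1) unfolding regular_epi_def by blast
 note D = coequaliserD[OF c]
 have cod: "cod h = cod k"
  by (rule Cmp_eqD(2)[OF assms(6) D(3) assms(2) D(3) assms(3) assms(4)[symmetric] assms(5)[symmetric]])
 have "(h*e)*f = (h*e)*g" using D assms(2,4) by simp
 hence "EX! l. l:hom (cod e) (cod h) & l*e = h*e"
  using c assms(2,4) D unfolding is_coequaliser_def by auto
 thus ?thesis using assms cod by (metis Hom_iff)
qed

lemma coequaliserI:
 assumes "arr f" "arr g" "arr e" "dom g = dom f" "cod g = cod f"
  "dom e = cod f" "e*f = e*g"
  and ex: "!!h. arr h ==> dom h = cod f ==> h*f = h*g ==>
   EX k. arr k & dom k = cod e & cod k = cod h & k*e = h"
  and un: "!!k k'. arr k ==> arr k' ==> dom k = cod e ==> dom k' = cod e ==>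
   cod k = cod k' ==> k*e = k'*e ==> k = k'"
 shows "is_coequaliser C f g e"
 unfolding is_coequaliser_def Hom_iff
proof (intro conjI allI ballI impI)
 fix Z h assume h: "h:hom (cod f) Z" and e: "h*f = h*g"
 obtain k where k: "arr k" "dom k = cod e" "cod k = cod h" "k*e = h"
  using ex[of h] h e by auto
 show "EX! k. (arr k & dom k = cod e & cod k = Z) & k*e = h"
  by (rule ex1I[of _ k]) (use k h un in auto)
qed (use assms(1-7) in auto)

lemma monicD: "monic C m ==> arr m"
 unfolding monic_def by simp

lemma monic_cancel:
 assumes "monic C m" "arr f" "arr g" "cod f = dom m" "cod g = dom m" "m*f = m*g"
 shows "f = g"
proof -
 have "dom f = dom g" using Cmp_eqD(1)[OF assms(6)] assms(2-5) monicD[OF assms(1)] by simp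
 hence "f:hom (dom f) (dom m)" "g:hom (dom f) (dom m)"
  using assms(2-5) by simp_all
 thus ?thesis using assms(1,6) unfolding monic_def by blast
qed

lemma productD:
 assumes "is_product C X Y P p q"
 shows "arr p" "arr q" "dom p = P" "dom q = P" "cod p = X" "cod q = Y" "ob P"
 using assms unfolding is_product_def Hom_iff by auto

lemma product_pair:
 assumes "is_product C X Y P p q" "arr f" "arr g" "dom g = dom f" "cod f = X" "cod g = Y"
 obtains h where "arr h" "dom h = dom f" "cod h = P" "p*h = f" "q*h = g"
proof -
 have "f:hom (dom f) X" "g:hom (dom f) Y" using assms by simp_all
 hence "EX h. h:hom (dom f) P & p*h = f & q*h = g"
  using assms(1) unfolding is_product_def by blast
 thus thesis using that by auto
qed

lemma product_unique:
 assumes "is_product C X Y P p q" "arr h" "arr k" "cod h = P" "cod k = P"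
  "p*h = p*k" "q*h = q*k"
 shows "h = k"
proof -
 note D = productD[OF assms(1)]
 have dom: "dom k = dom h" using Cmp_eqD(1)[OF assms(6) assms(2) D(1) assms(3) D(1)] assms(4,5) D(3) by simp
 have "p*h:hom (dom h) X" "q*h:hom (dom h) Y" using D assms(2,4) by auto
 hence "EX! l. l:hom (dom h) P & p*l = p*h & q*l = q*h"
  using assms(1) unfolding is_product_def by blast
 thus ?thesis using assms dom by (metis Hom_iff)
qed

end

section \<open>Finite limits in terms of diagrams\<close>

lemma functorD:
 assumes "is_functor A B F"
 shows "category A" "category B" "!!x. x:Ob A ==> fob F x:Ob B"
  "!!f. f:Arr A ==> farr F f:Arr B"
  "!!f. f:Arr A ==> Dom B (farr F f) = fob F (Dom A f)"
  "!!f. f:Arr A ==> Cod B (farr F f) = fob F (Cod A f)"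
  "!!x. x:Ob A ==> farr F (Idt A x) = Idt B (fob F x)"
  "!!f g. f:Arr A ==> g:Arr A ==> Dom A g = Cod A f ==>
   farr F (Cmp A g f) = Cmp B (farr F g) (farr F f)"
 using assms unfolding is_functor_def all_Hom all_Hom2 by simp_all

lemma functorI:
 assumes "category A" "category B" "!!x. x:Ob A ==> fob F x:Ob B"
  "!!f. f:Arr A ==> farr F f:Arr B"
  "!!f. f:Arr A ==> Dom B (farr F f) = fob F (Dom A f)"
  "!!f. f:Arr A ==> Cod B (farr F f) = fob F (Cod A f)"
  "!!x. x:Ob A ==> farr F (Idt A x) = Idt B (fob F x)"
  "!!f g. f:Arr A ==> g:Arr A ==> Dom A g = Cod A f ==>
   farr F (Cmp A g f) = Cmp B (farr F g) (farr F f)"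
 shows "is_functor A B F"
 using assms unfolding is_functor_def all_Hom all_Hom2 by simp

lemma functor_comp:
 assumes F: "is_functor A B F" and G: "is_functor B C G"
 shows "is_functor A C (comp_fctr G F)"
 using functorD[OF F] functorD[OF G] by (intro functorI) (auto simp: comp_fctr_def)

definition empty_shape :: "(nat, nat) cat" where
 "empty_shape = \<lparr>Ob = {}, Arr = {}, Dom = id, Cod = id, Idt = id, Cmp = (%g f. f)\<rparr>"

text \<open>Objects and their identities are 0, 1, 2; the other arrows are 3 from 0 to 2 and 4 from 1 to 2.\<close>

definition cospan_shape :: "(nat, nat) cat" where
 "cospan_shape = \<lparr>Ob = {0, 1, 2}, Arr = {0, 1, 2, 3, 4},
  Dom = (%f. if f = 3 then 0 else if f = 4 then 1 else f),
  Cod = (%f. if f < 3 then f else 2), Idt = (%x. x),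
  Cmp = (%g f. if f < 3 then g else f)\<rparr>"

definition cospan :: "('o, 'a) cat => 'a => 'a => (nat, nat, 'o, 'a) fctr" where
 "cospan C f g = \<lparr>fob = (%x. if x = 0 then Dom C f else if x = 1 then Dom C g else Cod C f),
  farr = (%x. if x = 0 then Idt C (Dom C f) else if x = 1 then Idt C (Dom C g) else
   if x = 2 then Idt C (Cod C f) else if x = 3 then f else g)\<rparr>"

lemma cone_iff:
 "is_cone J C F x l <-> x:Ob C &
  (ALL j:Ob J. l j:Arr C & Dom C (l j) = x & Cod C (l j) = fob F j) &
  (ALL f:Arr J. Cmp C (farr F f) (l (Dom J f)) = l (Cod J f))"
 unfolding is_cone_def all_Hom by simp

lemma limitD:
 assumes "is_limit J C F x l"
 shows "is_cone J C F x l" "x:Ob C"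
  "!!j. j:Ob J ==> l j:Arr C" "!!j. j:Ob J ==> Dom C (l j) = x"
  "!!j. j:Ob J ==> Cod C (l j) = fob F j"
  "!!f. f:Arr J ==> Cmp C (farr F f) (l (Dom J f)) = l (Cod J f)"
 using assms unfolding is_limit_def cone_iff by auto

lemma limit_lift:
 assumes "is_limit J C F x l" "is_cone J C F y m"
 obtains h where "h:Arr C" "Dom C h = y" "Cod C h = x" "!!j. j:Ob J ==> Cmp C (l j) h = m j"
 using assms unfolding is_limit_def Hom_iff by metis

lemma (in category) cone_precomp:
 assumes l: "is_cone J C F x l" and J: "is_functor J C F" and h: "arr h" "cod h = x"
 shows "is_cone J C F (dom h) (%j. l j*h)"
proof -
 interpret J: category J using functorD(1)[OF J] .
 have "farr F f*l (Dom J f)*h = l (Cod J f)*h" if "f:Arr J" for f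
  using that l functorD[OF J] h unfolding cone_iff by (intro Cmp_reassoc1) auto
 thus ?thesis using l h unfolding cone_iff by auto
qed

lemma (in category) limit_unique:
 assumes l: "is_limit J C F x l" and J: "is_functor J C F"
  and h: "arr h" "cod h = x" "arr k" "cod k = x" "dom k = dom h"
  and eq: "!!j. j:Ob J ==> l j*h = l j*k"
 shows "h = k"
proof -
 have "is_cone J C F (dom h) (%j. l j*h)"
  using cone_precomp[OF limitD(1)[OF l] J] h by simp
 hence "EX! t. t:hom (dom h) x & (ALL j:Ob J. l j*t = l j*h)"
  using l unfolding is_limit_def by blast
 thus ?thesis using h eq by (metis Hom_iff)
qed

lemma (in category) limitI:
 assumes c: "is_cone J C F x l"
  and ex: "!!y m. is_cone J C F y m ==>
   EX h. arr h & dom h = y & cod h = x & (ALL j:Ob J. l j*h = m j)"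
  and un: "!!h k. arr h ==> cod h = x ==> arr k ==> cod k = x ==> dom k = dom h ==>
   (!!j. j:Ob J ==> l j*h = l j*k) ==> h = k"
 shows "is_limit J C F x l"
 unfolding is_limit_def
proof (intro conjI c allI impI)
 fix y m assume "is_cone J C F y m"
 then obtain h where h: "arr h" "dom h = y" "cod h = x" "ALL j:Ob J. l j*h = m j"
  using ex by blast
 show "EX! h. h:hom y x & (ALL j:Ob J. l j*h = m j)"
  by (rule ex1I[of _ h]) (use h un in auto)
qed

lemma (in category) finite_diagram_empty: "finite_diagram empty_shape C F"
 unfolding finite_diagram_def
 by (auto intro!: functorI category_axioms simp: empty_shape_def category_def Hom_def)

lemma category_cospan_shape: "category cospan_shape"
 by unfold_locales (auto simp: cospan_shape_def Hom_def)

lemma (in category) finite_diagram_cospan: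
 assumes "arr f" "arr g" "cod f = cod g"
 shows "finite_diagram cospan_shape C (cospan C f g)"
 unfolding finite_diagram_def
proof (intro conjI functorI category_axioms category_cospan_shape)
 fix f' g' assume "f':Arr cospan_shape" "g':Arr cospan_shape" "Dom cospan_shape g' = Cod cospan_shape f'"
 thus "farr (cospan C f g) (Cmp cospan_shape g' f') =
   farr (cospan C f g) g'*farr (cospan C f g) f'"
  using assms by (auto simp: cospan_shape_def cospan_def split: if_splits)
qed (use assms in \<open>auto simp: cospan_shape_def cospan_def\<close>)

lemma (in category) pullback_of_limit:
 assumes fg: "arr f" "arr g" "cod f = cod g"
  and lim: "is_limit cospan_shape C (cospan C f g) x l"
 shows "is_pullback C f g (l 0) (l 1)"
proof -
 note F = finite_diagram_cospan[OF fg]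
 note D = limitD[OF lim]
 have l2: "f*l 0 = l 2" "g*l 1 = l 2"
  using D(6)[of 3] D(6)[of 4] by (simp_all add: cospan_shape_def cospan_def)
 have L: "arr (l 0)" "arr (l 1)" "dom (l 0) = x" "dom (l 1) = x" "cod (l 0) = dom f"
   "cod (l 1) = dom g"
  using D(3)[of 0] D(3)[of 1] D(4)[of 0] D(4)[of 1] D(5)[of 0] D(5)[of 1]
  by (simp_all add: cospan_shape_def cospan_def)
 show ?thesis
 proof (rule pullbackI[OF fg(1,2) _ _ fg(3)])
  fix a b assume a: "arr a" "arr b" "dom b = dom a" "cod a = dom f" "cod b = dom g"
   "f*a = g*b"
  have "is_cone cospan_shape C (cospan C f g) (dom a)
    (%j. if j = 0 then a else if j = 1 then b else f*a)"
   using a fg by (auto simp: cone_iff cospan_shape_def cospan_def)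
  from limit_lift[OF lim this] obtain h where "arr h" "dom h = dom a" "cod h = x"
    "!!j. j:Ob cospan_shape ==> l j*h = (if j = 0 then a else if j = 1 then b else f*a)"
   by metis
  from this(1-3) this(4)[of 0] this(4)[of 1]
  show "EX h. arr h & dom h = dom a & cod h = dom (l 0) & l 0*h = a & l 1*h = b"
   using L by (intro exI[of _ h]) (simp add: cospan_shape_def)
 next
  fix h k assume h: "arr h" "arr k" "dom h = dom k" "cod h = dom (l 0)"
   "cod k = dom (l 0)" "l 0*h = l 0*k" "l 1*h = l 1*k"
  have "l 2*h = l 2*k"
   using Cmp_reassoc1[OF l2(1), of h] Cmp_reassoc1[OF l2(1), of k] h L fg by simp
  hence "l j*h = l j*k" if "j:Ob cospan_shape" for j
   using that h(6,7) by (auto simp: cospan_shape_def)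
  thus "h = k"
   using limit_unique[OF lim _ h(1) _ h(2)] F h(3-5) L unfolding finite_diagram_def by simp
 qed (use L l2 in simp_all)
qed

definition terminal :: "('o, 'a) cat => 'o => bool" where
 "terminal C t <-> t:Ob C & (ALL x:Ob C. EX! f. f:Hom C x t)"

locale lex_category =
 fixes C :: "('o, 'a) cat"
 assumes fincomp: "finitely_complete C"
begin

sublocale category C using fincomp unfolding finitely_complete_def by blast

lemma ex_limit: "finite_diagram J C F ==> EX x l. is_limit J C F x l"
 using fincomp unfolding finitely_complete_def by blast

lemma ex_pullback:
 assumes "arr f" "arr g" "cod f = cod g" obtains p q where "is_pullback C f g p q"
 using ex_limit[OF finite_diagram_cospan[OF assms]] pullback_of_limit[OF assms] by blast

lemma ex_terminal: obtains t where "terminal C t"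
proof -
 obtain F :: "(nat, nat, 'o, 'a) fctr" and x l where lim: "is_limit empty_shape C F x l"
  using ex_limit[OF finite_diagram_empty] by blast
 have "EX! f. f:hom y x" if "ob y" for y
  using lim that unfolding is_limit_def by (auto simp: cone_iff empty_shape_def)
 thus thesis using that limitD(2)[OF lim] unfolding terminal_def by blast
qed

text \<open>A product is a pullback over the terminal object, where every square commutes.\<close>

lemma ex_product:
 assumes "ob X" "ob Y" obtains P p q where "is_product C X Y P p q"
proof -
 obtain t where t: "terminal C t" using ex_terminal .
 obtain f g where f: "f:hom X t" and g: "g:hom Y t" using t assms unfolding terminal_def by meson
 obtain p q where pb: "is_pullback C f g p q" using ex_pullback f g by (metis Hom_iff)
 have eq: "f*a = g*b" if "a:hom Z X" "b:hom Z Y" for a b Z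
  using that f g t unfolding terminal_def by (metis Cmp_in Dom_Ob Hom_iff)
 have "is_product C X Y (dom p) p q"
  unfolding is_product_def
 proof (intro conjI allI ballI)
  fix Z a b assume ab: "a:hom Z X" "b:hom Z Y"
  hence "f*a = g*b" by (rule eq)
  thus "EX! h. h:hom Z (dom p) & p*h = a & q*h = b"
   using pb f g ab unfolding is_pullback_def by simp
 qed (use pullbackD[OF pb] f g in auto)
 thus thesis using that by blast
qed

text \<open>The equaliser is the pullback of the two graphs \<open>(1, f)\<close> and
  \<open>(1, g)\<close> into the product: the first projection forces the legs to coincide, the
  second gives the equation.\<close>

lemma ex_equaliser:
 assumes f: "arr f" "arr g" "dom g = dom f" "cod g = cod f"
 obtains e where "arr e" "cod e = dom f" "f*e = g*e" "monic C e"
  "!!h. arr h ==> cod h = dom f ==> f*h = g*h ==>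
   EX k. arr k & dom k = dom h & cod k = dom e & e*k = h"
proof -
 let ?a = "dom f" and ?b = "cod f"
 have ab: "ob ?a" "ob ?b" using f by auto
 obtain P p q where P: "is_product C ?a ?b P p q" using ex_product[OF ab] .
 note PD = productD[OF P]
 obtain u where u: "arr u" "dom u = ?a" "cod u = P" "p*u = idt ?a" "q*u = f"
  using product_pair[OF P, of "idt ?a" f] f ab by auto
 obtain v where v: "arr v" "dom v = ?a" "cod v = P" "p*v = idt ?a" "q*v = g"
  using product_pair[OF P, of "idt ?a" g] f ab by auto
 obtain e e' where pb: "is_pullback C u v e e'" using ex_pullback u v by metis
 note D = pullbackD[OF pb]
 have "p*u*e = p*v*e'" "q*u*e = q*v*e'" using D by auto
 hence ee: "e' = e" "f*e = g*e'"
  using D u v PD Cmp_reassoc1[OF u(4), of e] Cmp_reassoc1[OF v(4), of e'] Cmp_reassoc1[OF u(5), of e] Cmp_reassoc1[OF v(5), of e']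
  by auto
 show thesis
 proof (rule that[of e])
  show "monic C e" unfolding monic_def
   using pullback_unique[OF pb] ee D by auto
  fix h assume h: "arr h" "cod h = dom f" "f*h = g*h"
  have "u*h = v*h"
   by (rule product_unique[OF P])
    (use h u v PD Cmp_reassoc1[OF u(4), of h] Cmp_reassoc1[OF v(4), of h] Cmp_reassoc1[OF u(5), of h] Cmp_reassoc1[OF v(5), of h] in auto)
  thus "EX k. arr k & dom k = dom h & cod k = dom e & e*k = h"
   using pullback_lift[OF pb, of h h] h u v by metis
 qed (use D u ee in auto)
qed

end

section \<open>Presheaves elementwise\<close>

lemma op_cat_simps [simp]: "Ob (op_cat C) = Ob C" "Arr (op_cat C) = Arr C" "Dom (op_cat C) = Cod C"
  "Cod (op_cat C) = Dom C" "Idt (op_cat C) = Idt C" "Cmp (op_cat C) g f = Cmp C f g"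
 by (simp_all add: op_cat_def)

lemma (in category) category_op_cat: "category (op_cat C)"
 by unfold_locales auto

lemma full_subcat_simps [simp]: "Ob (full_subcat C S) = Ob C Int S"
  "Arr (full_subcat C S) = {f:Arr C. Dom C f:S & Cod C f:S}" "Dom (full_subcat C S) = Dom C"
  "Cod (full_subcat C S) = Cod C" "Idt (full_subcat C S) = Idt C" "Cmp (full_subcat C S) = Cmp C"
 by (simp_all add: full_subcat_def)

lemma (in category) category_full_subcat: "category (full_subcat C S)"
 by unfold_locales auto

lemma Hom_full_subcat: "Hom (full_subcat C S) x y = {f:Hom C x y. x:S & y:S}"
 by (auto simp: Hom_def)

lemma Set_cat_simps [simp]: "Ob (Set_cat U) = U" "Dom (Set_cat U) t = fst t" "Cod (Set_cat U) t = snd (snd t)"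
  "Idt (Set_cat U) A = (A, \<lambda>u\<in>A. u, A)"
  "Cmp (Set_cat U) t s = (fst s, compose (fst s) (ap t) (ap s), snd (snd t))"
 by (simp_all add: Set_cat_def)

lemma Arr_Set_cat: "t:Arr (Set_cat U) <-> fst t:U & snd (snd t):U & ap t:fst t \<rightarrow>\<^sub>E snd (snd t)"
 by (auto simp: Set_cat_def ap_def)

lemma ap_simp [simp]: "ap (A, f, B) = f"
 by (simp add: ap_def)

lemma Set_cat_eqI:
 assumes "s:Arr (Set_cat U)" "t:Arr (Set_cat U)" "fst s = fst t" "snd (snd s) = snd (snd t)"
  "!!x. x:fst t ==> ap s x = ap t x"
 shows "s = t"
proof -
 have "ap s = ap t" using assms unfolding Arr_Set_cat
  by (intro extensionalityI[of _ "fst t"]) (auto simp: PiE_def)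
 thus ?thesis using assms(3,4) by (metis ap_def prod_eqI)
qed

lemma category_Set_cat: "category (Set_cat U)"
proof
 fix f g h and w x y z :: "'a set"
 assume f: "f:Hom (Set_cat U) w x" and g: "g:Hom (Set_cat U) x y" and h: "h:Hom (Set_cat U) y z"
 thus "Cmp (Set_cat U) h (Cmp (Set_cat U) g f) = Cmp (Set_cat U) (Cmp (Set_cat U) h g) f"
  by (auto simp: Arr_Set_cat intro!: compose_assoc)
next
 fix f and x y :: "'a set" assume f: "f:Hom (Set_cat U) x y"
 show "Cmp (Set_cat U) f (Idt (Set_cat U) x) = f"
  using f by (intro Set_cat_eqI[of _ U]) (auto simp: Arr_Set_cat compose_def PiE_iff)
 show "Cmp (Set_cat U) (Idt (Set_cat U) y) f = f"
  using f by (intro Set_cat_eqI[of _ U]) (auto simp: Arr_Set_cat compose_def PiE_iff)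
qed (auto simp: Arr_Set_cat compose_def PiE_iff)

lemma functor_cat_simps [simp]: "Ob (functor_cat A B) = {F. is_functor A B F}"
  "Arr (functor_cat A B) = {t. nat_trans A B (fst t) (fst (snd t)) (snd (snd t))}"
  "Dom (functor_cat A B) t = fst t" "Cod (functor_cat A B) t = fst (snd t)"
  "Idt (functor_cat A B) F = (F, F, \<lambda>x\<in>Ob A. Idt B (fob F x))"
  "Cmp (functor_cat A B) t s = (fst s, fst (snd t), \<lambda>x\<in>Ob A. Cmp B (snd (snd t) x) (snd (snd s) x))"
 by (auto simp: functor_cat_def)

lemma nat_trans_iff:
 "nat_trans A B F G al <-> is_functor A B F & is_functor A B G & al:extensional (Ob A) &
  (ALL x:Ob A. al x:Arr B & Dom B (al x) = fob F x & Cod B (al x) = fob G x) &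
  (ALL f:Arr A. Cmp B (al (Cod A f)) (farr F f) = Cmp B (farr G f) (al (Dom A f)))"
 unfolding nat_trans_def all_Hom by simp

lemma nat_trans_comp:
 assumes al: "nat_trans A B F G al" and bt: "nat_trans A B G H bt"
 shows "nat_trans A B F H (\<lambda>x\<in>Ob A. Cmp B (bt x) (al x))"
proof -
 have F: "is_functor A B F" and G: "is_functor A B G" and H: "is_functor A B H"
  using al bt by (auto simp: nat_trans_iff)
 interpret A: category A by (rule functorD(1)[OF F])
 interpret B: category B by (rule functorD(2)[OF F])
 note a = al[unfolded nat_trans_iff] and b = bt[unfolded nat_trans_iff]
 have "Cmp B (Cmp B (bt (Cod A f)) (al (Cod A f))) (farr F f) =
   Cmp B (farr H f) (Cmp B (bt (Dom A f)) (al (Dom A f)))" if f: "f:Arr A" for f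
 proof -
  have "Cmp B (Cmp B (bt (Cod A f)) (al (Cod A f))) (farr F f) =
    Cmp B (bt (Cod A f)) (Cmp B (al (Cod A f)) (farr F f))"
   using f a b functorD[OF F] by simp
  also have "... = Cmp B (bt (Cod A f)) (Cmp B (farr G f) (al (Dom A f)))" using a f by simp
  also have "... = Cmp B (farr H f) (Cmp B (bt (Dom A f)) (al (Dom A f)))"
   using f a b functorD[OF G] functorD[OF H] by (intro B.Cmp_reassoc) auto
  finally show ?thesis .
 qed
 thus ?thesis using a b F H unfolding nat_trans_iff by simp
qed

lemma category_functor_cat:
 assumes "category A" "category B" shows "category (functor_cat A B)"
proof -
 interpret A: category A by fact
 interpret B: category B by fact
 show ?thesis
 proof
  fix F assume "F:Ob (functor_cat A B)"
  thus "Idt (functor_cat A B) F:Hom (functor_cat A B) F F"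
   using functorD[of A B F] by (auto simp: nat_trans_iff)
 next
  fix f g x y z assume "f:Hom (functor_cat A B) x y" "g:Hom (functor_cat A B) y z"
  thus "Cmp (functor_cat A B) g f:Hom (functor_cat A B) x z"
   using nat_trans_comp[of A B x y "snd (snd f)" z "snd (snd g)"] by auto
 next
  fix f x y assume f: "f:Hom (functor_cat A B) x y"
  have "restrict (%a. Cmp B (snd (snd f) a) (restrict (%a. Idt B (fob x a)) (Ob A) a)) (Ob A) = snd (snd f)"
    "restrict (%a. Cmp B (restrict (%a. Idt B (fob y a)) (Ob A) a) (snd (snd f) a)) (Ob A) = snd (snd f)"
   using f by (auto simp: nat_trans_iff intro!: extensionalityI[of _ "Ob A"])
  thus "Cmp (functor_cat A B) f (Idt (functor_cat A B) x) = f"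
   "Cmp (functor_cat A B) (Idt (functor_cat A B) y) f = f"
   using f by (auto simp: prod_eq_iff)
 next
  fix f g h w x y z
  assume "f:Hom (functor_cat A B) w x" "g:Hom (functor_cat A B) x y" "h:Hom (functor_cat A B) y z"
  thus "Cmp (functor_cat A B) h (Cmp (functor_cat A B) g f) =
    Cmp (functor_cat A B) (Cmp (functor_cat A B) h g) f"
   by (auto simp: nat_trans_iff intro!: restrict_ext)
 qed (auto simp: nat_trans_iff)
qed

abbreviation act :: "('o, 'a, 'u) presheaf => 'a => 'u => 'u" where
 "act F f \<equiv> ap (farr F f)"

definition ev :: "('o, 'a, 'u) presheaf_map => 'o => 'u => 'u" where
 "ev t c = ap (snd (snd t) c)"

text \<open>Maps of presheaves are handled as bare families of functions satisfying this condition;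
  \<open>psh_map\<close> packs such a family into an extensional arrow, and \<open>ev\<close> reads
  it off again.\<close>

definition natural :: "('o, 'a) cat => ('o, 'a, 'u) presheaf => ('o, 'a, 'u) presheaf =>
  ('o => 'u => 'u) => bool" where
 "natural C F G ta <-> (ALL c:Ob C. ALL x:fob F c. ta c x:fob G c) &
  (ALL f:Arr C. ALL x:fob F (Cod C f). ta (Dom C f) (act F f x) = act G f (ta (Cod C f) x))"

definition psh_map :: "('o, 'a) cat => ('o, 'a, 'u) presheaf => ('o, 'a, 'u) presheaf =>
  ('o => 'u => 'u) => ('o, 'a, 'u) presheaf_map" where
 "psh_map C F G ta = (F, G, \<lambda>c\<in>Ob C. (fob F c, \<lambda>x\<in>fob F c. ta c x, fob G c))"

lemma naturalD:
 assumes "natural C F G ta"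
 shows "!!c x. c:Ob C ==> x:fob F c ==> ta c x:fob G c"
  "!!f x. f:Arr C ==> x:fob F (Cod C f) ==> ta (Dom C f) (act F f x) = act G f (ta (Cod C f) x)"
 using assms unfolding natural_def by auto

text \<open>A presheaf of small sets in any type, moved into the universe along codes.
  Representables are the case of hom-sets; limits use the case of compatible families.\<close>

definition coded_presheaf :: "'u set set => ('o, 'a) cat => ('o => 'x set) => ('a => 'x => 'x) =>
  ('o, 'a, 'u) presheaf" where
 "coded_presheaf U C T a = \<lparr>fob = (%x. coded U (T x)),
  farr = (%f. coded_map U (T (Cod C f)) (T (Dom C f)) (a f))\<rparr>"

definition decode :: "'u set set => 'x set => 'u => 'x" where
 "decode U S = inv_into S (code U S)"

lemma decode_code [simp]: "small U S ==> x:S ==> decode U S (code U S x) = x"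
 unfolding decode_def using code_inj by (rule inv_into_f_f)

lemma code_decode [simp]: "u:coded U S ==> code U S (decode U S u) = u"
 unfolding decode_def coded_def by (rule f_inv_into_f)

lemma decode_in [simp]: "u:coded U S ==> decode U S u:S"
 unfolding decode_def coded_def by (rule inv_into_into)

lemma code_coded [simp]: "x:S ==> code U S x:coded U S"
 unfolding coded_def by (rule imageI)

lemma coded_map_simps [simp]: "fst (coded_map U H K f) = coded U H" "snd (snd (coded_map U H K f)) = coded U K"
 "u:coded U H ==> ap (coded_map U H K f) u = code U K (f (decode U H u))"
 by (simp_all add: coded_map_def decode_def)

lemma coded_map_Arr:
 assumes "small U H" "small U K" "!!x. x:H ==> f x:K" shows "coded_map U H K f:Arr (Set_cat U)"
 unfolding Arr_Set_cat using assms code_in by (auto simp: coded_map_def decode_def[symmetric])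

locale presheaves = category C for C :: "('o, 'a) cat" +
 fixes U :: "'u set set"
begin

abbreviation psh where "psh F \<equiv> is_functor (op_cat C) (Set_cat U) F"
abbreviation PC where "PC \<equiv> presheaf_cat U C"

lemma pshD:
 assumes "psh F"
 shows "!!c. ob c ==> fob F c:U"
  "!!f x. arr f ==> x:fob F (cod f) ==> act F f x:fob F (dom f)"
  "!!c x. ob c ==> x:fob F c ==> act F (idt c) x = x"
  "!!f g x. arr f ==> arr g ==> dom g = cod f ==> x:fob F (cod g) ==>
   act F (g*f) x = act F f (act F g x)"
proof -
 note D = functorD[OF assms, simplified]
 show "!!c. ob c ==> fob F c:U" using D by auto
 show "act F f x:fob F (dom f)" if "arr f" "x:fob F (cod f)" for f x
  using D(4,5,6)[of f] that by (auto simp: Arr_Set_cat)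
 show "act F (idt c) x = x" if "ob c" "x:fob F c" for c x
  using D(7)[of c] that by simp
 show "act F (g*f) x = act F f (act F g x)"
  if "arr f" "arr g" "dom g = cod f" "x:fob F (cod g)" for f g x
  using D(8)[of g f] D(5)[of g] that by (simp add: compose_def)
qed

lemma pshI:
 assumes "!!c. ob c ==> fob F c:U"
  "!!f. arr f ==> farr F f:Arr (Set_cat U) & fst (farr F f) = fob F (cod f) &
   snd (snd (farr F f)) = fob F (dom f)"
  "!!c x. ob c ==> x:fob F c ==> act F (idt c) x = x"
  "!!f g x. arr f ==> arr g ==> dom g = cod f ==> x:fob F (cod g) ==>
   act F (g*f) x = act F f (act F g x)"
 shows "psh F"
proof (rule functorI[OF category_op_cat category_Set_cat])
 interpret S: category "Set_cat U" by (rule category_Set_cat)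
 fix x assume "x:Ob (op_cat C)"
 thus "farr F (Idt (op_cat C) x) = Idt (Set_cat U) (fob F x)"
  using assms(1,2,3) S.Idt_simps(1)[of "fob F x"] by (intro Set_cat_eqI[of _ U]) auto
next
 interpret S: category "Set_cat U" by (rule category_Set_cat)
 fix f g assume "f:Arr (op_cat C)" "g:Arr (op_cat C)" "Dom (op_cat C) g = Cod (op_cat C) f"
 thus "farr F (Cmp (op_cat C) g f) = Cmp (Set_cat U) (farr F g) (farr F f)"
  using assms(2)[of f] assms(2)[of g] assms(2)[of "f*g"] assms(4)[of g f]
   S.Cmp_simps(1)[of "farr F f" "farr F g"]
  by (intro Set_cat_eqI[of _ U]) (auto simp: compose_def)
qed (use assms in auto)

lemma act_in:
 "psh F ==> arr f ==> dom f = b ==> cod f = c ==> x:fob F c ==> act F f x:fob F b"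
 using pshD(2) by blast

lemma category_PC: "category PC"
 unfolding presheaf_cat_def by (intro category_functor_cat category_op_cat category_Set_cat)

lemma PC_simps [simp]: "Ob PC = {F. psh F}" "Dom PC t = fst t" "Cod PC t = fst (snd t)"
 by (simp_all add: presheaf_cat_def)

lemma ev_natural:
 assumes "t:Hom PC F G" shows "natural C F G (ev t)"
proof -
 have *: "psh F" "psh G" "nat_trans (op_cat C) (Set_cat U) F G (snd (snd t))"
  using assms by (auto simp: presheaf_cat_def nat_trans_iff)
 note n = *(3)[unfolded nat_trans_iff]
 have a: "ap (snd (snd t) c):fob F c \<rightarrow> fob G c" if "ob c" for c
  using n that unfolding Arr_Set_cat by auto
 have comp: "compose (fob F (cod f)) (ap (snd (snd t) (dom f))) (act F f) =
   compose (fob F (cod f)) (act G f) (ap (snd (snd t) (cod f)))" if f: "arr f" for f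
 proof -
  have "Cmp (Set_cat U) (snd (snd t) (dom f)) (farr F f) = Cmp (Set_cat U) (farr G f) (snd (snd t) (cod f))"
   using n f by (auto simp del: Set_cat_simps)
  moreover have "fst (snd (snd t) (cod f)) = fob F (cod f)" "fst (farr F f) = fob F (cod f)"
   using n[unfolded op_cat_simps, THEN conjunct2, THEN conjunct2, THEN conjunct2, THEN conjunct1,
     THEN bspec, OF Cod_Ob[OF f]] functorD(5)[OF *(1), of f] f by simp_all
  ultimately show ?thesis by simp
 qed
 hence "ap (snd (snd t) (dom f)) (act F f x) = act G f (ap (snd (snd t) (cod f)) x)"
  if "arr f" "x:fob F (cod f)" for f x
  using fun_cong[OF comp[OF that(1)], of x] that(2) by (simp add: compose_def)
 thus ?thesis using a unfolding natural_def ev_def by blast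
qed

lemma psh_map_Hom:
 assumes F: "psh F" and G: "psh G" and n: "natural C F G ta"
 shows "psh_map C F G ta:Hom PC F G"
proof -
 let ?al = "\<lambda>c\<in>Ob C. (fob F c, \<lambda>x\<in>fob F c. ta c x, fob G c)"
 have arr: "?al c:Arr (Set_cat U)" if "ob c" for c
  using that pshD(1)[OF F] pshD(1)[OF G] n by (auto simp: Arr_Set_cat natural_def)
 interpret S: category "Set_cat U" by (rule category_Set_cat)
 have "Cmp (Set_cat U) (?al (dom f)) (farr F f) = Cmp (Set_cat U) (farr G f) (?al (cod f))"
  if f: "arr f" for f
 proof (rule Set_cat_eqI)
  have f': "farr F f:Arr (Set_cat U)" "fst (farr F f) = fob F (cod f)" "snd (snd (farr F f)) = fob F (dom f)"
   "farr G f:Arr (Set_cat U)" "fst (farr G f) = fob G (cod f)" "snd (snd (farr G f)) = fob G (dom f)"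
   using functorD(4-6)[OF F, of f] functorD(4-6)[OF G, of f] f by simp_all
  show "fst (Cmp (Set_cat U) (?al (dom f)) (farr F f)) = fst (Cmp (Set_cat U) (farr G f) (?al (cod f)))"
   "snd (snd (Cmp (Set_cat U) (?al (dom f)) (farr F f))) = snd (snd (Cmp (Set_cat U) (farr G f) (?al (cod f))))"
   using f f' by simp_all
  show "Cmp (Set_cat U) (?al (dom f)) (farr F f):Arr (Set_cat U)"
   "Cmp (Set_cat U) (farr G f) (?al (cod f)):Arr (Set_cat U)"
   using arr[of "dom f"] arr[of "cod f"] f' f
    S.Cmp_simps(1)[of "farr F f" "?al (dom f)"] S.Cmp_simps(1)[of "?al (cod f)" "farr G f"]
   by simp_all
  show "ap (Cmp (Set_cat U) (?al (dom f)) (farr F f)) x = ap (Cmp (Set_cat U) (farr G f) (?al (cod f))) x"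
   if "x:fst (Cmp (Set_cat U) (farr G f) (?al (cod f)))" for x
   using that f f' n pshD(2)[OF F] by (simp add: compose_def natural_def)
 qed
 hence "nat_trans (op_cat C) (Set_cat U) F G ?al"
  using F G arr unfolding nat_trans_iff by (simp del: Set_cat_simps(5))
 thus ?thesis by (simp add: psh_map_def presheaf_cat_def)
qed

lemma psh_map_ev [simp]: "ob c ==> x:fob F c ==> ev (psh_map C F G ta) c x = ta c x"
 by (simp add: ev_def psh_map_def)

lemma psh_map_eqI:
 assumes s: "s:Hom PC F G" and t: "t:Hom PC F G"
  and eq: "!!c x. ob c ==> x:fob F c ==> ev s c x = ev t c x"
 shows "s = t"
proof -
 have n: "nat_trans (op_cat C) (Set_cat U) F G (snd (snd s))" "nat_trans (op_cat C) (Set_cat U) F G (snd (snd t))"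
  and ft: "fst s = F" "fst t = F" "fst (snd s) = G" "fst (snd t) = G"
  using s t by (auto simp: presheaf_cat_def)
 have "snd (snd s) c = snd (snd t) c" if "ob c" for c
  using n that eq[OF that] unfolding nat_trans_iff ev_def by (intro Set_cat_eqI[of _ U]) auto
 hence "snd (snd s) = snd (snd t)"
  using n unfolding nat_trans_iff by (intro extensionalityI[of _ "Ob C"]) auto
 thus ?thesis using ft by (simp add: prod_eq_iff)
qed

lemma ev_Cmp [simp]:
 assumes "s:Arr PC" "ob c" "x:fob (fst s) c"
 shows "ev (Cmp PC t s) c x = ev t c (ev s c x)"
 using assms by (simp add: presheaf_cat_def ev_def nat_trans_iff compose_def)

lemma ev_Idt [simp]: "ob c ==> x:fob F c ==> ev (Idt PC F) c x = x"
 by (simp add: presheaf_cat_def ev_def)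

lemma coded_presheaf:
 assumes small: "!!c. ob c ==> small U (T c)"
  and a: "!!f x. arr f ==> x:T (cod f) ==> a f x:T (dom f)"
  and a_id: "!!c x. ob c ==> x:T c ==> a (idt c) x = x"
  and a_cmp: "!!f g x. arr f ==> arr g ==> dom g = cod f ==> x:T (cod g) ==>
   a (g*f) x = a f (a g x)"
 shows "psh (coded_presheaf U C T a)"
proof (rule pshI)
 show "!!c. ob c ==> fob (coded_presheaf U C T a) c:U"
  by (simp add: coded_presheaf_def code_in small)
 show "!!f. arr f ==> farr (coded_presheaf U C T a) f:Arr (Set_cat U) &
   fst (farr (coded_presheaf U C T a) f) = fob (coded_presheaf U C T a) (cod f) &
   snd (snd (farr (coded_presheaf U C T a) f)) = fob (coded_presheaf U C T a) (dom f)"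
  using small a by (auto simp: coded_presheaf_def intro!: coded_map_Arr)
next
 fix f g x assume f: "arr f" "arr g" "dom g = cod f"
  and "x:fob (coded_presheaf U C T a) (cod g)"
 hence x: "x:coded U (T (cod g))" by (simp add: coded_presheaf_def)
 hence "a g (decode U (T (cod g)) x):T (cod f)" using a[OF f(2)] f(3) by simp
 thus "act (coded_presheaf U C T a) (g*f) x = act (coded_presheaf U C T a) f (act (coded_presheaf U C T a) g x)"
  using f x by (simp add: coded_presheaf_def a_cmp small)
qed (auto simp: coded_presheaf_def a_id)

lemma ex_presheaf:
 assumes "!!c. ob c ==> small U (T c)"
  "!!f x. arr f ==> x:T (cod f) ==> a f x:T (dom f)"
  "!!c x. ob c ==> x:T c ==> a (idt c) x = x"
  "!!f g x. arr f ==> arr g ==> dom g = cod f ==> x:T (cod g) ==>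
   a (g*f) x = a f (a g x)"
 obtains F e where "psh F" "!!c. ob c ==> bij_betw (e c) (T c) (fob F c)"
  "!!f x. arr f ==> x:T (cod f) ==> act F f (e (cod f) x) = e (dom f) (a f x)"
proof (rule that[of "coded_presheaf U C T a" "%c. code U (T c)"])
 show "psh (coded_presheaf U C T a)" by (intro coded_presheaf assms)
 show "bij_betw (code U (T c)) (T c) (fob (coded_presheaf U C T a) c)" if "ob c" for c
  using code_inj[OF assms(1)[OF that]] by (simp add: bij_betw_def coded_presheaf_def coded_def)
qed (simp add: coded_presheaf_def assms)

end

section \<open>Representable presheaves and the Yoneda lemma\<close>

locale loc_small = presheaves C U for C :: "('o, 'a) cat" and U :: "'u set set" +
 assumes U: "universe U" and ls: "locally_small U C"
begin

lemma small_Hom [simp]: "ob b ==> ob c ==> small U (hom b c)"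
 using ls unfolding locally_small_def by blast

abbreviation yo where "yo \<equiv> representable U C"
abbreviation cd where "cd b c \<equiv> code U (hom b c)"
abbreviation dc where "dc b c \<equiv> decode U (hom b c)"

lemma representable_coded: "yo c = coded_presheaf U C (%x. hom x c) (%f h. h*f)"
 by (simp add: representable_def coded_presheaf_def)

lemma psh_yo [simp]: "ob c ==> psh (yo c)"
 unfolding representable_coded by (rule coded_presheaf) auto

lemma yo_fob: "fob (yo c) b = coded U (hom b c)"
 by (simp add: representable_def)

lemma cd_yo [simp]: "arr h ==> dom h = b ==> cod h = c ==> cd b c h:fob (yo c) b"
 by (simp add: yo_fob)

lemma dc_yo [simp]: "u:fob (yo c) b ==> arr (dc b c u)" "u:fob (yo c) b ==> dom (dc b c u) = b"
  "u:fob (yo c) b ==> cod (dc b c u) = c" "u:fob (yo c) b ==> cd b c (dc b c u) = u"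
 using decode_in[of u U "hom b c"] by (auto simp: yo_fob)

lemma dc_cd [simp]: "arr h ==> dom h = b ==> cod h = c ==> dc b c (cd b c h) = h"
 by (intro decode_code small_Hom) auto

lemma dc_inj: "u:fob (yo c) b ==> v:fob (yo c) b ==> dc b c u = dc b c v ==> u = v"
 by (metis dc_yo(4))

lemma act_yo [simp]:
 assumes "arr f" "u:fob (yo c) (cod f)"
 shows "act (yo c) f u = cd (dom f) c (dc (cod f) c u*f)"
 using assms by (simp add: representable_def)

text \<open>The elementwise form of a map from \<open>F\<close> to the representable at \<open>c\<close>.\<close>

definition cnat :: "('o, 'a, 'u) presheaf => 'o => ('o => 'u => 'a) => bool" where
 "cnat F c ta <-> ob c & (ALL b:Ob C. ALL x:fob F b. arr (ta b x) & dom (ta b x) = b & cod (ta b x) = c) &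
  (ALL f:Arr C. ALL x:fob F (cod f). ta (dom f) (act F f x) = ta (cod f) x*f)"

lemma cnatD:
 assumes "cnat F c ta"
 shows "ob c" "!!b x. ob b ==> x:fob F b ==> arr (ta b x)"
  "!!b x. ob b ==> x:fob F b ==> dom (ta b x) = b"
  "!!b x. ob b ==> x:fob F b ==> cod (ta b x) = c"
  "!!f x. arr f ==> x:fob F (cod f) ==> ta (dom f) (act F f x) = ta (cod f) x*f"
 using assms unfolding cnat_def by auto

lemma cnat_natural:
 assumes "psh F" "cnat F c ta" shows "natural C F (yo c) (%b x. cd b c (ta b x))"
 using cnatD[OF assms(2)] unfolding natural_def by auto

lemma natural_cnat:
 assumes "psh F" "ob c" "natural C F (yo c) ta" shows "cnat F c (%b x. dc b c (ta b x))"
 using naturalD[OF assms(3)] assms(2) unfolding cnat_def by auto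

lemma natural_yo:
 assumes F: "psh F" and x: "x:fob F c" "ob c"
 shows "natural C (yo c) F (%b u. act F (dc b c u) x)"
 using x pshD(4)[OF F] act_in[OF F] unfolding natural_def by auto

text \<open>The Yoneda lemma on elements: \<open>u\<close> is the restriction of the coded identity
  along the arrow that it codes.\<close>

lemma natural_yo_eq:
 assumes "natural C (yo c) F ta" "ob b" "ob c" "u:fob (yo c) b"
 shows "ta b u = act F (dc b c u) (ta c (cd c c (idt c)))"
 using naturalD(2)[OF assms(1), of "dc b c u" "cd c c (idt c)"] assms by simp

lemma yoneda_arr:
 assumes g: "arr g"
 shows "farr (yoneda U C) g:Hom PC (yo (dom g)) (yo (cod g))"
  "ob b ==> u:fob (yo (dom g)) b ==>
   ev (farr (yoneda U C) g) b u = cd b (cod g) (g*dc b (dom g) u)"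
proof -
 let ?ta = "%b u. cd b (cod g) (g*dc b (dom g) u)"
 have n: "natural C (yo (dom g)) (yo (cod g)) ?ta"
  using g unfolding natural_def by auto
 have eq: "farr (yoneda U C) g = psh_map C (yo (dom g)) (yo (cod g)) ?ta"
  unfolding yoneda_def psh_map_def coded_map_def
  by (auto simp: yo_fob decode_def intro!: restrict_ext)
 show "farr (yoneda U C) g:Hom PC (yo (dom g)) (yo (cod g))"
  unfolding eq using g n by (intro psh_map_Hom) auto
 show "ob b ==> u:fob (yo (dom g)) b ==>
   ev (farr (yoneda U C) g) b u = cd b (cod g) (g*dc b (dom g) u)"
  unfolding eq by simp
qed

lemma yoneda_fob [simp]: "fob (yoneda U C) c = yo c"
 by (simp add: yoneda_def)

lemma yoneda_functor: "is_functor C PC (yoneda U C)"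
proof (rule functorI[OF category_axioms category_PC])
 fix x assume x: "ob x"
 interpret P: category PC by (rule category_PC)
 show "farr (yoneda U C) (idt x) = Idt PC (fob (yoneda U C) x)"
  using x yoneda_arr[of "idt x"] P.Idt_in[of "yo x"]
  by (intro psh_map_eqI[of _ "yo x" "yo x"]) auto
next
 fix f g assume fg: "arr f" "arr g" "dom g = cod f"
 interpret P: category PC by (rule category_PC)
 have h: "Cmp PC (farr (yoneda U C) g) (farr (yoneda U C) f):Hom PC (yo (dom f)) (yo (cod g))"
  using P.Cmp_in yoneda_arr(1)[OF fg(1)] yoneda_arr(1)[OF fg(2)] fg(3) by auto
 have f: "farr (yoneda U C) f:Arr PC" "fst (farr (yoneda U C) f) = yo (dom f)"
  using yoneda_arr(1)[OF fg(1)] by auto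
 show "farr (yoneda U C) (g*f) = Cmp PC (farr (yoneda U C) g) (farr (yoneda U C) f)"
  using fg yoneda_arr(1)[of "g*f"] h f
  by (intro psh_map_eqI[of _ "yo (dom f)" "yo (cod g)"]) (auto simp: yoneda_arr(2))
qed (use yoneda_arr in auto)

end

section \<open>Small presheaves\<close>

lemma comp_fctr_id [simp]: "comp_fctr F id_fctr = F"
 by (simp add: comp_fctr_def id_fctr_def)

lemma id_fctr_simps [simp]: "fob id_fctr x = x" "farr id_fctr f = f"
 by (simp_all add: id_fctr_def)

lemma comp_fctr_simps [simp]: "fob (comp_fctr G F) x = fob G (fob F x)" "farr (comp_fctr G F) f = farr G (farr F f)"
 by (simp_all add: comp_fctr_def)

context presheaves
begin

text \<open>The quotient is realised on a chosen representative of each class, so that it stays in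
  the type of \<open>X\<close>; the action restricts and then chooses again.\<close>

lemma ex_quotient:
 assumes small: "!!c. ob c ==> small U (X c)" and U: "universe U"
  and a: "!!f x. arr f ==> x:X (cod f) ==> a f x:X (dom f)"
  and a_id: "!!c x. ob c ==> x:X c ==> a (idt c) x = x"
  and a_cmp: "!!f g x. arr f ==> arr g ==> dom g = cod f ==> x:X (cod g) ==>
   a (g*f) x = a f (a g x)"
  and refl: "!!c x. ob c ==> x:X c ==> R c x x"
  and sym: "!!c x y. ob c ==> x:X c ==> y:X c ==> R c x y ==> R c y x"
  and trans: "!!c x y z. ob c ==> x:X c ==> y:X c ==> z:X c ==> R c x y ==> R c y z ==> R c x z"
  and stable: "!!f x y. arr f ==> x:X (cod f) ==> y:X (cod f) ==> R (cod f) x y ==>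
   R (dom f) (a f x) (a f y)"
 obtains Q q where "psh Q" "!!c. ob c ==> q c ` X c = fob Q c"
  "!!c x y. ob c ==> x:X c ==> y:X c ==> q c x = q c y <-> R c x y"
  "!!f x. arr f ==> x:X (cod f) ==> act Q f (q (cod f) x) = q (dom f) (a f x)"
proof -
 define r where "r c x = (SOME y. y:X c & R c x y)" for c x
 have r: "r c x:X c & R c x (r c x)" if "ob c" "x:X c" for c x
  unfolding r_def by (rule someI[of _ x]) (use that refl in auto)
 have r_eq: "r c x = r c y <-> R c x y" if "ob c" "x:X c" "y:X c" for c x y
 proof
  assume "r c x = r c y" thus "R c x y" using r that sym trans by metis
 next
  assume "R c x y"
  \<comment> \<open>Related elements define the same predicate, so the choice operator selects the
    same representative.\<close>
  hence "R c x z <-> R c y z" if "z:X c" for z using that \<open>c:Ob C\<close> \<open>x:X c\<close> \<open>y:X c\<close> sym trans by metis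
  thus "r c x = r c y" unfolding r_def by (metis (mono_tags, lifting))
 qed
 have r_act: "r (dom f) (a f (r (cod f) x)) = r (dom f) (a f x)"
  if "arr f" "x:X (cod f)" for f x
 proof -
  have "r (cod f) x:X (cod f)" "R (cod f) (r (cod f) x) x"
   using r[of "cod f" x] sym that by auto
  thus ?thesis using stable that a r_eq by simp
 qed
 define T where "T c = r c ` X c" for c
 have TX: "x:X c" if "ob c" "x:T c" for c x using that r unfolding T_def by blast
 have Tr: "r c x = x" if "ob c" "x:T c" for c x
 proof -
  obtain y where y: "x = r c y" "y:X c" using \<open>x:T c\<close> unfolding T_def by blast
  have "R c y x" "x:X c" using r[OF \<open>c:Ob C\<close> y(2)] y(1) by auto
  thus ?thesis using r_eq[OF \<open>c:Ob C\<close> y(2), of x] y(1) by simp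
 qed
 obtain F e where F: "psh F" "!!c. ob c ==> bij_betw (e c) (T c) (fob F c)"
  "!!f x. arr f ==> x:T (cod f) ==> act F f (e (cod f) x) = e (dom f) (r (dom f) (a f x))"
 proof (rule ex_presheaf[of T "%f x. r (dom f) (a f x)"])
  show "!!c. ob c ==> small U (T c)" unfolding T_def by (intro small_image U small)
  show "r (dom f) (a f x):T (dom f)" if "arr f" "x:T (cod f)" for f x
   using a[OF that(1) TX[OF Cod_Ob[OF that(1)] that(2)]] unfolding T_def by (rule imageI)
  show "!!c x. ob c ==> x:T c ==> r (dom (idt c)) (a (idt c) x) = x"
   using a_id TX Tr by simp
  show "r (dom (g*f)) (a (g*f) x) = r (dom f) (a f (r (dom g) (a g x)))"
   if "arr f" "arr g" "dom g = cod f" "x:T (cod g)" for f g x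
   using that r_act[of f "a g x"] a[of g x] TX[of "cod g" x] a_cmp by simp
 qed auto
 show thesis
 proof (rule that[of F "%c x. e c (r c x)"])
  fix c assume c: "ob c"
  show "(%x. e c (r c x)) ` X c = fob F c" using F(2)[OF c] unfolding bij_betw_def T_def by auto
  fix x y assume "x:X c" "y:X c"
  hence "e c (r c x) = e c (r c y) <-> r c x = r c y"
   using F(2)[OF c] inj_on_eq_iff[of "e c" "r c ` X c" "r c x" "r c y"]
   unfolding bij_betw_def T_def by blast
  thus "e c (r c x) = e c (r c y) <-> R c x y" using r_eq \<open>x:X c\<close> \<open>y:X c\<close> c by simp
 next
  fix f x assume "arr f" "x:X (cod f)"
  thus "act F f (e (cod f) (r (cod f) x)) = e (dom f) (r (dom f) (a f x))"
   using F(3)[of f "r (cod f) x"] r_act unfolding T_def by simp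
 qed (rule F(1))
qed

lemma psh_restrict:
 assumes "psh F" shows "is_functor (op_cat (full_subcat C S)) (Set_cat U) F"
proof -
 interpret S: category "full_subcat C S" by (rule category_full_subcat)
 show ?thesis by (rule functorI[OF S.category_op_cat category_Set_cat]) (use functorD[OF assms] in auto)
qed

lemma nat_trans_natural:
 assumes "nat_trans (op_cat C) (Set_cat U) F G bt"
 shows "natural C F G (%c. ap (bt c))" "ob c ==> fst (bt c) = fob F c" "ob c ==> snd (snd (bt c)) = fob G c"
proof -
 have "(F, G, bt):Hom PC F G" using assms by (simp add: presheaf_cat_def)
 thus "natural C F G (%c. ap (bt c))" using ev_natural[of "(F, G, bt)" F G] by (simp add: ev_def[abs_def])
 show "ob c ==> fst (bt c) = fob F c" "ob c ==> snd (snd (bt c)) = fob G c"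
  using assms by (auto simp: nat_trans_iff)
qed

lemma natural_nat_trans:
 assumes "psh F" "psh G" "natural C F G ta"
 shows "nat_trans (op_cat C) (Set_cat U) F G (\<lambda>c\<in>Ob C. (fob F c, \<lambda>x\<in>fob F c. ta c x, fob G c))"
 using psh_map_Hom[OF assms] by (simp add: presheaf_cat_def psh_map_def)

lemma nat_trans_eqI:
 assumes "nat_trans (op_cat C) (Set_cat U) F G al" "nat_trans (op_cat C) (Set_cat U) F G bt"
  and eq: "!!c x. ob c ==> x:fob F c ==> ap (al c) x = ap (bt c) x"
 shows "al = bt"
proof -
 have "(F, G, al):Hom PC F G" "(F, G, bt):Hom PC F G"
  using assms(1,2) by (simp_all add: presheaf_cat_def)
 from psh_map_eqI[OF this] eq show ?thesis by (simp add: ev_def)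
qed

lemma natural_comp:
 "natural C F G si ==> natural C G H ta ==> natural C F H (%c x. ta c (si c x))"
 unfolding natural_def by simp

lemma natural_id: "psh F ==> natural C F F (%c x. x)"
 unfolding natural_def by simp

end

context loc_small
begin

text \<open>The unit of the Kan extension may be any natural endomorphism \<open>h\<close> of the
  restriction of \<open>F\<close> to \<open>S\<close>, not only the identity. A map to
  \<open>F\<close> from a quotient of formal restrictions of elements over \<open>S\<close> is split
  by the universal property; hence \<open>F\<close> is generated by values of \<open>h\<close>, and
  \<open>h\<close> is surjective over \<open>S\<close>. Surjectivity then allows extension of
  \<open>ta\<close> itself instead of extension along \<open>h\<close>.\<close>

lemma small_presheafD:
 assumes "small_presheaf U C F"
 obtains S where "S <= Ob C" "small U S"
  "ALL c:Ob C. ALL x:fob F c.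
   EX f y. arr f & dom f = c & cod f:S & y:fob F (cod f) & x = act F f y"
  "ALL G ta. psh G --> natural (full_subcat C S) F G ta -->
   (EX bt. natural C F G bt & (ALL s:S. ALL x:fob F s. bt s x = ta s x))"
proof -
 have F: "psh F" using assms unfolding small_presheaf_def by blast
 obtain S et where S: "S <= Ob C" "small U S"
  and kan: "is_left_kan_extension (op_cat (full_subcat C S)) (op_cat C) (Set_cat U) id_fctr F F et"
  using assms unfolding small_presheaf_def comp_fctr_id by blast
 interpret S: category "full_subcat C S" by (rule category_full_subcat)
 interpret S: presheaves "full_subcat C S" U by unfold_locales
 have ObS: "Ob (full_subcat C S) = S" using S(1) by auto
 have et: "nat_trans (op_cat (full_subcat C S)) (Set_cat U) F F et"
  using kan unfolding is_left_kan_extension_def by simp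
 have un: "EX! bt. nat_trans (op_cat C) (Set_cat U) F G bt & (ALL a:S. al a = Cmp (Set_cat U) (bt a) (et a))"
  if "psh G" "nat_trans (op_cat (full_subcat C S)) (Set_cat U) F G al" for G al
  using kan that ObS unfolding is_left_kan_extension_def by simp
 define h where "h s = ap (et s)" for s
 have h: "natural (full_subcat C S) F F h"
  using S.nat_trans_natural(1)[OF et] by (simp add: h_def[abs_def])
 have hS: "h s x:fob F s" if "s:S" "x:fob F s" for s x using naturalD(1)[OF h] that ObS by auto
 have ex: "EX bt. natural C F G bt & (ALL s:S. ALL x:fob F s. bt s (h s x) = ta s x)"
  if G: "psh G" and ta: "natural (full_subcat C S) F G ta" for G ta
 proof -
  obtain bt where b: "nat_trans (op_cat C) (Set_cat U) F G bt"
    "ALL s:S. (fob F s, \<lambda>x\<in>fob F s. ta s x, fob G s) = Cmp (Set_cat U) (bt s) (et s)"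
   using ex1_implies_ex[OF un[OF G S.natural_nat_trans[OF psh_restrict[OF F] psh_restrict[OF G] ta]]]
   unfolding ObS by (auto simp del: Set_cat_simps)
  have "ap (bt s) (h s x) = ta s x" if "s:S" "x:fob F s" for s x
  proof -
   have "fst (et s) = fob F s" using S.nat_trans_natural(2)[OF et, of s] that(1) S(1) by auto
   hence "ap (fob F s, \<lambda>x\<in>fob F s. ta s x, fob G s) x = ap (bt s) (h s x)"
    using arg_cong[OF bspec[OF b(2) that(1)], of "%t. ap t x"] that(2) by (simp add: h_def compose_def)
   thus ?thesis using that by simp
  qed
  thus ?thesis using nat_trans_natural(1)[OF b(1)] by blast
 qed
 have unq: "bt c x = bt' c x" if G: "psh G" and b: "natural C F G bt" "natural C F G bt'"
   and eq: "!!s x. s:S ==> x:fob F s ==> bt s (h s x) = bt' s (h s x)" and c: "ob c" "x:fob F c"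
  for G bt bt' c x
 proof -
  let ?t = "%ta. \<lambda>c\<in>Ob C. (fob F c, \<lambda>x\<in>fob F c. ta c x, fob G c)"
  have nb: "nat_trans (op_cat C) (Set_cat U) F G (?t bt)" "nat_trans (op_cat C) (Set_cat U) F G (?t bt')"
   using natural_nat_trans F G b by auto
  let ?al = "\<lambda>s\<in>S. (fob F s, \<lambda>x\<in>fob F s. bt s (h s x), fob G s)"
  have "natural (full_subcat C S) F G (%s x. bt s (h s x))"
   using S.natural_comp[OF h, of G bt] b(1) unfolding natural_def by auto
  hence n: "nat_trans (op_cat (full_subcat C S)) (Set_cat U) F G ?al"
   using S.natural_nat_trans[OF psh_restrict[OF F] psh_restrict[OF G]] ObS by simp
  have ets: "fst (et s) = fob F s" if "s:S" for s
   using S.nat_trans_natural(2)[OF et, of s] that S(1) by auto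
  have "ALL a:S. ?al a = Cmp (Set_cat U) (?t bt a) (et a)" "ALL a:S. ?al a = Cmp (Set_cat U) (?t bt' a) (et a)"
   using S(1) ets hS eq by (auto simp: compose_def h_def[symmetric] subset_iff intro!: restrict_ext)
  hence "?t bt = ?t bt'" using un[OF G n] nb by blast
  hence "ap (?t bt c) x = ap (?t bt' c) x" by simp
  thus ?thesis using c by simp
 qed
 \<comment> \<open>\<open>Q\<close> is the part of \<open>F\<close> generated by the values of
   \<open>h\<close>, built as a presheaf of its own so that the extension property can be applied to
   it.\<close>
 have gen: "EX f y. arr f & dom f = c & cod f:S & y:fob F (cod f) & x = act F f (h (cod f) y)"
  if c: "ob c" "x:fob F c" for c x
 proof -
  define X where "X c = {(f, y). arr f & dom f = c & cod f:S & y:fob F (cod f)}" for c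
  define R where "R c w w' <-> act F (fst w) (h (cod (fst w)) (snd w)) = act F (fst w') (h (cod (fst w')) (snd w'))"
   for c :: 'o and w w' :: "'a \<times> 'u"
  have smX: "small U (X c)" if "ob c" for c
  proof -
   have "small U (SIGMA f:(\<Union>s\<in>S. hom c s). fob F (cod f))"
    using S that pshD(1)[OF F] by (intro small_Sigma[OF U] small_UN[OF U] small_in[OF U]) (auto simp: subset_iff)
   thus ?thesis by (rule small_subset[OF U]) (auto simp: X_def)
  qed
  obtain Q q where Q: "psh Q" "!!c. ob c ==> q c ` X c = fob Q c"
   "!!c x y. ob c ==> x:X c ==> y:X c ==> q c x = q c y <-> R c x y"
   "!!f x. arr f ==> x:X (cod f) ==> act Q f (q (cod f) x) = q (dom f) (fst x*f, snd x)"
   by (rule ex_quotient[of X "%f w. (fst w*f, snd w)" R, OF smX U])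
    (use hS pshD(4)[OF F] in \<open>auto simp: X_def R_def\<close>)
  define gm where "gm c u = (let w = inv_into (X c) (q c) u in act F (fst w) (h (cod (fst w)) (snd w)))" for c u
  have gm: "gm c (q c w) = act F (fst w) (h (cod (fst w)) (snd w))" if "ob c" "w:X c" for c w
  proof -
   have "inv_into (X c) (q c) (q c w):X c" "q c (inv_into (X c) (q c) (q c w)) = q c w"
    using that by (auto simp: inv_into_into f_inv_into_f)
   thus ?thesis using Q(3) that unfolding gm_def R_def by (auto simp: Let_def)
  qed
  have ngm: "natural C Q F gm"
   unfolding natural_def
  proof (intro conjI ballI)
   fix c u assume "ob c" "u:fob Q c"
   then obtain w where "w:X c" "u = q c w" using Q(2) by blast
   thus "gm c u:fob F c" using gm \<open>c:Ob C\<close> hS pshD(2)[OF F] by (auto simp: X_def)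
  next
   fix f u assume f: "arr f" "u:fob Q (cod f)"
   then obtain w where w: "w:X (cod f)" "u = q (cod f) w" using Q(2) by (metis Cod_Ob imageE)
   have "(fst w*f, snd w):X (dom f)" using w f by (auto simp: X_def)
   thus "gm (dom f) (act Q f u) = act F f (gm (cod f) u)"
    using Q(4) w f gm hS pshD(4)[OF F] by (auto simp: X_def)
  qed
  have "natural (full_subcat C S) F Q (%s y. q s (idt s, y))"
   unfolding natural_def
  proof (intro conjI ballI)
   fix c x assume "c:Ob (full_subcat C S)" "x:fob F c"
   hence "(idt c, x):X c" "ob c" using ObS by (auto simp: X_def)
   thus "q c (idt c, x):fob Q c" using Q(2)[of c] by blast
  next
   fix f x assume f: "f:Arr (full_subcat C S)" and x: "x:fob F (Cod (full_subcat C S) f)"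
   have in1: "(idt (dom f), act F f x):X (dom f)" "(idt (cod f), x):X (cod f)"
    and in2: "(f, x):X (dom f)"
    using f x pshD(2)[OF F] by (auto simp: X_def)
   have "h (dom f) (act F f x) = act F f (h (cod f) x)"
    using naturalD(2)[OF h, of f x] f x by simp
   moreover have "h (cod f) x:fob F (cod f)" using hS f x by simp
   ultimately have "R (dom f) (idt (dom f), act F f x) (f, x)"
    using f x pshD[OF F] unfolding R_def by simp
   thus "q (Dom (full_subcat C S) f) (idt (Dom (full_subcat C S) f), act F f x) =
     act Q f (q (Cod (full_subcat C S) f) (idt (Cod (full_subcat C S) f), x))"
    using Q(4)[of f "(idt (cod f), x)"] Q(3)[of "dom f"] in1 in2 f by simp
  qed
  from ex[OF Q(1) this] obtain bt where b: "natural C F Q bt"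
   "!!s x. s:S ==> x:fob F s ==> bt s (h s x) = q s (idt s, x)" by metis
  \<comment> \<open>The composite \<open>F\<close> to \<open>Q\<close> to \<open>F\<close> and the
    identity agree after \<open>h\<close> over \<open>S\<close>, hence everywhere by
    uniqueness.\<close>
  have "gm c (bt c x) = x"
  proof (rule unq[OF F natural_comp[OF b(1) ngm] natural_id[OF F] _ c])
   fix s x assume s: "s:S" "x:fob F s"
   hence "(idt s, x):X s" using S(1) by (auto simp: X_def)
   thus "gm s (bt s (h s x)) = h s x" using b(2) s S(1) gm hS pshD(3)[OF F] by (auto simp: subset_iff)
  qed
  moreover obtain w where "w:X c" "bt c x = q c w" using Q(2) naturalD(1)[OF b(1)] c by blast
  ultimately show ?thesis using gm[OF c(1), of w]
   by (intro exI[of _ "fst w"] exI[of _ "snd w"]) (auto simp: X_def)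
 qed
 have surj: "EX y. y:fob F s & x = h s y" if s: "s:S" "x:fob F s" for s x
 proof -
  obtain f y where f: "arr f" "dom f = s" "cod f:S" "y:fob F (cod f)" "x = act F f (h (cod f) y)"
   using gen[of s x] s S(1) by blast
  hence "x = h s (act F f y)" using naturalD(2)[OF h, of f y] s by simp
  thus ?thesis using pshD(2)[OF F f(1,4)] f(2) by auto
 qed
 show thesis
 proof (rule that[OF S]; intro ballI allI impI)
  fix c x assume "ob c" "x:fob F c"
  from gen[OF this] show "EX f y. arr f & dom f = c & cod f:S & y:fob F (cod f) & x = act F f y"
   using hS by blast
 next
  fix G ta assume G: "psh G" and ta: "natural (full_subcat C S) F G ta"
  \<comment> \<open>Extending \<open>ta\<close> after \<open>h\<close> gives agreement on values of
    \<open>h\<close>, which are all elements over \<open>S\<close>.\<close>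
  obtain bt where b: "natural C F G bt" "!!s x. s:S ==> x:fob F s ==> bt s (h s x) = ta s (h s x)"
   using ex[OF G S.natural_comp[OF h ta]] by metis
  have "bt s x = ta s x" if "s:S" "x:fob F s" for s x
   using surj[OF that] b(2) that(1) by blast
  thus "EX bt. natural C F G bt & (ALL s:S. ALL x:fob F s. bt s x = ta s x)" using b(1) by blast
 qed
qed

end

section \<open>Small presheaves as filtered colimits over small sets of objects\<close>

locale lex_loc_small = loc_small C U + lex_category C for C :: "('o, 'a) cat" and U :: "'u set set"
begin

text \<open>The closure properties of \<open>A\<close> make the comma category of arrows from any fixed object into \<open>A\<close>
 cofiltered, so that left Kan extension from \<open>A\<close> is a filtered colimit at each object.\<close>

definition filtering :: "'o set => bool" where
 "filtering A <-> A <= Ob C & small U A &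
  (ALL c:Ob C. EX f:Arr C. dom f = c & cod f:A) &
  (ALL f:Arr C. ALL g:Arr C. dom f = dom g --> cod f:A --> cod g:A -->
   (EX k:Arr C. EX p:Arr C. EX q:Arr C. dom k = dom f & cod k:A & dom p = cod k & dom q = cod k &
     cod p = cod f & cod q = cod g & p*k = f & q*k = g)) &
  (ALL k:Arr C. ALL p:Arr C. ALL q:Arr C. cod k:A --> dom p = cod k --> dom q = cod k -->
   cod p = cod q --> cod p:A --> p*k = q*k -->
   (EX k':Arr C. EX m:Arr C. dom k' = dom k & cod k':A & dom m = cod k' & cod m = cod k &
     m*k' = k & p*m = q*m))"

lemma filteringD:
 assumes "filtering A"
 shows "A <= Ob C" "small U A" "!!c. ob c ==> EX f:Arr C. dom f = c & cod f:A"
 using assms unfolding filtering_def by blast+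

lemma filtering_pair:
 assumes "filtering A" "arr f" "arr g" "dom f = dom g" "cod f:A" "cod g:A"
 obtains k p q where "arr k" "arr p" "arr q" "dom k = dom f" "cod k:A"
  "dom p = cod k" "dom q = cod k" "cod p = cod f" "cod q = cod g" "p*k = f" "q*k = g"
proof -
 have "ALL f:Arr C. ALL g:Arr C. dom f = dom g --> cod f:A --> cod g:A -->
   (EX k:Arr C. EX p:Arr C. EX q:Arr C. dom k = dom f & cod k:A & dom p = cod k & dom q = cod k &
     cod p = cod f & cod q = cod g & p*k = f & q*k = g)"
  using assms(1) unfolding filtering_def by (elim conjE)
 thus thesis using that assms(2-) by blast
qed

lemma filtering_equalise:
 assumes "filtering A" "arr k" "arr p" "arr q" "cod k:A" "dom p = cod k" "dom q = cod k"
  "cod p = cod q" "cod p:A" "p*k = q*k"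
 obtains k' m where "arr k'" "arr m" "dom k' = dom k" "cod k':A" "dom m = cod k'"
  "cod m = cod k" "m*k' = k" "p*m = q*m"
proof -
 have "ALL k:Arr C. ALL p:Arr C. ALL q:Arr C. cod k:A --> dom p = cod k --> dom q = cod k -->
   cod p = cod q --> cod p:A --> p*k = q*k -->
   (EX k':Arr C. EX m:Arr C. dom k' = dom k & cod k':A & dom m = cod k' & cod m = cod k &
     m*k' = k & p*m = q*m)"
  using assms(1) unfolding filtering_def by (elim conjE)
 thus thesis using that assms(2-) by blast
qed

text \<open>Each stage adds one chosen product for every pair of objects and one chosen equaliser
  for every parallel pair, which local smallness keeps a small set. After countably many stages,
  starting from \<open>S\<close> and a terminal object, nothing new is required.\<close>

lemma ex_filtering:
 assumes S: "S <= Ob C" "small U S" shows "EX A. filtering A & S <= A"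
proof -
 obtain t where t: "terminal C t" using ex_terminal .
 have "EX P. EX p q. is_product C (fst w) (snd w) P p q" if "w:Ob C \<times> Ob C" for w
  using ex_product that by (metis mem_Times_iff)
 then obtain pr where pr: "!!w. w:Ob C \<times> Ob C ==> EX p q. is_product C (fst w) (snd w) (pr w) p q" by metis
 define W where "W = {w. arr (fst w) & arr (snd w) & dom (snd w) = dom (fst w) & cod (snd w) = cod (fst w)}"
 define EQ where "EQ w e <-> arr e & cod e = dom (fst w) & fst w*e = snd w*e &
   (ALL h. arr h --> cod h = dom (fst w) --> fst w*h = snd w*h -->
   (EX k. arr k & dom k = dom h & cod k = dom e & e*k = h))" for w e
 have "EX e. EQ w e" if "w:W" for w
 proof -
  have "arr (fst w)" "arr (snd w)" "dom (snd w) = dom (fst w)" "cod (snd w) = cod (fst w)"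
   using that unfolding W_def by auto
  thus ?thesis
  proof (rule ex_equaliser)
   fix e assume "arr e" "cod e = dom (fst w)" "fst w*e = snd w*e"
    "!!h. arr h ==> cod h = dom (fst w) ==> fst w*h = snd w*h ==>
     EX k. arr k & dom k = dom h & cod k = dom e & e*k = h"
   thus "EX e. EQ w e" unfolding EQ_def by blast
  qed
 qed
 then obtain eq where EQ: "!!w. w:W ==> EQ w (eq w)" by metis
 hence eq: "!!w a b. fst w:hom a b ==> snd w:hom a b ==>arr (
   eq w) & cod (eq w) = dom (fst w) & fst w*eq w = snd w*eq w &
   (ALL h. arr h --> cod h = dom (fst w) --> fst w*h = snd w*h -->
   (EX k. arr k & dom k = dom h & cod k = dom (eq w) & eq w*k = h))"
  using EQ unfolding EQ_def W_def by simp
 define step where "step B = B Un pr ` (B \<times> B) Un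
  (\<Union>(a, b)\<in>B \<times> B. (%w. dom (eq w)) ` (hom a b \<times> hom a b))" for B
 define A where "A n = (step ^^ n) (insert t S)" for n
 have A0: "A 0 = insert t S" and AS: "A (Suc n) = step (A n)" for n by (simp_all add: A_def)
 have A: "A n <= Ob C & small U (A n)" for n
 proof (induction n)
  case 0
  have "small U ({t} Un S)" by (intro small_Un[OF U] small_finite[OF U] S) simp
  thus ?case using t S unfolding terminal_def A0 by simp
 next
  case (Suc n)
  hence s: "small U (A n \<times> A n)" by (intro small_Sigma[OF U]) auto
  have "small U (step (A n))"
   unfolding step_def using Suc s
   by (intro small_Un[OF U] small_UN[OF U] small_image[OF U]) (auto intro!: small_image[OF U] small_Sigma[OF U] simp: subset_iff)
  moreover have "step (A n) <= Ob C"
  proof -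
   have "ob (pr w)" if "w:A n \<times> A n" for w
   proof -
    have "w:Ob C \<times> Ob C" using that Suc by auto
    from pr[OF this] show ?thesis using productD(7) by blast
   qed
   moreover have "ob (dom (eq w))" if "w:hom a b \<times> hom a b" for w a b
    using eq[of w a b] that by auto
   ultimately show ?thesis using Suc unfolding step_def by blast
  qed
  ultimately show ?case by (simp add: AS)
 qed
 have inc: "A n <= A m" if "n <= m" for n m
  using that by (induction rule: dec_induct) (auto simp: AS step_def)
 have "filtering (\<Union>n. A n)"
  unfolding filtering_def
 proof (intro conjI ballI impI)
  show "(\<Union>n. A n) <= Ob C" using A by blast
  show "small U (\<Union>n. A n)" by (intro small_UN[OF U] small_nat[OF U]) (use A in auto)
  fix c assume "ob c"
  then obtain f where "f:hom c t" using t unfolding terminal_def by blast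
  thus "EX f:Arr C. dom f = c & cod f:(\<Union>n. A n)" using A0 by (auto simp: intro!: exI[of _ 0])
 next
  fix f g assume f: "arr f" "arr g" "dom f = dom g" "cod f:(\<Union>n. A n)" "cod g:(\<Union>n. A n)"
  then obtain n m where nm: "cod f:A n" "cod g:A m" by blast
  hence l: "cod f:A (max n m)" "cod g:A (max n m)" using inc[of n "max n m"] inc[of m "max n m"] by auto
  have P: "pr (cod f, cod g):(\<Union>n. A n)"
   using l by (intro UN_I[of "Suc (max n m)"]) (auto simp: AS step_def)
  obtain p q where pq: "is_product C (cod f) (cod g) (pr (cod f, cod g)) p q"
   using pr[of "(cod f, cod g)"] f by auto
  obtain k where k: "arr k" "dom k = dom f" "cod k = pr (cod f, cod g)" "p*k = f" "q*k = g"
   using product_pair[OF pq f(1,2)] f(3) by auto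
  have "cod k:(\<Union>n. A n)" "dom p = cod k" "dom q = cod k"
   using P k(3) productD(3,4)[OF pq] by (simp_all only:)
  thus "EX k:Arr C. EX p:Arr C. EX q:Arr C. dom k = dom f & cod k:(\<Union>n. A n) & dom p = cod k &
    dom q = cod k & cod p = cod f & cod q = cod g & p*k = f & q*k = g"
   using k productD(1,2,5,6)[OF pq] by blast
 next
  fix k p q assume h: "arr k" "arr p" "arr q" "cod k:(\<Union>n. A n)" "dom p = cod k"
   "dom q = cod k" "cod p = cod q" "cod p:(\<Union>n. A n)" "p*k = q*k"
  then obtain n m where nm: "cod k:A n" "cod p:A m" by blast
  hence l: "cod k:A (max n m)" "cod p:A (max n m)" using inc[of n "max n m"] inc[of m "max n m"] by auto
  have pq: "p:hom (cod k) (cod p)" "q:hom (cod k) (cod p)" using h by auto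
  have "dom (eq (p, q)):step (A (max n m))"
   using l pq unfolding step_def by blast
  hence E: "dom (eq (p, q)):(\<Union>n. A n)" by (intro UN_I[of "Suc (max n m)"]) (auto simp: AS)
  have e: "arr (eq (p, q))" "cod (eq (p, q)) = cod k" "p*eq (p, q) = q*eq (p, q)"
   "EX l. arr l & dom l = dom k & cod l = dom (eq (p, q)) & eq (p, q)*l = k"
   using eq[of "(p, q)"] pq h by auto
  thus "EX k':Arr C. EX m:Arr C. dom k' = dom k & cod k':(\<Union>n. A n) & dom m = cod k' &
    cod m = cod k & m*k' = k & p*m = q*m"
   using E by metis
 qed
 thus ?thesis using A0 by (metis UNIV_I UN_upper insert_subset subset_insertI subset_trans)
qed

text \<open>Over a filtering \<open>A\<close> the two clauses say that the canonical map to
  \<open>F c\<close> from the filtered colimit of the \<open>F a\<close>, taken over arrows from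
  \<open>c\<close> to objects \<open>a\<close> of \<open>A\<close>, is surjective and
  injective.\<close>

definition presented :: "'o set => ('o, 'a, 'u) presheaf => bool" where
 "presented A F <->
  (ALL c:Ob C. ALL x:fob F c. EX f y. arr f & dom f = c & cod f:A & y:fob F (cod f) & x = act F f y) &
  (ALL f:Arr C. ALL y:fob F (cod f). ALL y':fob F (cod f). cod f:A --> act F f y = act F f y' -->
   (EX k m. arr k & arr m & dom k = dom f & cod k:A & dom m = cod k & cod m = cod f &
    m*k = f & act F m y = act F m y'))"

lemma presented_gen:
 assumes "presented A F" "ob c" "x:fob F c"
 obtains f y where "arr f" "dom f = c" "cod f:A" "y:fob F (cod f)" "x = act F f y"
 using assms unfolding presented_def by blast

lemma presented_eq:
 assumes "presented A F" "arr f" "cod f:A" "y:fob F (cod f)" "y':fob F (cod f)"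
  "act F f y = act F f y'"
 obtains k m where "arr k" "arr m" "dom k = dom f" "cod k:A" "dom m = cod k" "cod m = cod f"
  "m*k = f" "act F m y = act F m y'"
 using assms unfolding presented_def by blast

text \<open>\<open>F\<close> is the Kan extension of its restriction with identity unit. An
  extension of \<open>ta\<close> must send \<open>act F f y\<close> to the restriction along
  \<open>f\<close> of the value at \<open>y\<close>; filteredness makes this independent of the
  presentation.\<close>

lemma presented_imp_small:
 assumes A: "filtering A" and F: "psh F" and p: "presented A F"
 shows "small_presheaf U C F"
proof -
 let ?D = "full_subcat C A"
 interpret S: category ?D by (rule category_full_subcat)
 interpret S: presheaves ?D U by unfold_locales
 have ObA: "Ob ?D = A" using filteringD(1)[OF A] by auto
 have AO: "ob a" if "a:A" for a using that filteringD(1)[OF A] by auto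
 have incl: "is_functor (op_cat ?D) (op_cat C) id_fctr"
  by (rule functorI[OF S.category_op_cat category_op_cat]) auto
 let ?et = "\<lambda>c\<in>Ob ?D. (fob F c, \<lambda>x\<in>fob F c. x, fob F c)"
 have et: "nat_trans (op_cat ?D) (Set_cat U) F F ?et"
  by (rule S.natural_nat_trans[OF psh_restrict[OF F] psh_restrict[OF F] S.natural_id[OF psh_restrict[OF F]]])
 have ke: "EX! bt. nat_trans (op_cat C) (Set_cat U) F G bt & (ALL a:A. al a = Cmp (Set_cat U) (bt a) (?et a))"
  if G: "psh G" and al: "nat_trans (op_cat ?D) (Set_cat U) F G al" for G al
 proof -
  define ta where "ta a = ap (al a)" for a
  have ta: "natural ?D F G ta" using S.nat_trans_natural(1)[OF al] by (simp add: ta_def[abs_def])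
  have tain: "ta a x:fob G a" if "a:A" "x:fob F a" for a x using naturalD(1)[OF ta] that ObA by auto
  have taact: "ta (dom m) (act F m x) = act G m (ta (cod m) x)"
   if "arr m" "dom m:A" "cod m:A" "x:fob F (cod m)" for m x
   using naturalD(2)[OF ta, of m x] that by simp
  \<comment> \<open>Two presentations are first brought to a common stage \<open>k\<close>, where
    they still differ, and then to a later stage \<open>l\<close> where injectivity makes them
    equal.\<close>
  have wd: "act G f (ta (cod f) y) = act G f' (ta (cod f') y')"
   if f: "arr f" "cod f:A" "y:fob F (cod f)" and f': "arr f'" "cod f':A" "y':fob F (cod f')"
    and d: "dom f = dom f'" and e: "act F f y = act F f' y'" for f y f' y'
  proof -
   obtain k p q where k: "arr k" "arr p" "arr q" "dom k = dom f" "cod k:A"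
    "dom p = cod k" "dom q = cod k" "cod p = cod f" "cod q = cod f'" "p*k = f" "q*k = f'"
    using filtering_pair[OF A f(1) f'(1) d f(2) f'(2)] .
   have py: "act F p y:fob F (cod k)" "act F q y':fob F (cod k)"
    using k f f' by (auto intro!: act_in[OF F])
   have "act F k (act F p y) = act F k (act F q y')"
    using e k f f' pshD(4)[OF F, of k p y] pshD(4)[OF F, of k q y'] by simp
   from presented_eq[OF p k(1,5) py this]
   obtain l m where m: "arr l" "arr m" "dom l = dom k" "cod l:A" "dom m = cod l"
    "cod m = cod k" "m*l = k" "act F m (act F p y) = act F m (act F q y')" .
   have 1: "act G f (ta (cod f) y) = act G l (ta (cod l) (act F (p*m) y))"
   proof -
    have "f = (p*m)*l" using k m by simp
    hence "act G f (ta (cod f) y) = act G l (act G (p*m) (ta (cod f) y))"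
     using k m f tain pshD(4)[OF G, of l "p*m" "ta (cod f) y"] by simp
    thus ?thesis using taact[of "p*m" y] k m f by simp
   qed
   have 2: "act G f' (ta (cod f') y') = act G l (ta (cod l) (act F (q*m) y'))"
   proof -
    have "f' = (q*m)*l" using k m by simp
    hence "act G f' (ta (cod f') y') = act G l (act G (q*m) (ta (cod f') y'))"
     using k m f' tain pshD(4)[OF G, of l "q*m" "ta (cod f') y'"] by simp
    thus ?thesis using taact[of "q*m" y'] k m f' by simp
   qed
   have "act F (p*m) y = act F (q*m) y'"
    using m k f f' pshD(4)[OF F, of m p y] pshD(4)[OF F, of m q y'] by simp
   thus ?thesis using 1 2 by simp
  qed
  define bt where "bt c x = (let w = SOME w. arr (fst w) & dom (fst w) = c & cod (fst w):A &
    snd w:fob F (cod (fst w)) & x = act F (fst w) (snd w) in act G (fst w) (ta (cod (fst w)) (snd w)))" for c x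
  have bt: "bt (dom f) (act F f y) = act G f (ta (cod f) y)"
   if f: "arr f" "cod f:A" "y:fob F (cod f)" for f y
  proof -
   let ?P = "%w. arr (fst w) & dom (fst w) = dom f & cod (fst w):A &
    snd w:fob F (cod (fst w)) & act F f y = act F (fst w) (snd w)"
   have "?P (SOME w. ?P w)" by (rule someI[of ?P "(f, y)"]) (use f in auto)
   thus ?thesis using wd[of "fst (SOME w. ?P w)" "snd (SOME w. ?P w)" f y] f
    unfolding bt_def Let_def by simp
  qed
  have nbt: "natural C F G bt"
   unfolding natural_def
  proof (intro conjI ballI)
   fix c x assume "ob c" "x:fob F c"
   thus "bt c x:fob G c" using presented_gen[OF p] bt tain pshD(2)[OF G] by metis
  next
   fix h x assume h: "arr h" "x:fob F (cod h)"
   then obtain f y where f: "arr f" "dom f = cod h" "cod f:A" "y:fob F (cod f)" "x = act F f y"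
    using presented_gen[OF p Cod_Ob[OF h(1)] h(2)] by metis
   have "bt (dom h) (act F (f*h) y) = act G (f*h) (ta (cod f) y)"
    using bt[of "f*h" y] f h by simp
   thus "bt (dom h) (act F h x) = act G h (bt (cod h) x)"
    using bt[OF f(1,3,4)] f h tain pshD(4)[OF F, of h f y] pshD(4)[OF G, of h f] by simp
  qed
  have btA: "bt a x = ta a x" if "a:A" "x:fob F a" for a x
   using bt[of "idt a" x] that AO pshD(3)[OF F] pshD(3)[OF G] tain by simp
  let ?t = "\<lambda>c\<in>Ob C. (fob F c, \<lambda>x\<in>fob F c. bt c x, fob G c)"
  have eq: "al a = Cmp (Set_cat U) (bt' a) (?et a) <-> (ALL x:fob F a. ta a x = ap (bt' a) x)"
   if "nat_trans (op_cat C) (Set_cat U) F G bt'" "a:A" for bt' a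
  proof -
   have "al a:Arr (Set_cat U)" "bt' a:Arr (Set_cat U)"
    "fst (al a) = fob F a" "snd (snd (al a)) = fob G a" "fst (bt' a) = fob F a" "snd (snd (bt' a)) = fob G a"
    using al that AO ObA unfolding nat_trans_iff by auto
   moreover have "?et a = Idt (Set_cat U) (fob F a)" using that AO by simp
   ultimately have "Cmp (Set_cat U) (bt' a) (?et a) = bt' a"
    using category.Cmp_Idt_right[OF category_Set_cat[of U], of "bt' a" "fob F a"] by (simp del: Set_cat_simps(5) restrict_apply)
   moreover have "al a = bt' a <-> (ALL x:fob F a. ta a x = ap (bt' a) x)"
    using Set_cat_eqI[of "al a" U "bt' a"] \<open>al a:_\<close> \<open>bt' a:_\<close> \<open>fst (al a) = _\<close> \<open>fst (bt' a) = _\<close>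
     \<open>snd (snd (al a)) = _\<close> \<open>snd (snd (bt' a)) = _\<close> unfolding ta_def by auto
   ultimately show ?thesis by simp
  qed
  have nt: "nat_trans (op_cat C) (Set_cat U) F G ?t" by (rule natural_nat_trans[OF F G nbt])
  show ?thesis
  proof (rule ex1I[of _ ?t])
   show "nat_trans (op_cat C) (Set_cat U) F G ?t & (ALL a:A. al a = Cmp (Set_cat U) (?t a) (?et a))"
    using nt eq[OF nt] btA AO by simp
   fix bt' assume b': "nat_trans (op_cat C) (Set_cat U) F G bt' & (ALL a:A. al a = Cmp (Set_cat U) (bt' a) (?et a))"
   hence n': "natural C F G (%c. ap (bt' c))" using nat_trans_natural(1) by blast
   have e': "ta a x = ap (bt' a) x" if "a:A" "x:fob F a" for a x using b' eq that by blast
   show "bt' = ?t"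
   proof (rule nat_trans_eqI[OF _ nt])
    fix c x assume c: "ob c" "x:fob F c"
    then obtain f y where f: "arr f" "dom f = c" "cod f:A" "y:fob F (cod f)" "x = act F f y"
     using presented_gen[OF p] by metis
    thus "ap (bt' c) x = ap (?t c) x" using naturalD(2)[OF n', of f y] e' bt c by auto
   qed (use b' in blast)
  qed
 qed
 have "is_left_kan_extension (op_cat ?D) (op_cat C) (Set_cat U) id_fctr F F ?et"
  unfolding is_left_kan_extension_def
 proof (intro conjI allI impI, goal_cases)
  case (4 G al)
  thus ?case using ke[of G al] by (simp only: comp_fctr_id id_fctr_simps op_cat_simps ObA)
 qed (use incl F et in \<open>simp_all only: comp_fctr_id\<close>)
 thus ?thesis using F filteringD(1,2)[OF A] unfolding small_presheaf_def comp_fctr_id by blast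
qed

text \<open>For any filtering \<open>A\<close> containing the set \<open>S\<close> of the Kan
  extension, let \<open>Q\<close> consist of the pairs \<open>(f, y)\<close> with
  \<open>cod f\<close> in \<open>S\<close>, modulo equality at some stage in \<open>A\<close>. The
  extension property yields a map from \<open>F\<close> to \<open>Q\<close> sending
  \<open>act F f y\<close> to the class of \<open>(f, y)\<close>; so elements equal in
  \<open>F\<close> are already equal at a stage.\<close>

lemma small_imp_presented:
 assumes "small_presheaf U C F"
 obtains S where "S <= Ob C" "small U S" "!!A. filtering A ==> S <= A ==> presented A F"
proof -
 have F: "psh F" using assms unfolding small_presheaf_def by blast
 obtain S where S: "S <= Ob C" "small U S"
  and gen': "ALL c:Ob C. ALL x:fob F c.
   EX f y. arr f & dom f = c & cod f:S & y:fob F (cod f) & x = act F f y"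
  and ext': "ALL G ta. psh G --> natural (full_subcat C S) F G ta -->
   (EX bt. natural C F G bt & (ALL s:S. ALL x:fob F s. bt s x = ta s x))"
  using small_presheafD[OF assms] .
 note gen = gen'[THEN bspec, THEN bspec]
 note ext = ext'[THEN spec, THEN spec, THEN mp, THEN mp]
 have "presented A F" if A: "filtering A" "S <= A" for A
 proof -
  define X where "X c = {(f, y). arr f & dom f = c & cod f:S & y:fob F (cod f)}" for c
  define R where "R c w w' <-> (EX k p p'. arr k & arr p & arr p' & dom k = c & cod k:A &
    dom p = cod k & dom p' = cod k & cod p = cod (fst w) & cod p' = cod (fst w') &
    p*k = fst w & p'*k = fst w' & act F p (snd w) = act F p' (snd w'))"
   for c :: 'o and w w' :: "'a \<times> 'u"
  have smX: "small U (X c)" if "ob c" for c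
  proof -
   have "small U (SIGMA f:(\<Union>s\<in>S. hom c s). fob F (cod f))"
    using S that pshD(1)[OF F] by (intro small_Sigma[OF U] small_UN[OF U] small_in[OF U]) (auto simp: subset_iff)
   thus ?thesis by (rule small_subset[OF U]) (auto simp: X_def)
  qed
  \<comment> \<open>The two witnessing stages are amalgamated; the two resulting arrows to
    \<open>cod (fst w')\<close> agree on the given object only, and are equalised in a further
    stage.\<close>
  have R_trans: "R c w w''" if c: "ob c" "w:X c" "w':X c" "w'':X c" and r: "R c w w'" "R c w' w''" for c w w' w''
  proof -
   obtain k p p' where k: "arr k" "arr p" "arr p'" "dom k = c" "cod k:A"
    "dom p = cod k" "dom p' = cod k" "cod p = cod (fst w)" "cod p' = cod (fst w')"
    "p*k = fst w" "p'*k = fst w'" "act F p (snd w) = act F p' (snd w')"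
    using r(1) unfolding R_def by blast
   obtain l q q' where l: "arr l" "arr q" "arr q'" "dom l = c" "cod l:A"
    "dom q = cod l" "dom q' = cod l" "cod q = cod (fst w')" "cod q' = cod (fst w'')"
    "q*l = fst w'" "q'*l = fst w''" "act F q (snd w') = act F q' (snd w'')"
    using r(2) unfolding R_def by blast
   have "dom k = dom l" using k l by simp
   from filtering_pair[OF A(1) k(1) l(1) this k(5) l(5)]
   obtain e a b where e: "arr e" "arr a" "arr b" "dom e = dom k" "cod e:A"
    "dom a = cod e" "dom b = cod e" "cod a = cod k" "cod b = cod l" "a*e = k" "b*e = l" .
   have c3: "(p'*a)*e = (q*b)*e" using e k l by simp
   have "cod (fst w'):A" using c(3) A(2) by (auto simp: X_def)
   hence "cod (p'*a):A" using k(3,7,9) e(2,8) by simp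
   from filtering_equalise[OF A(1) e(1) _ _ e(5) _ _ _ this c3]
   obtain e' m where m: "arr e'" "arr m" "dom e' = dom e" "cod e':A" "dom m = cod e'"
    "cod m = cod e" "m*e' = e" "(p'*a)*m = (q*b)*m"
    using k l e by auto
   have sn: "snd w:fob F (cod p)" "snd w':fob F (cod p')" "snd w':fob F (cod q)" "snd w'':fob F (cod q')"
    using c k l by (auto simp: X_def)
   have "act F (p*a*m) (snd w) = act F (a*m) (act F p' (snd w'))"
    using pshD(4)[OF F, of "a*m" p "snd w"] sn k e m by simp
   also have "... = act F (p'*a*m) (snd w')"
    using pshD(4)[OF F, of "a*m" p' "snd w'"] sn k e m by simp
   also have "... = act F (q*b*m) (snd w')" using m k l e by simp
   also have "... = act F (b*m) (act F q' (snd w''))"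
    using pshD(4)[OF F, of "b*m" q "snd w'"] sn l e m by simp
   also have "... = act F (q'*b*m) (snd w'')"
    using pshD(4)[OF F, of "b*m" q' "snd w''"] sn l e m by simp
   finally show ?thesis unfolding R_def
    using k l e m by (intro exI[of _ e'] exI[of _ "p*a*m"] exI[of _ "q'*b*m"]) simp
  qed
  obtain Q q where Q: "psh Q" "!!c. ob c ==> q c ` X c = fob Q c"
   "!!c x y. ob c ==> x:X c ==> y:X c ==> q c x = q c y <-> R c x y"
   "!!f x. arr f ==> x:X (cod f) ==> act Q f (q (cod f) x) = q (dom f) (fst x*f, snd x)"
  proof (rule ex_quotient[of X "%f w. (fst w*f, snd w)" R, OF smX U])
   fix c x assume c: "ob c" "x:X c"
   hence "cod (fst x):A" using A(2) by (auto simp: X_def)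
   thus "R c x x" unfolding R_def using c
    by (intro exI[of _ "fst x"] exI[of _ "idt (cod (fst x))"]) (auto simp: X_def)
  next
   fix c x y assume "R c x y" thus "R c y x" unfolding R_def by metis
  next
   fix f x y assume f: "arr f" "x:X (cod f)" "y:X (cod f)" "R (cod f) x y"
   then obtain k p p' where k: "arr k" "arr p" "arr p'" "dom k = cod f" "cod k:A"
    "dom p = cod k" "dom p' = cod k" "cod p = cod (fst x)" "cod p' = cod (fst y)"
    "p*k = fst x" "p'*k = fst y" "act F p (snd x) = act F p' (snd y)"
    unfolding R_def by blast
   moreover have "p*k*f = fst x*f" "p'*k*f = fst y*f"
    using k f by (auto simp: Cmp_reassoc1[OF k(10)] Cmp_reassoc1[OF k(11)])
   moreover have "arr (fst x)" "arr (fst y)" "dom (fst x) = cod f" "dom (fst y) = cod f"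
    using f by (auto simp: X_def)
   ultimately show "R (dom f) (fst x*f, snd x) (fst y*f, snd y)"
    unfolding R_def using f(1) by (intro exI[of _ "k*f"] exI[of _ p] exI[of _ p']) simp
  next
   fix c x y z assume "ob c" "x:X c" "y:X c" "z:X c" "R c x y" "R c y z"
   thus "R c x z" by (rule R_trans)
  qed (auto simp: X_def)
  have Idt_X: "(idt s, y):X s" if "s:S" "y:fob F s" for s y using that S(1) by (auto simp: X_def)
  have "natural (full_subcat C S) F Q (%s y. q s (idt s, y))"
   unfolding natural_def
  proof (intro conjI ballI)
   fix c x assume "c:Ob (full_subcat C S)" "x:fob F c"
   hence "(idt c, x):X c" "ob c" by (auto simp: X_def)
   thus "q c (idt c, x):fob Q c" using Q(2)[of c] by blast
  next
   fix f x assume f: "f:Arr (full_subcat C S)" and x: "x:fob F (Cod (full_subcat C S) f)"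
   have in1: "(idt (dom f), act F f x):X (dom f)" "(idt (cod f), x):X (cod f)"
    and in2: "(f, x):X (dom f)"
    using f x pshD(2)[OF F] by (auto simp: X_def)
   have "R (dom f) (idt (dom f), act F f x) (f, x)"
    unfolding R_def using f x A(2) pshD(3)[OF F Dom_Ob[of f] pshD(2)[OF F, of f x]]
    by (intro exI[of _ "idt (dom f)"] exI[of _ "idt (dom f)"] exI[of _ f]) auto
   thus "q (Dom (full_subcat C S) f) (idt (Dom (full_subcat C S) f), act F f x) =
     act Q f (q (Cod (full_subcat C S) f) (idt (Cod (full_subcat C S) f), x))"
    using Q(4)[of f "(idt (cod f), x)"] Q(3)[of "dom f"] in1 in2 f by simp
  qed
  from ext[OF Q(1) this] obtain bt where b: "natural C F Q bt"
   "!!s x. s:S ==> x:fob F s ==> bt s x = q s (idt s, x)" by metis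
  have bt: "bt (dom f) (act F f y) = q (dom f) (f, y)" if f: "arr f" "cod f:S" "y:fob F (cod f)" for f y
   using naturalD(2)[OF b(1) f(1,3)] b(2)[OF f(2,3)] Q(4)[OF f(1) Idt_X[OF f(2,3)]] f by simp
  show ?thesis
   unfolding presented_def
  proof (intro conjI ballI impI)
   fix c x assume "ob c" "x:fob F c"
   thus "EX f y. arr f & dom f = c & cod f:A & y:fob F (cod f) & x = act F f y"
    using gen A(2) by (meson subsetD)
  next
   fix f y y' assume f: "arr f" and y: "y:fob F (cod f)" "y':fob F (cod f)"
    and fA: "cod f:A" and e: "act F f y = act F f y'"
   obtain g z where g: "arr g" "dom g = cod f" "cod g:S" "z:fob F (cod g)" "y = act F g z"
    using gen[OF Cod_Ob[OF f] y(1)] by blast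
   obtain g' z' where g': "arr g'" "dom g' = cod f" "cod g':S" "z':fob F (cod g')" "y' = act F g' z'"
    using gen[OF Cod_Ob[OF f] y(2)] by blast
   have "q (dom f) (g*f, z) = q (dom f) (g'*f, z')"
    using bt[of "g*f" z] bt[of "g'*f" z'] pshD(4)[OF F, of f g z] pshD(4)[OF F, of f g' z'] e f g g' by simp
   moreover have "(g*f, z):X (dom f)" "(g'*f, z'):X (dom f)" using f g g' by (auto simp: X_def)
   ultimately have "R (dom f) (g*f, z) (g'*f, z')" using Q(3)[OF Dom_Ob[OF f]] by blast
   then obtain k p p' where k: "arr k" "arr p" "arr p'" "dom k = dom f" "cod k:A"
    "dom p = cod k" "dom p' = cod k" "cod p = cod g" "cod p' = cod g'"
    "p*k = g*f" "p'*k = g'*f" "act F p z = act F p' z'"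
    unfolding R_def using f g g' by auto
   \<comment> \<open>The stage \<open>k\<close> that witnesses the relation is unrelated to
     \<open>f\<close>. Amalgamating the two and equalising twice forces \<open>p*a\<close> to agree
     with \<open>g*b\<close> and \<open>p'*a\<close> with \<open>g'*b\<close>, so that the equality
     passes to the branch over \<open>cod f\<close>.\<close>
   obtain e a b where e: "arr e" "arr a" "arr b" "dom e = dom k" "cod e:A"
    "dom a = cod e" "dom b = cod e" "cod a = cod k" "cod b = cod f" "a*e = k" "b*e = f"
    using filtering_pair[OF A(1) k(1) f k(4,5) fA] .
   have 1: "(p*a)*e = (g*b)*e" "(p'*a)*e = (g'*b)*e" using e k f g g' by simp_all
   have "cod (p*a):A" "cod (p'*a):A" using k e g g' A(2) by auto
   from filtering_equalise[OF A(1) e(1) _ _ e(5) _ _ _ this(1) 1(1)] this(2)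
   obtain e' m where m: "arr e'" "arr m" "dom e' = dom e" "cod e':A" "dom m = cod e'"
    "cod m = cod e" "m*e' = e" "(p*a)*m = (g*b)*m" and cA: "cod (p'*a):A"
    using k g e by auto
   have "((p'*a)*m)*e' = ((g'*b)*m)*e'" using 1(2) m e k g' by simp
   from filtering_equalise[OF A(1) m(1) _ _ m(4) _ _ _ _ this]
   obtain e'' n where n: "arr e''" "arr n" "dom e'' = dom e'" "cod e'':A" "dom n = cod e''"
    "cod n = cod e'" "n*e'' = e'" "((p'*a)*m)*n = ((g'*b)*m)*n"
    using k g' e m cA by auto
   let ?m = "b*m*n"
   have "act F ?m y = act F (g*?m) z"
    using pshD(4)[OF F, of ?m g z] g e m n by simp
   also have "g*?m = p*a*m*n" using Cmp_reassoc[OF m(8), of n] g e m n k by simp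
   also have "act F (p*a*m*n) z = act F (a*m*n) (act F p' z')"
    using pshD(4)[OF F, of "a*m*n" p z] g e m n k by simp
   also have "... = act F (p'*a*m*n) z'"
    using pshD(4)[OF F, of "a*m*n" p' z'] g' e m n k by simp
   also have "p'*a*m*n = g'*?m" using n(8) g' e m n k by simp
   also have "act F (g'*?m) z' = act F ?m y'"
    using pshD(4)[OF F, of ?m g' z'] g' e m n by simp
   finally have "act F ?m y = act F ?m y'" .
   thus "EX k m. arr k & arr m & dom k = dom f & cod k:A & dom m = cod k &
     cod m = cod f & m*k = f & act F m y = act F m y'"
    using e m n k by (intro exI[of _ e''] exI[of _ ?m]) simp
  qed
 qed
 thus thesis using that S by blast
qed

end

context lex_loc_small
begin

section \<open>Limits of presheaves\<close>

abbreviation PV where "PV V \<equiv> full_subcat PC V"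
abbreviation Sm where "Sm \<equiv> {F. small_presheaf U C F}"

lemma P_cat_PV: "P_cat U C = PV Sm"
 by (simp add: P_cat_def)

lemma category_PV: "category (PV V)"
 by (rule category.category_full_subcat[OF category_PC])

lemma Hom_PV: "t:Hom (PV V) F G <-> t:Hom PC F G & F:V & G:V"
 by (auto simp: Hom_full_subcat)

lemma Arr_PC_psh: "t:Arr PC ==> psh (fst t) & psh (fst (snd t))"
 by (simp add: presheaf_cat_def nat_trans_iff)

lemma Sm_psh: "F:Sm ==> psh F"
 unfolding small_presheaf_def by simp

text \<open>An element of a representable is an arrow, so injectivity of the presentation is the
  equalising condition on \<open>A\<close>.\<close>

lemma presented_yo:
 assumes A: "filtering A" and c: "c:A" shows "presented A (yo c)"
 unfolding presented_def
proof (intro conjI ballI impI)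
 fix b x assume "ob b" "x:fob (yo c) b"
 thus "EX f y. arr f & dom f = b & cod f:A & y:fob (yo c) (cod f) & x = act (yo c) f y"
  using c filteringD(1)[OF A]
  by (intro exI[of _ "dc b c x"] exI[of _ "cd c c (idt c)"]) auto
next
 fix f y y' assume f: "arr f" and y: "y:fob (yo c) (cod f)" "y':fob (yo c) (cod f)"
  and fA: "cod f:A" and e: "act (yo c) f y = act (yo c) f y'"
 let ?p = "dc (cod f) c y" and ?q = "dc (cod f) c y'"
 have pq: "?p*f = ?q*f"
  using arg_cong[OF e, of "dc (dom f) c"] f y by simp
 have cod: "cod ?p = cod ?q" "cod ?p:A" using y c by simp_all
 obtain k m where km: "arr k" "arr m" "dom k = dom f" "cod k:A" "dom m = cod k"
  "cod m = cod f" "m*k = f" "?p*m = ?q*m"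
  using filtering_equalise[OF A f dc_yo(1)[OF y(1)] dc_yo(1)[OF y(2)] fA dc_yo(2)[OF y(1)] dc_yo(2)[OF y(2)]
   cod pq] .
 have "y:fob (yo c) (cod m)" "y':fob (yo c) (cod m)" using y km(6) by (simp_all only:)
 hence "act (yo c) m y = act (yo c) m y'"
  using act_yo[OF km(2), of y c] act_yo[OF km(2), of y' c] km(6,8) by (simp only:)
 thus "EX k m. arr k & arr m & dom k = dom f & cod k:A & dom m = cod k &
   cod m = cod f & m*k = f & act (yo c) m y = act (yo c) m y'"
  using km by blast
qed

lemma small_yo: assumes "ob c" shows "yo c:Sm"
proof -
 have "small U {c}" by (intro small_finite[OF U]) simp
 then obtain A where "filtering A" "{c} <= A" using ex_filtering[of "{c}"] assms by blast
 thus ?thesis using presented_imp_small[OF _ psh_yo presented_yo] assms by auto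
qed

lemma yoneda_functor_PV:
 assumes "yo ` Ob C <= V" shows "is_functor C (PV V) (yoneda U C)"
 by (rule functorI[OF category_axioms category_PV])
  (use functorD[OF yoneda_functor] assms in \<open>auto simp: image_subset_iff\<close>)

definition compat :: "('j, 'k) cat => ('j, 'k, ('o, 'a, 'u) presheaf, ('o, 'a, 'u) presheaf_map) fctr => 'o =>
  ('j => 'u) => bool" where
 "compat J D c w <-> (ALL j:Ob J. w j:fob (fob D j) c) &
  (ALL ph:Arr J. ev (farr D ph) c (w (Dom J ph)) = w (Cod J ph))"

text \<open>The cone is a limit of sets at each object: a compatible family has exactly one common
  lift.\<close>

definition el_limit :: "('j, 'k) cat => ('j, 'k, ('o, 'a, 'u) presheaf, ('o, 'a, 'u) presheaf_map) fctr =>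
  ('o, 'a, 'u) presheaf => ('j => ('o, 'a, 'u) presheaf_map) => bool" where
 "el_limit J D x l <->
  (ALL c:Ob C. ALL w. compat J D c w --> (EX u:fob x c. ALL j:Ob J. ev (l j) c u = w j)) &
  (ALL c:Ob C. ALL u:fob x c. ALL v:fob x c. (ALL j:Ob J. ev (l j) c u = ev (l j) c v) --> u = v)"

lemma functor_PV:
 assumes "is_functor J (PV V) D"
 shows "!!j. j:Ob J ==> psh (fob D j)" "!!j. j:Ob J ==> fob D j:V"
  "!!ph. ph:Arr J ==> farr D ph:Hom PC (fob D (Dom J ph)) (fob D (Cod J ph))"
  "!!ph. ph:Arr J ==> natural C (fob D (Dom J ph)) (fob D (Cod J ph)) (ev (farr D ph))"
proof -
 note D = functorD[OF assms]
 show "!!j. j:Ob J ==> psh (fob D j)" "!!j. j:Ob J ==> fob D j:V"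
  using D(3) by auto
 show h: "farr D ph:Hom PC (fob D (Dom J ph)) (fob D (Cod J ph))" if "ph:Arr J" for ph
  using D(4-6)[OF that] by auto
 show "!!ph. ph:Arr J ==> natural C (fob D (Dom J ph)) (fob D (Cod J ph)) (ev (farr D ph))"
  using ev_natural[OF h] .
qed

lemma cone_PV:
 assumes D: "is_functor J (PV V) D"
 shows "is_cone J (PV V) D x l <-> psh x & x:V & (ALL j:Ob J. l j:Hom PC x (fob D j)) &
  (ALL ph:Arr J. ALL c:Ob C. ALL u:fob x c. ev (farr D ph) c (ev (l (Dom J ph)) c u) = ev (l (Cod J ph)) c u)"
  (is "?L = ?R")
proof -
 interpret J: category J using functorD(1)[OF D] .
 interpret P: category PC by (rule category_PC)
 have "(Cmp PC (farr D ph) (l (Dom J ph)) = l (Cod J ph)) <->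
   (ALL c:Ob C. ALL u:fob x c. ev (farr D ph) c (ev (l (Dom J ph)) c u) = ev (l (Cod J ph)) c u)"
  if l: "ALL j:Ob J. l j:Hom PC x (fob D j)" and ph: "ph:Arr J" for ph
 proof -
  have l1: "l (Dom J ph):Hom PC x (fob D (Dom J ph))" "l (Cod J ph):Hom PC x (fob D (Cod J ph))"
   using l ph by auto
  have "Cmp PC (farr D ph) (l (Dom J ph)):Hom PC x (fob D (Cod J ph))"
   using P.Cmp_in[OF l1(1) functor_PV(3)[OF D ph]] .
  moreover have "ev (Cmp PC (farr D ph) (l (Dom J ph))) c u = ev (farr D ph) c (ev (l (Dom J ph)) c u)"
   if "ob c" "u:fob x c" for c u
   using l1(1) that by (intro ev_Cmp) auto
  ultimately show ?thesis using psh_map_eqI[OF _ l1(2)] by metis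
 qed
 moreover have "(ALL j:Ob J. l j:Hom PC x (fob D j)) <->
   (ALL j:Ob J. l j:Arr (PV V) & Dom (PV V) (l j) = x & Cod (PV V) (l j) = fob D j)" if "x:V"
  using that functor_PV(2)[OF D] by auto
 ultimately show ?thesis unfolding cone_iff by auto
qed

lemma limit_of_elements:
 assumes D: "is_functor J (PV V) D" and l: "is_cone J (PV V) D x l" and el: "el_limit J D x l"
 shows "is_limit J (PV V) D x l"
proof -
 interpret J: category J using functorD(1)[OF D] .
 interpret P: category PC by (rule category_PC)
 interpret PV: category "PV V" by (rule category_PV)
 have x: "psh x" "x:V" and lH: "!!j. j:Ob J ==> l j:Hom PC x (fob D j)"
  using l unfolding cone_PV[OF D] by auto
 have ln: "natural C x (fob D j) (ev (l j))" if "j:Ob J" for j using ev_natural[OF lH[OF that]] .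
 have elU: "u = v" if "ob c" "u:fob x c" "v:fob x c" "!!j. j:Ob J ==> ev (l j) c u = ev (l j) c v" for c u v
  using el that unfolding el_limit_def by blast
 show ?thesis
 proof (rule PV.limitI[OF l])
  fix y m assume "is_cone J (PV V) D y m"
  hence y: "psh y" "y:V" and m: "!!j. j:Ob J ==> m j:Hom PC y (fob D j)"
   and mc: "!!ph c u. ph:Arr J ==> ob c ==> u:fob y c ==>
    ev (farr D ph) c (ev (m (Dom J ph)) c u) = ev (m (Cod J ph)) c u"
   unfolding cone_PV[OF D] by auto
  have mn: "natural C y (fob D j) (ev (m j))" if "j:Ob J" for j using ev_natural[OF m[OF that]] .
  define ta where "ta c v = (SOME u. u:fob x c & (ALL j:Ob J. ev (l j) c u = ev (m j) c v))" for c v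
  have ta: "ta c v:fob x c & (ALL j:Ob J. ev (l j) c (ta c v) = ev (m j) c v)" if "ob c" "v:fob y c" for c v
  proof -
   have "compat J D c (%j. ev (m j) c v)"
    unfolding compat_def using mc that naturalD(1)[OF mn] by auto
   hence "EX u. u:fob x c & (ALL j:Ob J. ev (l j) c u = ev (m j) c v)"
    using el that(1) unfolding el_limit_def by blast
   thus ?thesis unfolding ta_def by (rule someI_ex)
  qed
  have n: "natural C y x ta"
   unfolding natural_def
  proof (intro conjI ballI)
   fix f v assume f: "arr f" "v:fob y (cod f)"
   hence fv: "act y f v:fob y (dom f)" using pshD(2)[OF y(1)] by blast
   have tx: "ta (cod f) v:fob x (cod f)" using ta f by auto
   show "ta (dom f) (act y f v) = act x f (ta (cod f) v)"
   proof (rule elU[of "dom f"])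
    fix j assume j: "j:Ob J"
    show "ev (l j) (dom f) (ta (dom f) (act y f v)) = ev (l j) (dom f) (act x f (ta (cod f) v))"
     using ta[of "dom f" "act y f v"] ta[of "cod f" v] naturalD(2)[OF ln[OF j] f(1) tx]
      naturalD(2)[OF mn[OF j] f] f fv j by simp
   qed (use ta f fv tx pshD(2)[OF x(1)] in auto)
  qed (use ta in auto)
  let ?h = "psh_map C y x ta"
  have h: "?h:Hom PC y x" using psh_map_Hom[OF y(1) x(1) n] .
  have "Cmp PC (l j) ?h = m j" if j: "j:Ob J" for j
  proof (rule psh_map_eqI[OF P.Cmp_in[OF h lH[OF j]] m[OF j]])
   fix c u assume "ob c" "u:fob y c"
   thus "ev (Cmp PC (l j) ?h) c u = ev (m j) c u"
    using h ta j by (subst ev_Cmp) auto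
  qed
  thus "EX h. h:Arr (PV V) & Dom (PV V) h = y & Cod (PV V) h = x & (ALL j:Ob J. Cmp (PV V) (l j) h = m j)"
   using h x y by (intro exI[of _ ?h]) auto
 next
  fix h k assume hk: "h:Arr (PV V)" "Cod (PV V) h = x" "k:Arr (PV V)" "Cod (PV V) k = x" "Dom (PV V) k = Dom (PV V) h"
   and eq: "!!j. j:Ob J ==> Cmp (PV V) (l j) h = Cmp (PV V) (l j) k"
  have H: "h:Hom PC (fst h) x" "k:Hom PC (fst h) x" using hk by auto
  show "h = k"
  proof (rule psh_map_eqI[OF H])
   fix c u assume c: "ob c" "u:fob (fst h) c"
   show "ev h c u = ev k c u"
   proof (rule elU[OF c(1)])
    fix j assume "j:Ob J"
    hence "ev (Cmp PC (l j) h) c u = ev (Cmp PC (l j) k) c u" using eq by simp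
    thus "ev (l j) c (ev h c u) = ev (l j) c (ev k c u)" using H c by simp
   qed (use naturalD(1)[OF ev_natural[OF H(1)]] naturalD(1)[OF ev_natural[OF H(2)]] c in auto)
  qed
 qed
qed

text \<open>By Yoneda a compatible family at \<open>c\<close> is a cone from the representable at
  \<open>c\<close>. Hence every limit in a full subcategory that contains the representables is
  computed pointwise.\<close>

lemma limit_elements:
 assumes V: "yo ` Ob C <= V" and D: "is_functor J (PV V) D" and lim: "is_limit J (PV V) D x l"
 shows "el_limit J D x l"
proof -
 interpret J: category J using functorD(1)[OF D] .
 interpret P: category PC by (rule category_PC)
 interpret PV: category "PV V" by (rule category_PV)
 have x: "psh x" "x:V" and lH: "!!j. j:Ob J ==> l j:Hom PC x (fob D j)"
  and lc: "!!ph c u. ph:Arr J ==> ob c ==> u:fob x c ==>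
    ev (farr D ph) c (ev (l (Dom J ph)) c u) = ev (l (Cod J ph)) c u"
  using limitD(1)[OF lim] unfolding cone_PV[OF D] by auto
 have ln: "natural C x (fob D j) (ev (l j))" if "j:Ob J" for j using ev_natural[OF lH[OF that]] .
 have yoV: "yo c:V" if "ob c" for c using V that by auto
 have id: "cd c c (idt c):fob (yo c) c" if "ob c" for c using that by simp
 show ?thesis
  unfolding el_limit_def
 proof (intro conjI ballI allI impI)
  fix c w assume c: "ob c" and w: "compat J D c w"
  have wD: "w j:fob (fob D j) c" if "j:Ob J" for j using w that unfolding compat_def by blast
  define m where "m j = psh_map C (yo c) (fob D j) (%b u. act (fob D j) (dc b c u) (w j))" for j
  have mH: "m j:Hom PC (yo c) (fob D j)" if "j:Ob J" for j
   unfolding m_def using functor_PV(1)[OF D that] wD[OF that] c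
   by (intro psh_map_Hom natural_yo) auto
  have mev: "ev (m j) b u = act (fob D j) (dc b c u) (w j)" if "ob b" "u:fob (yo c) b" for j b u
   using that by (simp add: m_def)
  have "is_cone J (PV V) D (yo c) m"
   unfolding cone_PV[OF D]
  proof (intro conjI ballI)
   fix ph b u assume ph: "ph:Arr J" and b: "ob b" "u:fob (yo c) b"
   have "ev (farr D ph) b (act (fob D (Dom J ph)) (dc b c u) (w (Dom J ph))) =
     act (fob D (Cod J ph)) (dc b c u) (ev (farr D ph) c (w (Dom J ph)))"
    using naturalD(2)[OF functor_PV(4)[OF D ph], of "dc b c u" "w (Dom J ph)"] b wD ph by simp
   thus "ev (farr D ph) b (ev (m (Dom J ph)) b u) = ev (m (Cod J ph)) b u"
    using b ph w by (simp add: mev compat_def)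
  qed (use mH yoV c in auto)
  from limit_lift[OF lim this] obtain h where h: "h:Arr (PV V)" "Dom (PV V) h = yo c" "Cod (PV V) h = x"
   "!!j. j:Ob J ==> Cmp (PV V) (l j) h = m j" by metis
  have hH: "h:Hom PC (yo c) x" using h by simp
  let ?u = "ev h c (cd c c (idt c))"
  have "ev (l j) c ?u = w j" if j: "j:Ob J" for j
  proof -
   have "ev (l j) c ?u = ev (m j) c (cd c c (idt c))"
    using h(4)[OF j] hH c ev_Cmp[of h c "cd c c (idt c)" "l j"] id by simp
   thus ?thesis using mev[OF c id[OF c]] c pshD(3)[OF functor_PV(1)[OF D j] c wD[OF j]] by simp
  qed
  moreover have "?u:fob x c" using naturalD(1)[OF ev_natural[OF hH] c id[OF c]] .
  ultimately show "EX u:fob x c. ALL j:Ob J. ev (l j) c u = w j" by blast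
 next
  fix c u v assume c: "ob c" and uv: "u:fob x c" "v:fob x c" and eq: "ALL j:Ob J. ev (l j) c u = ev (l j) c v"
  let ?h = "%u. psh_map C (yo c) x (%b t. act x (dc b c t) u)"
  have hH: "?h u:Hom PC (yo c) x" if "u:fob x c" for u
   using x that c by (intro psh_map_Hom natural_yo) auto
  have "?h u = ?h v"
  proof (rule PV.limit_unique[OF lim D])
   fix j assume j: "j:Ob J"
   have "ev (Cmp PC (l j) (?h u)) b t = ev (Cmp PC (l j) (?h v)) b t" if "ob b" "t:fob (yo c) b" for b t
    using that hH uv eq j c naturalD(2)[OF ln[OF j], of "dc b c t" u] naturalD(2)[OF ln[OF j], of "dc b c t" v]
    by simp
   thus "Cmp (PV V) (l j) (?h u) = Cmp (PV V) (l j) (?h v)"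
    using psh_map_eqI[OF P.Cmp_in[OF hH[OF uv(1)] lH[OF j]] P.Cmp_in[OF hH[OF uv(2)] lH[OF j]]] by simp
  qed (use hH[OF uv(1)] hH[OF uv(2)] x yoV[OF c] in auto)
  hence "ev (?h u) c (cd c c (idt c)) = ev (?h v) c (cd c c (idt c))" by simp
  thus "u = v" using c uv id pshD(3)[OF x(1)] by simp
 qed
qed

text \<open>Refinements that achieve one condition each are combined into one that achieves all: two
  stages are amalgamated and their arrows to \<open>cod k\<close> equalised, while \<open>st\<close>
  keeps conditions already achieved.\<close>

lemma filtering_finite:
 assumes A: "filtering A" and k: "arr k" "cod k:A" and "finite I"
  and ex: "!!i. i:I ==> EX k' m. arr k' & arr m & dom k' = dom k & cod k':A &
   dom m = cod k' & cod m = cod k & m*k' = k & P i k' m"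
  and st: "!!i k' m n l. i:I ==> arr k' ==> arr m ==> dom k' = dom k ==> cod k':A ==>
   dom m = cod k' ==> cod m = cod k ==> m*k' = k ==> P i k' m ==> arr n ==> arr l ==>
   cod n = dom m ==> dom n = cod l ==> n*l = k' ==> P i l (m*n)"
 shows "EX k' m. arr k' & arr m & dom k' = dom k & cod k':A &
   dom m = cod k' & cod m = cod k & m*k' = k & (ALL i:I. P i k' m)"
 using \<open>finite I\<close> ex st
proof (induction I rule: finite_induct)
 case empty
 thus ?case using k by (intro exI[of _ k] exI[of _ "idt (cod k)"]) simp
next
 case (insert i I)
 have "EX k' m. arr k' & arr m & dom k' = dom k & cod k':A &
   dom m = cod k' & cod m = cod k & m*k' = k & (ALL i:I. P i k' m)"
  by (rule insert.IH) (use insert.prems in blast)+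
 then obtain k1 m1 where 1: "arr k1" "arr m1" "dom k1 = dom k" "cod k1:A"
   "dom m1 = cod k1" "cod m1 = cod k" "m1*k1 = k" "ALL i:I. P i k1 m1" by blast
 obtain k2 m2 where 2: "arr k2" "arr m2" "dom k2 = dom k" "cod k2:A"
   "dom m2 = cod k2" "cod m2 = cod k" "m2*k2 = k" "P i k2 m2" using insert.prems(1)[of i] by blast
 have "dom k1 = dom k2" using 1 2 by simp
 from filtering_pair[OF A 1(1) 2(1) this 1(4) 2(4)]
 obtain e a b where e: "arr e" "arr a" "arr b" "dom e = dom k1" "cod e:A"
  "dom a = cod e" "dom b = cod e" "cod a = cod k1" "cod b = cod k2" "a*e = k1" "b*e = k2" .
 have eq: "(m1*a)*e = (m2*b)*e" using e 1 2 by simp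
 have cod: "cod (m1*a):A" using e 1 k by simp
 from filtering_equalise[OF A e(1) _ _ e(5) _ _ _ cod eq]
 obtain l m where m: "arr l" "arr m" "dom l = dom e" "cod l:A" "dom m = cod l"
  "cod m = cod e" "m*l = e" "(m1*a)*m = (m2*b)*m" using e 1 2 by auto
 have "P i' l (m1*a*m)" if "i':I" for i'
  by (rule insert.prems(2)[of i' k1]) (use that 1 e m in auto)
 moreover have "P i l (m2*b*m)"
  by (rule insert.prems(2)[of i k2]) (use 2 e m in auto)
 moreover have "m2*b*m = m1*a*m" using m e 1 2 by simp
 ultimately have "ALL i:insert i I. P i l (m1*a*m)" by auto
 moreover have "(m1*a*m)*l = k" using 1(1-7) e m(1-7) by simp
 ultimately show ?case using 1(1-6) e m(1-7) by (intro exI[of _ l] exI[of _ "m1*a*m"]) (simp del: assoc)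
qed

lemma common_filtering:
 assumes "finite I" "!!i. i:I ==> F i:Sm"
 obtains A where "filtering A" "!!i. i:I ==> presented A (F i)"
proof -
 have "EX S. S <= Ob C & small U S & (ALL A. filtering A --> S <= A --> presented A (F i))" if "i:I" for i
  using small_imp_presented[of "F i"] assms(2)[OF that] by (metis mem_Collect_eq)
 then obtain S where S: "!!i. i:I ==> S i <= Ob C & small U (S i) & (ALL A. filtering A --> S i <= A --> presented A (F i))"
  by metis
 have "(\<Union>i\<in>I. S i) <= Ob C" "small U (\<Union>i\<in>I. S i)"
  using S small_finite[OF U assms(1)] by (auto intro: small_UN[OF U])
 from ex_filtering[OF this] obtain A where "filtering A" "(\<Union>i\<in>I. S i) <= A" by blast
 thus thesis using that S by (meson UN_subset_iff)
qed

text \<open>The pointwise limit is small because finite limits commute with filtered colimits of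
  sets: all presheaves of the diagram are presented over one common \<open>A\<close>, and so is
  their limit.\<close>

lemma ex_limit_presheaf:
 assumes fin: "finite_diagram J (PV V) D" and V: "V <= Sm"
 obtains x l where "x:Sm" "!!j. j:Ob J ==> l j:Hom PC x (fob D j)" "el_limit J D x l"
  "!!ph c u. ph:Arr J ==> ob c ==> u:fob x c ==>
   ev (farr D ph) c (ev (l (Dom J ph)) c u) = ev (l (Cod J ph)) c u"
proof -
 have D: "is_functor J (PV V) D" and finJ: "finite (Ob J)" "finite (Arr J)"
  using fin unfolding finite_diagram_def by auto
 interpret J: category J using functorD(1)[OF D] .
 note Dp = functor_PV(1)[OF D]
 define T where "T c = {w:PiE (Ob J) (%j. fob (fob D j) c). compat J D c w}" for c
 define a where "a f w = (\<lambda>j\<in>Ob J. act (fob D j) f (w j))" for f w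
 have TI: "w:T c" if "w:extensional (Ob J)" "compat J D c w" for c w
  using that unfolding T_def compat_def by (auto simp: PiE_iff)
 have TD: "w j:fob (fob D j) c" "compat J D c w" "w:extensional (Ob J)" if "w:T c" "j:Ob J | True" "j:Ob J" for w c j
  using that unfolding T_def by (auto simp: PiE_iff)
 have TD2: "compat J D c w" "w:extensional (Ob J)" if "w:T c" for w c
  using that unfolding T_def by (auto simp: PiE_iff)
 have aT: "a f w:T (dom f)" if f: "arr f" "w:T (cod f)" for f w
 proof (rule TI)
  show "compat J D (dom f) (a f w)"
   unfolding compat_def
  proof (intro conjI ballI)
   fix j assume "j:Ob J" thus "a f w j:fob (fob D j) (dom f)"
    using f TD pshD(2)[OF Dp] by (simp add: a_def)
  next
   fix ph assume ph: "ph:Arr J"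
   thus "ev (farr D ph) (dom f) (a f w (Dom J ph)) = a f w (Cod J ph)"
    using naturalD(2)[OF functor_PV(4)[OF D ph] f(1), of "w (Dom J ph)"] TD[OF f(2)] TD2[OF f(2)]
    by (simp add: a_def compat_def)
  qed
 qed (simp add: a_def)
 obtain x e where x: "psh x" "!!c. ob c ==> bij_betw (e c) (T c) (fob x c)"
  "!!f w. arr f ==> w:T (cod f) ==> act x f (e (cod f) w) = e (dom f) (a f w)"
 proof (rule ex_presheaf[of T a])
  show "small U (T c)" if "ob c" for c
  proof (rule small_subset[OF U])
   show "small U (PiE (Ob J) (%j. fob (fob D j) c))"
    using pshD(1)[OF Dp] that by (intro small_PiE[OF U finJ(1)] small_in[OF U]) auto
  qed (auto simp: T_def)
  show "a (idt c) w = w" if "ob c" "w:T c" for c w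
   using that TD2 TD pshD(3)[OF Dp] by (intro extensionalityI[of _ "Ob J"]) (auto simp: a_def)
  show "a (g*f) w = a f (a g w)" if "arr f" "arr g" "dom g = cod f" "w:T (cod g)" for f g w
   unfolding a_def using that TD pshD(4)[OF Dp] by (intro restrict_ext) simp
 qed (use aT in auto)
 define p where "p c u = inv_into (T c) (e c) u" for c u
 have p: "p c u:T c" "e c (p c u) = u" if "ob c" "u:fob x c" for c u
  using x(2)[OF that(1)] that(2) by (auto simp: p_def bij_betw_def inv_into_into f_inv_into_f)
 have pe: "p c (e c w) = w" "e c w:fob x c" if "ob c" "w:T c" for c w
  using x(2)[OF that(1)] that(2) by (auto simp: p_def bij_betw_def)
 have pa: "p (dom f) (act x f u) = a f (p (cod f) u)" if "arr f" "u:fob x (cod f)" for f u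
  using x(3)[OF that(1), of "p (cod f) u"] p[of "cod f" u] pe aT that by simp
 define l where "l j = psh_map C x (fob D j) (%c u. p c u j)" for j
 have lH: "l j:Hom PC x (fob D j)" if j: "j:Ob J" for j
  unfolding l_def
 proof (rule psh_map_Hom[OF x(1) Dp[OF j]])
  show "natural C x (fob D j) (%c u. p c u j)"
   unfolding natural_def using p TD j pa by (auto simp: a_def)
 qed
 have lev: "ev (l j) c u = p c u j" if "ob c" "u:fob x c" for j c u using that by (simp add: l_def)
 have el: "el_limit J D x l"
  unfolding el_limit_def
 proof (intro conjI ballI allI impI)
  fix c w assume c: "ob c" and w: "compat J D c w"
  have "restrict w (Ob J):T c" using w by (intro TI) (auto simp: compat_def)
  thus "EX u:fob x c. ALL j:Ob J. ev (l j) c u = w j"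
   using pe[OF c] c by (intro bexI[of _ "e c (restrict w (Ob J))"]) (auto simp: lev)
 next
  fix c u v assume c: "ob c" "u:fob x c" "v:fob x c" and "ALL j:Ob J. ev (l j) c u = ev (l j) c v"
  hence "!!j. j:Ob J ==> p c u j = p c v j" by (simp add: lev)
  hence "p c u = p c v"
   using extensionalityI[OF TD2(2)[OF p(1)[OF c(1,2)]] TD2(2)[OF p(1)[OF c(1,3)]]] by blast
  thus "u = v" using p(2) c by metis
 qed
 obtain A where A: "filtering A" "!!j. j:Ob J ==> presented A (fob D j)"
  using common_filtering[OF finJ(1), of "fob D"] functor_PV(2)[OF D] V by blast
 have "presented A x"
  unfolding presented_def
 proof (intro conjI ballI impI)
  fix c u assume c: "ob c" "u:fob x c"
  define w where "w = p c u"
  have w: "w:T c" "e c w = u" using p c by (auto simp: w_def)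
  obtain k0 where k0: "arr k0" "dom k0 = c" "cod k0:A" using filteringD(3)[OF A(1) c(1)] by blast
  \<comment> \<open>From an arbitrary arrow \<open>k0\<close> into \<open>A\<close>, refinement
    leads to a stage at which every coordinate of \<open>w\<close> has a preimage.\<close>
  have "EX k m. arr k & arr m & dom k = dom k0 & cod k:A & dom m = cod k & cod m = cod k0 &
    m*k = k0 & (ALL j:Ob J. EX y:fob (fob D j) (cod k). w j = act (fob D j) k y)"
  proof (rule filtering_finite[OF A(1) k0(1,3) finJ(1)])
   fix j assume j: "j:Ob J"
   obtain f y where f: "arr f" "dom f = c" "cod f:A" "y:fob (fob D j) (cod f)" "w j = act (fob D j) f y"
    using presented_gen[OF A(2)[OF j] c(1) TD(1)[OF w(1) _ j]] by auto
   have "dom f = dom k0" using f k0 by simp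
   from filtering_pair[OF A(1) f(1) k0(1) this f(3) k0(3)]
   obtain k s q where k: "arr k" "arr s" "arr q" "dom k = dom f" "cod k:A"
    "dom s = cod k" "dom q = cod k" "cod s = cod f" "cod q = cod k0" "s*k = f" "q*k = k0" .
   have "act (fob D j) s y:fob (fob D j) (cod k)" using k f by (intro act_in[OF Dp[OF j]]) auto
   moreover have "w j = act (fob D j) k (act (fob D j) s y)"
    using pshD(4)[OF Dp[OF j], of k s y] k f by simp
   ultimately show "EX k m. arr k & arr m & dom k = dom k0 & cod k:A & dom m = cod k &
     cod m = cod k0 & m*k = k0 & (EX y:fob (fob D j) (cod k). w j = act (fob D j) k y)"
    using k f k0 by (intro exI[of _ k] exI[of _ q]) auto
  next
   fix j k m n k'' assume j: "j:Ob J" and "EX y:fob (fob D j) (cod k). w j = act (fob D j) k y"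
    and n: "arr n" "arr k''" "cod n = dom m" "dom n = cod k''" "n*k'' = k" "dom m = cod k"
   then obtain y where y: "y:fob (fob D j) (cod k)" "w j = act (fob D j) k y" by blast
   have "act (fob D j) n y:fob (fob D j) (cod k'')" using n y by (intro act_in[OF Dp[OF j]]) auto
   moreover have "w j = act (fob D j) k'' (act (fob D j) n y)"
    using pshD(4)[OF Dp[OF j], of k'' n y] n y by simp
   ultimately show "EX y:fob (fob D j) (cod k''). w j = act (fob D j) k'' y" by blast
  qed
  then obtain k where k: "arr k" "dom k = c" "cod k:A"
   and "ALL j:Ob J. EX y:fob (fob D j) (cod k). w j = act (fob D j) k y" using k0 by auto
  then obtain y where y: "!!j. j:Ob J ==> y j:fob (fob D j) (cod k) & w j = act (fob D j) k (y j)" by metis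
  \<comment> \<open>The lifted coordinates are compatible only after restriction along
    \<open>k\<close>; one further refinement for each arrow of the shape makes them compatible at a
    stage.\<close>
  have "EX k' m. arr k' & arr m & dom k' = dom k & cod k':A & dom m = cod k' & cod m = cod k &
    m*k' = k & (ALL ph:Arr J. act (fob D (Cod J ph)) m (ev (farr D ph) (cod k) (y (Dom J ph))) =
     act (fob D (Cod J ph)) m (y (Cod J ph)))"
  proof (rule filtering_finite[OF A(1) k(1,3) finJ(2)])
   fix ph assume ph: "ph:Arr J"
   have 1: "ev (farr D ph) (cod k) (y (Dom J ph)):fob (fob D (Cod J ph)) (cod k)"
    using naturalD(1)[OF functor_PV(4)[OF D ph]] y[of "Dom J ph"] ph k by simp
   have 2: "y (Cod J ph):fob (fob D (Cod J ph)) (cod k)" using y ph by simp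
   have "act (fob D (Cod J ph)) k (ev (farr D ph) (cod k) (y (Dom J ph))) = act (fob D (Cod J ph)) k (y (Cod J ph))"
   proof -
    have "act (fob D (Cod J ph)) k (ev (farr D ph) (cod k) (y (Dom J ph))) = ev (farr D ph) c (w (Dom J ph))"
     using naturalD(2)[OF functor_PV(4)[OF D ph] k(1), of "y (Dom J ph)"] y[of "Dom J ph"] ph k(2) by simp
    also have "... = w (Cod J ph)" using TD2(1)[OF w(1)] ph by (simp add: compat_def)
    also have "... = act (fob D (Cod J ph)) k (y (Cod J ph))" using y[of "Cod J ph"] ph by simp
    finally show ?thesis .
   qed
   from presented_eq[OF A(2) k(1,3) 1 2 this] ph
   show "EX k' m. arr k' & arr m & dom k' = dom k & cod k':A & dom m = cod k' &
     cod m = cod k & m*k' = k & act (fob D (Cod J ph)) m (ev (farr D ph) (cod k) (y (Dom J ph))) =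
     act (fob D (Cod J ph)) m (y (Cod J ph))" by (metis J.Cod_Ob)
  next
   fix ph k' m n k'' assume ph: "ph:Arr J" and m: "arr m" "cod m = cod k" "arr n" "cod n = dom m"
    and eq: "act (fob D (Cod J ph)) m (ev (farr D ph) (cod k) (y (Dom J ph))) = act (fob D (Cod J ph)) m (y (Cod J ph))"
   have 1: "ev (farr D ph) (cod k) (y (Dom J ph)):fob (fob D (Cod J ph)) (cod k)"
    using naturalD(1)[OF functor_PV(4)[OF D ph]] y[of "Dom J ph"] ph k by simp
   thus "act (fob D (Cod J ph)) (m*n) (ev (farr D ph) (cod k) (y (Dom J ph))) =
     act (fob D (Cod J ph)) (m*n) (y (Cod J ph))"
    using pshD(4)[OF Dp, of "Cod J ph" n m] y[of "Cod J ph"] ph m eq by simp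
  qed
  then obtain k' m where m: "arr k'" "arr m" "dom k' = c" "cod k':A" "dom m = cod k'"
   "cod m = cod k" "m*k' = k"
   and mc: "ALL ph:Arr J. act (fob D (Cod J ph)) m (ev (farr D ph) (cod k) (y (Dom J ph))) =
     act (fob D (Cod J ph)) m (y (Cod J ph))" using k by auto
  let ?w = "\<lambda>j\<in>Ob J. act (fob D j) m (y j)"
  have "?w:T (cod k')"
  proof (rule TI)
   show "compat J D (cod k') ?w"
    unfolding compat_def
   proof (intro conjI ballI)
    fix j assume "j:Ob J" thus "?w j:fob (fob D j) (cod k')"
     using y m by (auto intro!: act_in[OF Dp])
   next
    fix ph assume ph: "ph:Arr J"
    have "y (Dom J ph):fob (fob D (Dom J ph)) (cod m)" using y[of "Dom J ph"] ph m by simp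
    from naturalD(2)[OF functor_PV(4)[OF D ph] m(2) this] mc ph m
    show "ev (farr D ph) (cod k') (?w (Dom J ph)) = ?w (Cod J ph)" by simp
   qed
  qed simp
  moreover have "a k' ?w = w"
  proof (rule extensionalityI[of _ "Ob J"])
   fix j assume j: "j:Ob J"
   show "a k' ?w j = w j"
    using pshD(4)[OF Dp[OF j], of k' m "y j"] y[OF j] m j by (simp add: a_def)
  qed (use TD2(2)[OF w(1)] in \<open>auto simp: a_def\<close>)
  ultimately show "EX f y. arr f & dom f = c & cod f:A & y:fob x (cod f) & u = act x f y"
   using m x(3)[OF m(1), of ?w] pe(2)[of "cod k'" ?w] w
   by (intro exI[of _ k'] exI[of _ "e (cod k') ?w"]) simp
 next
  fix f u v assume f: "arr f" and uv: "u:fob x (cod f)" "v:fob x (cod f)" and fA: "cod f:A"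
   and eq: "act x f u = act x f v"
  have pu: "p (cod f) u:T (cod f)" "p (cod f) v:T (cod f)" using p uv f by auto
  have aeq: "a f (p (cod f) u) = a f (p (cod f) v)" using pa[OF f uv(1)] pa[OF f uv(2)] eq by simp
  \<comment> \<open>Equality in the limit is equality of finitely many coordinates, each of which is
    reached at some stage.\<close>
  have "EX k m. arr k & arr m & dom k = dom f & cod k:A & dom m = cod k &
    cod m = cod f & m*k = f & (ALL j:Ob J. act (fob D j) m (p (cod f) u j) = act (fob D j) m (p (cod f) v j))"
  proof (rule filtering_finite[OF A(1) f fA finJ(1)])
   fix j assume j: "j:Ob J"
   have "act (fob D j) f (p (cod f) u j) = act (fob D j) f (p (cod f) v j)"
    using fun_cong[OF aeq, of j] j by (simp add: a_def)
   from presented_eq[OF A(2)[OF j] f fA TD(1)[OF pu(1) _ j] TD(1)[OF pu(2) _ j] this]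
   show "EX k m. arr k & arr m & dom k = dom f & cod k:A & dom m = cod k &
    cod m = cod f & m*k = f & act (fob D j) m (p (cod f) u j) = act (fob D j) m (p (cod f) v j)"
    by metis
  next
   fix j k' m n l assume j: "j:Ob J" and m: "arr m" "cod m = cod f" "arr n" "cod n = dom m"
    and eq: "act (fob D j) m (p (cod f) u j) = act (fob D j) m (p (cod f) v j)"
   show "act (fob D j) (m*n) (p (cod f) u j) = act (fob D j) (m*n) (p (cod f) v j)"
    using pshD(4)[OF Dp[OF j] m(3,1) m(4)[symmetric]] TD(1)[OF pu(1) _ j] TD(1)[OF pu(2) _ j] m eq by simp
  qed
  then obtain k m where m: "arr k" "arr m" "dom k = dom f" "cod k:A" "dom m = cod k"
   "cod m = cod f" "m*k = f" and
   mj: "ALL j:Ob J. act (fob D j) m (p (cod f) u j) = act (fob D j) m (p (cod f) v j)" by blast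
  have "a m (p (cod f) u) = a m (p (cod f) v)" unfolding a_def using mj by (intro restrict_ext) simp
  hence "act x m u = act x m v"
   using x(3)[OF m(2), of "p (cod f) u"] x(3)[OF m(2), of "p (cod f) v"] pu p(2)[OF Cod_Ob[OF f]] uv m(6) by simp
  thus "EX k m. arr k & arr m & dom k = dom f & cod k:A & dom m = cod k &
    cod m = cod f & m*k = f & act x m u = act x m v" using m by blast
 qed
 hence "x:Sm" using presented_imp_small[OF A(1) x(1)] by simp
 moreover have "ev (farr D ph) c (ev (l (Dom J ph)) c u) = ev (l (Cod J ph)) c u"
  if "ph:Arr J" "ob c" "u:fob x c" for ph c u
  using that p TD2(1)[of "p c u" c] by (simp add: lev compat_def)
 ultimately show thesis using that lH el by blast
qed

text \<open>Being a limit is detected on elements, independently of the full subcategory in which it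
  is formed; only membership of the vertex is at stake.\<close>

lemma PV_finitely_complete:
 assumes V: "V <= Sm"
  and cl: "!!J D x l. finite_diagram J (PV V) D ==> x:Sm ==> is_limit J (PV Sm) D x l ==> x:V"
 shows "finitely_complete (PV V)"
 unfolding finitely_complete_def
proof (intro conjI allI impI category_PV)
 fix J :: "(nat, nat) cat" and D assume fin: "finite_diagram J (PV V) D"
 have D: "is_functor J (PV V) D" using fin unfolding finite_diagram_def by simp
 have D': "is_functor J (PV Sm) D"
  by (rule functorI[OF functorD(1)[OF D] category_PV]) (use functorD[OF D] subsetD[OF V] in auto)
 obtain x l where x: "x:Sm" "!!j. j:Ob J ==> l j:Hom PC x (fob D j)" "el_limit J D x l"
  "!!ph c u. ph:Arr J ==> ob c ==> u:fob x c ==>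
   ev (farr D ph) c (ev (l (Dom J ph)) c u) = ev (l (Cod J ph)) c u"
  using ex_limit_presheaf[OF fin V] by metis
 have "is_limit J (PV Sm) D x l"
  by (rule limit_of_elements[OF D' _ x(3)]) (use x Sm_psh in \<open>auto simp: cone_PV[OF D']\<close>)
 hence "x:V" using cl fin x(1) by blast
 hence "is_limit J (PV V) D x l"
  by (intro limit_of_elements[OF D _ x(3)]) (use x Sm_psh in \<open>auto simp: cone_PV[OF D]\<close>)
 thus "EX x l. is_limit J (PV V) D x l" by blast
qed

end

section \<open>Coequalisers of presheaves\<close>

lemma equivclp_induct_step [consumes 1, case_names refl forward backward]:
 assumes "equivclp r x y" "P x" "!!y z. r y z ==> P y ==> P z" "!!y z. r z y ==> P y ==> P z"
 shows "P y"
 using assms(1) unfolding equivclp_def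
 by (induction rule: rtranclp_induct) (use assms(2-) in \<open>auto elim!: symclpE\<close>)

lemma equivclp_step: "r x y ==> equivclp r x y"
 unfolding equivclp_def by (intro r_into_rtranclp symclpI1)

lemma equivclp_map:
 assumes "equivclp r x y" "!!x y. r x y ==> equivclp r' (f x) (f y)" shows "equivclp r' (f x) (f y)"
 using assms(1)
proof (induction rule: equivclp_induct_step)
 case refl
 show ?case by (rule equivclp_refl)
next
 case (forward y z)
 thus ?case using assms(2) by (metis equivclp_trans)
next
 case (backward y z)
 thus ?case using assms(2) by (metis equivclp_trans equivclp_sym)
qed

context presheaves
begin

definition step :: "('o, 'a, 'u) presheaf => ('o => 'u => 'u) => ('o => 'u => 'u) => 'o => 'u => 'u => bool" where
 "step F s t b y y' <-> (EX x:fob F b. y = s b x & y' = t b x)"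

lemma step_act:
 assumes s: "natural C F G s" and t: "natural C F G t" and f: "arr f"
  and e: "equivclp (step F s t (cod f)) y y'" and F: "psh F"
 shows "equivclp (step F s t (dom f)) (act G f y) (act G f y')"
 using e
proof (rule equivclp_map)
 fix x y assume "step F s t (cod f) x y"
 then obtain u where "u:fob F (cod f)" "x = s (cod f) u" "y = t (cod f) u" unfolding step_def by blast
 hence "step F s t (dom f) (act G f x) (act G f y)"
  using naturalD(2)[OF s f] naturalD(2)[OF t f] pshD(2)[OF F f] unfolding step_def
  by (intro bexI[of _ "act F f u"]) auto
 thus "equivclp (step F s t (dom f)) (act G f x) (act G f y)" by (rule equivclp_step)
qed

lemma ex_coequaliser_presheaf:
 assumes F: "psh F" and G: "psh G" and s: "natural C F G s" and t: "natural C F G t" and U: "universe U"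
 obtains Q q where "psh Q" "natural C G Q q" "!!c. ob c ==> q c ` fob G c = fob Q c"
  "!!c x y. ob c ==> x:fob G c ==> y:fob G c ==> q c x = q c y <-> equivclp (step F s t c) x y"
proof -
 obtain Q q where Q: "psh Q" "!!c. ob c ==> q c ` fob G c = fob Q c"
  "!!c x y. ob c ==> x:fob G c ==> y:fob G c ==> q c x = q c y <-> equivclp (step F s t c) x y"
  "!!f x. arr f ==> x:fob G (cod f) ==> act Q f (q (cod f) x) = q (dom f) (act G f x)"
 proof (rule ex_quotient[of "fob G" "act G" "%c. equivclp (step F s t c)"])
  show "!!c. ob c ==> small U (fob G c)" using pshD(1)[OF G] small_in[OF U] by blast
  show "!!f x y. arr f ==> x:fob G (cod f) ==> y:fob G (cod f) ==>
    equivclp (step F s t (cod f)) x y ==> equivclp (step F s t (dom f)) (act G f x) (act G f y)"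
   using step_act[OF s t _ _ F] by blast
 qed (use pshD[OF G] U in \<open>auto intro: equivclp_sym equivclp_trans\<close>)
 have "natural C G Q q" unfolding natural_def using Q(2,4) by auto
 thus thesis using that Q by blast
qed

lemma natural_descend:
 assumes q: "natural C G Q q" and surj: "ALL c:Ob C. q c ` fob G c = fob Q c" and h: "natural C G H h"
  and wd: "ALL c:Ob C. ALL x:fob G c. ALL y:fob G c. q c x = q c y --> h c x = h c y" and G: "psh G"
 shows "EX k. natural C Q H k & (ALL c:Ob C. ALL x:fob G c. k c (q c x) = h c x)"
proof -
 define k where "k c u = h c (inv_into (fob G c) (q c) u)" for c u
 have k: "k c (q c x) = h c x" if "ob c" "x:fob G c" for c x
 proof -
  have "q c x:q c ` fob G c" using that by blast
  from inv_into_into[OF this] f_inv_into_f[OF this] show ?thesis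
   unfolding k_def using wd that by blast
 qed
 have "natural C Q H k"
  unfolding natural_def
 proof (intro conjI ballI)
  fix c u assume "ob c" "u:fob Q c"
  then obtain x where "x:fob G c" "u = q c x" using surj by blast
  thus "k c u:fob H c" using k[OF \<open>c:Ob C\<close>] naturalD(1)[OF h \<open>c:Ob C\<close>] by simp
 next
  fix f u assume f: "arr f" "u:fob Q (cod f)"
  then obtain x where x: "x:fob G (cod f)" "u = q (cod f) x" using surj by (metis Cod_Ob imageE)
  have "k (dom f) (act Q f u) = k (dom f) (q (dom f) (act G f x))"
   unfolding x(2) naturalD(2)[OF q f(1) x(1)] ..
  also have "... = h (dom f) (act G f x)" by (rule k[OF Dom_Ob[OF f(1)] pshD(2)[OF G f(1) x(1)]])
  also have "... = act H f (h (cod f) x)" by (rule naturalD(2)[OF h f(1) x(1)])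
  also have "... = act H f (k (cod f) u)" unfolding x(2) k[OF Cod_Ob[OF f(1)] x(1)] ..
  finally show "k (dom f) (act Q f u) = act H f (k (cod f) u)" .
 qed
 thus ?thesis using k by blast
qed

lemma coequaliser_of_elements:
 assumes V: "F:V" "G:V" "Q:V" and F: "psh F" and G: "psh G" and Q: "psh Q"
  and s: "natural C F G s" and t: "natural C F G t" and q: "natural C G Q q"
  and surj: "!!c. ob c ==> q c ` fob G c = fob Q c"
  and ker: "!!c x y. ob c ==> x:fob G c ==> y:fob G c ==> q c x = q c y <-> equivclp (step F s t c) x y"
 shows "is_coequaliser (full_subcat PC V) (psh_map C F G s) (psh_map C F G t) (psh_map C G Q q)"
proof -
 interpret P: category PC by (rule category_PC)
 interpret PV: category "full_subcat PC V" by (rule P.category_full_subcat)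
 have H: "psh_map C F G s:Hom PC F G" "psh_map C F G t:Hom PC F G" "psh_map C G Q q:Hom PC G Q"
  using psh_map_Hom assms by auto
 have ev: "!!t c x. ob c ==> x:fob F c ==> ev (Cmp PC t (psh_map C F G s)) c x = ev t c (s c x)"
  "!!u c x. ob c ==> x:fob F c ==> ev (Cmp PC u (psh_map C F G t)) c x = ev u c (t c x)"
  "!!t c x. ob c ==> x:fob G c ==> ev (Cmp PC t (psh_map C G Q q)) c x = ev t c (q c x)"
  using H by auto
 show ?thesis
 proof (rule PV.coequaliserI)
  have "Cmp PC (psh_map C G Q q) (psh_map C F G s) = Cmp PC (psh_map C G Q q) (psh_map C F G t)"
  proof (rule psh_map_eqI[OF P.Cmp_in[OF H(1,3)] P.Cmp_in[OF H(2,3)]])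
   fix c x assume c: "ob c" "x:fob F c"
   hence "equivclp (step F s t c) (s c x) (t c x)" by (intro equivclp_step) (auto simp: step_def)
   thus "ev (Cmp PC (psh_map C G Q q) (psh_map C F G s)) c x = ev (Cmp PC (psh_map C G Q q) (psh_map C F G t)) c x"
    using c ker naturalD(1)[OF s] naturalD(1)[OF t] by (simp add: ev)
  qed
  thus "Cmp (full_subcat PC V) (psh_map C G Q q) (psh_map C F G s) =
    Cmp (full_subcat PC V) (psh_map C G Q q) (psh_map C F G t)" by simp
 next
  fix h assume h: "h:Arr (full_subcat PC V)" "Dom (full_subcat PC V) h = Cod (full_subcat PC V) (psh_map C F G s)"
   and eq: "Cmp (full_subcat PC V) h (psh_map C F G s) = Cmp (full_subcat PC V) h (psh_map C F G t)"
  define Z where "Z = fst (snd h)"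
  have hH: "h:Hom PC G Z" and Z: "Z:V" "psh Z"
   using h H by (auto simp: Z_def presheaf_cat_def nat_trans_iff)
  have "ev h c x = ev h c y" if c: "ob c" "x:fob G c" "y:fob G c" "q c x = q c y" for c x y
  proof -
   have "equivclp (step F s t c) x y" using ker c by blast
   moreover have "ev h c u = ev h c v" if st: "step F s t c u v" for u v
   proof -
    obtain w where "w:fob F c" "u = s c w" "v = t c w" using st unfolding step_def by blast
    thus ?thesis using arg_cong[OF eq, of "%t. ev t c w"] c by (simp add: ev)
   qed
   ultimately show ?thesis by (induction rule: equivclp_induct_step) auto
  qed
  then obtain k where k: "natural C Q Z k" "!!c x. ob c ==> x:fob G c ==> k c (q c x) = ev h c x"
   using natural_descend[OF q _ ev_natural[OF hH] _ G] surj by blast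
  have kH: "psh_map C Q Z k:Hom PC Q Z" using psh_map_Hom[OF Q Z(2) k(1)] .
  have "Cmp PC (psh_map C Q Z k) (psh_map C G Q q) = h"
   by (rule psh_map_eqI[OF P.Cmp_in[OF H(3) kH] hH]) (use k naturalD(1)[OF q] in \<open>simp add: ev\<close>)
  thus "EX k. k:Arr (full_subcat PC V) & Dom (full_subcat PC V) k = Cod (full_subcat PC V) (psh_map C G Q q) &
    Cod (full_subcat PC V) k = Cod (full_subcat PC V) h & Cmp (full_subcat PC V) k (psh_map C G Q q) = h"
   using kH H Z V hH by (intro exI[of _ "psh_map C Q Z k"]) auto
 next
  fix k k' assume k: "k:Arr (full_subcat PC V)" "k':Arr (full_subcat PC V)"
   "Dom (full_subcat PC V) k = Cod (full_subcat PC V) (psh_map C G Q q)"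
   "Dom (full_subcat PC V) k' = Cod (full_subcat PC V) (psh_map C G Q q)"
   "Cod (full_subcat PC V) k = Cod (full_subcat PC V) k'"
   and eq: "Cmp (full_subcat PC V) k (psh_map C G Q q) = Cmp (full_subcat PC V) k' (psh_map C G Q q)"
  hence kH: "k:Hom PC Q (fst (snd k))" "k':Hom PC Q (fst (snd k))" using H(3) by auto
  show "k = k'"
  proof (rule psh_map_eqI[OF kH])
   fix c u assume c: "ob c" "u:fob Q c"
   then obtain x where "x:fob G c" "u = q c x" using surj by blast
   thus "ev k c u = ev k' c u" using arg_cong[OF eq, of "%t. ev t c x"] c by (simp add: ev)
  qed
 qed (use H V in auto)
qed

text \<open>The pointwise coequaliser lies in the subcategory by the last hypothesis and has the
  same universal property, so the given one is isomorphic to it under \<open>G\<close> and inherits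
  its description by zigzags.\<close>

lemma coequaliser_elements:
 assumes e: "is_coequaliser (full_subcat PC V) (psh_map C F G s) (psh_map C F G t) e"
  and V: "F:V" "G:V" and F: "psh F" and G: "psh G" and s: "natural C F G s" and t: "natural C F G t"
  and U: "universe U" and VQ: "ALL Q q. psh Q & natural C G Q q & (ALL c:Ob C. q c ` fob G c = fob Q c) &
   (ALL c:Ob C. ALL x:fob G c. ALL y:fob G c. q c x = q c y <-> equivclp (step F s t c) x y) --> Q:V"
 shows "!!c. ob c ==> ev e c ` fob G c = fob (Cod PC e) c"
  "!!c x y. ob c ==> x:fob G c ==> y:fob G c ==> ev e c x = ev e c y <-> equivclp (step F s t c) x y"
  "e:Hom PC G (Cod PC e)"
proof -
 interpret P: category PC by (rule category_PC)
 interpret PV: category "full_subcat PC V" by (rule P.category_full_subcat)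
 obtain Q q where Q: "psh Q" "natural C G Q q" "!!c. ob c ==> q c ` fob G c = fob Q c"
  "!!c x y. ob c ==> x:fob G c ==> y:fob G c ==> q c x = q c y <-> equivclp (step F s t c) x y"
  using ex_coequaliser_presheaf[OF F G s t U] by metis
 have QV: "Q:V" using VQ Q by blast
 note cq = coequaliser_of_elements[OF V QV F G Q(1) s t Q(2,3,4)]
 have H: "psh_map C F G s:Hom PC F G" "psh_map C F G t:Hom PC F G" "psh_map C G Q q:Hom PC G Q"
  using psh_map_Hom assms Q by auto
 note D = PV.coequaliserD[OF e] and D' = PV.coequaliserD[OF cq]
 show eH: "e:Hom PC G (Cod PC e)" using D(3,6) H by auto
 let ?V = "full_subcat PC V"
 obtain k where k: "k:Arr ?V" "Dom ?V k = Cod ?V e" "Cod ?V k = Q" "Cmp ?V k e = psh_map C G Q q"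
  using PV.coequaliser_factor[OF e D'(3)] D' H(3) by auto
 obtain k' where k': "k':Arr ?V" "Dom ?V k' = Q" "Cod ?V k' = Cod ?V e" "Cmp ?V k' (psh_map C G Q q) = e"
  using PV.coequaliser_factor[OF cq D(3)] D H(3) by auto
 have kH: "k:Hom PC (Cod PC e) Q" "k':Hom PC Q (Cod PC e)" using k k' by auto
 have re: "regular_epi ?V e" using e unfolding regular_epi_def by blast
 have "Cmp ?V k' k = Idt ?V (Cod ?V e)"
 proof (rule PV.regular_epi_cancel[OF re])
  have "Cmp ?V (Cmp ?V k' k) e = Cmp ?V k' (psh_map C G Q q)"
   using PV.assoc[of e k k'] k k'(1,2) D(3) by (simp del: full_subcat_simps)
  thus "Cmp ?V (Cmp ?V k' k) e = Cmp ?V (Idt ?V (Cod ?V e)) e"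
   using k'(4) D(3) by (simp del: full_subcat_simps)
 qed (use k(1-3) k'(1-3) D(3) in \<open>simp_all del: full_subcat_simps\<close>)
 hence kk: "ev k' c (ev k c u) = u" if "ob c" "u:fob (Cod PC e) c" for c u
  using that kH arg_cong[of _ _ "%t. ev t c u"] ev_Cmp[of k c u k'] by simp
 have ek: "ev k c (ev e c x) = q c x" "ev k' c (q c x) = ev e c x" if "ob c" "x:fob G c" for c x
  using arg_cong[OF k(4), of "%t. ev t c x"] arg_cong[OF k'(4), of "%t. ev t c x"] that eH H(3)
  by simp_all
 show "ev e c ` fob G c = fob (Cod PC e) c" if c: "ob c" for c
 proof
  show "ev e c ` fob G c <= fob (Cod PC e) c" using naturalD(1)[OF ev_natural[OF eH] c] by blast
  show "fob (Cod PC e) c <= ev e c ` fob G c"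
  proof
   fix u assume u: "u:fob (Cod PC e) c"
   hence "ev k c u:fob Q c" using naturalD(1)[OF ev_natural[OF kH(1)] c] by blast
   then obtain x where x: "x:fob G c" "ev k c u = q c x" using Q(3)[OF c] by blast
   hence "u = ev e c x" using kk[OF c u] ek(2)[OF c x(1)] by simp
   thus "u:ev e c ` fob G c" using x by blast
  qed
 qed
 show "ev e c x = ev e c y <-> equivclp (step F s t c) x y" if c: "ob c" "x:fob G c" "y:fob G c" for c x y
  using ek[OF c(1,2)] ek[OF c(1,3)] Q(4)[OF c] by metis
qed

lemma psh_map_ev_eq:
 assumes "t:Hom PC F G" shows "psh_map C F G (ev t) = t"
proof -
 have "psh F" "psh G" using assms by (auto simp: presheaf_cat_def nat_trans_iff)
 thus ?thesis using psh_map_Hom[OF _ _ ev_natural[OF assms]] by (intro psh_map_eqI[OF _ assms]) auto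
qed

end

context lex_loc_small
begin

text \<open>Over a common filtering \<open>A\<close>, a zigzag at \<open>c\<close> has finitely many
  steps, each coming from some stage. The relation \<open>E\<close> says that the whole zigzag comes
  from one stage; once it is shown to contain all zigzags, injectivity of the presentation of
  \<open>Q\<close> follows from that of \<open>G\<close>.\<close>

lemma coequaliser_small:
 assumes F: "F:Sm" and G: "G:Sm" and s: "natural C F G s" and t: "natural C F G t"
  and Q: "psh Q" "natural C G Q q" "!!c. ob c ==> q c ` fob G c = fob Q c"
  "!!c x y. ob c ==> x:fob G c ==> y:fob G c ==> q c x = q c y <-> equivclp (step F s t c) x y"
 shows "Q:Sm"
proof -
 note Fp = Sm_psh[OF F] and Gp = Sm_psh[OF G]
 obtain A where A: "filtering A" and pF: "presented A F" and pG: "presented A G"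
 proof (rule common_filtering[of "{True, False}" "%b. if b then F else G"])
  fix A assume "filtering A" and p: "!!i. i:{True, False} ==> presented A (if i then F else G)"
  thus thesis using that p[of True] p[of False] by simp
 qed (use F G in auto)
 define E where "E c v v' <-> (EX k w w'. arr k & dom k = c & cod k:A & w:fob G (cod k) & w':fob G (cod k) &
   v = act G k w & v' = act G k w' & equivclp (step F s t (cod k)) w w')" for c v v'
 have E_refl: "E c v v" if v: "ob c" "v:fob G c" for c v
  using presented_gen[OF pG v] unfolding E_def by (metis equivclp_refl)
 have E_sym: "E c v v' ==> E c v' v" for c v v' unfolding E_def by (metis equivclp_sym)
 \<comment> \<open>The middle element has two presentations, at \<open>k\<close> and at
   \<open>l\<close>; a later stage identifies them, and both zigzags are restricted to it.\<close>
 have E_trans: "E c v v''" if e1: "E c v v'" and e2: "E c v' v''" for c v v' v''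
 proof -
  obtain k w w' where k: "arr k" "dom k = c" "cod k:A" "w:fob G (cod k)" "w':fob G (cod k)"
   "v = act G k w" "v' = act G k w'" "equivclp (step F s t (cod k)) w w'" using e1 unfolding E_def by blast
  obtain l z z' where l: "arr l" "dom l = c" "cod l:A" "z:fob G (cod l)" "z':fob G (cod l)"
   "v' = act G l z" "v'' = act G l z'" "equivclp (step F s t (cod l)) z z'" using e2 unfolding E_def by blast
  have "dom k = dom l" using k l by simp
  from filtering_pair[OF A k(1) l(1) this k(3) l(3)]
  obtain e a b where e: "arr e" "arr a" "arr b" "dom e = dom k" "cod e:A"
   "dom a = cod e" "dom b = cod e" "cod a = cod k" "cod b = cod l" "a*e = k" "b*e = l" .
  have in1: "act G a w':fob G (cod e)" "act G b z:fob G (cod e)" using e k l by (auto intro!: act_in[OF Gp])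
  have "act G e (act G a w') = act G e (act G b z)"
   using pshD(4)[OF Gp, of e a w'] pshD(4)[OF Gp, of e b z] e k l by simp
  from presented_eq[OF pG e(1,5) in1 this]
  obtain n m where m: "arr n" "arr m" "dom n = dom e" "cod n:A" "dom m = cod n"
   "cod m = cod e" "m*n = e" "act G m (act G a w') = act G m (act G b z)" .
  have eq: "act G (a*m) w' = act G (b*m) z"
   using pshD(4)[OF Gp, of m a w'] pshD(4)[OF Gp, of m b z] m e k l by simp
  have "equivclp (step F s t (dom (a*m))) (act G (a*m) w) (act G (a*m) w')"
   by (rule step_act[OF s t _ _ Fp]) (use k e m in auto)
  moreover have "equivclp (step F s t (dom (b*m))) (act G (b*m) z) (act G (b*m) z')"
   by (rule step_act[OF s t _ _ Fp]) (use l e m in auto)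
  ultimately have "equivclp (step F s t (cod n)) (act G (a*m) w) (act G (b*m) z')"
   using eq e m by (auto intro: equivclp_trans)
  moreover have "v = act G n (act G (a*m) w)" "v'' = act G n (act G (b*m) z')"
   using pshD(4)[OF Gp, of n "a*m" w] pshD(4)[OF Gp, of n "b*m" z'] k l e m by simp_all
  moreover have "act G (a*m) w:fob G (cod n)"
   by (rule act_in[OF Gp, where c = "cod k"]) (use k(4) e(2,8) m(2,5,6) e(6) in simp_all)
  moreover have "act G (b*m) z':fob G (cod n)"
   by (rule act_in[OF Gp, where c = "cod l"]) (use l(5) e(3,9) m(2,5,6) e(7) in simp_all)
  ultimately show ?thesis unfolding E_def using m e k by (intro exI[of _ n]) auto
 qed
 have E_step: "E c v v'" if c: "ob c" and st: "step F s t c v v'" for c v v'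
 proof -
  obtain x where x: "x:fob F c" "v = s c x" "v' = t c x" using st unfolding step_def by blast
  obtain f y where f: "arr f" "dom f = c" "cod f:A" "y:fob F (cod f)" "x = act F f y"
   using presented_gen[OF pF c x(1)] .
  have "equivclp (step F s t (cod f)) (s (cod f) y) (t (cod f) y)"
   using f by (intro equivclp_step) (auto simp: step_def)
  thus ?thesis unfolding E_def
   using f x naturalD(2)[OF s f(1,4)] naturalD(2)[OF t f(1,4)] naturalD(1)[OF s _ f(4)] naturalD(1)[OF t _ f(4)]
   by (intro exI[of _ f] exI[of _ "s (cod f) y"] exI[of _ "t (cod f) y"]) auto
 qed
 have E: "E c v v'" if "ob c" "v:fob G c" "equivclp (step F s t c) v v'" for c v v'
  using that(3)
  by (induction rule: equivclp_induct_step)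
   (use E_refl[OF that(1,2)] E_step[OF that(1)] E_trans E_sym in blast)+
 have "presented A Q"
  unfolding presented_def
 proof (intro conjI ballI impI)
  fix c x assume c: "ob c" "x:fob Q c"
  then obtain v where v: "v:fob G c" "x = q c v" using Q(3) by blast
  obtain f y where f: "arr f" "dom f = c" "cod f:A" "y:fob G (cod f)" "v = act G f y"
   using presented_gen[OF pG c(1) v(1)] .
  thus "EX f y. arr f & dom f = c & cod f:A & y:fob Q (cod f) & x = act Q f y"
   using naturalD(2)[OF Q(2) f(1,4)] naturalD(1)[OF Q(2) _ f(4)] v
   by (intro exI[of _ f] exI[of _ "q (cod f) y"]) auto
 next
  fix f y y' assume f: "arr f" and y: "y:fob Q (cod f)" "y':fob Q (cod f)" and fA: "cod f:A"
   and eq: "act Q f y = act Q f y'"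
  obtain v v' where v: "v:fob G (cod f)" "y = q (cod f) v" "v':fob G (cod f)" "y' = q (cod f) v'"
   using y Q(3)[OF Cod_Ob[OF f]] by blast
  have in1: "act G f v:fob G (dom f)" "act G f v':fob G (dom f)" using v pshD(2)[OF Gp f] by auto
  have "q (dom f) (act G f v) = q (dom f) (act G f v')"
   using naturalD(2)[OF Q(2) f v(1)] naturalD(2)[OF Q(2) f v(3)] eq v by simp
  hence "E (dom f) (act G f v) (act G f v')" using E Q(4) in1 f by auto
  then obtain k w w' where k: "arr k" "dom k = dom f" "cod k:A" "w:fob G (cod k)" "w':fob G (cod k)"
   "act G f v = act G k w" "act G f v' = act G k w'" "equivclp (step F s t (cod k)) w w'" unfolding E_def by blast
  \<comment> \<open>The zigzag from \<open>w\<close> to \<open>w'\<close> lives at the stage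
    \<open>k\<close>, whereas \<open>v\<close> and \<open>v'\<close> live over \<open>cod f\<close>.
    After amalgamation, two successive refinements identify \<open>w\<close> with \<open>v\<close>
    and \<open>w'\<close> with \<open>v'\<close>.\<close>
  from filtering_pair[OF A k(1) f k(2) k(3) fA]
  obtain e a b where e: "arr e" "arr a" "arr b" "dom e = dom k" "cod e:A"
   "dom a = cod e" "dom b = cod e" "cod a = cod k" "cod b = cod f" "a*e = k" "b*e = f" .
  have in2: "act G a w:fob G (cod e)" "act G b v:fob G (cod e)"
   using e k v by (auto intro!: act_in[OF Gp])
  have "act G e (act G a w) = act G e (act G b v)"
   using pshD(4)[OF Gp, of e a w] pshD(4)[OF Gp, of e b v] e k v by simp
  from presented_eq[OF pG e(1,5) in2 this]
  obtain n m where m: "arr n" "arr m" "dom n = dom e" "cod n:A" "dom m = cod n"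
   "cod m = cod e" "m*n = e" "act G m (act G a w) = act G m (act G b v)" .
  have "act G (a*m) w':fob G (cod n)"
   by (rule act_in[OF Gp, where c = "cod k"]) (use k(5) e(2,6,8) m(2,5,6) in simp_all)
  moreover have "act G (b*m) v':fob G (cod n)"
   by (rule act_in[OF Gp, where c = "cod f"]) (use v(3) e(3,7,9) m(2,5,6) in simp_all)
  ultimately have in3: "act G (a*m) w':fob G (cod n)" "act G (b*m) v':fob G (cod n)" .
  have "act G n (act G (a*m) w') = act G n (act G (b*m) v')"
   using pshD(4)[OF Gp, of n "a*m" w'] pshD(4)[OF Gp, of n "b*m" v'] e k v m by simp
  from presented_eq[OF pG m(1,4) in3 this]
  obtain n' m' where m': "arr n'" "arr m'" "dom n' = dom n" "cod n':A" "dom m' = cod n'"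
   "cod m' = cod n" "m'*n' = n" "act G m' (act G (a*m) w') = act G m' (act G (b*m) v')" .
  let ?a = "a*m*m'" and ?b = "b*m*m'"
  have 1: "act G ?a w = act G ?b v"
  proof -
   have "act G (m*m') (act G a w) = act G (m*m') (act G b v)"
    using pshD(4)[OF Gp, of m' m] m m' in2 by simp
   thus ?thesis using pshD(4)[OF Gp, of "m*m'" a w] pshD(4)[OF Gp, of "m*m'" b v] e k v m m' by simp
  qed
  have 2: "act G ?a w' = act G ?b v'"
   using pshD(4)[OF Gp, of m' "a*m" w'] pshD(4)[OF Gp, of m' "b*m" v'] e k v m m' by simp
  have "equivclp (step F s t (dom ?a)) (act G ?a w) (act G ?a w')"
   by (rule step_act[OF s t _ _ Fp]) (use k e m m' in auto)
  hence "equivclp (step F s t (cod n')) (act G ?b v) (act G ?b v')" using 1 2 e m m' by simp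
  moreover have "act G ?b x:fob G (cod n')" if "x:fob G (cod f)" for x
   by (rule act_in[OF Gp, where c = "cod f"]) (use that e(3,7,9) m(2,5,6) m'(2,5,6) in simp_all)
  ultimately have "q (cod n') (act G ?b v) = q (cod n') (act G ?b v')"
   using Q(4)[OF Cod_Ob[OF m'(1)], of "act G ?b v" "act G ?b v'"] v by blast
  hence "act Q ?b y = act Q ?b y'"
   using naturalD(2)[OF Q(2), of ?b v] naturalD(2)[OF Q(2), of ?b v'] v e m m' by simp
  thus "EX k m. arr k & arr m & dom k = dom f & cod k:A & dom m = cod k &
    cod m = cod f & m*k = f & act Q m y = act Q m y'"
   using e m m' k by (intro exI[of _ n'] exI[of _ ?b]) simp
 qed
 thus ?thesis using presented_imp_small[OF A Q(1)] by simp
qed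

end

section \<open>Weighted colimits as coequalisers\<close>

text \<open>The weight is the coequaliser of two maps of representables, so by Yoneda a weighted cocone is
 an arrow out of \<open>D Y\<close> that coequalises the images of the two maps.\<close>

locale coequaliser_weight = loc_small K U for K :: "('o, 'a) cat" and U :: "'u set set" +
 fixes X Y :: 'o and d c :: 'a and e :: "('o, 'a, 'u) presheaf_map"
 assumes d: "d:Hom K X Y" and c: "c:Hom K X Y"
  and coeq: "is_coequaliser (presheaf_cat U K) (farr (yoneda U K) d) (farr (yoneda U K) c) e"
begin

abbreviation w where "w \<equiv> Cod (presheaf_cat U K) e"

lemma weight:
 shows "psh w" "!!k. k:Ob K ==> ev e k ` fob (yo Y) k = fob w k" "natural K (yo Y) w (ev e)"
  "!!k x y. k:Ob K ==> x:fob (yo Y) k ==> y:fob (yo Y) k ==> ev e k x = ev e k y <->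
   equivclp (step (yo X) (ev (farr (yoneda U K) d)) (ev (farr (yoneda U K) c)) k) x y"
proof -
 have dc: "d:Arr K" "c:Arr K" "Dom K d = X" "Dom K c = X" "Cod K d = Y" "Cod K c = Y" "X:Ob K" "Y:Ob K"
  using d c by auto
 have h: "farr (yoneda U K) d:Hom PC (yo X) (yo Y)" "farr (yoneda U K) c:Hom PC (yo X) (yo Y)"
  using yoneda_arr(1)[of d] yoneda_arr(1)[of c] dc by auto
 have full: "full_subcat PC UNIV = PC" by (simp add: full_subcat_def)
 have co: "is_coequaliser (full_subcat PC UNIV) (psh_map K (yo X) (yo Y) (ev (farr (yoneda U K) d)))
   (psh_map K (yo X) (yo Y) (ev (farr (yoneda U K) c))) e"
  unfolding full using coeq psh_map_ev_eq[OF h(1)] psh_map_ev_eq[OF h(2)] by simp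
 have VQ: "ALL (Q :: ('o, 'a, 'u) presheaf) (q :: 'o => 'u => 'u). P Q q --> Q:UNIV" for P by simp
 note E = coequaliser_elements[OF co UNIV_I UNIV_I psh_yo[OF dc(7)] psh_yo[OF dc(8)] ev_natural[OF h(1)] ev_natural[OF h(2)] U VQ]
 show "!!k. k:Ob K ==> ev e k ` fob (yo Y) k = fob w k"
  "!!k x y. k:Ob K ==> x:fob (yo Y) k ==> y:fob (yo Y) k ==> ev e k x = ev e k y <->
   equivclp (step (yo X) (ev (farr (yoneda U K) d)) (ev (farr (yoneda U K) c)) k) x y"
  by (fact E(1), fact E(2))
 show "natural K (yo Y) w (ev e)" using ev_natural[OF E(3)] .
 show "psh w" using E(3) by (auto simp: presheaf_cat_def nat_trans_iff)
qed

text \<open>The class of the identity of \<open>Y\<close>. It generates the weight, so that a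
  weighted cocone is determined by its value here.\<close>

definition gen where "gen = ev e Y (cd Y Y (Idt K Y))"

lemma gen: "gen:fob w Y"
 using naturalD(1)[OF weight(3), of Y] d unfolding gen_def by auto

lemma act_gen: "f:Arr K ==> Cod K f = Y ==> act w f gen = ev e (Dom K f) (cd (Dom K f) Y f)"
 using naturalD(2)[OF weight(3), of f "cd Y Y (Idt K Y)"] unfolding gen_def by auto

lemma weight_surj:
 assumes "k:Ob K" "x:fob w k" obtains f where "f:Arr K" "Dom K f = k" "Cod K f = Y" "x = act w f gen"
proof -
 obtain u where u: "u:fob (yo Y) k" "x = ev e k u" using assms weight(2) by blast
 thus thesis using that[of "dc k Y u"] act_gen[of "dc k Y u"] by simp
qed

lemma act_gen_eq: "act w d gen = act w c gen"
proof -
 have dc: "d:Arr K" "c:Arr K" "Dom K d = X" "Dom K c = X" "Cod K d = Y" "Cod K c = Y" "X:Ob K"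
  using d c by auto
 have "step (yo X) (ev (farr (yoneda U K) d)) (ev (farr (yoneda U K) c)) X (cd X Y d) (cd X Y c)"
  unfolding step_def using dc yoneda_arr(2)[of d X] yoneda_arr(2)[of c X]
  by (intro bexI[of _ "cd X X (Idt K X)"]) auto
 hence "ev e X (cd X Y d) = ev e X (cd X Y c)" using weight(4)[of X] dc by (auto intro: equivclp_step)
 thus ?thesis using act_gen[of d] act_gen[of c] dc by simp
qed

text \<open>Well-definedness principle for functions on the weight: a function of arrows into
  \<open>Y\<close> depends only on the element they name as soon as it does not distinguish
  \<open>d\<close> from \<open>c\<close>.\<close>

lemma weight_kernel:
 assumes f: "f:Arr K" "f':Arr K" "Cod K f = Y" "Cod K f' = Y" "Dom K f = k" "Dom K f' = k" and eq: "act w f gen = act w f' gen"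
  and P: "!!h. h:Arr K ==> Dom K h = k ==> Cod K h = X ==> P (Cmp K d h) = P (Cmp K c h)"
 shows "P f = P f'"
proof -
 have dc: "d:Arr K" "c:Arr K" "Dom K d = X" "Dom K c = X" "Cod K d = Y" "Cod K c = Y" "X:Ob K"
  using d c by auto
 have k: "k:Ob K" using f by auto
 have "equivclp (step (yo X) (ev (farr (yoneda U K) d)) (ev (farr (yoneda U K) c)) k) (cd k Y f) (cd k Y f')"
  using weight(4)[OF k, of "cd k Y f" "cd k Y f'"] act_gen[of f] act_gen[of f'] f eq by simp
 moreover have "P (dc k Y x) = P (dc k Y y)"
  if st: "step (yo X) (ev (farr (yoneda U K) d)) (ev (farr (yoneda U K) c)) k x y" for x y
 proof -
  obtain u where u: "u:fob (yo X) k" "x = ev (farr (yoneda U K) d) k u" "y = ev (farr (yoneda U K) c) k u"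
   using st unfolding step_def by blast
  hence "x = cd k Y (Cmp K d (dc k X u))" "y = cd k Y (Cmp K c (dc k X u))"
   using yoneda_arr(2)[of d k u] yoneda_arr(2)[of c k u] dc k by auto
  thus ?thesis using P[of "dc k X u"] u(1) dc by simp
 qed
 ultimately have "P (dc k Y (cd k Y f)) = P (dc k Y (cd k Y f'))"
  by (induction rule: equivclp_induct_step) auto
 thus ?thesis using f by simp
qed

lemma weighted_cocone_iff:
 assumes D: "is_functor K E D"
 shows weighted_cocone_coequalises: "is_weighted_cocone U K w E D z io ==>
   io Y gen:Hom E (fob D Y) z & Cmp E (io Y gen) (farr D d) = Cmp E (io Y gen) (farr D c) &
   (ALL f:Arr K. Cod K f = Y --> io (Dom K f) (act w f gen) = Cmp E (io Y gen) (farr D f))"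
  and ex_weighted_cocone: "g:Hom E (fob D Y) z ==> Cmp E g (farr D d) = Cmp E g (farr D c) ==>
   EX io. is_weighted_cocone U K w E D z io & io Y gen = g"
proof -
 interpret E: category E using functorD(2)[OF D] .
 note F = functorD[OF D]
 have dc: "d:Arr K" "c:Arr K" "Dom K d = X" "Dom K c = X" "Cod K d = Y" "Cod K c = Y" "X:Ob K" "Y:Ob K"
  using d c by auto
 {
  assume io: "is_weighted_cocone U K w E D z io"
  have n: "io (Dom K f) (act w f gen) = Cmp E (io Y gen) (farr D f)" if "f:Arr K" "Cod K f = Y" for f
   using io gen that unfolding is_weighted_cocone_def by auto
  have "io Y gen:Hom E (fob D Y) z" using io gen dc unfolding is_weighted_cocone_def by auto
  thus "io Y gen:Hom E (fob D Y) z & Cmp E (io Y gen) (farr D d) = Cmp E (io Y gen) (farr D c) &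
   (ALL f:Arr K. Cod K f = Y --> io (Dom K f) (act w f gen) = Cmp E (io Y gen) (farr D f))"
   using n n[OF dc(1,5)] n[OF dc(2,6)] act_gen_eq dc by simp
 next
  assume g: "g:Hom E (fob D Y) z" and eq: "Cmp E g (farr D d) = Cmp E g (farr D c)"
  \<comment> \<open>The value at \<open>x\<close> is read off any arrow that produces
    \<open>x\<close> from the generator; coequalising the pair makes the choice irrelevant.\<close>
  define io where "io k x = (let f = SOME f. f:Arr K & Dom K f = k & Cod K f = Y & x = act w f gen in Cmp E g (farr D f))" for k x
  have io: "io k (act w f gen) = Cmp E g (farr D f)" if f: "f:Arr K" "Dom K f = k" "Cod K f = Y" for k f
  proof -
   let ?P = "%f'. f':Arr K & Dom K f' = k & Cod K f' = Y & act w f gen = act w f' gen"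
   have s: "?P (SOME f'. ?P f')" by (rule someI[of ?P f]) (use f in auto)
   show ?thesis unfolding io_def Let_def
   proof (rule weight_kernel[where k = k])
    fix h assume h: "h:Arr K" "Dom K h = k" "Cod K h = X"
    have "Cmp E (Cmp E g (farr D d)) (farr D h) = Cmp E (Cmp E g (farr D c)) (farr D h)" using eq by simp
    thus "Cmp E g (farr D (Cmp K d h)) = Cmp E g (farr D (Cmp K c h))"
     using h dc F g by simp
   qed (use s f in auto)
  qed
  have "is_weighted_cocone U K w E D z io"
   unfolding is_weighted_cocone_def
  proof (intro conjI allI ballI)
   show "psh w" by (rule weight(1))
   show "is_functor K E D" by (rule D)
   show "z:Ob E" using g by auto
   fix k x assume k: "k:Ob K" "x:fob w k"
   then obtain f where f: "f:Arr K" "Dom K f = k" "Cod K f = Y" "x = act w f gen" using weight_surj by metis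
   thus "io k x:Hom E (fob D k) z" using io[OF f(1-3)] g F by auto
  next
   fix k k' h x assume h: "h:Hom K k k'" and x: "x:fob w k'"
   hence h': "h:Arr K" "Dom K h = k" "Cod K h = k'" "k':Ob K" by auto
   obtain f where f: "f:Arr K" "Dom K f = k'" "Cod K f = Y" "x = act w f gen" using weight_surj[OF h'(4) x] by metis
   have "act w h x = act w (Cmp K f h) gen" using pshD(4)[OF weight(1), of h f gen] f h' gen by simp
   thus "io k (act w h x) = Cmp E (io k' x) (farr D h)"
    using io[OF f(1-3)] io[of "Cmp K f h" k] f h' g F by simp
  qed
  moreover have "io Y gen = g"
   using io[of "Idt K Y" Y] pshD(3)[OF weight(1) dc(8) gen] F g dc by auto
  ultimately show "EX io. is_weighted_cocone U K w E D z io & io Y gen = g" by blast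
 }
qed

lemma weighted_colimit_coequaliser:
 assumes D: "is_functor K E D" and wc: "is_weighted_colimit U K w E D z io"
 shows "is_coequaliser E (farr D d) (farr D c) (io Y gen)" "Cod E (io Y gen) = z"
proof -
 interpret E: category E using functorD(2)[OF D] .
 note F = functorD[OF D]
 have dc: "d:Arr K" "c:Arr K" "Dom K d = X" "Dom K c = X" "Cod K d = Y" "Cod K c = Y" "X:Ob K" "Y:Ob K"
  using d c by auto
 have c': "is_weighted_cocone U K w E D z io" using wc unfolding is_weighted_colimit_def by blast
 note g = weighted_cocone_coequalises[OF D c']
 show "Cod E (io Y gen) = z" using g by simp
 show "is_coequaliser E (farr D d) (farr D c) (io Y gen)"
 proof (rule E.coequaliserI)
  fix h assume h: "h:Arr E" "Dom E h = Cod E (farr D d)" "Cmp E h (farr D d) = Cmp E h (farr D c)"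
  hence "h:Hom E (fob D Y) (Cod E h)" using F dc by auto
  from ex_weighted_cocone[OF D this h(3)] obtain kg where kg: "is_weighted_cocone U K w E D (Cod E h) kg" "kg Y gen = h" by blast
  then obtain k where "k:Hom E z (Cod E h)" "ALL k':Ob K. ALL x:fob w k'. Cmp E k (io k' x) = kg k' x"
   using wc unfolding is_weighted_colimit_def by blast
  thus "EX k. k:Arr E & Dom E k = Cod E (io Y gen) & Cod E k = Cod E h & Cmp E k (io Y gen) = h"
   using kg(2) gen dc g by (intro exI[of _ k]) auto
 next
  fix k k' assume k: "k:Arr E" "k':Arr E" "Dom E k = Cod E (io Y gen)" "Dom E k' = Cod E (io Y gen)" "Cod E k = Cod E k'"
   and eq: "Cmp E k (io Y gen) = Cmp E k' (io Y gen)"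
  have co: "is_weighted_cocone U K w E D (Cod E k) (%j x. Cmp E k (io j x))"
   unfolding is_weighted_cocone_def
  proof (intro conjI allI ballI)
   fix j j' h x assume h: "h:Hom K j j'" "x:fob w j'"
   hence "io j (act w h x) = Cmp E (io j' x) (farr D h)" "io j' x:Hom E (fob D j') z"
    using c' unfolding is_weighted_cocone_def by auto
   thus "Cmp E k (io j (act w h x)) = Cmp E (Cmp E k (io j' x)) (farr D h)"
    using k g h F by auto
  qed (use c' k g in \<open>auto simp: is_weighted_cocone_def\<close>)
  have "Cmp E k (io j x) = Cmp E k' (io j x)" if j: "j:Ob K" "x:fob w j" for j x
  proof -
   obtain f where f: "f:Arr K" "Dom K f = j" "Cod K f = Y" "x = act w f gen" using weight_surj[OF j] by metis
   have "Cmp E (Cmp E k (io Y gen)) (farr D f) = Cmp E (Cmp E k' (io Y gen)) (farr D f)" using eq by simp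
   thus ?thesis using g f k F by auto
  qed
  hence "ALL j:Ob K. ALL x:fob w j. Cmp E k' (io j x) = Cmp E k (io j x)" by simp
  moreover have "EX! h. h:Hom E z (Cod E k) & (ALL j:Ob K. ALL x:fob w j. Cmp E h (io j x) = Cmp E k (io j x))"
   using wc co unfolding is_weighted_colimit_def by blast
  moreover have "k:Hom E z (Cod E k)" "k':Hom E z (Cod E k)" using k g by auto
  ultimately show "k = k'" by blast
 qed (use F dc g in auto)
qed

lemma coequaliser_weighted_colimit:
 assumes D: "is_functor K E D" and g: "is_coequaliser E (farr D d) (farr D c) g"
 shows "EX io. is_weighted_colimit U K w E D (Cod E g) io"
proof -
 interpret E: category E using functorD(2)[OF D] .
 note F = functorD[OF D]
 have dc: "d:Arr K" "c:Arr K" "Dom K d = X" "Dom K c = X" "Cod K d = Y" "Cod K c = Y" "X:Ob K" "Y:Ob K"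
  using d c by auto
 note G = E.coequaliserD[OF g]
 have gH: "g:Hom E (fob D Y) (Cod E g)" using G F dc by auto
 from ex_weighted_cocone[OF D this G(7)] obtain io where io: "is_weighted_cocone U K w E D (Cod E g) io" "io Y gen = g" by blast
 note g' = weighted_cocone_coequalises[OF D io(1)]
 have "is_weighted_colimit U K w E D (Cod E g) io"
  unfolding is_weighted_colimit_def
 proof (intro conjI allI impI io(1))
  fix z kg assume kg: "is_weighted_cocone U K w E D z kg"
  note k' = weighted_cocone_coequalises[OF D kg]
  obtain h where h: "h:Arr E" "Dom E h = Cod E g" "Cod E h = z" "Cmp E h g = kg Y gen"
   using E.coequaliser_factor[OF g, of "kg Y gen"] k' F dc by auto
  show "EX! h. h:Hom E (Cod E g) z & (ALL k:Ob K. ALL x:fob w k. Cmp E h (io k x) = kg k x)"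
  proof (rule ex1I[of _ h], intro conjI ballI)
   show "h:Hom E (Cod E g) z" using h by simp
   fix k x assume k: "k:Ob K" "x:fob w k"
   obtain f where f: "f:Arr K" "Dom K f = k" "Cod K f = Y" "x = act w f gen" using weight_surj[OF k] by metis
   have 1: "io k x = Cmp E g (farr D f)" using g' io(2) f by metis
   have 2: "kg k x = Cmp E (kg Y gen) (farr D f)" using k' f by metis
   have "Dom E g = Cod E (farr D f)" using G(6) F dc f by simp
   thus "Cmp E h (io k x) = kg k x"
    unfolding 1 2 using E.assoc[of "farr D f" g h] h G(3) F(4)[OF f(1)] by simp
  next
   fix h' assume h': "h':Hom E (Cod E g) z & (ALL k:Ob K. ALL x:fob w k. Cmp E h' (io k x) = kg k x)"
   hence "Cmp E h' g = kg Y gen" using gen dc io(2) by auto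
   moreover have "regular_epi E g" using g unfolding regular_epi_def by blast
   ultimately show "h' = h" using E.regular_epi_cancel[of g h' h] h h' by auto
  qed
 qed
 thus ?thesis by blast
qed

end

section \<open>Extending freeness to large categories\<close>

lemma functor_iso:
 assumes F: "is_functor A B F" and f: "is_iso A f" shows "is_iso B (farr F f)"
proof -
 interpret A: category A by (rule functorD(1)[OF F])
 obtain g where g: "is_inverse_pair A f g" using f unfolding is_iso_def by blast
 have "f:Arr A" "g:Arr A" "Dom A g = Cod A f" "Cod A g = Dom A f" "Cmp A g f = Idt A (Dom A f)" "Cmp A f g = Idt A (Cod A f)"
  using g unfolding is_inverse_pair_def by auto
 hence "is_inverse_pair B (farr F f) (farr F g)"
  unfolding is_inverse_pair_def using functorD[OF F]
   functorD(8)[OF F, of f g] functorD(8)[OF F, of g f] by simp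
 thus ?thesis unfolding is_iso_def by blast
qed

context category
begin

lemma limit_cong:
 assumes l: "is_limit J C F x l" and J: "category J" and eq: "!!j. j:Ob J ==> l' j = l j"
 shows "is_limit J C F x l'"
proof -
 interpret J: category J by (rule J)
 have "is_cone J C F x l'" using limitD(1)[OF l] eq unfolding cone_iff by simp
 thus ?thesis using l eq unfolding is_limit_def by simp
qed

lemma limit_of_iso:
 assumes l: "is_limit J C F x l" and J: "is_functor J C F" and c: "is_cone J C F x' l'"
  and h: "is_inverse_pair C h k" "dom h = x'" "cod h = x" and eq: "!!j. j:Ob J ==> l j*h = l' j"
 shows "is_limit J C F x' l'"
proof (rule limitI[OF c])
 have hk: "arr h" "arr k" "dom k = x" "cod k = x'" "k*h = idt x'" "h*k = idt x"
  using h unfolding is_inverse_pair_def by auto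
 note D = limitD[OF l]
 fix y m assume "is_cone J C F y m"
 then obtain t where t: "arr t" "dom t = y" "cod t = x" "!!j. j:Ob J ==> l j*t = m j"
  using limit_lift[OF l] by metis
 have "l' j*k*t = m j" if j: "j:Ob J" for j
 proof -
  have "h*k*t = t" using Cmp_reassoc1[OF hk(6), of t] hk t h by simp
  moreover have "l j*h*k*t = l' j*k*t"
   using Cmp_reassoc1[OF eq[OF j], of "k*t"] D j hk t h by simp
  ultimately show ?thesis using t j by simp
 qed
 thus "EX h. arr h & dom h = y & cod h = x' & (ALL j:Ob J. l' j*h = m j)"
  using hk t by (intro exI[of _ "k*t"]) simp
next
 have hk: "arr h" "arr k" "dom k = x" "cod k = x'" "k*h = idt x'" "h*k = idt x"
  using h unfolding is_inverse_pair_def by auto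
 note D = limitD[OF l]
 fix s t assume s: "arr s" "cod s = x'" "arr t" "cod t = x'" "dom t = dom s"
  and e: "!!j. j:Ob J ==> l' j*s = l' j*t"
 have "h*s = h*t"
 proof (rule limit_unique[OF l J])
  fix j assume j: "j:Ob J"
  have "(l j*h)*s = (l j*h)*t" using e eq j by simp
  thus "l j*h*s = l j*h*t" using D j hk s h by simp
 qed (use hk s h in simp_all)
 hence "k*h*s = k*h*t" by simp
 thus "s = t" using Cmp_reassoc1[OF hk(5), of s] Cmp_reassoc1[OF hk(5), of t] hk s h(2,3) by simp
qed

lemma limits_iso:
 assumes l: "is_limit J C F x l" and l': "is_limit J C F x' l'" and J: "is_functor J C F"
 obtains h k where "is_inverse_pair C h k" "dom h = x'" "cod h = x" "!!j. j:Ob J ==> l j*h = l' j"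
proof -
 note D = limitD[OF l] and D' = limitD[OF l']
 obtain h where h: "arr h" "dom h = x'" "cod h = x" "!!j. j:Ob J ==> l j*h = l' j"
  using limit_lift[OF l D'(1)] by metis
 obtain k where k: "arr k" "dom k = x" "cod k = x'" "!!j. j:Ob J ==> l' j*k = l j"
  using limit_lift[OF l' D(1)] by metis
 have "h*k = idt x"
 proof (rule limit_unique[OF l J])
  fix j assume j: "j:Ob J"
  have "l j*h*k = l' j*k" using Cmp_reassoc1[OF h(4)[OF j], of k] D j h k by simp
  thus "l j*h*k = l j*idt x" using D j k(4)[OF j] by simp
 qed (use h k D in simp_all)
 moreover have "k*h = idt x'"
 proof (rule limit_unique[OF l' J])
  fix j assume j: "j:Ob J"
  have "l' j*k*h = l j*h" using Cmp_reassoc1[OF k(4)[OF j], of h] D' j h k by simp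
  thus "l' j*k*h = l' j*idt x'" using D' j h(4)[OF j] by simp
 qed (use h k D' in simp_all)
 ultimately show thesis using that h k unfolding is_inverse_pair_def by auto
qed

end

lemma lex_functor_comp:
 assumes "lex_functor A B F" "lex_functor B C G" shows "lex_functor A C (comp_fctr G F)"
proof -
 have F: "is_functor A B F" and G: "is_functor B C G" using assms unfolding lex_functor_def by auto
 have "is_limit J C (comp_fctr (comp_fctr G F) D) (fob (comp_fctr G F) x) (%j. farr (comp_fctr G F) (l j))"
  if D: "finite_diagram J A D" and l: "is_limit J A D x l" for J D x l
 proof -
  have "finite_diagram J B (comp_fctr F D)" using D functor_comp[OF _ F] unfolding finite_diagram_def by blast
  moreover have "is_limit J B (comp_fctr F D) (fob F x) (%j. farr F (l j))"
   using assms(1) D l unfolding lex_functor_def by blast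
  ultimately have "is_limit J C (comp_fctr G (comp_fctr F D)) (fob G (fob F x)) (%j. farr G (farr F (l j)))"
   using assms(2) unfolding lex_functor_def by blast
  thus ?thesis by (simp add: comp_fctr_def)
 qed
 thus ?thesis using assms functor_comp[OF F G] unfolding lex_functor_def by blast
qed

text \<open>Finite diagrams are coded by lists of arrows, so that the closure of finitely many arrows under
 composition and finite limits is the image of a countable type of terms. Full subcategories
 would not do here: hom-sets of presheaf categories need not be small.\<close>

datatype limit_term = Gen nat | IdDom limit_term | IdCod limit_term | Comp limit_term limit_term
 | Lim "nat list" "limit_term list" "nat list" "limit_term list" "nat list"
 | Proj "nat list" "limit_term list" "nat list" "limit_term list" "nat list" nat
 | Ind "nat list" "limit_term list" "nat list" "limit_term list" "nat list" limit_term "limit_term list"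

instance limit_term :: countable
 by countable_datatype

text \<open>Object indices and the identities at their images, then for each arrow of the shape its
  source index, image and target index. Objects appear through identities so that a term only
  mentions arrows.\<close>

type_synonym 'b diagram_code = "nat list \<times> 'b list \<times> nat list \<times> 'b list \<times> nat list"

section \<open>Closure of countably many arrows under finite limits\<close>

context lex_category
begin

fun code_cone :: "'a diagram_code => 'o => (nat => 'a) => bool" where
 "code_cone (js, es, ds, fs, ks) x l <-> ob x &
  (ALL t:set (zip js es). arr (l (fst t)) & dom (l (fst t)) = x & cod (l (fst t)) = dom (snd t)) &
  (ALL t:set (zip ds (zip fs ks)). fst (snd t)*l (fst t) = l (snd (snd t)))"

definition code_limit :: "'a diagram_code => 'o => (nat => 'a) => bool" where
 "code_limit kg x l <-> code_cone kg x l &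
  (ALL y m. code_cone kg y m --> (EX! h. h:hom y x & (ALL j:set (fst kg). l j*h = m j)))"

definition coding :: "(nat, nat) cat => (nat, nat, 'o, 'a) fctr => 'a diagram_code" where
 "coding J F = (sorted_list_of_set (Ob J), map (%j. idt (fob F j)) (sorted_list_of_set (Ob J)),
  map (Dom J) (sorted_list_of_set (Arr J)), map (farr F) (sorted_list_of_set (Arr J)),
  map (Cod J) (sorted_list_of_set (Arr J)))"

lemma set_zip_map: "set (zip xs (map f xs)) = (%x. (x, f x)) ` set xs"
 by (induction xs) auto

lemma set_zip_map3: "set (zip (map f xs) (zip (map g xs) (map h xs))) = (%x. (f x, g x, h x)) ` set xs"
 by (induction xs) auto

lemma code_cone_coding:
 assumes "finite_diagram J C F" shows "code_cone (coding J F) x l <-> is_cone J C F x l"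
proof -
 have fin: "finite (Ob J)" "finite (Arr J)" and F: "is_functor J C F" using assms unfolding finite_diagram_def by auto
 show ?thesis using fin functorD(3)[OF F] unfolding coding_def cone_iff by (simp add: set_zip_map set_zip_map3)
qed

lemma code_limit_coding:
 assumes "finite_diagram J C F" shows "code_limit (coding J F) x l <-> is_limit J C F x l"
 using assms unfolding code_limit_def is_limit_def code_cone_coding[OF assms]
 by (simp add: coding_def finite_diagram_def)

definition code_ok where "code_ok kg <-> (EX J F. finite_diagram J C F & kg = coding J F)"
definition lim_ob where "lim_ob kg = (SOME x. EX l. code_limit kg x l)"
definition lim_pr where "lim_pr kg = (SOME l. code_limit kg (lim_ob kg) l)"
definition lim_ind where "lim_ind kg y m = (THE h. h:hom y (lim_ob kg) & (ALL j:set (fst kg). lim_pr kg j*h = m j))"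

lemma code_limit_lim:
 assumes "code_ok kg" shows "code_limit kg (lim_ob kg) (lim_pr kg)"
proof -
 obtain J F where "finite_diagram J C F" "kg = coding J F" using assms unfolding code_ok_def by blast
 hence "EX x l. code_limit kg x l" using ex_limit code_limit_coding by blast
 hence "EX l. code_limit kg (lim_ob kg) l" unfolding lim_ob_def by (rule someI_ex)
 thus ?thesis unfolding lim_pr_def by (rule someI_ex)
qed

lemma lim_ind:
 assumes "code_ok kg" "code_cone kg y m"
 shows "lim_ind kg y m:hom y (lim_ob kg)" "!!j. j:set (fst kg) ==> lim_pr kg j*lim_ind kg y m = m j"
proof -
 have "EX! h. h:hom y (lim_ob kg) & (ALL j:set (fst kg). lim_pr kg j*h = m j)"
  using code_limit_lim[OF assms(1)] assms(2) unfolding code_limit_def by blast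
 from theI'[OF this] show "lim_ind kg y m:hom y (lim_ob kg)"
  "!!j. j:set (fst kg) ==> lim_pr kg j*lim_ind kg y m = m j" unfolding lim_ind_def by blast+
qed

text \<open>Ill-formed terms denote \<open>gm 0\<close>, which keeps evaluation total without
  leaving the closure. In \<open>Ind\<close> the arrow \<open>e\<close> only serves to name the
  vertex of the cone, namely its domain.\<close>

primrec eval_term :: "(nat => 'a) => limit_term => 'a" where
 "eval_term gm (Gen n) = gm n"
| "eval_term gm (IdDom t) = idt (dom (eval_term gm t))"
| "eval_term gm (IdCod t) = idt (cod (eval_term gm t))"
| "eval_term gm (Comp s t) = (if dom (eval_term gm s) = cod (eval_term gm t) then eval_term gm s*eval_term gm t else gm 0)"
| "eval_term gm (Lim js es ds fs ks) = (let kg = (js, map (eval_term gm) es, ds, map (eval_term gm) fs, ks) in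
  if code_ok kg then idt (lim_ob kg) else gm 0)"
| "eval_term gm (Proj js es ds fs ks j) = (let kg = (js, map (eval_term gm) es, ds, map (eval_term gm) fs, ks) in
  if code_ok kg & j:set js then lim_pr kg j else gm 0)"
| "eval_term gm (Ind js es ds fs ks e ms) = (let kg = (js, map (eval_term gm) es, ds, map (eval_term gm) fs, ks);
   y = dom (eval_term gm e); m = (%j. the (map_of (zip js (map (eval_term gm) ms)) j)) in
  if code_ok kg & code_cone kg y m then lim_ind kg y m else gm 0)"

end

text \<open>The class \<open>V\<close> is carried along so that the objects of the generated
  subcategory stay in a prescribed class closed under finite limits.\<close>

locale generated_lex = lex_category C for C :: "('o, 'a) cat" +
 fixes gm :: "nat => 'a" and V :: "'o set"
 assumes gm: "!!n. gm n:Arr C & Dom C (gm n):V & Cod C (gm n):V"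
  and V: "!!J F x l. finite_diagram J C F ==> fob F ` Ob J <= V ==> is_limit J C F x l ==> x:V"
begin

definition Ar where "Ar = range (eval_term gm)"

lemma code_ok_V:
 assumes "code_ok (js, es, ds, fs, ks)" "!!e. e:set es ==> e:Arr C & Dom C e:V"
 shows "lim_ob (js, es, ds, fs, ks):V" "lim_ob (js, es, ds, fs, ks):Ob C"
  "!!j. j:set js ==> lim_pr (js, es, ds, fs, ks) j:Arr C & Dom C (lim_pr (js, es, ds, fs, ks) j) = lim_ob (js, es, ds, fs, ks) &
   Cod C (lim_pr (js, es, ds, fs, ks) j):V"
proof -
 obtain J F where J: "finite_diagram J C F" "(js, es, ds, fs, ks) = coding J F" using assms(1) unfolding code_ok_def by blast
 hence js: "set js = Ob J" and es: "set es = (%j. Idt C (fob F j)) ` Ob J"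
  by (auto simp: coding_def finite_diagram_def)
 have F: "is_functor J C F" using J unfolding finite_diagram_def by blast
 have FV: "fob F j:V" if "j:Ob J" for j
  using assms(2)[of "Idt C (fob F j)"] functorD(3)[OF F that] that es by auto
 have l: "is_limit J C F (lim_ob (js, es, ds, fs, ks)) (lim_pr (js, es, ds, fs, ks))"
  using code_limit_lim[OF assms(1)] code_limit_coding[OF J(1)] J(2) by simp
 show "lim_ob (js, es, ds, fs, ks):V" using V[OF J(1) _ l] FV by blast
 show "lim_ob (js, es, ds, fs, ks):Ob C" using limitD(2)[OF l] .
 show "!!j. j:set js ==> lim_pr (js, es, ds, fs, ks) j:Arr C & Dom C (lim_pr (js, es, ds, fs, ks) j) = lim_ob (js, es, ds, fs, ks) &
   Cod C (lim_pr (js, es, ds, fs, ks) j):V"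
  using limitD(3-5)[OF l] js FV by auto
qed

lemma eval_term_V: "eval_term gm t:Arr C & Dom C (eval_term gm t):V & Cod C (eval_term gm t):V"
proof (induction t)
 case (Lim js es ds fs ks)
 have "e:Arr C & Dom C e:V" if "e:set (map (eval_term gm) es)" for e using that Lim by auto
 from code_ok_V(1,2)[of js "map (eval_term gm) es" ds "map (eval_term gm) fs" ks, OF _ this] show ?case using gm by (simp add: Let_def)
next
 case (Proj js es ds fs ks j)
 have "e:Arr C & Dom C e:V" if "e:set (map (eval_term gm) es)" for e using that Proj by auto
 from code_ok_V[of js "map (eval_term gm) es" ds "map (eval_term gm) fs" ks, OF _ this] show ?case using gm by (simp add: Let_def)
next
 case (Ind js es ds fs ks e ms)
 let ?kg = "(js, map (eval_term gm) es, ds, map (eval_term gm) fs, ks)"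
 let ?m = "%j. the (map_of (zip js (map (eval_term gm) ms)) j)"
 show ?case
 proof (cases "code_ok ?kg & code_cone ?kg (Dom C (eval_term gm e)) ?m")
  case True
  hence "lim_ind ?kg (Dom C (eval_term gm e)) ?m:Hom C (Dom C (eval_term gm e)) (lim_ob ?kg)" using lim_ind(1) by blast
  moreover have "e:Arr C & Dom C e:V" if "e:set (map (eval_term gm) es)" for e using that Ind by auto
  from code_ok_V(1)[OF conjunct1[OF True] this] have "lim_ob ?kg:V" by simp
  ultimately show ?thesis using True Ind by (auto simp: Let_def)
 qed (use gm in \<open>auto simp: Let_def\<close>)
qed (use gm in auto)

lemma Ar: "f:Ar ==> f:Arr C" "f:Ar ==> Dom C f:V" "f:Ar ==> Cod C f:V"
 using eval_term_V unfolding Ar_def by auto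

lemma Ar_countable: "countable Ar"
 unfolding Ar_def by (rule countable_image[OF countableI_type])

lemma Ar_Idt:
 assumes "f:Ar" shows "Idt C (Dom C f):Ar" "Idt C (Cod C f):Ar"
proof -
 obtain t where "f = eval_term gm t" using assms unfolding Ar_def by blast
 hence "eval_term gm (IdDom t) = Idt C (Dom C f)" "eval_term gm (IdCod t) = Idt C (Cod C f)" by simp_all
 thus "Idt C (Dom C f):Ar" "Idt C (Cod C f):Ar" unfolding Ar_def by (metis rangeI)+
qed

lemma Ar_Cmp:
 assumes "f:Ar" "g:Ar" "Dom C g = Cod C f" shows "g*f:Ar"
proof -
 obtain s t where st: "g = eval_term gm s" "f = eval_term gm t" using assms(1,2) unfolding Ar_def by blast
 hence "eval_term gm (Comp s t) = g*f" using assms(3) by simp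
 thus ?thesis unfolding Ar_def by (metis rangeI)
qed

lemma Ar_list: assumes "set es <= Ar" shows "EX ts. es = map (eval_term gm) ts"
 using assms unfolding Ar_def by (metis ex_map_conv imageE subsetD)

lemma Ar_lim:
 assumes ok: "code_ok (js, es, ds, fs, ks)" and sub: "set es <= Ar" "set fs <= Ar"
 shows "Idt C (lim_ob (js, es, ds, fs, ks)):Ar" "!!j. j:set js ==> lim_pr (js, es, ds, fs, ks) j:Ar"
proof -
 obtain ts us where t: "es = map (eval_term gm) ts" "fs = map (eval_term gm) us" using Ar_list sub by metis
 have "eval_term gm (Lim js ts ds us ks) = Idt C (lim_ob (js, es, ds, fs, ks))" using ok t by (simp add: Let_def)
 thus "Idt C (lim_ob (js, es, ds, fs, ks)):Ar" unfolding Ar_def by (metis rangeI)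
 fix j assume "j:set js"
 hence "eval_term gm (Proj js ts ds us ks j) = lim_pr (js, es, ds, fs, ks) j" using ok t by (simp add: Let_def)
 thus "lim_pr (js, es, ds, fs, ks) j:Ar" unfolding Ar_def by (metis rangeI)
qed

lemma Ar_ind:
 assumes ok: "code_ok (js, es, ds, fs, ks)" and sub: "set es <= Ar" "set fs <= Ar"
  and c: "code_cone (js, es, ds, fs, ks) (Dom C e) (%j. the (map_of (zip js ms) j))" and e: "e:Ar" "set ms <= Ar"
 shows "lim_ind (js, es, ds, fs, ks) (Dom C e) (%j. the (map_of (zip js ms) j)):Ar"
proof -
 obtain ts us vs where t: "es = map (eval_term gm) ts" "fs = map (eval_term gm) us" "ms = map (eval_term gm) vs"
  using Ar_list sub e by metis
 obtain s where s: "e = eval_term gm s" using e unfolding Ar_def by blast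
 have "eval_term gm (Ind js ts ds us ks s vs) = lim_ind (js, es, ds, fs, ks) (Dom C e) (%j. the (map_of (zip js ms) j))"
  using ok c t s by (simp add: Let_def)
 thus ?thesis unfolding Ar_def by (metis rangeI)
qed

text \<open>In the coded copy of the generated subcategory, objects are the codes of their identities.\<close>

definition gcat :: "'u set set => ('u, 'u) cat" where
 "gcat U = (let ea = code U Ar; de = decode U Ar in
  \<lparr>Ob = (%f. ea (Idt C (Dom C f))) ` Ar, Arr = ea ` Ar, Dom = (%u. ea (Idt C (Dom C (de u)))),
  Cod = (%u. ea (Idt C (Cod C (de u)))), Idt = (%u. u), Cmp = (%v u. ea (de v*de u))\<rparr>)"

definition ginc :: "'u set set => ('u, 'u, 'o, 'a) fctr" where
 "ginc U = \<lparr>fob = (%u. Dom C (decode U Ar u)), farr = decode U Ar\<rparr>"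

context
 fixes U :: "'u set set"
 assumes U: "universe U"
begin

abbreviation ea where "ea \<equiv> code U Ar"
abbreviation de where "de \<equiv> decode U Ar"
abbreviation G where "G \<equiv> gcat U"

lemma small_Ar: "small U Ar"
 by (rule small_countable[OF U Ar_countable])

lemma de_ea [simp]: "f:Ar ==> de (ea f) = f"
 by (rule decode_code[OF small_Ar])

lemma G_simps: "Ob G = (%f. ea (Idt C (Dom C f))) ` Ar" "Arr G = ea ` Ar" "Dom G u = ea (Idt C (Dom C (de u)))"
 "Cod G u = ea (Idt C (Cod C (de u)))" "Idt G u = u" "Cmp G v u = ea (de v*de u)"
 by (simp_all add: gcat_def Let_def)

lemma Arr_G: "u:Arr G ==> de u:Ar & ea (de u) = u"
 by (auto simp: G_simps)

lemma Ob_G: "u:Ob G ==> de u:Ar & de u = Idt C (Dom C (de u)) & ea (de u) = u"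
 using Ar_Idt(1) Ar(1) by (auto simp: G_simps)

lemma ObG_I: "f:Ar ==> ea (Idt C (Dom C f)):Ob G" "f:Ar ==> ea (Idt C (Cod C f)):Ob G"
 using Ar_Idt(2)[of f] Ar(1)[of f] by (auto simp: G_simps intro!: image_eqI[of _ _ "Idt C (Cod C f)"])

lemma ea_eq: "f:Ar ==> g:Ar ==> ea f = ea g <-> f = g"
 by (metis de_ea)

lemma Idt_eq: "x:Ob C ==> y:Ob C ==> Idt C x = Idt C y <-> x = y"
 by (metis Idt_simps(2))

lemma DomCod_G:
 assumes "u:Arr G" "v:Arr G" shows "Dom G v = Cod G u <-> Dom C (de v) = Cod C (de u)"
  "Dom G v = Dom G u <-> Dom C (de v) = Dom C (de u)" "Cod G v = Cod G u <-> Cod C (de v) = Cod C (de u)"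
 using Arr_G[OF assms(1)] Arr_G[OF assms(2)] Ar_Idt Ar(1) by (auto simp: G_simps ea_eq Idt_eq)

lemma Cmp_G:
 assumes "u:Arr G" "v:Arr G" "Dom G v = Cod G u"
 shows "Cmp G v u:Arr G" "de (Cmp G v u) = de v*de u" "Dom G (Cmp G v u) = Dom G u" "Cod G (Cmp G v u) = Cod G v"
proof -
 have c: "Dom C (de v) = Cod C (de u)" using DomCod_G(1)[OF assms(1,2)] assms(3) by simp
 note a = Arr_G[OF assms(1)] Arr_G[OF assms(2)]
 have in1: "de v*de u:Ar" using Ar_Cmp a c by blast
 thus "Cmp G v u:Arr G" and d: "de (Cmp G v u) = de v*de u" by (auto simp: G_simps)
 show "Dom G (Cmp G v u) = Dom G u" "Cod G (Cmp G v u) = Cod G v"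
  using d c a Ar(1) by (simp_all add: G_simps)
qed

lemma G_eqI: "u:Arr G ==> v:Arr G ==> de u = de v ==> u = v"
 by (metis Arr_G)

lemma category_G: "category G"
proof
 fix f assume "f:Arr G"
 thus "Dom G f:Ob G" "Cod G f:Ob G" using ObG_I Arr_G by (auto simp: G_simps(3,4))
next
 fix x assume "x:Ob G"
 note x = Ob_G[OF this]
 have "Dom C (de x):Ob C" using x Ar(1) by simp
 hence "Cod C (de x) = Dom C (de x)" using x Idt_simps(3) by metis
 moreover have "Idt G x:Arr G" unfolding G_simps using x by (metis imageI)
 ultimately show "Idt G x:Hom G x x" using x by (simp add: G_simps(3-5))
next
 fix f g x y z assume "f:Hom G x y" "g:Hom G y z"
 thus "Cmp G g f:Hom G x z" using Cmp_G[of f g] by auto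
next
 fix f x y assume f: "f:Hom G x y"
 hence a: "f:Arr G" "de f:Ar" "ea (de f) = f" "x = ea (Idt C (Dom C (de f)))" "y = ea (Idt C (Cod C (de f)))"
  using Arr_G by (auto simp: G_simps(3,4))
 thus "Cmp G f (Idt G x) = f" "Cmp G (Idt G y) f = f" using Ar_Idt Ar(1) by (simp_all add: G_simps(5,6))
next
 fix f g h w x y z assume "f:Hom G w x" "g:Hom G x y" "h:Hom G y z"
 hence a: "f:Arr G" "g:Arr G" "h:Arr G" "Dom G g = Cod G f" "Dom G h = Cod G g" by auto
 have "de (Cmp G h (Cmp G g f)) = de (Cmp G (Cmp G h g) f)"
  using a Cmp_G[of f g] Cmp_G[of g h] Cmp_G[of "Cmp G g f" h] Cmp_G[of f "Cmp G h g"] DomCod_G(1)[of f g] DomCod_G(1)[of g h]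
   Arr_G[of f] Arr_G[of g] Arr_G[of h] Ar(1) by simp
 thus "Cmp G h (Cmp G g f) = Cmp G (Cmp G h g) f"
  using a Cmp_G[of f g] Cmp_G[of g h] Cmp_G[of "Cmp G g f" h] Cmp_G[of f "Cmp G h g"] by (intro G_eqI) simp_all
qed

lemma functor_ginc: "is_functor G C (ginc U)"
proof (rule functorI[OF category_G category_axioms])
 fix f assume f: "f:Arr G"
 note a = Arr_G[OF f]
 show "farr (ginc U) f:Arr C" using a Ar(1) by (simp add: ginc_def)
 show "Dom C (farr (ginc U) f) = fob (ginc U) (Dom G f)" "Cod C (farr (ginc U) f) = fob (ginc U) (Cod G f)"
  using a Ar_Idt Ar(1) by (simp_all add: ginc_def G_simps(3,4))
next
 fix x assume "x:Ob G"
 note x = Ob_G[OF this]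
 show "fob (ginc U) x:Ob C" "farr (ginc U) (Idt G x) = Idt C (fob (ginc U) x)"
  using x Ar(1) by (simp_all add: ginc_def G_simps(5))
next
 fix f g assume "f:Arr G" "g:Arr G" "Dom G g = Cod G f"
 thus "farr (ginc U) (Cmp G g f) = farr (ginc U) g*farr (ginc U) f" using Cmp_G by (simp add: ginc_def)
qed

lemma small_G: "small_category U G"
proof -
 have "ea ` Ar:U" using code_in[OF small_Ar] by (simp add: coded_def)
 moreover have "Ob G <= ea ` Ar" using Ar_Idt(1) by (auto simp: G_simps)
 ultimately show ?thesis unfolding small_category_def using category_G universe_subset[OF U] by (simp add: G_simps(2))
qed

lemma cone_ginc:
 assumes D: "is_functor J G D"
 shows "is_cone J G D x l <-> x:Ob G & (ALL j:Ob J. l j:Arr G) & is_cone J C (comp_fctr (ginc U) D) (fob (ginc U) x) (%j. farr (ginc U) (l j))"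
proof -
 interpret J: category J using functorD(1)[OF D] .
 note F = functorD[OF D] and I = functorD[OF functor_ginc]
 have ob: "x = y <-> fob (ginc U) x = fob (ginc U) y" if "x:Ob G" "y:Ob G" for x y
  using Ob_G[OF that(1)] Ob_G[OF that(2)] unfolding ginc_def by (metis fctr.select_convs(1))
 show ?thesis
 proof
  assume c: "is_cone J G D x l"
  have "Cmp C (farr (ginc U) (farr D f)) (farr (ginc U) (l (Dom J f))) = farr (ginc U) (l (Cod J f))" if "f:Arr J" for f
   using I(8)[of "l (Dom J f)" "farr D f"] c F that unfolding cone_iff by simp
  thus "x:Ob G & (ALL j:Ob J. l j:Arr G) & is_cone J C (comp_fctr (ginc U) D) (fob (ginc U) x) (%j. farr (ginc U) (l j))"
   using c I F unfolding cone_iff by simp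
 next
  assume c: "x:Ob G & (ALL j:Ob J. l j:Arr G) & is_cone J C (comp_fctr (ginc U) D) (fob (ginc U) x) (%j. farr (ginc U) (l j))"
  interpret G: category G by (rule category_G)
  have dc: "Dom G (l j) = x & Cod G (l j) = fob D j" if "j:Ob J" for j
  proof -
   have l: "l j:Arr G" "fob (ginc U) (Dom G (l j)) = fob (ginc U) x" "fob (ginc U) (Cod G (l j)) = fob (ginc U) (fob D j)"
    using c that I(5)[of "l j"] I(6)[of "l j"] unfolding cone_iff by auto
   thus ?thesis using ob[of "Dom G (l j)" x] ob[of "Cod G (l j)" "fob D j"] F(3)[OF that] c by simp
  qed
  have "Cmp G (farr D f) (l (Dom J f)) = l (Cod J f)" if "f:Arr J" for f
  proof (rule G_eqI)
   have s: "Dom G (farr D f) = Cod G (l (Dom J f))" using dc[of "Dom J f"] F that by simp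
   thus "Cmp G (farr D f) (l (Dom J f)):Arr G" using c F that by simp
   show "l (Cod J f):Arr G" using c that by simp
   show "de (Cmp G (farr D f) (l (Dom J f))) = de (l (Cod J f))"
    using Cmp_G(2)[OF _ _ s] c F that unfolding cone_iff by (auto simp: ginc_def)
  qed
  thus "is_cone J G D x l" using c dc unfolding cone_iff by simp
 qed
qed

text \<open>The chosen limit in \<open>C\<close>, its projections and its mediating arrows are all
  values of terms, so they already lie in the generated subcategory.\<close>

lemma ex_limit_G:
 assumes fin: "finite_diagram J G D"
 shows "EX x l. is_limit J G D x l & is_limit J C (comp_fctr (ginc U) D) (fob (ginc U) x) (%j. farr (ginc U) (l j))"
proof -
 interpret G: category G by (rule category_G)
 have D: "is_functor J G D" and finJ: "finite (Ob J)" "finite (Arr J)" using fin unfolding finite_diagram_def by auto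
 note F = functorD[OF D] and I = functorD[OF functor_ginc]
 let ?D = "comp_fctr (ginc U) D"
 have D': "is_functor J C ?D" by (rule functor_comp[OF D functor_ginc])
 hence fin': "finite_diagram J C ?D" using finJ unfolding finite_diagram_def by blast
 define js where "js = sorted_list_of_set (Ob J)"
 define es where "es = map (%j. Idt C (fob ?D j)) js"
 define as where "as = sorted_list_of_set (Arr J)"
 define kg where "kg = (js, es, map (Dom J) as, map (farr ?D) as, map (Cod J) as)"
 have kg: "coding J ?D = kg" unfolding coding_def kg_def es_def js_def as_def by simp
 have js: "set js = Ob J" "distinct js" using finJ by (auto simp: js_def)
 have sub: "set es <= Ar" "set (map (farr ?D) as) <= Ar"
  using Ob_G[OF F(3)] Arr_G[OF F(4)] js finJ by (auto simp: es_def as_def ginc_def)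
 have ok: "code_ok kg" unfolding code_ok_def using fin' kg by blast
 define x where "x = lim_ob kg"
 define l where "l = lim_pr kg"
 have xl: "is_limit J C ?D x l" using code_limit_lim[OF ok] code_limit_coding[OF fin'] kg unfolding x_def l_def by simp
 have xA: "Idt C x:Ar" and lA: "!!j. j:Ob J ==> l j:Ar"
  using Ar_lim[OF ok[unfolded kg_def] sub] js unfolding x_def l_def kg_def by auto
 note L = limitD[OF xl]
 have xG: "ea (Idt C x):Ob G" "fob (ginc U) (ea (Idt C x)) = x"
  using ObG_I(1)[OF xA] L(2) xA by (auto simp: ginc_def)
 have lG: "ea (l j):Arr G" "farr (ginc U) (ea (l j)) = l j" if "j:Ob J" for j
  using lA[OF that] by (auto simp: ginc_def G_simps)
 have lim': "is_limit J C ?D x (%j. farr (ginc U) (ea (l j)))"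
  by (rule limit_cong[OF xl functorD(1)[OF D]]) (use lG in simp)
 note conecong = limitD(1)[OF lim'] lim'
 have "is_limit J G D (ea (Idt C x)) (%j. ea (l j))"
 proof (rule G.limitI)
  show cone: "is_cone J G D (ea (Idt C x)) (%j. ea (l j))"
   unfolding cone_ginc[OF D] using xG lG conecong(1) by simp
  fix y m assume m: "is_cone J G D y m"
  hence mc: "y:Ob G" "!!j. j:Ob J ==> m j:Arr G" "is_cone J C ?D (fob (ginc U) y) (%j. farr (ginc U) (m j))"
   unfolding cone_ginc[OF D] by auto
  \<comment> \<open>\<open>Ind\<close> terms take the legs of a cone as a list, from which
    \<open>m'\<close> looks them up again.\<close>
  define ms where "ms = map (%j. de (m j)) js"
  define m' where "m' = (%j. the (map_of (zip js ms) j))"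
  have m': "m' j = de (m j)" if "j:Ob J" for j
   using that js unfolding m'_def ms_def by (simp add: map_of_zip_map)
  have "is_cone J C ?D (Dom C (de y)) m'"
   using mc(3) m' category.Dom_Ob[OF functorD(1)[OF D]] category.Cod_Ob[OF functorD(1)[OF D]] unfolding cone_iff by (simp add: ginc_def)
  hence cc: "code_cone kg (Dom C (de y)) m'" using code_cone_coding[OF fin'] kg by simp
  define h where "h = lim_ind kg (Dom C (de y)) m'"
  have msA: "set ms <= Ar" using Arr_G[OF mc(2)] js unfolding ms_def by auto
  have yA: "de y:Ar" "ea (Idt C (Dom C (de y))) = y" using Ob_G[OF mc(1)] by auto
  have hA: "h:Ar"
   unfolding h_def m'_def kg_def
   by (rule Ar_ind[OF ok[unfolded kg_def] sub]) (use cc yA msA in \<open>auto simp only: kg_def m'_def\<close>)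
  have h: "h:Hom C (Dom C (de y)) x" "!!j. j:Ob J ==> l j*h = de (m j)"
   using lim_ind[OF ok cc] js m' unfolding h_def x_def l_def kg_def by auto
  have "Cmp G (ea (l j)) (ea h) = m j" if j: "j:Ob J" for j
   using h(2)[OF j] hA lA[OF j] Arr_G[OF mc(2)[OF j]] by (simp add: G_simps(6))
  moreover have "ea h:Arr G" "Dom G (ea h) = y" "Cod G (ea h) = ea (Idt C x)"
   using hA h(1) yA by (auto simp: G_simps)
  ultimately show "EX h. h:Arr G & Dom G h = y & Cod G h = ea (Idt C x) & (ALL j:Ob J. Cmp G (ea (l j)) h = m j)" by blast
 next
  fix h k assume h: "h:Arr G" "Cod G h = ea (Idt C x)" "k:Arr G" "Cod G k = ea (Idt C x)" "Dom G k = Dom G h"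
   and eq: "!!j. j:Ob J ==> Cmp G (ea (l j)) h = Cmp G (ea (l j)) k"
  have hx: "Cod C (de h) = x" "Cod C (de k) = x" "Dom C (de k) = Dom C (de h)"
   using h xA L(2) Ar_Idt Arr_G[of h] Arr_G[of k] Ar(1) by (auto simp: G_simps(3,4) ea_eq Idt_eq)
  have "de h = de k"
  proof (rule limit_unique[OF xl D'])
   fix j assume j: "j:Ob J"
   have "Dom G (ea (l j)) = Cod G h" "Dom G (ea (l j)) = Cod G k" using h lA[OF j] L(4)[OF j] by (auto simp: G_simps(3))
   thus "l j*de h = l j*de k"
    using arg_cong[OF eq[OF j], of de] Cmp_G(2)[OF h(1) lG(1)[OF j]] Cmp_G(2)[OF h(3) lG(1)[OF j]] lA[OF j] by simp
  qed (use hx Arr_G[OF h(1)] Arr_G[OF h(3)] Ar(1) in auto)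
  thus "h = k" using G_eqI h by blast
 qed
 thus ?thesis using conecong(2) xG(2) by (intro exI[of _ "ea (Idt C x)"] exI[of _ "%j. ea (l j)"]) simp
qed

lemma G_finitely_complete: "finitely_complete G"
 unfolding finitely_complete_def using category_G ex_limit_G by blast

text \<open>The inclusion preserves the chosen limits, and every limit in the subcategory is
  isomorphic to a chosen one.\<close>

lemma lex_ginc: "lex_functor G C (ginc U)"
 unfolding lex_functor_def
proof (intro conjI allI impI G_finitely_complete fincomp functor_ginc)
 fix J :: "(nat, nat) cat" and D x l assume *: "finite_diagram J G D & is_limit J G D x l"
 interpret G: category G by (rule category_G)
 have D: "is_functor J G D" using * unfolding finite_diagram_def by blast
 note I = functorD[OF functor_ginc]
 obtain x' l' where l': "is_limit J G D x' l'" "is_limit J C (comp_fctr (ginc U) D) (fob (ginc U) x') (%j. farr (ginc U) (l' j))"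
  using ex_limit_G * by blast
 obtain h k where h: "is_inverse_pair G h k" "Dom G h = x" "Cod G h = x'" "!!j. j:Ob J ==> Cmp G (l' j) h = l j"
  using G.limits_iso[OF l'(1) conjunct2[OF *] D] by metis
 have hk: "h:Arr G" "k:Arr G" "Dom G k = x'" "Cod G k = x" "Cmp G k h = Idt G x" "Cmp G h k = Idt G x'"
  using h unfolding is_inverse_pair_def by auto
 have inv: "is_inverse_pair C (farr (ginc U) h) (farr (ginc U) k)"
  unfolding is_inverse_pair_def Hom_iff
  using I(8)[of h k] I(8)[of k h] hk h(2,3) I(4,5,6,7) limitD(2)[OF l'(1)] limitD(2)[OF conjunct2[OF *]] by simp
 show "is_limit J C (comp_fctr (ginc U) D) (fob (ginc U) x) (%j. farr (ginc U) (l j))"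
 proof (rule limit_of_iso[OF l'(2) functor_comp[OF D functor_ginc] _ inv])
  show "is_cone J C (comp_fctr (ginc U) D) (fob (ginc U) x) (%j. farr (ginc U) (l j))"
   using limitD(1)[OF conjunct2[OF *]] cone_ginc[OF D] by blast
  fix j assume j: "j:Ob J"
  show "farr (ginc U) (l' j)*farr (ginc U) h = farr (ginc U) (l j)"
   using I(8)[of h "l' j"] hk h(3) h(4)[OF j] limitD(3,4)[OF l'(1) j] by simp
 qed (use I(5,6) hk(1) h in auto)
qed

end

end

text \<open>Freeness speaks only of small categories in the type of the universe. The given pair is
  placed in the coded copy of the countable subcategory that it generates, and the functor obtained
  there is composed with the inclusion.\<close>

lemma (in lex_category) free_lex_extend:
 assumes U: "universe U" and free: "free_lex_on_reflexive_pair U K X Y d c r"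
  and pair: "is_reflexive_pair C X' Y' d' c' r'" and XY: "X':V" "Y':V"
  and V: "ALL J F x l. finite_diagram J C F --> fob F ` Ob J <= V --> is_limit J C F x l --> x:V"
 shows "EX D a b. lex_functor K C D & fob D ` Ob K <= V & a:hom (fob D X) X' & is_iso C a &
  b:hom (fob D Y) Y' & is_iso C b & b*farr D d = d'*a & b*farr D c = c'*a"
proof -
 \<comment> \<open>A sequence enumerating the three arrows of the pair; from the third place on it
   repeats the splitting.\<close>
 define gm where "gm n = (if n = 0 then d' else if n = Suc 0 then c' else r')" for n
 have p: "arr d'" "arr c'" "arr r'" "dom d' = X'" "dom c' = X'" "dom r' = Y'"
  "cod d' = Y'" "cod c' = Y'" "cod r' = X'" "d'*r' = idt Y'" "c'*r' = idt Y'"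
  using pair unfolding is_reflexive_pair_def by auto
 interpret g: generated_lex C gm V
 proof unfold_locales
  fix n show "arr (gm n) & dom (gm n):V & cod (gm n):V" using p XY by (simp add: gm_def)
 next
  fix J F x l assume "finite_diagram J C F" "fob F ` Ob J <= V" "is_limit J C F x l"
  thus "x:V" using V by blast
 qed
 have "gm n:g.Ar" for n unfolding g.Ar_def by (metis eval_term.simps(1) rangeI)
 from this[of 0] this[of 1] this[of 2] have A: "d':g.Ar" "c':g.Ar" "r':g.Ar" by (auto simp: gm_def)
 let ?G = "g.gcat U" and ?I = "g.ginc U" and ?e = "code U g.Ar" and ?d = "decode U g.Ar"
 note Gs = g.G_simps[OF U] and de = g.de_ea[OF U] and I = functorD[OF g.functor_ginc[OF U]]
 have idA: "idt X':g.Ar" "idt Y':g.Ar" using g.Ar_Idt(1)[OF A(1)] g.Ar_Idt(2)[OF A(1)] p by auto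
 have "is_reflexive_pair ?G (?e (idt X')) (?e (idt Y')) (?e d') (?e c') (?e r')"
  unfolding is_reflexive_pair_def using A p de by (auto simp: Gs)
 then obtain F a b where F: "lex_functor K ?G F" and
  ab: "a:Hom ?G (fob F X) (?e (idt X'))" "is_iso ?G a" "b:Hom ?G (fob F Y) (?e (idt Y'))" "is_iso ?G b"
  "Cmp ?G b (farr F d) = Cmp ?G (?e d') a" "Cmp ?G b (farr F c) = Cmp ?G (?e c') a"
  using free g.small_G[OF U] g.G_finitely_complete[OF U] unfolding free_lex_on_reflexive_pair_def by metis
 have Ff: "is_functor K ?G F" using F unfolding lex_functor_def by blast
 note FF = functorD[OF Ff]
 have dc: "d:Arr K" "c:Arr K" "Dom K d = X" "Dom K c = X" "Cod K d = Y" "Cod K c = Y"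
  using free unfolding free_lex_on_reflexive_pair_def is_reflexive_pair_def by auto
 have Iob: "fob ?I (?e (idt X')) = X'" "fob ?I (?e (idt Y')) = Y'" using idA de p
  by (simp_all add: g.ginc_def) (metis Dom_Ob Idt_simps(2) p(4), metis Cod_Ob Idt_simps(2) p(7))
 show ?thesis
 proof (rule exI[of _ "comp_fctr ?I F"], rule exI[of _ "farr ?I a"], rule exI[of _ "farr ?I b"], intro conjI)
  show "lex_functor K C (comp_fctr ?I F)" by (rule lex_functor_comp[OF F g.lex_ginc[OF U]])
  show "fob (comp_fctr ?I F) ` Ob K <= V"
   using g.Ob_G[OF U FF(3)] g.Ar(2) by (auto simp: g.ginc_def)
  show "farr ?I a:hom (fob (comp_fctr ?I F) X) X'" "farr ?I b:hom (fob (comp_fctr ?I F) Y) Y'"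
   using I(4,5,6) ab Iob by auto
  show "is_iso C (farr ?I a)" "is_iso C (farr ?I b)" using functor_iso[OF g.functor_ginc[OF U]] ab by auto
  have "farr ?I (Cmp ?G b (farr F d)) = farr ?I b*farr ?I (farr F d)" "farr ?I (Cmp ?G b (farr F c)) = farr ?I b*farr ?I (farr F c)"
   using I(8)[of "farr F d" b] I(8)[of "farr F c" b] ab dc FF by auto
  moreover have "farr ?I (Cmp ?G (?e d') a) = d'*farr ?I a" "farr ?I (Cmp ?G (?e c') a) = c'*farr ?I a"
   using I(8)[of a "?e d'"] I(8)[of a "?e c'"] ab A p de by (auto simp: Gs(2,3) g.ginc_def)
  ultimately show "farr ?I b*farr (comp_fctr ?I F) d = d'*farr ?I a" "farr ?I b*farr (comp_fctr ?I F) c = c'*farr ?I a"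
   using ab by auto
 qed
qed

section \<open>Universal arrows to representables\<close>

lemma (in category) coequaliser_iso:
 assumes e: "is_coequaliser C d' c' e" and ab: "is_inverse_pair C a a'" "is_inverse_pair C b b'"
  and t: "arr d" "arr c" "dom d = dom a" "dom c = dom a" "cod d = dom b" "cod c = dom b"
   "cod a = dom d'" "cod b = cod d'" and eq: "b*d = d'*a" "b*c = c'*a"
 shows "is_coequaliser C d c (e*b)"
proof -
 note E = coequaliserD[OF e]
 have A: "arr a" "arr a'" "dom a' = cod a" "cod a' = dom a" "a'*a = idt (dom a)" "a*a' = idt (cod a)"
  and B: "arr b" "arr b'" "dom b' = cod b" "cod b' = dom b" "b'*b = idt (dom b)" "b*b' = idt (cod b)"
  using ab unfolding is_inverse_pair_def by auto
 show ?thesis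
 proof (rule coequaliserI)
  have "e*d'*a = e*c'*a" using Cmp_reassoc[OF E(7), of a] E(1-6) A(1) t by simp
  moreover have "(e*b)*d = e*d'*a" "(e*b)*c = e*c'*a" using E(1-6) B(1) t eq by simp_all
  ultimately show "(e*b)*d = (e*b)*c" by simp
 next
  fix h assume h: "arr h" "dom h = cod d" "h*d = h*c"
  have d': "b'*d' = d*a'" "b'*c' = c*a'"
  proof -
   have 1: "b*d*a' = d'" "b*c*a' = c'"
    using Cmp_reassoc[OF eq(1), of a'] Cmp_reassoc[OF eq(2), of a'] A B t E by simp_all
   have "b'*b*d*a' = d*a'" "b'*b*c*a' = c*a'"
    using Cmp_reassoc1[OF B(5), of "d*a'"] Cmp_reassoc1[OF B(5), of "c*a'"] A(1-4) B(1-4) t by simp_all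
   thus "b'*d' = d*a'" "b'*c' = c*a'" unfolding 1 by simp_all
  qed
  have "(h*b')*d' = h*d*a'" "(h*b')*c' = h*c*a'" using d' h(1,2) A B t E by simp_all
  moreover have "h*d*a' = h*c*a'" using Cmp_reassoc[OF h(3), of a'] h(1,2) A(2,4) t by simp
  ultimately have "(h*b')*d' = (h*b')*c'" by simp
  then obtain k where k: "arr k" "dom k = cod e" "cod k = cod (h*b')" "k*e = h*b'"
   using coequaliser_factor[OF e, of "h*b'"] h A B t by auto
  have "k*e*b = h"
   using Cmp_reassoc[OF k(4), of b] k h B E t by simp
  thus "EX k. arr k & dom k = cod (e*b) & cod k = cod h & k*e*b = h"
   using k h B E t by (intro exI[of _ k]) simp
 next
  fix k k' assume k: "arr k" "arr k'" "dom k = cod (e*b)" "dom k' = cod (e*b)" "cod k = cod k'"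
   "k*e*b = k'*e*b"
  have d: "dom k = cod e" "dom k' = cod e" using k E B t by simp_all
  have "(k*e*b)*b' = (k'*e*b)*b'" using k(6) by simp
  hence "k*e = k'*e" using d k(1,2) B E t by simp
  thus "k = k'" using regular_epi_cancel[of e k k'] e k d unfolding regular_epi_def by blast
 qed (use E A B t in simp_all)
qed

section \<open>Classes of presheaves closed under finite limits and weighted colimits\<close>

context lex_loc_small
begin

lemma Phi_closed_Sm: "Phi_closed U \<Phi> C Sm"
 unfolding Phi_closed_def
proof (intro conjI allI impI ballI, goal_cases)
 case 1
 thus ?case using Sm_psh by (auto simp: P_cat_def)
next
 case (2 f)
 hence "f:Arr (P_cat U C)" unfolding is_iso_def is_inverse_pair_def by blast
 thus ?case by (auto simp: P_cat_def)
next
 case (3 c)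
 thus ?case using small_yo by simp
next
 case (4 J F x l)
 hence "is_limit J (P_cat U C) F x l" by (elim conjE)
 hence "x:Ob (P_cat U C)" by (rule limitD(2))
 thus ?case by (simp add: P_cat_def)
next
 case (5 p)
 thus ?case
  by (auto simp: P_cat_def is_weighted_colimit_def is_weighted_cocone_def)
qed

lemma Phi_closedD:
 assumes "Phi_closed U \<Phi> C S"
 shows "S <= Sm" "yo ` Ob C <= S"
  "!!J F x l. finite_diagram J (PV Sm) F ==> fob F ` Ob J <= S ==> is_limit J (PV Sm) F x l ==> x:S"
  "!!K w D z io. (K, w):\<Phi> ==> lex_functor K (PV Sm) D ==> fob D ` Ob K <= S ==>
   is_weighted_colimit U K w (PV Sm) D z io ==> z:S"
proof -
 note a = assms[unfolded Phi_closed_def P_cat_PV]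
 show "S <= Sm" using a[THEN conjunct1] by auto
 show "yo ` Ob C <= S" using a[THEN conjunct2, THEN conjunct2, THEN conjunct1] by blast
 show "x:S" if "finite_diagram J (PV Sm) F" "fob F ` Ob J <= S" "is_limit J (PV Sm) F x l" for J F x l
  using a[THEN conjunct2, THEN conjunct2, THEN conjunct2, THEN conjunct1] that by blast
 show "z:S" if "(K, w):\<Phi>" "lex_functor K (PV Sm) D" "fob D ` Ob K <= S" "is_weighted_colimit U K w (PV Sm) D z io" for K w D z io
  using bspec[OF a[THEN conjunct2, THEN conjunct2, THEN conjunct2, THEN conjunct2] that(1)] that(2-) by blast
qed

lemma full_subcat_twice: assumes "T <= S" shows "full_subcat (full_subcat D S) T = full_subcat D T"
proof -
 have "Ob D Int S Int T = Ob D Int T"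
  "{f:{f:Arr D. Dom D f:S & Cod D f:S}. Dom D f:T & Cod D f:T} = {f:Arr D. Dom D f:T & Cod D f:T}"
  using assms by auto
 thus ?thesis unfolding full_subcat_def by simp
qed

lemma finitely_complete_PV:
 assumes "Phi_closed U \<Phi> C S" shows "finitely_complete (PV S)"
proof (rule PV_finitely_complete[OF Phi_closedD(1)[OF assms]])
 fix J :: "(nat, nat) cat" and D x l assume *: "finite_diagram J (PV S) D" "x:Sm" "is_limit J (PV Sm) D x l"
 hence D: "is_functor J (PV S) D" unfolding finite_diagram_def by blast
 have "is_functor J (PV Sm) D"
  by (rule functorI[OF functorD(1)[OF D] category_PV]) (use functorD[OF D] subsetD[OF Phi_closedD(1)[OF assms]] in auto)
 thus "x:S" using Phi_closedD(3)[OF assms _ _ *(3)] * functor_PV(2)[OF D] unfolding finite_diagram_def by auto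
qed

lemma lex_category_PV_Sm: "lex_category (PV Sm)"
 using finitely_complete_PV[OF Phi_closed_Sm[of "{}"]] by unfold_locales

lemma Phi_l_PV:
 assumes "T = \<Inter>{S. Phi_closed U \<Phi> C S}" shows "Phi_l U \<Phi> C = PV T" "T <= Sm"
proof -
 show T: "T <= Sm" using Phi_closed_Sm[of \<Phi>] assms by blast
 thus "Phi_l U \<Phi> C = PV T"
  unfolding Phi_l_def P_cat_PV assms[symmetric] by (rule full_subcat_twice)
qed

lemma Phi_closed_Inter:
 assumes T: "T = \<Inter>{S. Phi_closed U \<Phi> C S}" shows "Phi_closed U \<Phi> C T"
proof -
 have T_I: "x:T" if "!!S. Phi_closed U \<Phi> C S ==> x:S" for x using that T by blast
 have T_D: "T <= S" if "Phi_closed U \<Phi> C S" for S using that T by blast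
 show ?thesis
  unfolding Phi_closed_def
 proof (intro conjI allI impI ballI, goal_cases)
  case 1
  show ?case using T_D[OF Phi_closed_Sm[of \<Phi>]] Phi_closed_Sm[of \<Phi>] unfolding Phi_closed_def by blast
 next
  case (2 f)
  show ?case by (rule T_I) (use 2 T_D in \<open>unfold Phi_closed_def, blast\<close>)
 next
  case (3 c)
  show ?case by (rule T_I) (use 3 in \<open>unfold Phi_closed_def, blast\<close>)
 next
  case (4 J F x l)
  show ?case
  proof (rule T_I)
   fix S assume S: "Phi_closed U \<Phi> C S"
   have l: "finite_diagram J (PV Sm) F" "fob F ` Ob J <= T" "is_limit J (PV Sm) F x l"
    using 4 unfolding P_cat_PV by blast+
   show "x:S" using Phi_closedD(3)[OF S l(1) order_trans[OF l(2) T_D[OF S]] l(3)] .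
  qed
 next
  case (5 p)
  obtain K w where p: "p = (K, w)" by fastforce
  show ?case unfolding p prod.case
  proof (intro allI impI)
   fix D z io assume *: "lex_functor K (P_cat U C) D & fob D ` Ob K <= T & is_weighted_colimit U K w (P_cat U C) D z io"
   show "z:T"
   proof (rule T_I)
    fix S assume S: "Phi_closed U \<Phi> C S"
    have l: "lex_functor K (PV Sm) D" "fob D ` Ob K <= T" "is_weighted_colimit U K w (PV Sm) D z io"
     using * unfolding P_cat_PV by blast+
    show "z:S" using Phi_closedD(4)[OF S 5[unfolded p] l(1) order_trans[OF l(2) T_D[OF S]] l(3)] .
   qed
  qed
 qed
qed

lemma coequaliser_weight_rc:
 assumes free: "free_lex_on_reflexive_pair U K X Y d c r"
  and e: "is_coequaliser (presheaf_cat U K) (farr (yoneda U K) d) (farr (yoneda U K) c) e"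
 shows "coequaliser_weight K U X Y d c e"
proof -
 have sm: "small_category U K" and dc: "d:Hom K X Y" "c:Hom K X Y"
  using free unfolding free_lex_on_reflexive_pair_def is_reflexive_pair_def by auto
 interpret K: category K using sm unfolding small_category_def by blast
 have "locally_small U K"
  unfolding locally_small_def
 proof (intro ballI)
  fix x y show "small U (Hom K x y)"
  proof (rule small_in[OF U], rule universe_subset[OF U])
   show "Arr K:U" using sm unfolding small_category_def by blast
   show "Hom K x y <= Arr K" unfolding Hom_def by blast
  qed
 qed
 thus ?thesis using U dc e by unfold_locales
qed

definition reflexive_coequaliser where
 "reflexive_coequaliser F G s t r Q q <-> psh F & psh G & psh Q & natural C F G s & natural C F G t & natural C G F r &
  natural C G Q q & (ALL c:Ob C. ALL x:fob G c. s c (r c x) = x & t c (r c x) = x) & (ALL c:Ob C. q c ` fob G c = fob Q c) &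
  (ALL c:Ob C. ALL x:fob G c. ALL y:fob G c. q c x = q c y <-> equivclp (step F s t c) x y)"

lemma ex_reflexive_coequaliser:
 assumes "psh F" "psh G" "natural C F G s" "natural C F G t" "natural C G F r"
  "!!c x. ob c ==> x:fob G c ==> s c (r c x) = x & t c (r c x) = x"
 shows "EX Q q. reflexive_coequaliser F G s t r Q q"
proof (rule ex_coequaliser_presheaf[OF assms(1-4) U])
 fix Q q assume "psh Q" "natural C G Q q" "!!c. ob c ==> q c ` fob G c = fob Q c"
  "!!c x y. ob c ==> x:fob G c ==> y:fob G c ==> q c x = q c y <-> equivclp (step F s t c) x y"
 hence "reflexive_coequaliser F G s t r Q q" unfolding reflexive_coequaliser_def using assms by blast
 thus ?thesis by blast
qed

text \<open>Freeness extends the reflexive pair, up to isomorphism, to a lex functor from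
  \<open>K\<close> with values in \<open>S\<close>. The colimit of that functor weighted by the
  single member of \<Phi> is the coequaliser.\<close>

lemma closed_reflexive_coequaliser:
 assumes rc: "is_Phi_rc U \<Phi>" and S: "Phi_closed U \<Phi> C S" and FG: "F:S" "G:S"
  and q: "reflexive_coequaliser F G s t r Q q"
 shows "Q:S"
proof -
 obtain K X Y d c r' e where free: "free_lex_on_reflexive_pair U K X Y d c r'"
  and e: "is_coequaliser (presheaf_cat U K) (farr (yoneda U K) d) (farr (yoneda U K) c) e"
  and \<Phi>: "\<Phi> = {(K, Cod (presheaf_cat U K) e)}" using rc unfolding is_Phi_rc_def by blast
 interpret w: coequaliser_weight K U X Y d c e by (rule coequaliser_weight_rc[OF free e])
 interpret P: lex_category "PV Sm" by (rule lex_category_PV_Sm)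
 interpret PC: category PC by (rule category_PC)
 have p: "psh F" "psh G" "psh Q" "natural C F G s" "natural C F G t" "natural C G F r" "natural C G Q q"
  "!!c x. ob c ==> x:fob G c ==> s c (r c x) = x & t c (r c x) = x" "!!c. ob c ==> q c ` fob G c = fob Q c"
  "!!c x y. ob c ==> x:fob G c ==> y:fob G c ==> q c x = q c y <-> equivclp (step F s t c) x y"
  using q unfolding reflexive_coequaliser_def by blast+
 have FGs: "F:Sm" "G:Sm" using FG Phi_closedD(1)[OF S] by auto
 have Qs: "Q:Sm" by (rule coequaliser_small[OF FGs p(4,5,3,7,9,10)])
 let ?s = "psh_map C F G s" and ?t = "psh_map C F G t" and ?r = "psh_map C G F r" and ?q = "psh_map C G Q q"
 have H: "?s:Hom PC F G" "?t:Hom PC F G" "?r:Hom PC G F" using psh_map_Hom p by auto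
 have "Cmp PC ?s ?r = Idt PC G" "Cmp PC ?t ?r = Idt PC G"
  using p naturalD(1)[OF p(6)] H
  by (auto intro!: psh_map_eqI[OF PC.Cmp_in[OF H(3,1)]] psh_map_eqI[OF PC.Cmp_in[OF H(3,2)]] simp: Hom_iff[of ?r] PC.Idt_in[of G] simp del: Hom_iff)
 hence pair: "is_reflexive_pair (PV Sm) F G ?s ?t ?r"
  unfolding is_reflexive_pair_def using H FGs by (auto simp: Hom_PV)
 obtain D a b where D: "lex_functor K (PV Sm) D" "fob D ` Ob K <= S"
  and ab: "a:Hom (PV Sm) (fob D X) F" "is_iso (PV Sm) a" "b:Hom (PV Sm) (fob D Y) G" "is_iso (PV Sm) b"
  "Cmp (PV Sm) b (farr D d) = Cmp (PV Sm) ?s a" "Cmp (PV Sm) b (farr D c) = Cmp (PV Sm) ?t a"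
  using P.free_lex_extend[OF U free pair FG] Phi_closedD(3)[OF S] by blast
 obtain a' b' where inv: "is_inverse_pair (PV Sm) a a'" "is_inverse_pair (PV Sm) b b'"
  using ab unfolding is_iso_def by blast
 have Df: "is_functor K (PV Sm) D" using D unfolding lex_functor_def by blast
 note F = functorD[OF Df]
 have dc: "d:Arr K" "c:Arr K" "Dom K d = X" "Dom K c = X" "Cod K d = Y" "Cod K c = Y"
  using w.d w.c by auto
 have cq: "is_coequaliser (PV Sm) ?s ?t ?q"
  by (rule coequaliser_of_elements[OF FGs Qs p(1,2,3,4,5,7,9,10)])
 have "is_coequaliser (PV Sm) (farr D d) (farr D c) (Cmp (PV Sm) ?q b)"
 proof (rule P.coequaliser_iso[OF cq inv])
  show "farr D d:Arr (PV Sm)" "farr D c:Arr (PV Sm)" using F(4) dc by auto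
  show "Dom (PV Sm) (farr D d) = Dom (PV Sm) a" "Dom (PV Sm) (farr D c) = Dom (PV Sm) a"
   "Cod (PV Sm) (farr D d) = Dom (PV Sm) b" "Cod (PV Sm) (farr D c) = Dom (PV Sm) b"
   using F(5)[of d] F(5)[of c] F(6)[of d] F(6)[of c] dc ab(1,3) by auto
  show "Cod (PV Sm) a = Dom (PV Sm) ?s" "Cod (PV Sm) b = Cod (PV Sm) ?s" using ab(1,3) H by auto
 qed (use ab in auto)
 from w.coequaliser_weighted_colimit[OF Df this]
 obtain io where "is_weighted_colimit U K w.w (PV Sm) D (Cod (PV Sm) (Cmp (PV Sm) ?q b)) io" by blast
 moreover have "Cod (PV Sm) (Cmp (PV Sm) ?q b) = Q"
 proof -
  note E = P.coequaliserD[OF cq]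
  have "Cod (PV Sm) (Cmp (PV Sm) ?q b) = Cod (PV Sm) ?q"
   using ab(3) E(3,6) H by (intro P.Cmp_simps(3)) auto
  thus ?thesis by (simp add: psh_map_def)
 qed
 ultimately show ?thesis using Phi_closedD(4)[OF S _ D] \<Phi> by simp
qed

text \<open>The converse direction: a weighted colimit of a lex functor is the pointwise coequaliser
  of the image of the generic pair, with the image of \<open>r'\<close> as splitting.\<close>

lemma weighted_colimit_rc:
 assumes rc: "is_Phi_rc U \<Phi>" and Kw: "(K, w):\<Phi>" and D: "lex_functor K (PV Sm) D"
  and z: "is_weighted_colimit U K w (PV Sm) D z io"
 shows "EX X Y s t r q. X:Ob K & Y:Ob K & reflexive_coequaliser (fob D X) (fob D Y) s t r z q"
proof -
 obtain X Y d c r' e where free: "free_lex_on_reflexive_pair U K X Y d c r'"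
  and e: "is_coequaliser (presheaf_cat U K) (farr (yoneda U K) d) (farr (yoneda U K) c) e"
  and w: "w = Cod (presheaf_cat U K) e" using rc Kw unfolding is_Phi_rc_def by blast
 interpret w: coequaliser_weight K U X Y d c e by (rule coequaliser_weight_rc[OF free e])
 have Df: "is_functor K (PV Sm) D" using D unfolding lex_functor_def by blast
 have dc: "d:Arr K" "c:Arr K" "r':Arr K" "Dom K d = X" "Dom K c = X" "Dom K r' = Y" "Cod K d = Y" "Cod K c = Y" "Cod K r' = X"
   "Cmp K d r' = Idt K Y" "Cmp K c r' = Idt K Y" "X:Ob K" "Y:Ob K"
  using free unfolding free_lex_on_reflexive_pair_def is_reflexive_pair_def by auto
 note F = functorD[OF Df] and V = functor_PV[OF Df]
 have h: "farr D d:Hom PC (fob D X) (fob D Y)" "farr D c:Hom PC (fob D X) (fob D Y)" "farr D r':Hom PC (fob D Y) (fob D X)"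
  using V(3)[OF dc(1)] V(3)[OF dc(2)] V(3)[OF dc(3)] dc by auto
 note co = w.weighted_colimit_coequaliser[OF Df z[unfolded w]]
 have coe: "is_coequaliser (PV Sm) (psh_map C (fob D X) (fob D Y) (ev (farr D d))) (psh_map C (fob D X) (fob D Y) (ev (farr D c))) (io Y w.gen)"
  using co(1) psh_map_ev_eq[OF h(1)] psh_map_ev_eq[OF h(2)] by simp
 have VQ: "ALL Q q. psh Q & natural C (fob D Y) Q q & (ALL c:Ob C. q c ` fob (fob D Y) c = fob Q c) &
   (ALL b:Ob C. ALL x:fob (fob D Y) b. ALL y:fob (fob D Y) b.
    q b x = q b y <-> equivclp (step (fob D X) (ev (farr D d)) (ev (farr D c)) b) x y) --> Q:Sm"
 proof (intro allI impI)
  fix Q q assume a: "psh Q & natural C (fob D Y) Q q & (ALL c:Ob C. q c ` fob (fob D Y) c = fob Q c) &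
   (ALL b:Ob C. ALL x:fob (fob D Y) b. ALL y:fob (fob D Y) b.
    q b x = q b y <-> equivclp (step (fob D X) (ev (farr D d)) (ev (farr D c)) b) x y)"
  show "Q:Sm"
   by (rule coequaliser_small[OF V(2)[OF dc(12)] V(2)[OF dc(13)] ev_natural[OF h(1)] ev_natural[OF h(2)], of Q q])
    (use a in simp_all)
 qed
 note E = coequaliser_elements[OF coe V(2)[OF dc(12)] V(2)[OF dc(13)] V(1)[OF dc(12)] V(1)[OF dc(13)] ev_natural[OF h(1)] ev_natural[OF h(2)] U VQ]
 have zz: "Cod PC (io Y w.gen) = z" using co(2) by simp
 have rr: "ev (farr D d) b (ev (farr D r') b x) = x & ev (farr D c) b (ev (farr D r') b x) = x" if "ob b" "x:fob (fob D Y) b" for b x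
 proof -
  have "Cmp PC (farr D d) (farr D r') = Idt PC (fob D Y)" "Cmp PC (farr D c) (farr D r') = Idt PC (fob D Y)"
   using F(8)[of r' d] F(8)[of r' c] F(7)[of Y] dc by simp_all
  hence "ev (Cmp PC (farr D d) (farr D r')) b x = x" "ev (Cmp PC (farr D c) (farr D r')) b x = x" using that by simp_all
  thus ?thesis using h(3) that by simp
 qed
 have "psh z" using E(3) zz Arr_PC_psh[of "io Y w.gen"] by auto
 hence "reflexive_coequaliser (fob D X) (fob D Y) (ev (farr D d)) (ev (farr D c)) (ev (farr D r')) z (ev (io Y w.gen))"
  unfolding reflexive_coequaliser_def
  using V(1)[OF dc(12)] V(1)[OF dc(13)] ev_natural[OF h(1)] ev_natural[OF h(2)] ev_natural[OF h(3)] rr E ev_natural[OF E(3)] zz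
  by blast
 thus ?thesis using dc by blast
qed

definition el_pullback where
 "el_pullback F1 F2 s1 s2 H p1 p2 <-> natural C H F1 p1 & natural C H F2 p2 &
  (ALL c:Ob C. ALL x:fob H c. s1 c (p1 c x) = s2 c (p2 c x)) &
  (ALL c:Ob C. ALL x1:fob F1 c. ALL x2:fob F2 c. s1 c x1 = s2 c x2 --> (EX x:fob H c. p1 c x = x1 & p2 c x = x2)) &
  (ALL c:Ob C. ALL x:fob H c. ALL x':fob H c. p1 c x = p1 c x' --> p2 c x = p2 c x' --> x = x')"

lemma closed_pullback:
 assumes S: "Phi_closed U \<Phi> C S" and F: "F1:S" "F2:S" "F0:S" and s: "natural C F1 F0 s1" "natural C F2 F0 s2"
 shows "EX H p1 p2. H:S & el_pullback F1 F2 s1 s2 H p1 p2"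
proof -
 interpret P: lex_category "PV S" by unfold_locales (rule finitely_complete_PV[OF S])
 have Fp: "psh F1" "psh F2" "psh F0" using F Phi_closedD(1)[OF S] Sm_psh by auto
 let ?s = "psh_map C F1 F0 s1" and ?t = "psh_map C F2 F0 s2"
 have H: "?s:Hom (PV S) F1 F0" "?t:Hom (PV S) F2 F0" using psh_map_Hom Fp s F by (auto simp: Hom_PV)
 have H': "?s:Arr (PV S)" "?t:Arr (PV S)" "Cod (PV S) ?s = Cod (PV S) ?t" using H unfolding Hom_iff by auto
 note fin = P.finite_diagram_cospan[OF H']
 hence D: "is_functor cospan_shape (PV S) (cospan (PV S) ?s ?t)" unfolding finite_diagram_def by blast
 obtain x l where l: "is_limit cospan_shape (PV S) (cospan (PV S) ?s ?t) x l" using P.ex_limit[OF fin] by blast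
 note el = limit_elements[OF Phi_closedD(2)[OF S] D l]
 note pb = P.pullbackD[OF P.pullback_of_limit[OF H' l]]
 have x: "x:S" "psh x" using limitD(2)[OF l] by auto
 have dx: "Dom (PV S) (l 0) = x" using limitD(4)[OF l, of 0] by (simp add: cospan_shape_def)
 have l01: "l 0:Hom PC x F1" "l 1:Hom PC x F2" using pb dx H by auto
 note n = ev_natural[OF l01(1)] ev_natural[OF l01(2)]
 have comm: "s1 c (ev (l 0) c u) = s2 c (ev (l 1) c u)" "ev (l 2) c u = s1 c (ev (l 0) c u)" if c: "ob c" "u:fob x c" for c u
 proof -
  have "ev (Cmp PC ?s (l 0)) c u = ev (Cmp PC ?t (l 1)) c u" using pb(9) by simp
  thus "s1 c (ev (l 0) c u) = s2 c (ev (l 1) c u)"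
   using l01 c naturalD(1)[OF n(1) c] naturalD(1)[OF n(2) c] by simp
  have "ev (Cmp PC ?s (l 0)) c u = ev (l 2) c u" using limitD(6)[OF l, of 3] by (simp add: cospan_shape_def cospan_def)
  thus "ev (l 2) c u = s1 c (ev (l 0) c u)" using l01 c naturalD(1)[OF n(1) c] by simp
 qed
 have "EX u:fob x c. ev (l 0) c u = x1 & ev (l 1) c u = x2" if c: "ob c" "x1:fob F1 c" "x2:fob F2 c" "s1 c x1 = s2 c x2" for c x1 x2
 proof -
  let ?w = "%j::nat. if j = 0 then x1 else if j = 1 then x2 else s1 c x1"
  have "compat cospan_shape (cospan (PV S) ?s ?t) c ?w"
   using c naturalD(1)[OF s(1)] naturalD(1)[OF s(2)] H by (auto simp: compat_def cospan_shape_def cospan_def)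
  then obtain u where "u:fob x c" "ALL j:Ob cospan_shape. ev (l j) c u = ?w j" using el c(1) unfolding el_limit_def by blast
  thus ?thesis by (intro bexI[of _ u]) (auto simp: cospan_shape_def)
 qed
 moreover have "u = v" if "ob c" "u:fob x c" "v:fob x c" "ev (l 0) c u = ev (l 0) c v" "ev (l 1) c u = ev (l 1) c v" for c u v
 proof -
  have "ALL j:Ob cospan_shape. ev (l j) c u = ev (l j) c v" using that comm(2) by (simp add: cospan_shape_def)
  thus ?thesis using el that(1-3) unfolding el_limit_def by blast
 qed
 ultimately have "el_pullback F1 F2 s1 s2 x (ev (l 0)) (ev (l 1))"
  unfolding el_pullback_def using n comm(1) by blast
 thus ?thesis using x by blast
qed

text \<open>A universal arrow from \<open>F\<close> to the Yoneda embedding, expressed by arrows of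
  \<open>C\<close> in place of codes; \<open>c\<close> is the reflection of
  \<open>F\<close>.\<close>

definition univ where
 "univ F c ta <-> cnat F c ta & (ALL d si. cnat F d si -->
  (EX! g. g:hom c d & (ALL b:Ob C. ALL x:fob F b. si b x = g*ta b x)))"

lemma univ_cnat: "univ F c ta ==> cnat F c ta"
 unfolding univ_def by blast

lemma univ_lift:
 assumes "univ F c ta" "cnat F d si"
 obtains g where "arr g" "dom g = c" "cod g = d" "!!b x. ob b ==> x:fob F b ==> g*ta b x = si b x"
 using assms unfolding univ_def Hom_iff by metis

lemma cnat_comp:
 assumes "cnat F c ta" "arr g" "dom g = c" shows "cnat F (cod g) (%b x. g*ta b x)"
proof -
 note D = cnatD[OF assms(1)]
 show ?thesis unfolding cnat_def
 proof (intro conjI ballI)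
  fix f x assume "arr f" "x:fob F (cod f)"
  thus "g*ta (dom f) (act F f x) = (g*ta (cod f) x)*f" using D assms by simp
 qed (use D assms in auto)
qed

lemma cnat_precomp:
 assumes "natural C G F s" "cnat F c ta" shows "cnat G c (%b x. ta b (s b x))"
 using naturalD[OF assms(1)] cnatD[OF assms(2)] unfolding cnat_def by simp

lemma univ_eq:
 assumes u: "univ F c ta" and g: "arr g" "arr h" "dom g = c" "dom h = c" "cod g = cod h"
  and eq: "!!b x. ob b ==> x:fob F b ==> g*ta b x = h*ta b x"
 shows "g = h"
proof -
 have "cnat F (cod g) (%b x. g*ta b x)" using cnat_comp[OF univ_cnat[OF u]] g by blast
 hence "EX! k. k:hom c (cod g) & (ALL b:Ob C. ALL x:fob F b. g*ta b x = k*ta b x)"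
  using u unfolding univ_def by blast
 moreover have "g:hom c (cod g)" "h:hom c (cod g)" using g by auto
 ultimately show ?thesis using eq by metis
qed

lemma univI:
 assumes ta: "cnat F c ta"
  and ex: "!!d si. cnat F d si ==> EX g. arr g & dom g = c & cod g = d & (ALL b:Ob C. ALL x:fob F b. g*ta b x = si b x)"
  and un: "!!g h. arr g ==> arr h ==> dom g = c ==> dom h = c ==> cod g = cod h ==>
   ALL b:Ob C. ALL x:fob F b. g*ta b x = h*ta b x ==> g = h"
 shows "univ F c ta"
 unfolding univ_def
proof (intro conjI ta allI impI)
 fix d si assume "cnat F d si"
 then obtain g where "arr g" "dom g = c" "cod g = d" "ALL b:Ob C. ALL x:fob F b. g*ta b x = si b x" using ex by metis
 note g = this
 show "EX! g. g:hom c d & (ALL b:Ob C. ALL x:fob F b. si b x = g*ta b x)"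
 proof (rule ex1I[of _ g])
  show "g:hom c d & (ALL b:Ob C. ALL x:fob F b. si b x = g*ta b x)" using g by simp
  fix k assume k: "k:hom c d & (ALL b:Ob C. ALL x:fob F b. si b x = k*ta b x)"
  hence "arr k" "dom k = c" "cod k = cod g" "ALL b:Ob C. ALL x:fob F b. k*ta b x = g*ta b x"
   using g by simp_all
  thus "k = g" using un[of k g] g by blast
 qed
qed

lemma univ_transport:
 assumes u: "univ F c ta" and k: "is_inverse_pair C k k'" "dom k = c" and ta': "cnat F (cod k) ta'"
  and eq: "!!b x. ob b ==> x:fob F b ==> k*ta b x = ta' b x"
 shows "univ F (cod k) ta'"
proof (rule univI[OF ta'])
 have K: "arr k" "arr k'" "dom k' = cod k" "cod k' = c" "k'*k = idt c" "k*k' = idt (cod k)"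
  using k unfolding is_inverse_pair_def by auto
 note D = cnatD[OF univ_cnat[OF u]]
 fix d si assume "cnat F d si"
 from univ_lift[OF u this] obtain g where g: "arr g" "dom g = c" "cod g = d"
  "!!b x. ob b ==> x:fob F b ==> g*ta b x = si b x" by metis
 have "(g*k')*ta' b x = si b x" if bx: "ob b" "x:fob F b" for b x
 proof -
  have t: "arr (ta b x)" "cod (ta b x) = c" using D bx by auto
  have "k'*k*ta b x = ta b x" using Cmp_reassoc1[OF K(5), of "ta b x"] t K(1-4) k(2) by simp
  thus ?thesis unfolding eq[OF bx, symmetric] using g(1,2) g(4)[OF bx] K(1-4) k(2) t by simp
 qed
 thus "EX g. arr g & dom g = cod k & cod g = d & (ALL b:Ob C. ALL x:fob F b. g*ta' b x = si b x)"
  using g K by (intro exI[of _ "g*k'"]) auto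
next
 have K: "arr k" "arr k'" "dom k' = cod k" "cod k' = c" "k'*k = idt c" "k*k' = idt (cod k)"
  using k unfolding is_inverse_pair_def by auto
 note D = cnatD[OF univ_cnat[OF u]]
 fix g h assume g: "arr g" "arr h" "dom g = cod k" "dom h = cod k" "cod g = cod h"
  and e: "ALL b:Ob C. ALL x:fob F b. g*ta' b x = h*ta' b x"
 have "g*k = h*k"
 proof (rule univ_eq[OF u])
  fix b x assume "ob b" "x:fob F b"
  thus "(g*k)*ta b x = (h*k)*ta b x" using e g K D k(2) eq by simp
 qed (use g K k(2) in simp_all)
 hence "(g*k)*k' = (h*k)*k'" by simp
 thus "g = h" using g K k(2) by simp
qed

lemma univ_iso:
 assumes u: "univ F c ta" and u': "univ F c' ta'"
 obtains k k' where "is_inverse_pair C k k'" "dom k = c" "cod k = c'" "!!b x. ob b ==> x:fob F b ==> k*ta b x = ta' b x"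
proof -
 note D = cnatD[OF univ_cnat[OF u]] and D' = cnatD[OF univ_cnat[OF u']]
 obtain k where k: "arr k" "dom k = c" "cod k = c'" "!!b x. ob b ==> x:fob F b ==> k*ta b x = ta' b x"
  using univ_lift[OF u univ_cnat[OF u']] by metis
 obtain k' where k': "arr k'" "dom k' = c'" "cod k' = c" "!!b x. ob b ==> x:fob F b ==> k'*ta' b x = ta b x"
  using univ_lift[OF u' univ_cnat[OF u]] by metis
 have "k'*k = idt c" by (rule univ_eq[OF u]) (use k k' D in simp_all)
 moreover have "k*k' = idt c'" by (rule univ_eq[OF u']) (use k k' D' in simp_all)
 ultimately show thesis using that k k' unfolding is_inverse_pair_def by auto
qed

lemma univ_yo:
 assumes c: "ob c" shows "univ (yo c) c (%b u. dc b c u)"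
proof (rule univI)
 show cn: "cnat (yo c) c (%b u. dc b c u)" unfolding cnat_def using c by auto
 have i: "cd c c (idt c):fob (yo c) c" using c by simp
 fix d si assume si: "cnat (yo c) d si"
 note D = cnatD[OF si]
 have "si c (cd c c (idt c))*dc b c u = si b u" if "ob b" "u:fob (yo c) b" for b u
  using D(5)[of "dc b c u" "cd c c (idt c)"] that c by simp
 thus "EX g. arr g & dom g = c & cod g = d & (ALL b:Ob C. ALL u:fob (yo c) b. g*dc b c u = si b u)"
  using D c i by blast
next
 fix g h assume g: "arr g" "arr h" "dom g = c" "dom h = c"
  and "ALL b:Ob C. ALL u:fob (yo c) b. g*dc b c u = h*dc b c u"
 moreover have "cd c c (idt c):fob (yo c) c" using c by simp
 ultimately have "g*dc c c (cd c c (idt c)) = h*dc c c (cd c c (idt c))" using c by blast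
 thus "g = h" using g c by simp
qed

end

lemma limit_functor_cong:
 assumes l: "is_limit J C F x l" and J: "category J" and ob: "!!j. j:Ob J ==> fob F' j = fob F j"
  and arr: "!!f. f:Arr J ==> farr F' f = farr F f"
 shows "is_limit J C F' x l"
proof -
 have "is_cone J C F' y m <-> is_cone J C F y m" for y m unfolding cone_iff using ob arr by simp
 thus ?thesis using l unfolding is_limit_def by simp
qed

lemma (in category) pullbacks_iso:
 assumes pb: "is_pullback C f g p q" and pb': "is_pullback C f g p' q'"
 obtains m n where "is_inverse_pair C m n" "dom m = dom p'" "cod m = dom p" "p*m = p'" "q*m = q'"
proof -
 note D = pullbackD[OF pb] and D' = pullbackD[OF pb']
 obtain m where m: "arr m" "dom m = dom p'" "cod m = dom p" "p*m = p'" "q*m = q'"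
  using pullback_lift[OF pb D'(3,4)] D D' by metis
 obtain n where n: "arr n" "dom n = dom p" "cod n = dom p'" "p'*n = p" "q'*n = q"
  using pullback_lift[OF pb' D(3,4)] D D' by metis
 have "m*n = idt (dom p)"
 proof (rule pullback_unique[OF pb])
  show "p*m*n = p*idt (dom p)" using Cmp_reassoc1[OF m(4), of n] m(1-3) n D by simp
  show "q*m*n = q*idt (dom p)" using Cmp_reassoc1[OF m(5), of n] m(1-3) n D by simp
 qed (use m n D in simp_all)
 moreover have "n*m = idt (dom p')"
 proof (rule pullback_unique[OF pb'])
  show "p'*n*m = p'*idt (dom p')" using Cmp_reassoc1[OF n(4), of m] m n(1-3) D' by simp
  show "q'*n*m = q'*idt (dom p')" using Cmp_reassoc1[OF n(5), of m] m n(1-3) D' by simp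
 qed (use m n D' in simp_all)
 ultimately show thesis using that m n unfolding is_inverse_pair_def by auto
qed

lemma (in category) pullback_iso_cospan:
 assumes pb: "is_pullback C s t a b"
  and k: "is_inverse_pair C k0 l0" "is_inverse_pair C k1 l1" "is_inverse_pair C k2 l2"
  and ty: "dom k0 = cod s" "dom k1 = dom s" "dom k2 = dom t"
  and f: "arr f" "arr g" "dom f = cod k1" "dom g = cod k2" "cod f = cod k0" "cod g = cod k0"
  and eq: "f*k1 = k0*s" "g*k2 = k0*t"
 shows "is_pullback C f g (k1*a) (k2*b)"
proof -
 note D = pullbackD[OF pb]
 have K: "arr k0" "arr l0" "dom l0 = cod k0" "cod l0 = dom k0" "l0*k0 = idt (dom k0)"
  "arr k1" "arr l1" "dom l1 = cod k1" "cod l1 = dom k1" "l1*k1 = idt (dom k1)" "k1*l1 = idt (cod k1)"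
  "arr k2" "arr l2" "dom l2 = cod k2" "cod l2 = dom k2" "l2*k2 = idt (dom k2)" "k2*l2 = idt (cod k2)"
  using k unfolding is_inverse_pair_def by auto
 have ea: "f*k1*a = k0*s*a" "g*k2*b = k0*t*b"
  using Cmp_reassoc[OF eq(1), of a] Cmp_reassoc[OF eq(2), of b] D(1-8) K f ty by simp_all
 show ?thesis
 proof (rule pullbackI)
  show "f*k1*a = g*k2*b" using ea D(9) by simp
  fix x y assume x: "arr x" "arr y" "dom y = dom x" "cod x = dom f" "cod y = dom g" "f*x = g*y"
  have kk: "k1*l1*x = x" "k2*l2*y = y"
   using Cmp_reassoc1[OF K(11), of x] Cmp_reassoc1[OF K(17), of y] K(6-9,12-15) x f by simp_all
  have "k0*s*l1*x = f*k1*l1*x" "k0*t*l2*y = g*k2*l2*y"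
   using Cmp_reassoc[OF eq(1), of "l1*x"] Cmp_reassoc[OF eq(2), of "l2*y"] D(1-8) K(1,6-9,12-15) f ty x(1-5) by simp_all
  hence "k0*s*l1*x = k0*t*l2*y" using kk x(6) by simp
  hence "l0*k0*s*l1*x = l0*k0*t*l2*y" by simp
  hence st: "s*l1*x = t*l2*y"
   using Cmp_reassoc1[OF K(5), of "s*l1*x"] Cmp_reassoc1[OF K(5), of "t*l2*y"] D(1-8) K(1-4,6-9,12-15) f ty x(1-5) by simp
  obtain h where h: "arr h" "dom h = dom x" "cod h = dom a" "a*h = l1*x" "b*h = l2*y"
   using pullback_lift[OF pb _ _ _ _ _ st] K(6-9,12-15) f ty x(1-5) by auto
  thus "EX h. arr h & dom h = dom x & cod h = dom (k1*a) & (k1*a)*h = x & (k2*b)*h = y"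
   using kk D(1-8) K(6,12) ty by (intro exI[of _ h]) simp
 next
  fix h k assume h: "arr h" "arr k" "dom h = dom k" "cod h = dom (k1*a)" "cod k = dom (k1*a)"
   and e: "(k1*a)*h = (k1*a)*k" "(k2*b)*h = (k2*b)*k"
  have h': "cod h = dom a" "cod k = dom a" using h D(1-8) K(6) ty by simp_all
  have "k1*a*h = k1*a*k" "k2*b*h = k2*b*k" using e h(1-3) h' D(1-8) K(6,12) ty by simp_all
  hence "l1*k1*a*h = l1*k1*a*k" "l2*k2*b*h = l2*k2*b*k" by simp_all
  hence "a*h = a*k" "b*h = b*k"
   using Cmp_reassoc1[OF K(10), of "a*h"] Cmp_reassoc1[OF K(10), of "a*k"] Cmp_reassoc1[OF K(16), of "b*h"]
    Cmp_reassoc1[OF K(16), of "b*k"] h(1-3) h' D(1-8) K(6-9,12-15) ty by simp_all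
  thus "h = k" using pullback_unique[OF pb h(1,2) h'] by blast
 qed (use D(1-8) K f ty in simp_all)
qed

context lex_loc_small
begin

text \<open>The lex left adjoint unpacked on elements. The unit gives universal arrows and its
  naturality the equation for \<open>La\<close>; a pointwise pullback is a limit in the full
  subcategory, hence preserved by \<open>L\<close>.\<close>

lemma exactD:
 assumes ex: "Phi_exact U \<Phi> C" and T: "T = \<Inter>{S. Phi_closed U \<Phi> C S}"
 obtains Lo La Lt where "!!F. F:T ==> univ F (Lo F) (Lt F)"
  "!!F G s. F:T ==> G:T ==> natural C F G s ==>arr (
   La F G s) & dom (La F G s) = Lo F & cod (La F G s) = Lo G &
   (ALL b:Ob C. ALL x:fob F b. La F G s*Lt F b x = Lt G b (s b x))"
  "!!F1 F2 F0 H s1 s2 p1 p2. F1:T ==> F2:T ==> F0:T ==> H:T ==> natural C F1 F0 s1 ==>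
   natural C F2 F0 s2 ==> el_pullback F1 F2 s1 s2 H p1 p2 ==>
   is_pullback C (La F1 F0 s1) (La F2 F0 s2) (La H F1 p1) (La H F2 p2)"
proof -
 note Tp = Phi_l_PV[OF T]
 have cl: "Phi_closed U \<Phi> C T" by (rule Phi_closed_Inter[OF T])
 obtain L et where adj: "is_adjunction (PV T) C L (yoneda U C) et" and lex: "lex_functor (PV T) C L"
  using ex unfolding Phi_exact_def Tp(1) by blast
 have L: "is_functor (PV T) C L" using lex unfolding lex_functor_def by blast
 note LF = functorD[OF L]
 interpret V: category "PV T" by (rule category_PV)
 have Tpsh: "psh F" if "F:T" for F using that Tp(2) Sm_psh by blast
 have TOb: "F:Ob (PV T)" if "F:T" for F using that Tpsh by simp
 have LOb: "ob (fob L F)" if "F:T" for F using LF(3)[OF TOb[OF that]] .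
 have et: "et F:Hom PC F (yo (fob L F))" if "F:T" for F
 proof -
  have "nat_trans (PV T) (PV T) id_fctr (comp_fctr (yoneda U C) L) et" using adj unfolding is_adjunction_def by blast
  hence "et F:Arr (PV T) & Dom (PV T) (et F) = F & Cod (PV T) (et F) = yo (fob L F)"
   using TOb[OF that] unfolding nat_trans_iff by (simp del: full_subcat_simps)
  thus ?thesis by simp
 qed
 define Lt where "Lt F b x = dc b (fob L F) (ev (et F) b x)" for F b x
 have cn: "cnat F (fob L F) (Lt F)" if "F:T" for F
  unfolding Lt_def by (rule natural_cnat[OF Tpsh[OF that] LOb[OF that] ev_natural[OF et[OF that]]])
 have evin: "ev (et F) b x:fob (yo (fob L F)) b" if "F:T" "ob b" "x:fob F b" for F b x
  using naturalD(1)[OF ev_natural[OF et[OF that(1)]]] that by blast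
 have yn: "ev (Cmp PC (farr (yoneda U C) g) (et F)) b x = cd b (cod g) (g*Lt F b x)"
  if "F:T" "arr g" "dom g = fob L F" "ob b" "x:fob F b" for F g b x
  using that et[OF that(1)] evin[OF that(1,4,5)] yoneda_arr(2)[OF that(2), of b "ev (et F) b x"] by (simp add: Lt_def)
 have u: "univ F (fob L F) (Lt F)" if F: "F:T" for F
  unfolding univ_def
 proof (intro conjI cn[OF F] allI impI)
  fix d si assume si: "cnat F d si"
  note S = cnatD[OF si]
  let ?f = "psh_map C F (yo d) (%b x. cd b d (si b x))"
  have fH: "?f:Hom PC F (yo d)" using psh_map_Hom[OF Tpsh[OF F] psh_yo[OF S(1)] cnat_natural[OF Tpsh[OF F] si]] .
  have yd: "yo d:T" using Phi_closedD(2)[OF cl] S(1) by auto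
  have ex1: "EX! g. g:hom (fob L F) d & Cmp (PV T) (farr (yoneda U C) g) (et F) = ?f"
   using adj TOb[OF F] S(1) fH F yd unfolding is_adjunction_def by (simp add: Hom_PV)
  have "Cmp (PV T) (farr (yoneda U C) g) (et F) = ?f <-> (ALL b:Ob C. ALL x:fob F b. si b x = g*Lt F b x)"
   if g: "g:hom (fob L F) d" for g
  proof -
   have g': "arr g" "dom g = fob L F" "cod g = d" using g by auto
   have yg: "farr (yoneda U C) g:Hom PC (yo (fob L F)) (yo d)" using yoneda_arr(1)[OF g'(1)] g' by simp
   have cH: "Cmp PC (farr (yoneda U C) g) (et F):Hom PC F (yo d)"
    using category.Cmp_in[OF category_PC et[OF F] yg] .
   note cF = cnatD[OF cn[OF F]]
   have e: "ev (Cmp PC (farr (yoneda U C) g) (et F)) b x = ev ?f b x <-> si b x = g*Lt F b x"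
    if bx: "ob b" "x:fob F b" for b x
   proof -
    have "dc b d (cd b d (g*Lt F b x)) = g*Lt F b x" "dc b d (cd b d (si b x)) = si b x"
     using cF S bx g' by simp_all
    hence "cd b d (g*Lt F b x) = cd b d (si b x) <-> g*Lt F b x = si b x" by metis
    thus ?thesis using yn[OF F g'(1,2) bx] bx g'(3) by auto
   qed
   show ?thesis
   proof
    assume "Cmp (PV T) (farr (yoneda U C) g) (et F) = ?f"
    thus "ALL b:Ob C. ALL x:fob F b. si b x = g*Lt F b x" using e by simp
   next
    assume "ALL b:Ob C. ALL x:fob F b. si b x = g*Lt F b x"
    hence "Cmp PC (farr (yoneda U C) g) (et F) = ?f" using e by (intro psh_map_eqI[OF cH fH]) blast
    thus "Cmp (PV T) (farr (yoneda U C) g) (et F) = ?f" by simp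
   qed
  qed
  hence "(g:hom (fob L F) d & Cmp (PV T) (farr (yoneda U C) g) (et F) = ?f) <->
    (g:hom (fob L F) d & (ALL b:Ob C. ALL x:fob F b. si b x = g*Lt F b x))" for g by blast
  thus "EX! g. g:hom (fob L F) d & (ALL b:Ob C. ALL x:fob F b. si b x = g*Lt F b x)"
   using ex1 by (simp only:)
 qed
 define La where "La F G s = farr L (psh_map C F G s)" for F G s
 have pm: "psh_map C F G s:Arr (PV T)" "Dom (PV T) (psh_map C F G s) = F" "Cod (PV T) (psh_map C F G s) = G"
  "psh_map C F G s:Hom PC F G"
  if "F:T" "G:T" "natural C F G s" for F G s
  using psh_map_Hom[OF Tpsh[OF that(1)] Tpsh[OF that(2)] that(3)] that by auto
 have La: "arr (La F G s) & dom (La F G s) = fob L F & cod (La F G s) = fob L G &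
   (ALL b:Ob C. ALL x:fob F b. La F G s*Lt F b x = Lt G b (s b x))"
  if FG: "F:T" "G:T" "natural C F G s" for F G s
 proof -
  note P = pm[OF FG]
  have t: "arr (La F G s)" "dom (La F G s) = fob L F" "cod (La F G s) = fob L G"
   using LF(4-6)[OF P(1)] P by (simp_all add: La_def del: full_subcat_simps)
  have "nat_trans (PV T) (PV T) id_fctr (comp_fctr (yoneda U C) L) et" using adj unfolding is_adjunction_def by blast
  hence "Cmp (PV T) (et (Cod (PV T) (psh_map C F G s))) (psh_map C F G s) =
    Cmp (PV T) (farr (yoneda U C) (La F G s)) (et (Dom (PV T) (psh_map C F G s)))"
   using P(1) unfolding nat_trans_iff La_def by (simp del: full_subcat_simps)
  hence eq: "Cmp PC (et G) (psh_map C F G s) = Cmp PC (farr (yoneda U C) (La F G s)) (et F)"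
   unfolding P(2,3) by simp
  have "La F G s*Lt F b x = Lt G b (s b x)" if bx: "ob b" "x:fob F b" for b x
  proof -
   have "ev (Cmp PC (et G) (psh_map C F G s)) b x = ev (et G) b (s b x)" using P(4) bx by simp
   hence "ev (et G) b (s b x) = cd b (fob L G) (La F G s*Lt F b x)"
    using yn[OF FG(1) t(1,2) bx] eq t(3) by simp
   hence "Lt G b (s b x) = dc b (fob L G) (cd b (fob L G) (La F G s*Lt F b x))" by (simp add: Lt_def)
   thus ?thesis using t cnatD[OF cn[OF FG(1)]] bx by simp
  qed
  thus ?thesis using t by blast
 qed
 have pbk: "is_pullback C (La F1 F0 s1) (La F2 F0 s2) (La H F1 p1) (La H F2 p2)"
  if F: "F1:T" "F2:T" "F0:T" "H:T" and s: "natural C F1 F0 s1" "natural C F2 F0 s2" and el: "el_pullback F1 F2 s1 s2 H p1 p2"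
  for F1 F2 F0 H s1 s2 p1 p2
 proof -
  have pn: "natural C H F1 p1" "natural C H F2 p2" using el unfolding el_pullback_def by auto
  let ?s = "psh_map C F1 F0 s1" and ?t = "psh_map C F2 F0 s2"
  note S1 = pm[OF F(1,3) s(1)] and S2 = pm[OF F(2,3) s(2)] and P1 = pm[OF F(4,1) pn(1)] and P2 = pm[OF F(4,2) pn(2)]
  have sp: "natural C H F0 (%c x. s1 c (p1 c x))" by (rule natural_comp[OF pn(1) s(1)])
  note P0 = pm[OF F(4,3) sp]
  have co: "Cod (PV T) ?s = Cod (PV T) ?t" using S1 S2 by simp
  note fin = V.finite_diagram_cospan[OF S1(1) S2(1) co]
  hence D: "is_functor cospan_shape (PV T) (cospan (PV T) ?s ?t)" unfolding finite_diagram_def by blast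
  define l where "l j = (if j = 0 then psh_map C H F1 p1 else if j = 1 then psh_map C H F2 p2 else psh_map C H F0 (%c x. s1 c (p1 c x)))" for j :: nat
  have ob: "fob (cospan (PV T) ?s ?t) 0 = F1" "fob (cospan (PV T) ?s ?t) 1 = F2" "fob (cospan (PV T) ?s ?t) 2 = F0"
   using S1 S2 by (auto simp: cospan_def)
  have lev: "ev (l 0) c u = p1 c u" "ev (l 1) c u = p2 c u" "ev (l (Suc 0)) c u = p2 c u" "ev (l 2) c u = s1 c (p1 c u)" if "ob c" "u:fob H c" for c u
   using that by (simp_all add: l_def)
  have "is_limit cospan_shape (PV T) (cospan (PV T) ?s ?t) H l"
  proof (rule limit_of_elements[OF D])
   show "is_cone cospan_shape (PV T) (cospan (PV T) ?s ?t) H l"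
    unfolding cone_PV[OF D]
   proof (intro conjI ballI)
    show "psh H" "H:T" using F Tpsh by auto
    fix j assume "j:Ob cospan_shape"
    thus "l j:Hom PC H (fob (cospan (PV T) ?s ?t) j)"
     using P1(4) P2(4) P0(4) ob by (auto simp: cospan_shape_def l_def)
   next
    fix ph c u assume "ph:Arr cospan_shape" and c: "ob c" "u:fob H c"
    hence "ph:{0, 1, 2, 3, 4}" by (simp add: cospan_shape_def)
    moreover have "p1 c u:fob F1 c" "p2 c u:fob F2 c" "s1 c (p1 c u):fob F0 c" "s1 c (p1 c u) = s2 c (p2 c u)"
     using naturalD(1)[OF pn(1)] naturalD(1)[OF pn(2)] naturalD(1)[OF sp] c el unfolding el_pullback_def by auto
    ultimately show "ev (farr (cospan (PV T) ?s ?t) ph) c (ev (l (Dom cospan_shape ph)) c u) = ev (l (Cod cospan_shape ph)) c u"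
     using c S1(2,3) S2(2,3) by (auto simp: lev cospan_shape_def cospan_def)
   qed
   show "el_limit cospan_shape (cospan (PV T) ?s ?t) H l"
    unfolding el_limit_def
   proof (intro conjI ballI allI impI)
    fix c w assume c: "ob c" and w: "compat cospan_shape (cospan (PV T) ?s ?t) c w"
    have w0: "w 0:fob F1 c" "w 1:fob F2 c" using w ob unfolding compat_def by (auto simp: cospan_shape_def)
    have "ev ?s c (w 0) = w 2" "ev ?t c (w 1) = w 2"
     using w unfolding compat_def by (auto simp: cospan_shape_def cospan_def)
    hence w2: "s1 c (w 0) = w 2" "s2 c (w 1) = w 2" using w0 c by simp_all
    then obtain u where "u:fob H c" "p1 c u = w 0" "p2 c u = w 1" using el w0 c unfolding el_pullback_def by metis
    thus "EX u:fob H c. ALL j:Ob cospan_shape. ev (l j) c u = w j"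
     using w2 c lev by (intro bexI[of _ u]) (auto simp: cospan_shape_def)
   next
    fix c u v assume c: "ob c" "u:fob H c" "v:fob H c" and e: "ALL j:Ob cospan_shape. ev (l j) c u = ev (l j) c v"
    hence "p1 c u = p1 c v" "p2 c u = p2 c v" using lev by (auto simp: cospan_shape_def)
    thus "u = v" using el c unfolding el_pullback_def by blast
   qed
  qed
  hence lim: "is_limit cospan_shape C (comp_fctr L (cospan (PV T) ?s ?t)) (fob L H) (%j. farr L (l j))"
   using lex fin unfolding lex_functor_def by blast
  note LS1 = LF(4-6)[OF S1(1)] and LS2 = LF(4-6)[OF S2(1)]
  have lim': "is_limit cospan_shape C (cospan C (La F1 F0 s1) (La F2 F0 s2)) (fob L H) (%j. farr L (l j))"
  proof (rule limit_functor_cong[OF lim category_cospan_shape])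
   show "fob (cospan C (La F1 F0 s1) (La F2 F0 s2)) j = fob (comp_fctr L (cospan (PV T) ?s ?t)) j" for j
    using LS1 LS2 by (simp add: cospan_def La_def del: full_subcat_simps)
   fix f assume "f:Arr cospan_shape"
   thus "farr (cospan C (La F1 F0 s1) (La F2 F0 s2)) f = farr (comp_fctr L (cospan (PV T) ?s ?t)) f"
    using LS1 LS2 LF(7)[OF V.Dom_Ob[OF S1(1)]] LF(7)[OF V.Dom_Ob[OF S2(1)]] LF(7)[OF V.Cod_Ob[OF S1(1)]]
    by (simp add: cospan_def La_def del: full_subcat_simps)
  qed
  have "is_pullback C (La F1 F0 s1) (La F2 F0 s2) (farr L (l 0)) (farr L (l 1))"
   by (rule pullback_of_limit[OF _ _ _ lim']) (use La[OF F(1,3) s(1)] La[OF F(2,3) s(2)] in simp_all)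
  thus ?thesis by (simp add: l_def La_def)
 qed
 show thesis
 proof (rule that[of "fob L" Lt La])
  show "univ F (fob L F) (Lt F)" if "F:T" for F using u[OF that] .
  show "arr (La F G s) & dom (La F G s) = fob L F & cod (La F G s) = fob L G &
   (ALL b:Ob C. ALL x:fob F b. La F G s*Lt F b x = Lt G b (s b x))"
   if "F:T" "G:T" "natural C F G s" for F G s using La[OF that] .
  show "is_pullback C (La F1 F0 s1) (La F2 F0 s2) (La H F1 p1) (La H F2 p2)"
   if "F1:T" "F2:T" "F0:T" "H:T" "natural C F1 F0 s1" "natural C F2 F0 s2" "el_pullback F1 F2 s1 s2 H p1 p2"
   for F1 F2 F0 H s1 s2 p1 p2 using pbk[OF that] .
 qed
qed

end

text \<open>The properties of \<open>Phi_l\<close> from which conditions (2) and (3) are derived.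
  The pullback axiom accepts arbitrary universal arrows and an arbitrary pullback in
  \<open>C\<close>, so that any convenient reflecting object may be used.\<close>

locale univ_class = lex_loc_small C U for C :: "('o, 'a) cat" and U :: "'u set set" +
 fixes T :: "('o, 'a, 'u) presheaf set"
 assumes T_psh: "F:T ==> psh F"
  and T_yo: "c:Ob C ==> yo c:T"
  and T_coeq: "F:T ==> G:T ==> reflexive_coequaliser F G s t r Q q ==> Q:T"
  and T_univ: "F:T ==> EX c ta. univ F c ta"
  and T_pullback: "F1:T ==> F2:T ==> F0:T ==> natural C F1 F0 s1 ==> natural C F2 F0 s2 ==>
   univ F1 c1 ta1 ==> univ F2 c2 ta2 ==> univ F0 c0 ta0 ==> is_pullback C f1 f2 q1 q2 ==>
   Dom C f1 = c1 ==> Dom C f2 = c2 ==> Cod C f1 = c0 ==>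
   ALL b:Ob C. ALL x:fob F1 b. f1*ta1 b x = ta0 b (s1 b x) ==>
   ALL b:Ob C. ALL x:fob F2 b. f2*ta2 b x = ta0 b (s2 b x) ==>
   EX H p1 p2 th. H:T & el_pullback F1 F2 s1 s2 H p1 p2 & univ H (Dom C q1) th &
    (ALL b:Ob C. ALL x:fob H b. q1*th b x = ta1 b (p1 b x) & q2*th b x = ta2 b (p2 b x))"

context lex_loc_small
begin

lemma exact_univ_class:
 assumes ex: "Phi_exact U \<Phi> C" and rc: "is_Phi_rc U \<Phi>"
 shows "univ_class C U (\<Inter>{S. Phi_closed U \<Phi> C S})"
proof -
 define T where "T = \<Inter>{S. Phi_closed U \<Phi> C S}"
 have cl: "Phi_closed U \<Phi> C T" by (rule Phi_closed_Inter[OF T_def])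
 have "univ_class C U T"
 proof (rule exactD[OF ex T_def])
 fix Lo La Lt
 assume u: "!!F. F:T ==> univ F (Lo F) (Lt F)"
  and La: "!!F G s. F:T ==> G:T ==> natural C F G s ==>arr (
   La F G s) & dom (La F G s) = Lo F & cod (La F G s) = Lo G &
   (ALL b:Ob C. ALL x:fob F b. La F G s*Lt F b x = Lt G b (s b x))"
  and Lpb: "!!F1 F2 F0 H s1 s2 p1 p2. F1:T ==> F2:T ==> F0:T ==> H:T ==> natural C F1 F0 s1 ==>
   natural C F2 F0 s2 ==> el_pullback F1 F2 s1 s2 H p1 p2 ==>
   is_pullback C (La F1 F0 s1) (La F2 F0 s2) (La H F1 p1) (La H F2 p2)"
 show "univ_class C U T"
 proof
  show "psh F" if "F:T" for F using that Phi_closedD(1)[OF cl] Sm_psh by blast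
  show "yo c:T" if "ob c" for c using that Phi_closedD(2)[OF cl] by blast
  show "Q:T" if "F:T" "G:T" "reflexive_coequaliser F G s t r Q q" for F G s t r Q q
   by (rule closed_reflexive_coequaliser[OF rc cl that])
  show "EX c ta. univ F c ta" if "F:T" for F using u[OF that] by blast
  fix F1 F2 F0 s1 s2 c1 ta1 c2 ta2 c0 ta0 f1 f2 q1 q2
  assume F: "F1:T" "F2:T" "F0:T" and s: "natural C F1 F0 s1" "natural C F2 F0 s2"
   and us: "univ F1 c1 ta1" "univ F2 c2 ta2" "univ F0 c0 ta0" and pb: "is_pullback C f1 f2 q1 q2"
   and ty: "dom f1 = c1" "dom f2 = c2" "cod f1 = c0"
   and e1: "ALL b:Ob C. ALL x:fob F1 b. f1*ta1 b x = ta0 b (s1 b x)"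
   and e2: "ALL b:Ob C. ALL x:fob F2 b. f2*ta2 b x = ta0 b (s2 b x)"
  obtain H p1 p2 where H: "H:T" "el_pullback F1 F2 s1 s2 H p1 p2" using closed_pullback[OF cl F s] by blast
  have pn: "natural C H F1 p1" "natural C H F2 p2" using H(2) unfolding el_pullback_def by auto
  note pbL = Lpb[OF F H(1) s H(2)]
  note L1 = La[OF F(1,3) s(1)] and L2 = La[OF F(2,3) s(2)] and LP1 = La[OF H(1) F(1) pn(1)] and LP2 = La[OF H(1) F(2) pn(2)]
  obtain k1 l1 where k1: "is_inverse_pair C k1 l1" "dom k1 = Lo F1" "cod k1 = c1"
   "!!b x. ob b ==> x:fob F1 b ==> k1*Lt F1 b x = ta1 b x" using univ_iso[OF u[OF F(1)] us(1)] by metis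
  obtain k2 l2 where k2: "is_inverse_pair C k2 l2" "dom k2 = Lo F2" "cod k2 = c2"
   "!!b x. ob b ==> x:fob F2 b ==> k2*Lt F2 b x = ta2 b x" using univ_iso[OF u[OF F(2)] us(2)] by metis
  obtain k0 l0 where k0: "is_inverse_pair C k0 l0" "dom k0 = Lo F0" "cod k0 = c0"
   "!!b x. ob b ==> x:fob F0 b ==> k0*Lt F0 b x = ta0 b x" using univ_iso[OF u[OF F(3)] us(3)] by metis
  have ka: "arr k0" "arr k1" "arr k2" using k0(1) k1(1) k2(1) unfolding is_inverse_pair_def by auto
  note pD = pullbackD[OF pb]
  \<comment> \<open>Given and chosen reflections agree only up to isomorphism; the comparisons
    commute with the arrows over \<open>F0\<close> because both composites agree on universal
    elements.\<close>
  have sq: "f*k = k0*La G F0 s"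
   if G: "G:T" "natural C G F0 s" and k: "arr k" "dom k = Lo G" "cod k = dom f" and f: "arr f" "cod f = c0"
    and kt: "!!b x. ob b ==> x:fob G b ==> k*Lt G b x = ta b x"
    and ft: "!!b x. ob b ==> x:fob G b ==> f*ta b x = ta0 b (s b x)" for G s k f ta
  proof (rule univ_eq[OF u[OF G(1)]])
   note L = La[OF G(1) F(3) G(2)]
   note cG = cnatD[OF univ_cnat[OF u[OF G(1)]]]
   fix b x assume bx: "ob b" "x:fob G b"
   have "(f*k)*Lt G b x = ta0 b (s b x)" using kt[OF bx] ft[OF bx] cG bx k f by simp
   moreover have "(k0*La G F0 s)*Lt G b x = k0*Lt F0 b (s b x)" using L cG bx ka k0(2) by simp
   ultimately show "(f*k)*Lt G b x = (k0*La G F0 s)*Lt G b x"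
    using k0(4)[OF bx(1) naturalD(1)[OF G(2) bx]] by simp
  qed (use k f ka k0 La[OF G(1) F(3) G(2)] in simp_all)
  have sq1: "f1*k1 = k0*La F1 F0 s1" by (rule sq[OF F(1) s(1), of k1 f1 ta1]) (use k1 ka pD ty e1 in simp_all)
  have sq2: "f2*k2 = k0*La F2 F0 s2" by (rule sq[OF F(2) s(2), of k2 f2 ta2]) (use k2 ka pD ty e2 in simp_all)
  have pb': "is_pullback C f1 f2 (k1*La H F1 p1) (k2*La H F2 p2)"
   by (rule pullback_iso_cospan[OF pbL k0(1) k1(1) k2(1)]) (use k0 k1 k2 L1 L2 pD(1-8) ty sq1 sq2 in simp_all)
  \<comment> \<open>The reflection of \<open>H\<close> is identified with the prescribed pullback,
    and its universal arrow is transported along \<open>m\<close>.\<close>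
  obtain m n where m: "is_inverse_pair C m n" "dom m = dom (k1*La H F1 p1)" "cod m = dom q1"
   "q1*m = k1*La H F1 p1" "q2*m = k2*La H F2 p2" using pullbacks_iso[OF pb pb'] by metis
  have ma: "arr m" "dom m = Lo H" using m(1,2) LP1 ka k1 unfolding is_inverse_pair_def by auto
  define th where "th b x = m*Lt H b x" for b x
  have cth: "cnat H (cod m) th" unfolding th_def by (rule cnat_comp[OF univ_cnat[OF u[OF H(1)]] ma])
  have "univ H (cod m) th" by (rule univ_transport[OF u[OF H(1)] m(1) ma(2) cth]) (simp add: th_def)
  moreover have "q1*th b x = ta1 b (p1 b x) & q2*th b x = ta2 b (p2 b x)" if bx: "ob b" "x:fob H b" for b x
  proof -
   note cH = cnatD[OF univ_cnat[OF u[OF H(1)]]]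
   have "q1*m*Lt H b x = k1*La H F1 p1*Lt H b x" "q2*m*Lt H b x = k2*La H F2 p2*Lt H b x"
    using Cmp_reassoc[OF m(4), of "Lt H b x"] Cmp_reassoc[OF m(5), of "Lt H b x"] cH bx ma m(3) pD(1-8) LP1 LP2 ka k1 k2 by simp_all
   thus ?thesis
    using LP1 LP2 bx k1(4)[OF bx(1) naturalD(1)[OF pn(1) bx]] k2(4)[OF bx(1) naturalD(1)[OF pn(2) bx]] by (simp add: th_def)
  qed
  ultimately show "EX H p1 p2 th. H:T & el_pullback F1 F2 s1 s2 H p1 p2 & univ H (dom q1) th &
    (ALL b:Ob C. ALL x:fob H b. q1*th b x = ta1 b (p1 b x) & q2*th b x = ta2 b (p2 b x))"
   using H m(3) by (intro exI[of _ H] exI[of _ p1] exI[of _ p2] exI[of _ th]) simp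
 qed
 qed
 thus ?thesis unfolding T_def .
qed

end

section \<open>Exactness properties of a class with stable universal arrows\<close>

lemma (in category) pullback_comm:
 assumes pb: "is_pullback C f g p q" and h: "arr h" "cod h = dom p" shows "f*p*h = g*q*h"
 by (rule Cmp_reassoc[OF pullbackD(9)[OF pb]]) (use pullbackD(1-8)[OF pb] h in simp_all)

definition (in category) arr_step :: "'a => 'a => 'o => 'a => 'a => bool" where
 "arr_step d c b u v <-> (EX w. arr w & dom w = b & cod w = dom d & u = d*w & v = c*w)"

context univ_class
begin

lemma natural_yarr:
 assumes "arr g" shows "natural C (yo (dom g)) (yo (cod g)) (%b u. cd b (cod g) (g*dc b (dom g) u))"
 using assms unfolding natural_def by auto

text \<open>The presheaf pullback over the representable at \<open>cod f1\<close>; \<open>th\<close>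
  exhibits the pullback in \<open>C\<close> as its reflection.\<close>

definition yo_pullback where
 "yo_pullback F1 ta1 f1 F2 ta2 f2 q1 q2 H p1 p2 th <-> H:T & natural C H F1 p1 & natural C H F2 p2 & univ H (dom q1) th &
  (ALL b:Ob C. ALL x:fob H b. q1*th b x = ta1 b (p1 b x) & q2*th b x = ta2 b (p2 b x)) &
  (ALL b:Ob C. ALL x1:fob F1 b. ALL x2:fob F2 b. f1*ta1 b x1 = f2*ta2 b x2 --> (EX x:fob H b. p1 b x = x1 & p2 b x = x2)) &
  (ALL b:Ob C. ALL x:fob H b. ALL x':fob H b. p1 b x = p1 b x' --> p2 b x = p2 b x' --> x = x')"

lemma yo_pullbackD:
 assumes "yo_pullback F1 ta1 f1 F2 ta2 f2 q1 q2 H p1 p2 th"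
 shows "H:T" "natural C H F1 p1" "natural C H F2 p2" "univ H (dom q1) th"
  "!!b x. ob b ==> x:fob H b ==> q1*th b x = ta1 b (p1 b x) & q2*th b x = ta2 b (p2 b x)"
  "!!b x1 x2. ob b ==> x1:fob F1 b ==> x2:fob F2 b ==> f1*ta1 b x1 = f2*ta2 b x2 ==> EX x:fob H b. p1 b x = x1 & p2 b x = x2"
  "!!b x x'. ob b ==> x:fob H b ==> x':fob H b ==> p1 b x = p1 b x' ==> p2 b x = p2 b x' ==> x = x'"
 using assms unfolding yo_pullback_def by blast+

lemma T_pullback_yo:
 assumes F: "F1:T" "F2:T" and u: "univ F1 (dom f1) ta1" "univ F2 (dom f2) ta2" and pb: "is_pullback C f1 f2 q1 q2"
 shows "EX H p1 p2 th. yo_pullback F1 ta1 f1 F2 ta2 f2 q1 q2 H p1 p2 th"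
proof -
 note D = pullbackD[OF pb]
 let ?c = "cod f1"
 have c: "ob ?c" using D by simp
 let ?s1 = "%b x. cd b ?c (f1*ta1 b x)" and ?s2 = "%b x. cd b ?c (f2*ta2 b x)"
 have c1: "cnat F1 ?c (%b x. f1*ta1 b x)" using cnat_comp[OF univ_cnat[OF u(1)] D(1)] by simp
 have c2: "cnat F2 ?c (%b x. f2*ta2 b x)" using cnat_comp[OF univ_cnat[OF u(2)] D(2)] D(5) by simp
 note n = cnat_natural[OF T_psh[OF F(1)] c1] cnat_natural[OF T_psh[OF F(2)] c2]
 have dcs: "dc b ?c (?s1 b x) = f1*ta1 b x" if "ob b" "x:fob F1 b" for b x using cnatD[OF c1] that by simp
 have dcs2: "dc b ?c (?s2 b x) = f2*ta2 b x" if "ob b" "x:fob F2 b" for b x using cnatD[OF c2] that by simp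
 obtain H p1 p2 th where H: "H:T" "el_pullback F1 F2 ?s1 ?s2 H p1 p2" "univ H (dom q1) th"
  "ALL b:Ob C. ALL x:fob H b. q1*th b x = ta1 b (p1 b x) & q2*th b x = ta2 b (p2 b x)"
  using T_pullback[OF F T_yo[OF c] n u univ_yo[OF c] pb refl refl refl] dcs dcs2 by auto
 have "?s1 b x1 = ?s2 b x2" if "f1*ta1 b x1 = f2*ta2 b x2" for b x1 x2 using that by simp
 thus ?thesis using H unfolding el_pullback_def yo_pullback_def by (intro exI[of _ H] exI[of _ p1] exI[of _ p2] exI[of _ th]) simp
qed

text \<open>\<open>I\<close> is the presheaf of the arrows \<open>e*th b x\<close>. It may be a
  proper part of the representable at \<open>cod e\<close>, yet it has the same reflection.\<close>

definition image_in where
 "image_in H th e I io <-> I:T & univ I (cod e) io & (ALL b:Ob C. ALL z:fob I b. ALL z':fob I b. io b z = io b z' --> z = z') &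
  (ALL b:Ob C. ALL x:fob H b. EX z:fob I b. io b z = e*th b x) & (ALL b:Ob C. ALL z:fob I b. EX x:fob H b. io b z = e*th b x)"

lemma image_inD:
 assumes "image_in H th e I io"
 shows "I:T" "univ I (cod e) io" "!!b z z'. ob b ==> z:fob I b ==> z':fob I b ==> io b z = io b z' ==> z = z'"
  "!!b x. ob b ==> x:fob H b ==> EX z:fob I b. io b z = e*th b x"
  "!!b z. ob b ==> z:fob I b ==> EX x:fob H b. io b z = e*th b x"
 using assms unfolding image_in_def by blast+

text \<open>The pointwise image of \<open>H\<close> in the representable at the codomain of a regular epimorphism: its
 kernel pair is computed by the kernel pair in \<open>C\<close>.\<close>

lemma univ_image:
 assumes HT: "H:T" and u: "univ H (dom e) th" and e: "regular_epi C e"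
 shows "EX I io. image_in H th e I io"
proof -
 obtain f g where co: "is_coequaliser C f g e" using e unfolding regular_epi_def by blast
 note E = coequaliserD[OF co]
 obtain k k' where pb: "is_pullback C e e k k'" using ex_pullback[OF E(3,3)] by blast
 note D = pullbackD[OF pb]
 obtain K p1 p2 th' where kp: "yo_pullback H th e H th e k k' K p1 p2 th'"
  using T_pullback_yo[OF HT HT u u pb] by blast
 note K = yo_pullbackD(1-4)[OF kp] and Kth = yo_pullbackD(5)[OF kp] and Kex = yo_pullbackD(6)[OF kp] and Kun = yo_pullbackD(7)[OF kp]
 note Hp = T_psh[OF HT] and Kp = T_psh[OF K(1)]
 note cth = cnatD[OF univ_cnat[OF u]] and cth' = cnatD[OF univ_cnat[OF K(4)]]
 \<comment> \<open>The diagonal makes the pointwise kernel pair reflexive, so that its quotient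
   stays in \<open>T\<close>.\<close>
 have "EX z. z:fob K b & p1 b z = x & p2 b z = x" if "ob b" "x:fob H b" for b x using Kex[OF that that(2)] by blast
 then obtain r where r: "!!b x. ob b ==> x:fob H b ==> r b x:fob K b & p1 b (r b x) = x & p2 b (r b x) = x" by metis
 have rn: "natural C H K r"
  unfolding natural_def
 proof (intro conjI ballI)
  fix h x assume h: "arr h" "x:fob H (cod h)"
  have rx: "r (cod h) x:fob K (cod h)" "act H h x:fob H (dom h)" using r h pshD(2)[OF Hp] by auto
  show "r (dom h) (act H h x) = act K h (r (cod h) x)"
   by (rule Kun[of "dom h"])
    (use r rx h pshD(2)[OF Kp] naturalD(2)[OF K(2) h(1) rx(1)] naturalD(2)[OF K(3) h(1) rx(1)] in auto)
 qed (use r in blast)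
 obtain I q where Iq: "reflexive_coequaliser K H p1 p2 r I q" using ex_reflexive_coequaliser[OF Kp Hp K(2,3) rn] r by blast
 have IT: "I:T" by (rule T_coeq[OF K(1) HT Iq])
 note Ip = T_psh[OF IT]
 have q: "natural C H I q" "!!b. ob b ==> q b ` fob H b = fob I b"
  "!!b x y. ob b ==> x:fob H b ==> y:fob H b ==> q b x = q b y <-> equivclp (step K p1 p2 b) x y"
  using Iq unfolding reflexive_coequaliser_def by auto
 have ker: "q b x = q b y <-> e*th b x = e*th b y" if b: "ob b" "x:fob H b" "y:fob H b" for b x y
 proof
  assume "q b x = q b y"
  hence "equivclp (step K p1 p2 b) x y" using q(3) b by blast
  moreover have "e*th b v = e*th b w" if "step K p1 p2 b v w" for v w
  proof -
   obtain z where z: "z:fob K b" "v = p1 b z" "w = p2 b z" using \<open>step K p1 p2 b v w\<close> unfolding step_def by blast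
   have "e*k*th' b z = e*k'*th' b z" using pullback_comm[OF pb cth'(2,4)] b(1) z(1) by blast
   thus ?thesis using Kth[OF b(1) z(1)] z by simp
  qed
  ultimately show "e*th b x = e*th b y" by (induction rule: equivclp_induct_step) auto
 next
  assume "e*th b x = e*th b y"
  then obtain z where "z:fob K b" "p1 b z = x" "p2 b z = y" using Kex b by blast
  hence "step K p1 p2 b x y" unfolding step_def by blast
  thus "q b x = q b y" using q(3) b equivclp_step by metis
 qed
 define io where "io b z = e*th b (inv_into (fob H b) (q b) z)" for b z
 have ioq: "io b (q b x) = e*th b x" if b: "ob b" "x:fob H b" for b x
 proof -
  have i: "q b x:q b ` fob H b" using b by blast
  from ker[OF b(1) inv_into_into[OF i] b(2)] f_inv_into_f[OF i] show ?thesis unfolding io_def by simp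
 qed
 have Iel: "EX x:fob H b. z = q b x" if "ob b" "z:fob I b" for b z using q(2) that by blast
 have io: "cnat I (cod e) io"
  unfolding cnat_def
 proof (intro conjI ballI)
  fix h z assume h: "arr h" "z:fob I (cod h)"
  obtain x where x: "x:fob H (cod h)" "z = q (cod h) x" using Iel[OF Cod_Ob[OF h(1)] h(2)] by blast
  have "act I h z = q (dom h) (act H h x)" using naturalD(2)[OF q(1) h(1) x(1)] x(2) by simp
  thus "io (dom h) (act I h z) = io (cod h) z*h"
   using ioq[OF Dom_Ob[OF h(1)] pshD(2)[OF Hp h(1) x(1)]] ioq[OF Cod_Ob[OF h(1)] x(1)] x(2) cth h(1) x(1) E(3) by simp
 next
  fix b z assume b: "ob b" "z:fob I b"
  obtain x where x: "x:fob H b" "z = q b x" using Iel[OF b] by blast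
  thus "arr (io b z)" "dom (io b z) = b" "cod (io b z) = cod e" using ioq[OF b(1) x(1)] cth(2-4)[OF b(1) x(1)] E(3) by simp_all
 qed (use E(3) in simp)
 have "univ I (cod e) io"
 proof (rule univI[OF io])
  fix d si assume si: "cnat I d si"
  from univ_lift[OF u cnat_precomp[OF q(1) si]]
  obtain h where h: "arr h" "dom h = dom e" "cod h = d" "!!b x. ob b ==> x:fob H b ==> h*th b x = si b (q b x)" by metis
  \<comment> \<open>The kernel pair in \<open>C\<close> is the reflection of the pointwise one, so
    the equation can be tested on elements of \<open>K\<close>.\<close>
  have hk: "h*k = h*k'"
  proof (rule univ_eq[OF K(4)])
   fix b x assume b: "ob b" "x:fob K b"
   have pp: "p1 b x:fob H b" "p2 b x:fob H b" using naturalD(1)[OF K(2) b] naturalD(1)[OF K(3) b] by auto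
   have "e*k*th' b x = e*k'*th' b x" using pullback_comm[OF pb cth'(2,4)] b by blast
   hence "q b (p1 b x) = q b (p2 b x)" using ker[OF b(1) pp] Kth[OF b] by simp
   thus "(h*k)*th' b x = (h*k')*th' b x" using h Kth[OF b] b pp D(1-8) cth' by simp
  qed (use h D in simp_all)
  \<comment> \<open>The regular epimorphism coequalises some pair \<open>f\<close>,
    \<open>g\<close>, which factors through its kernel pair.\<close>
  obtain t where t: "arr t" "dom t = dom f" "cod t = dom k" "k*t = f" "k'*t = g"
   using pullback_lift[OF pb E(1,2)] E by metis
  have "h*k*t = h*k'*t" using Cmp_reassoc[OF hk, of t] h D(1-8) t by simp
  hence "h*f = h*g" using t by simp
  then obtain l where l: "arr l" "dom l = cod e" "cod l = cod h" "l*e = h"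
   using coequaliser_factor[OF co h(1)] h(2) E(6) by metis
  have "l*io b z = si b z" if b: "ob b" "z:fob I b" for b z
  proof -
   obtain x where x: "x:fob H b" "z = q b x" using Iel[OF b] by blast
   have "l*e*th b x = h*th b x" using Cmp_reassoc1[OF l(4), of "th b x"] l(1,2) E(3) cth b(1) x(1) by simp
   thus ?thesis using ioq[OF b(1) x(1)] h(4)[OF b(1) x(1)] x(2) by simp
  qed
  thus "EX g. arr g & dom g = cod e & cod g = d & (ALL b:Ob C. ALL x:fob I b. g*io b x = si b x)"
   using l h(3) by blast
 next
  fix g h assume g: "arr g" "arr h" "dom g = cod e" "dom h = cod e" "cod g = cod h"
   and eq: "ALL b:Ob C. ALL x:fob I b. g*io b x = h*io b x"
  have "g*e = h*e"
  proof (rule univ_eq[OF u])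
   fix b x assume b: "ob b" "x:fob H b"
   have "q b x:fob I b" using naturalD(1)[OF q(1) b] .
   hence "g*io b (q b x) = h*io b (q b x)" using eq b by blast
   thus "(g*e)*th b x = (h*e)*th b x" using ioq[OF b] g E(3) cth b by simp
  qed (use g E(3) in simp_all)
  thus "g = h" using regular_epi_cancel[OF e g(1,2)] g by blast
 qed
 moreover have "ALL b:Ob C. ALL z:fob I b. ALL z':fob I b. io b z = io b z' --> z = z'"
 proof (intro ballI impI)
  fix b z z' assume b: "ob b" "z:fob I b" "z':fob I b" "io b z = io b z'"
  obtain x x' where "x:fob H b" "z = q b x" "x':fob H b" "z' = q b x'" using Iel b by metis
  thus "z = z'" using ker ioq b by simp
 qed
 moreover have "ALL b:Ob C. ALL x:fob H b. EX z:fob I b. io b z = e*th b x" using ioq naturalD(1)[OF q(1)] by blast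
 moreover have "ALL b:Ob C. ALL z:fob I b. EX x:fob H b. io b z = e*th b x" using Iel ioq by blast
 ultimately show ?thesis using IT unfolding image_in_def by blast
qed

text \<open>The pointwise coequaliser of the Yoneda images of \<open>d\<close> and \<open>c\<close>,
  its kernel written with arrows instead of codes.\<close>

definition arr_quotient where
 "arr_quotient d c Q q <-> Q:T & natural C (yo (cod d)) Q q & (ALL b:Ob C. q b ` fob (yo (cod d)) b = fob Q b) &
  (ALL b:Ob C. ALL x:fob (yo (cod d)) b. ALL y:fob (yo (cod d)) b.
   q b x = q b y <-> equivclp (arr_step d c b) (dc b (cod d) x) (dc b (cod d) y))"

lemma arr_quotientD:
 assumes "arr_quotient d c Q q"
 shows "Q:T" "natural C (yo (cod d)) Q q" "!!b. ob b ==> q b ` fob (yo (cod d)) b = fob Q b"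
  "!!b x y. ob b ==> x:fob (yo (cod d)) b ==> y:fob (yo (cod d)) b ==>
   q b x = q b y <-> equivclp (arr_step d c b) (dc b (cod d) x) (dc b (cod d) y)"
 using assms unfolding arr_quotient_def by blast+

lemma reflexive_pair_quotient:
 assumes d: "arr d" "arr c" "dom d = dom c" "cod d = cod c" "arr s" "dom s = cod d" "cod s = dom d"
  "d*s = idt (cod d)" "c*s = idt (cod d)"
 shows "EX Q q. arr_quotient d c Q q"
proof -
 let ?X = "cod d" and ?R = "dom d"
 let ?f = "%b u. cd b ?X (d*dc b ?R u)" and ?g = "%b u. cd b ?X (c*dc b ?R u)" and ?s = "%b u. cd b ?R (s*dc b ?X u)"
 have n: "natural C (yo ?R) (yo ?X) ?f" "natural C (yo ?R) (yo ?X) ?g" "natural C (yo ?X) (yo ?R) ?s"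
  using natural_yarr[of d] natural_yarr[of c] natural_yarr[of s] d by auto
 have X: "ob ?X" "ob ?R" using d by auto
 have sp: "?f b (?s b x) = x & ?g b (?s b x) = x" if "ob b" "x:fob (yo ?X) b" for b x
  using that d Cmp_reassoc1[OF d(8), of "dc b ?X x"] Cmp_reassoc1[OF d(9), of "dc b ?X x"] by simp
 obtain Q q where Q: "reflexive_coequaliser (yo ?R) (yo ?X) ?f ?g ?s Q q"
  using ex_reflexive_coequaliser[OF psh_yo[OF X(2)] psh_yo[OF X(1)] n sp] by blast
 have "Q:T" by (rule T_coeq[OF T_yo[OF X(2)] T_yo[OF X(1)] Q])
 moreover have "equivclp (step (yo ?R) ?f ?g b) x y <-> equivclp (arr_step d c b) (dc b ?X x) (dc b ?X y)"
  if b: "ob b" "x:fob (yo ?X) b" "y:fob (yo ?X) b" for b x y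
 proof
  assume "equivclp (step (yo ?R) ?f ?g b) x y"
  thus "equivclp (arr_step d c b) (dc b ?X x) (dc b ?X y)"
  proof (rule equivclp_map)
   fix x y assume "step (yo ?R) ?f ?g b x y"
   then obtain w where "w:fob (yo ?R) b" "x = ?f b w" "y = ?g b w" unfolding step_def by blast
   hence "arr_step d c b (dc b ?X x) (dc b ?X y)"
    unfolding arr_step_def using d b(1) by (intro exI[of _ "dc b ?R w"]) simp
   thus "equivclp (arr_step d c b) (dc b ?X x) (dc b ?X y)" by (rule equivclp_step)
  qed
 next
  assume "equivclp (arr_step d c b) (dc b ?X x) (dc b ?X y)"
  hence "equivclp (step (yo ?R) ?f ?g b) (cd b ?X (dc b ?X x)) (cd b ?X (dc b ?X y))"
  proof (rule equivclp_map)
   fix u v assume "arr_step d c b u v"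
   then obtain w where "arr w" "dom w = b" "cod w = ?R" "u = d*w" "v = c*w" unfolding arr_step_def by blast
   hence "step (yo ?R) ?f ?g b (cd b ?X u) (cd b ?X v)"
    unfolding step_def using b(1) by (intro bexI[of _ "cd b ?R w"]) simp_all
   thus "equivclp (step (yo ?R) ?f ?g b) (cd b ?X u) (cd b ?X v)" by (rule equivclp_step)
  qed
  thus "equivclp (step (yo ?R) ?f ?g b) x y" using b by simp
 qed
 ultimately show ?thesis using Q unfolding reflexive_coequaliser_def arr_quotient_def by (intro exI[of _ Q] exI[of _ q]) simp
qed

lemma arr_quotient_arrow:
 assumes aq: "arr_quotient d c Q q" and d: "arr d" and u: "univ Q z ta"
 shows "EX e. arr e & dom e = cod d & cod e = z &
  (ALL b:Ob C. ALL x:fob (yo (cod d)) b. ta b (q b x) = e*dc b (cod d) x)"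
proof -
 let ?X = "cod d"
 note Q = arr_quotientD[OF aq] and U = cnatD[OF univ_cnat[OF u]]
 have X: "ob ?X" using d by auto
 have i: "cd ?X ?X (idt ?X):fob (yo ?X) ?X" using X by simp
 define e where "e = ta ?X (q ?X (cd ?X ?X (idt ?X)))"
 have e: "arr e" "dom e = ?X" "cod e = z" using U naturalD(1)[OF Q(2) X i] X by (auto simp: e_def)
 have "ta b (q b x) = e*dc b ?X x" if b: "ob b" "x:fob (yo ?X) b" for b x
 proof -
  let ?u = "dc b ?X x"
  have "q b x = act Q ?u (q ?X (cd ?X ?X (idt ?X)))" using natural_yo_eq[OF Q(2) b(1) X b(2)] .
  thus ?thesis using U(5)[of ?u "q ?X (cd ?X ?X (idt ?X))"] b naturalD(1)[OF Q(2) X i] by (simp add: e_def)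
 qed
 thus ?thesis using e by blast
qed

text \<open>An arrow out of \<open>cod d\<close> that coequalises the pair descends to the pointwise
  quotient, hence to its reflection.\<close>

lemma reflexive_pair_coequaliser:
 assumes d: "arr d" "arr c" "dom d = dom c" "cod d = cod c" "arr s" "dom s = cod d" "cod s = dom d"
  "d*s = idt (cod d)" "c*s = idt (cod d)"
 shows "EX e. is_coequaliser C d c e"
proof -
 let ?X = "cod d" and ?R = "dom d"
 obtain Q q where aq: "arr_quotient d c Q q" using reflexive_pair_quotient[OF d] by blast
 note Q = arr_quotientD[OF aq]
 obtain z ta where u: "univ Q z ta" using T_univ[OF Q(1)] by blast
 note U = cnatD[OF univ_cnat[OF u]]
 have X: "ob ?X" "ob ?R" using d by auto
 have i: "cd ?X ?X (idt ?X):fob (yo ?X) ?X" using X by simp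
 obtain e where e: "arr e" "dom e = ?X" "cod e = z"
  and eu: "!!b x. ob b ==> x:fob (yo ?X) b ==> ta b (q b x) = e*dc b ?X x"
  using arr_quotient_arrow[OF aq d(1) u] by blast
 have "is_coequaliser C d c e"
 proof (rule coequaliserI)
  have x: "cd ?R ?X d:fob (yo ?X) ?R" "cd ?R ?X c:fob (yo ?X) ?R" using d by auto
  have "arr_step d c ?R d c" unfolding arr_step_def using d by (intro exI[of _ "idt ?R"]) simp
  hence "q ?R (cd ?R ?X d) = q ?R (cd ?R ?X c)" using Q(4)[OF X(2) x] d equivclp_step by (metis dc_cd)
  thus "e*d = e*c" using eu[OF X(2) x(1)] eu[OF X(2) x(2)] d by simp
 next
  fix h assume h: "arr h" "dom h = ?X" "h*d = h*c"
  have "EX k. natural C Q (yo (cod h)) k & (ALL b:Ob C. ALL x:fob (yo ?X) b. k b (q b x) = cd b (cod h) (h*dc b ?X x))"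
  proof (rule natural_descend[OF Q(2)])
   show "natural C (yo ?X) (yo (cod h)) (%b x. cd b (cod h) (h*dc b ?X x))" using natural_yarr[OF h(1)] h(2) by simp
   show "ALL b:Ob C. ALL x:fob (yo ?X) b. ALL y:fob (yo ?X) b. q b x = q b y --> cd b (cod h) (h*dc b ?X x) = cd b (cod h) (h*dc b ?X y)"
   proof (intro ballI impI)
    fix b x y assume b: "ob b" "x:fob (yo ?X) b" "y:fob (yo ?X) b" "q b x = q b y"
    hence "equivclp (arr_step d c b) (dc b ?X x) (dc b ?X y)" using Q(4) by blast
    moreover have "h*u = h*v" if st: "arr_step d c b u v" for u v
    proof -
     obtain w where w: "arr w" "cod w = ?R" "u = d*w" "v = c*w" using st unfolding arr_step_def by blast
     thus ?thesis using Cmp_reassoc[OF h(3), of w] h(1,2) d by simp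
    qed
    ultimately have "h*dc b ?X x = h*dc b ?X y" by (induction rule: equivclp_induct_step) auto
    thus "cd b (cod h) (h*dc b ?X x) = cd b (cod h) (h*dc b ?X y)" by simp
   qed
  qed (use Q(3) psh_yo[OF X(1)] in auto)
  then obtain k where k: "natural C Q (yo (cod h)) k" "!!b x. ob b ==> x:fob (yo ?X) b ==> k b (q b x) = cd b (cod h) (h*dc b ?X x)" by blast
  have "cnat Q (cod h) (%b x. dc b (cod h) (k b x))" using natural_cnat[OF T_psh[OF Q(1)] _ k(1)] h by simp
  from univ_lift[OF u this] obtain l where l: "arr l" "dom l = z" "cod l = cod h"
   "!!b x. ob b ==> x:fob Q b ==> l*ta b x = dc b (cod h) (k b x)" by metis
  have "l*e = h" using l(4)[OF X(1) naturalD(1)[OF Q(2) X(1) i]] k(2)[OF X(1) i] eu[OF X(1) i] h X e by simp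
  thus "EX k. arr k & dom k = cod e & cod k = cod h & k*e = h" using l e by (intro exI[of _ l]) simp
 next
  fix k k' assume k: "arr k" "arr k'" "dom k = cod e" "dom k' = cod e" "cod k = cod k'" "k*e = k'*e"
  show "k = k'"
  proof (rule univ_eq[OF u k(1,2) _ _ k(5)])
   fix b x assume b: "ob b" "x:fob Q b"
   then obtain y where y: "y:fob (yo ?X) b" "x = q b y" using Q(3) by blast
   show "k*ta b x = k'*ta b x"
    using Cmp_reassoc[OF k(6), of "dc b ?X y"] eu[OF b(1) y(1)] y k(1-4) e by simp
  qed (use k e in simp_all)
 qed (use d e in simp_all)
 thus ?thesis by blast
qed

text \<open>The pointwise image \<open>I\<close> of \<open>e\<close> reflects to
  \<open>cod e\<close>, so by the pullback axiom its pullback \<open>H\<close> along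
  \<open>g\<close> reflects to \<open>dom g\<close>. The elements of \<open>H\<close> are the arrows
  that factor through \<open>p\<close>. An arrow out of \<open>dom p\<close> that respects the
  kernel pair is therefore a map out of \<open>H\<close>, and descends.\<close>

lemma regular_epi_pullback:
 assumes e: "regular_epi C e" and pb: "is_pullback C g e p q"
 shows "regular_epi C p"
proof -
 note D = pullbackD[OF pb]
 let ?X = "dom e" and ?Y = "cod e" and ?Z = "dom g"
 have O: "ob ?X" "ob ?Y" "ob ?Z" using D by auto
 obtain I io where im: "image_in (yo ?X) (%b u. dc b ?X u) e I io"
  using univ_image[OF T_yo[OF O(1)] univ_yo[OF O(1)] e] by blast
 note I = image_inD(1,2,4,5)[OF im]
 \<comment> \<open>Since \<open>I\<close> reflects to all of \<open>cod e\<close>, the corresponding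
   pullback in \<open>C\<close> is the trivial one along the identity.\<close>
 have pbi: "is_pullback C g (idt ?Y) (idt ?Z) g"
  by (rule pullbackI) (use D O in auto)
 have uI: "univ I (dom (idt ?Y)) io" using I(2) O by simp
 obtain H p1 p2 th where hp: "yo_pullback (yo ?Z) (%b u. dc b ?Z u) g I io (idt ?Y) (idt ?Z) g H p1 p2 th"
  using T_pullback_yo[OF T_yo[OF O(3)] I(1) univ_yo[OF O(3)] uI pbi] by blast
 note H = yo_pullbackD(1-4)[OF hp] and Hth = yo_pullbackD(5)[OF hp] and Hex = yo_pullbackD(6)[OF hp]
 have uH: "univ H ?Z th" using H(4) O by simp
 note cth = cnatD[OF univ_cnat[OF uH]] and cI = cnatD[OF univ_cnat[OF I(2)]]
 have lift: "EX v. arr v & dom v = b & cod v = dom p & p*v = th b x" if b: "ob b" "x:fob H b" for b x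
 proof -
  obtain y where y: "y:fob (yo ?X) b" "io b (p2 b x) = e*dc b ?X y" using I(4)[OF b(1) naturalD(1)[OF H(3) b]] by blast
  have eq: "g*th b x = e*dc b ?X y" using Hth[OF b] y by simp
  show ?thesis using pullback_lift[OF pb _ _ _ _ _ eq] cth b y(1) by (metis dc_yo(1,2,3))
 qed
 have cover: "EX x:fob H b. th b x = p*v" if v: "arr v" "dom v = b" "cod v = dom p" for b v
 proof -
  have b: "ob b" using v by auto
  obtain z where z: "z:fob I b" "io b z = e*q*v" using I(3)[OF b, of "cd b ?X (q*v)"] v D by auto
  have "g*p*v = e*q*v" using pullback_comm[OF pb v(1,3)] .
  hence eq: "g*dc b ?Z (cd b ?Z (p*v)) = idt ?Y*io b z" using z v D(1-8) b cI by simp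
  have pv: "cd b ?Z (p*v):fob (yo ?Z) b" using v D(1-8) b by simp
  obtain x where "x:fob H b" "p1 b x = cd b ?Z (p*v)" using Hex[OF b pv z(1) eq] by blast
  thus ?thesis using Hth[OF b] cth b v D by (intro bexI[of _ x]) auto
 qed
 obtain k k' where kp: "is_pullback C p p k k'" using ex_pullback[OF D(3,3)] by blast
 note K = pullbackD[OF kp]
 have "is_coequaliser C k k' p"
 proof (rule coequaliserI)
  fix h assume h: "arr h" "dom h = cod k" "h*k = h*k'"
  have hv: "h*v = h*v'" if v: "arr v" "arr v'" "cod v = dom p" "cod v' = dom p" "p*v = p*v'" for v v'
  proof -
   have "dom v' = dom v" using Cmp_eqD(1)[OF v(5,1) D(3) v(2) D(3) v(3,4)] by simp
   from pullback_lift[OF kp v(1,2) this v(3,4,5)] obtain t where t: "arr t" "cod t = dom k" "k*t = v" "k'*t = v'" by metis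
   have "h*k*t = h*k'*t" using Cmp_reassoc[OF h(3), of t] h(1,2) K(1-8) t by simp
   thus ?thesis using t by simp
  qed
  obtain V where V: "!!b x. ob b ==> x:fob H b ==> arr (V b x) & dom (V b x) = b & cod (V b x) = dom p & p*V b x = th b x"
   using lift by metis
  have hC: "dom h = dom p" using h(2) K by simp
  have "cnat H (cod h) (%b x. h*V b x)"
   unfolding cnat_def
  proof (intro conjI ballI)
   fix f x assume f: "arr f" "x:fob H (cod f)"
   have fx: "act H f x:fob H (dom f)" using pshD(2)[OF T_psh[OF H(1)] f] .
   note V1 = V[OF Cod_Ob[OF f(1)] f(2)] and V2 = V[OF Dom_Ob[OF f(1)] fx]
   have "p*V (cod f) x*f = th (cod f) x*f" using Cmp_reassoc1[of p "V (cod f) x" _ f] V1 f D(3) by simp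
   hence "p*V (dom f) (act H f x) = p*V (cod f) x*f" using V2 cth(5)[OF f] by simp
   hence "h*V (dom f) (act H f x) = h*V (cod f) x*f" by (intro hv) (use V1 V2 f in simp_all)
   thus "h*V (dom f) (act H f x) = (h*V (cod f) x)*f" using V1 f h(1) hC by simp
  qed (use V h(1) hC in auto)
  from univ_lift[OF uH this] obtain l where l: "arr l" "dom l = ?Z" "cod l = cod h"
   "!!b x. ob b ==> x:fob H b ==> l*th b x = h*V b x" by metis
  let ?V = "dom p"
  have VO: "ob ?V" using D by simp
  \<comment> \<open>The element of \<open>H\<close> named by \<open>p\<close> itself: its chosen
    lift may differ from the identity, but \<open>h\<close> respects the kernel pair and does not
    see the difference.\<close>
  obtain x where x: "x:fob H ?V" "th ?V x = p*idt ?V" using cover[of "idt ?V" ?V] VO by auto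
  hence "th ?V x = p" using D by simp
  moreover have "h*V ?V x = h*idt ?V" by (rule hv) (use V[OF VO x(1)] x VO D(3) in simp_all)
  ultimately have "l*p = h" using l(4)[OF VO x(1)] h(1) hC by simp
  thus "EX k. arr k & dom k = cod p & cod k = cod h & k*p = h" using l D by auto
 next
  fix l l' assume l: "arr l" "arr l'" "dom l = cod p" "dom l' = cod p" "cod l = cod l'" "l*p = l'*p"
  show "l = l'"
  proof (rule univ_eq[OF uH l(1,2) _ _ l(5)])
   fix b x assume b: "ob b" "x:fob H b"
   obtain v where v: "arr v" "dom v = b" "cod v = dom p" "p*v = th b x" using lift[OF b] by blast
   show "l*th b x = l'*th b x" using Cmp_reassoc[OF l(6), of v] v l(1-4) D(3) by simp
  qed (use l D in simp_all)
 qed (use K D in simp_all)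
 thus ?thesis unfolding regular_epi_def by blast
qed

lemma regular_category_univ: "regular_category C"
 unfolding regular_category_def
proof (intro conjI allI impI fincomp)
 fix f k k' assume pb: "is_pullback C f f k k'"
 note D = pullbackD[OF pb]
 obtain s where s: "arr s" "dom s = dom f" "cod s = dom k" "k*s = idt (dom f)" "k'*s = idt (dom f)"
  using pullback_lift[OF pb, of "idt (dom f)" "idt (dom f)"] D by auto
 show "EX e. is_coequaliser C k k' e" by (rule reflexive_pair_coequaliser[of k k' s]) (use D s in simp_all)
qed (use regular_epi_pullback in blast)

end

section \<open>Relations and zigzag chains\<close>

context category
begin

lemma relationD:
 assumes "relation_on C X P p q r"
 shows "arr p" "arr q" "arr r" "dom p = P" "dom q = P" "cod p = X" "cod q = X" "cod r = P"
  "monic C r" "is_product C X X P p q"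
 using assms productD[of X X P p q] monicD[of r] unfolding relation_on_def by auto

lemma relation_cancel:
 assumes rel: "relation_on C X P p q r" and w: "arr w" "arr w'" "cod w = dom r" "cod w' = dom r"
  and eq: "p*r*w = p*r*w'" "q*r*w = q*r*w'"
 shows "w = w'"
proof -
 note R = relationD[OF rel]
 have "r*w = r*w'" by (rule product_unique[OF R(10)]) (use R(1-8) w eq in simp_all)
 thus ?thesis using monic_cancel[OF R(9) w] by blast
qed

text \<open>On generalised elements the composite contains every composable pair outright; passing
  back from the composite to such a pair takes a cover by the regular epimorphism.\<close>

lemma composite_lift:
 assumes co: "composite_relation C X P p q r s t"
  and f: "f:hom Z (dom r)" "g:hom Z (dom s)" and eq: "q*r*f = p*s*g"
 shows "EX h:hom Z (dom t). p*t*h = p*r*f & q*t*h = q*s*g"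
proof -
 have rel: "relation_on C X P p q r" "relation_on C X P p q s" "relation_on C X P p q t" using co unfolding composite_relation_def by blast+
 note R = relationD[OF rel(1)] and S = relationD[OF rel(2)] and T = relationD[OF rel(3)]
 obtain a b e where pb: "is_pullback C (q*r) (p*s) a b" and e: "arr e" "dom e = dom a" "cod e = dom t"
  and te: "(p*t)*e = (p*r)*a" "(q*t)*e = (q*s)*b"
  using co unfolding composite_relation_def by auto
 have F: "arr f" "arr g" "dom f = Z" "dom g = Z" "cod f = dom r" "cod g = dom s" using f by auto
 obtain h where h: "arr h" "dom h = Z" "cod h = dom a" "a*h = f" "b*h = g"
  using pullback_lift[OF pb F(1,2)] F R S eq by auto
 note D = pullbackD[OF pb]
 have "p*t*e*h = p*r*a*h"
  using Cmp_reassoc[OF te(1), of h] e h(1-3) D(1-8) R(1-8) S(1-8) T(1-8) by simp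
 moreover have "q*t*e*h = q*s*b*h"
  using Cmp_reassoc[OF te(2), of h] e h(1-3) D(1-8) R(1-8) S(1-8) T(1-8) by simp
 ultimately show ?thesis using h e by (intro bexI[of _ "e*h"]) auto
qed

lemma reflexiveD:
 assumes "reflexive_relation C X P p q r"
 obtains s where "arr s" "dom s = X" "cod s = dom r" "p*r*s = idt X" "q*r*s = idt X" "relation_on C X P p q r" "ob X"
proof -
 have rel: "relation_on C X P p q r" using assms unfolding reflexive_relation_def by blast
 note R = relationD[OF rel]
 obtain s where "s:hom X (dom r)" "(p*r)*s = idt X" "(q*r)*s = idt X"
  using assms unfolding reflexive_relation_def by blast
 thus thesis using that[of s] R(1-8) rel Cod_Ob[OF R(1)] by simp
qed

lemma inclusion_eq:
 assumes "monic C u" "i:hom (dom m) (dom u)" "u*i = m"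
 shows "inclusion C m u = i"
 unfolding inclusion_def
proof (rule the_equality)
 fix k assume "k:hom (dom m) (dom u) & u*k = m"
 thus "k = i" using monic_cancel[OF assms(1), of k i] assms(2,3) by simp
qed (use assms in simp)

lemma inclusionD:
 assumes "monic C u" "subobject_le C m u"
 shows "inclusion C m u:hom (dom m) (dom u)" "u*inclusion C m u = m"
proof -
 obtain i where i: "i:hom (dom m) (dom u)" "u*i = m" using assms(2) unfolding subobject_le_def by blast
 thus "inclusion C m u:hom (dom m) (dom u)" "u*inclusion C m u = m" using inclusion_eq[OF assms(1) i] by simp_all
qed

lemma zigzag_relation:
 assumes "zigzag_chain C X P p q r m" shows "relation_on C X P p q (m n)"
 using assms unfolding zigzag_chain_def composite_relation_def by (cases n) auto

lemma zigzag_transition: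
 assumes re: "reflexive_relation C X P p q r" and zz: "zigzag_chain C X P p q r m"
 shows "transition C m n:hom (dom (m n)) (dom (m (Suc n)))" "m (Suc n)*transition C m n = m n"
proof -
 obtain z where z: "arr z" "dom z = X" "cod z = dom r" "p*r*z = idt X" "q*r*z = idt X"
  and rel: "relation_on C X P p q r" and X: "ob X" by (rule reflexiveD[OF re])
 obtain r' s where op: "opposite_relation C X P p q r r'" and s: "composite_relation C X P p q r r' s"
  and c: "!!n. composite_relation C X P p q s (m n) (m (Suc n))"
  using zz unfolding zigzag_chain_def by blast
 have r': "dom r' = dom r" "p*r' = q*r" "q*r' = p*r" "relation_on C X P p q r'" using op unfolding opposite_relation_def by auto
 note R = relationD[OF rel] and R' = relationD[OF r'(4)]
 have z': "p*r'*z = idt X" "q*r'*z = idt X"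
  using Cmp_reassoc[OF r'(2), of z] Cmp_reassoc[OF r'(3), of z] z R(1-8) R'(1-8) r'(1) by simp_all
 \<comment> \<open>The relation \<open>RR^o\<close> is reflexive, so composing with it enlarges each
   member of the chain.\<close>
 obtain y where y: "y:hom X (dom s)" "p*s*y = idt X" "q*s*y = idt X"
  using composite_lift[OF s, of z X z] z z' r'(1) by auto
 note M = relationD[OF zigzag_relation[OF zz, of n]] and MS = relationD[OF zigzag_relation[OF zz, of "Suc n"]]
 have rs: "relation_on C X P p q s" using s unfolding composite_relation_def by blast
 note S = relationD[OF rs]
 have ya: "arr y" "dom y = X" "cod y = dom s" using y(1) by auto
 let ?f = "p*m n" and ?i = "idt (dom (m n))"
 have e1: "q*s*y*?f = ?f" "p*s*y*?f = ?f"
 proof -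
  have "(q*s*y)*?f = ?f" "(p*s*y)*?f = ?f" unfolding y(2,3) using M(1-8) by simp_all
  thus "q*s*y*?f = ?f" "p*s*y*?f = ?f" using M(1-8) S(1-8) ya by simp_all
 qed
 obtain h where h: "h:hom (dom (m n)) (dom (m (Suc n)))" "p*m (Suc n)*h = ?f" "q*m (Suc n)*h = q*m n"
  using composite_lift[OF c[of n], of "y*?f" "dom (m n)" ?i] M(1-8) ya e1 by auto
 have "m (Suc n)*h = m n"
  by (rule product_unique[OF M(10)]) (use h M(1-8) MS(1-8) in auto)
 hence "transition C m n = h & m (Suc n)*h = m n"
  unfolding transition_def using inclusion_eq[OF MS(9) h(1)] by blast
 thus "transition C m n:hom (dom (m n)) (dom (m (Suc n)))" "m (Suc n)*transition C m n = m n"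
  using h(1) by auto
qed

lemma chain_map:
 assumes i: "!!n. i n:hom (A n) (A (Suc n))" and nk: "n <= k" and A: "!!n. ob (A n)"
 shows "EX h:hom (A n) (A k). ALL Z j. is_chain_cocone C A i Z j --> j k*h = j n"
 using nk
proof (induction k rule: dec_induct)
 case base
 show ?case using A by (intro bexI[of _ "idt (A n)"]) (auto simp: is_chain_cocone_def)
next
 case (step k)
 then obtain h where h: "h:hom (A n) (A k)" "!!Z j. is_chain_cocone C A i Z j ==> j k*h = j n" by blast
 have "j (Suc k)*i k*h = j n" if c: "is_chain_cocone C A i Z j" for Z j
  using Cmp_reassoc1[of "j (Suc k)" "i k" "j k" h] c h i[of k] h(2)[OF c] unfolding is_chain_cocone_def by simp
 thus ?case using h i[of k] by (intro bexI[of _ "i k*h"]) auto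
qed

text \<open>Both arrows are moved to the later of the two stages, where monicity of \<open>m\<close>
  makes them equal; any cocone then identifies them.\<close>

lemma monic_chain_eq:
 assumes c: "is_chain_cocone C A i P m" and mono: "!!n. monic C (m n)" and c': "is_chain_cocone C A i Z j"
  and x: "arr x" "cod x = A n" "arr y" "cod y = A k" and eq: "m n*x = m k*y"
 shows "j n*x = j k*y"
proof -
 have i: "!!n. i n:hom (A n) (A (Suc n))" and jA: "!!n. j n:hom (A n) Z" and mA: "!!n. m n:hom (A n) P"
  using c c' unfolding is_chain_cocone_def by blast+
 have A: "ob (A n)" for n using i[of n] Dom_Ob[of "i n"] by simp
 have *: "j n*x = j k*y" if nk: "n <= k" and x: "arr x" "cod x = A n" "arr y" "cod y = A k" and eq: "m n*x = m k*y" for n k x y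
 proof -
  obtain h where h: "h:hom (A n) (A k)" "m k*h = m n" "j k*h = j n"
   using chain_map[where i=i and A=A, OF i nk A] c c' by blast
  have H: "arr h" "dom h = A n" "cod h = A k" "arr (m k)" "dom (m k) = A k" "arr (j k)" "dom (j k) = A k"
   using h(1) mA[of k] jA[of k] by auto
  have "m k*h*x = m k*y" using Cmp_reassoc1[OF h(2), of x] H x eq by simp
  hence "h*x = y" using monic_cancel[OF mono[of k], of "h*x" y] H x by simp
  moreover have "j k*h*x = j n*x" using Cmp_reassoc1[OF h(3), of x] H x by simp
  ultimately show ?thesis by simp
 qed
 show ?thesis
 proof (cases "n <= k")
  case True thus ?thesis using * x eq by blast
 next
  case False thus ?thesis using *[of k n y x] x eq by simp
 qed
qed

end

context lex_loc_small
begin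

text \<open>Every element of \<open>F\<close> factors through some stage, and as the legs are monic
  a cocone \<open>h\<close> takes a well-defined value on it. This is a map out of \<open>F\<close>,
  hence an arrow out of its reflection \<open>t\<close>. The presheaves \<open>G n\<close> serve to
  test equations on \<open>A n\<close>.\<close>

lemma chain_colimit_univ:
 assumes c: "is_chain_cocone C A i t j" and mono: "!!n. monic C (j n)"
  and F: "psh F" and u: "univ F t th" and un: "!!n. univ (G n) (A n) (ep n)"
  and sub: "!!n b x. ob b ==> x:fob (G n) b ==> EX y:fob F b. th b y = j n*ep n b x"
  and cov: "!!b y. ob b ==> y:fob F b ==> EX n a. arr a & cod a = A n & th b y = j n*a"
 shows "is_chain_colimit C A i t j"
 unfolding is_chain_colimit_def
proof (intro conjI c allI impI)
 fix Z h assume c': "is_chain_cocone C A i Z h"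
 have jA: "arr (j n)" "dom (j n) = A n" "cod (j n) = t" "arr (h n)" "dom (h n) = A n" "cod (h n) = Z" for n
  using c c' unfolding is_chain_cocone_def by auto
 note D = cnatD[OF univ_cnat[OF u]]
 define si where "si b y = (SOME s. EX n a. arr a & cod a = A n & th b y = j n*a & s = h n*a)" for b y
 have si: "si b y = h n*a" if b: "ob b" "y:fob F b" "arr a" "cod a = A n" "th b y = j n*a" for b y n a
 proof -
  have "EX n a. arr a & cod a = A n & th b y = j n*a & si b y = h n*a"
   unfolding si_def by (rule someI_ex) (use b in blast)
  thus ?thesis using monic_chain_eq[OF c mono c'] b by metis
 qed
 have si': "EX n a. arr a & cod a = A n & dom a = b & th b y = j n*a & si b y = h n*a" if b: "ob b" "y:fob F b" for b y
 proof -
  obtain n a where a: "arr a" "cod a = A n" "th b y = j n*a" using cov[OF b] by blast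
  hence "dom a = b" using D(3)[OF b] jA by simp
  thus ?thesis using si[OF b a] a by blast
 qed
 have "cnat F Z si"
  unfolding cnat_def
 proof (intro conjI ballI)
  fix f y assume f: "arr f" "y:fob F (cod f)"
  obtain n a where a: "arr a" "cod a = A n" "dom a = cod f" "th (cod f) y = j n*a" "si (cod f) y = h n*a"
   using si'[OF Cod_Ob[OF f(1)] f(2)] by blast
  have "th (dom f) (act F f y) = j n*a*f" using D(5)[OF f] a f(1) jA by simp
  moreover have "act F f y:fob F (dom f)" using pshD(2)[OF F f] .
  ultimately show "si (dom f) (act F f y) = si (cod f) y*f"
   using si[of "dom f" "act F f y" "a*f" n] a f(1) jA by simp
 next
  fix b y assume "ob b" "y:fob F b"
  thus "arr (si b y)" "dom (si b y) = b" "cod (si b y) = Z" using si'[of b y] jA by auto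
 qed (use jA(4,6)[of 0] in auto)
 from univ_lift[OF u this] obtain g where g: "arr g" "dom g = t" "cod g = Z"
  "!!b x. ob b ==> x:fob F b ==> g*th b x = si b x" by metis
 have gj: "g*j n = h n" for n
 proof (rule univ_eq[OF un])
  fix b x assume b: "ob b" "x:fob (G n) b"
  note En = cnatD[OF univ_cnat[OF un[of n]]]
  obtain y where y: "y:fob F b" "th b y = j n*ep n b x" using sub[OF b] by blast
  hence "si b y = h n*ep n b x" using si En b by blast
  thus "(g*j n)*ep n b x = h n*ep n b x" using g(4)[OF b(1) y(1)] y(2) g(1,2) jA En b by simp
 qed (use g jA in simp_all)
 show "EX! g. g:hom t Z & (ALL n. g*j n = h n)"
 proof (rule ex1I[of _ g])
  fix g' assume g': "g':hom t Z & (ALL n. g'*j n = h n)"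
  show "g' = g"
  proof (rule univ_eq[OF u])
   fix b y assume "ob b" "y:fob F b"
   then obtain n a where a: "arr a" "cod a = A n" "th b y = j n*a" using cov by blast
   have "g'*j n = g*j n" using g' gj by simp
   hence "g'*j n*a = g*j n*a" using Cmp_reassoc[of g' "j n" g "j n" a] g' g(1,2) jA a by simp
   thus "g'*th b y = g*th b y" using a by simp
  qed (use g' g in auto)
 qed (use g gj in auto)
qed

end

section \<open>Exactness implies stable zigzag colimits\<close>

context category
begin

text \<open>The words \<open>R\<close>, \<open>RR^oR\<close>, ... composed pointwise on generalised
  elements: each successor prepends one step forwards and one step backwards, both through the same
  \<open>y'\<close>.\<close>

primrec zz :: "'a => 'a => nat => 'o => 'a => 'a => bool" where
 "zz d c 0 b u v = arr_step d c b u v"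
| "zz d c (Suc n) b u v = (EX y. (EX y'. arr_step d c b u y' & arr_step d c b y y') & zz d c n b y v)"

lemma zz_equivclp: "zz d c n b u v ==> equivclp (arr_step d c b) u v"
proof (induction n arbitrary: u)
 case (Suc n)
 then obtain y y' where "arr_step d c b u y'" "arr_step d c b y y'" "zz d c n b y v" by auto
 hence "equivclp (arr_step d c b) u y'" "equivclp (arr_step d c b) y' y" "equivclp (arr_step d c b) y v"
  using Suc.IH equivclp_step equivclp_sym[OF equivclp_step] by blast+
 thus ?case by (blast intro: equivclp_trans)
qed (simp add: equivclp_step)

text \<open>Reflexivity pads a single step in either direction to a full \<open>RR^o\<close>, so
  every zigzag acquires the standard shape. The induction extends the zigzag at its far end while
  \<open>zz\<close> grows at its front, whence the exchanged arguments.\<close>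

lemma equivclp_zz:
 assumes dz: "arr d" "arr c" "dom d = dom c" "cod d = cod c" "arr z" "dom z = cod d" "cod z = dom d"
  "d*z = idt (cod d)" "c*z = idt (cod d)"
  and v: "v:hom b (cod d)" and e: "equivclp (arr_step d c b) v u"
 shows "EX n. zz d c n b u v"
proof -
 have rf: "arr_step d c b y y" if "y:hom b (cod d)" for y
 proof -
  have "d*z*y = y" "c*z*y = y"
   using Cmp_reassoc1[OF dz(8), of y] Cmp_reassoc1[OF dz(9), of y] that dz(1-7) by simp_all
  thus ?thesis unfolding arr_step_def using that dz(1-7) by (intro exI[of _ "z*y"]) simp
 qed
 have hom: "x:hom b (cod d)" "y:hom b (cod d)" if "arr_step d c b x y" for x y
  using that dz(1-4) unfolding arr_step_def by auto
 from e show ?thesis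
 proof (induction rule: equivclp_induct_step)
  case refl
  show ?case using rf[OF v] by (intro exI[of _ 0]) simp
 next
  case (forward y y')
  then obtain n where "zz d c n b y v" by blast
  hence "zz d c (Suc n) b y' v" using forward(1) rf[OF hom(2)[OF forward(1)]] by auto
  thus ?case by blast
 next
  case (backward y y')
  then obtain n where "zz d c n b y v" by blast
  hence "zz d c (Suc n) b y' v" using backward(1) rf[OF hom(2)[OF backward(1)]] by auto
  thus ?case by blast
 qed
qed

end

context univ_class
begin

text \<open>\<open>N\<close> is the pointwise kernel pair of the quotient, that is, the equivalence
  relation generated by the pair on generalised elements; its reflection is the kernel pair of
  \<open>e\<close> in \<open>C\<close>.\<close>

definition kernel_rep where
 "kernel_rep d c e k k' N th <-> is_pullback C e e k k' & dom e = cod d & N:T & univ N (dom k) th &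
  (ALL b:Ob C. ALL u:hom b (cod d). ALL v:hom b (cod d).
   equivclp (arr_step d c b) u v <-> (EX x:fob N b. k*th b x = u & k'*th b x = v))"

lemma kernel_repD:
 assumes "kernel_rep d c e k k' N th"
 shows "is_pullback C e e k k'" "dom e = cod d" "N:T" "univ N (dom k) th"
  "!!b u v. ob b ==> u:hom b (cod d) ==> v:hom b (cod d) ==>
   equivclp (arr_step d c b) u v <-> (EX x:fob N b. k*th b x = u & k'*th b x = v)"
 using assms unfolding kernel_rep_def by blast+

text \<open>The pullback axiom is applied to the pointwise quotient map against itself, with the
  arrow \<open>e\<close> induced on reflections.\<close>

lemma ex_kernel_rep:
 assumes d: "arr d" "arr c" "dom d = dom c" "cod d = cod c" "arr s" "dom s = cod d" "cod s = dom d"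
  "d*s = idt (cod d)" "c*s = idt (cod d)"
 shows "EX e k k' N th. kernel_rep d c e k k' N th"
proof -
 let ?X = "cod d"
 obtain Q q where aq: "arr_quotient d c Q q" using reflexive_pair_quotient[OF d] by blast
 note Q = arr_quotientD[OF aq]
 obtain z ta where u: "univ Q z ta" using T_univ[OF Q(1)] by blast
 have X: "ob ?X" using d by auto
 obtain e where e: "arr e" "dom e = ?X" "cod e = z"
  and eu: "ALL b:Ob C. ALL x:fob (yo ?X) b. ta b (q b x) = e*dc b ?X x"
  using arr_quotient_arrow[OF aq d(1) u] by blast
 obtain k k' where pb: "is_pullback C e e k k'" using ex_pullback[OF e(1,1)] by blast
 note D = pullbackD[OF pb]
 have ev: "ALL b:Ob C. ALL x:fob (yo ?X) b. e*dc b ?X x = ta b (q b x)" using eu by simp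
 obtain N p1 p2 th where N: "N:T" "el_pullback (yo ?X) (yo ?X) q q N p1 p2" "univ N (dom k) th"
  "!!b x. ob b ==> x:fob N b ==> k*th b x = dc b ?X (p1 b x) & k'*th b x = dc b ?X (p2 b x)"
  using T_pullback[OF T_yo[OF X] T_yo[OF X] Q(1,2,2) univ_yo[OF X] univ_yo[OF X] u pb e(2,2,3) ev ev] by blast
 have "equivclp (arr_step d c b) u v <-> (EX x:fob N b. k*th b x = u & k'*th b x = v)"
  if b: "ob b" "u:hom b ?X" "v:hom b ?X" for b u v
 proof -
  let ?u = "cd b ?X u" and ?v = "cd b ?X v"
  have uv: "?u:fob (yo ?X) b" "?v:fob (yo ?X) b" "dc b ?X ?u = u" "dc b ?X ?v = v" using b by auto
  have "equivclp (arr_step d c b) u v <-> q b ?u = q b ?v" using Q(4)[OF b(1) uv(1,2)] uv by simp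
  also have "... <-> (EX x:fob N b. p1 b x = ?u & p2 b x = ?v)" using N(2) b(1) uv(1,2) unfolding el_pullback_def by metis
  also have "... <-> (EX x:fob N b. k*th b x = u & k'*th b x = v)"
  proof (intro bex_cong refl)
   fix x assume x: "x:fob N b"
   have "p1 b x:fob (yo ?X) b" "p2 b x:fob (yo ?X) b"
    using N(2) naturalD(1)[of C N "yo ?X" p1 b x] naturalD(1)[of C N "yo ?X" p2 b x] b(1) x unfolding el_pullback_def by auto
   thus "p1 b x = ?u & p2 b x = ?v <-> k*th b x = u & k'*th b x = v"
    using N(4)[OF b(1) x] dc_inj uv by metis
  qed
  finally show ?thesis .
 qed
 thus ?thesis unfolding kernel_rep_def using pb e N(1,3) by blast
qed

lemma arr_step_equivalence:
 assumes eq: "equivalence_relation C X P p q r" and u: "u:hom b X" and e: "equivclp (arr_step (p*r) (q*r) b) u v"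
 shows "arr_step (p*r) (q*r) b u v"
proof -
 have re: "reflexive_relation C X P p q r" and sy: "symmetric_relation C X P p q r" and tr: "transitive_relation C X P p q r"
  using eq unfolding equivalence_relation_def by auto
 obtain z where z: "arr z" "dom z = X" "cod z = dom r" "p*r*z = idt X" "q*r*z = idt X"
  and rel: "relation_on C X P p q r" and X: "ob X" by (rule reflexiveD[OF re])
 note R = relationD[OF rel]
 let ?d = "p*r" and ?c = "q*r"
 have dc: "arr ?d" "arr ?c" "dom ?d = dom r" "dom ?c = dom r" "cod ?d = X" "cod ?c = X" using R(1-8) by simp_all
 have dz: "?d*z = idt X" "?c*z = idt X" using z R(1-8) by simp_all
 obtain s where s: "arr s" "dom s = dom r" "cod s = dom r" "?d*s = ?c" "?c*s = ?d"
  using sy unfolding symmetric_relation_def by auto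
 have sym: "arr_step ?d ?c b y x" if "arr_step ?d ?c b x y" for x y
 proof -
  obtain w where w: "arr w" "dom w = b" "cod w = dom r" "x = ?d*w" "y = ?c*w" using \<open>arr_step ?d ?c b x y\<close> dc(3) unfolding arr_step_def by metis
  have "?d*s*w = ?c*w" "?c*s*w = ?d*w"
   using Cmp_reassoc1[OF s(4), of w] Cmp_reassoc1[OF s(5), of w] s(1-3) w(1-3) dc by metis+
  thus ?thesis unfolding arr_step_def using s(1-3) w dc(3) by (intro exI[of _ "s*w"]) simp
 qed
 have trans: "arr_step ?d ?c b x x'" if xy: "arr_step ?d ?c b x y" "arr_step ?d ?c b y x'" for x y x'
 proof -
  obtain w where w: "arr w" "dom w = b" "cod w = dom r" "x = ?d*w" "y = ?c*w" using xy(1) dc(3) unfolding arr_step_def by metis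
  obtain v where v: "arr v" "dom v = b" "cod v = dom r" "y = ?d*v" "x' = ?c*v" using xy(2) dc(3) unfolding arr_step_def by metis
  obtain f g where pb: "is_pullback C ?c ?d f g" using ex_pullback[OF dc(2,1)] dc by metis
  note D = pullbackD[OF pb]
  obtain t where t: "arr t" "dom t = dom f" "cod t = dom r" "?d*t = ?d*f" "?c*t = ?c*g"
  proof -
   have "EX t:hom (dom f) (dom r). ?d*t = ?d*f & ?c*t = ?c*g" using tr pb unfolding transitive_relation_def by blast
   thus thesis using that by (auto simp: simp del: assoc)
  qed
  have "?c*w = ?d*v" using w v by simp
  then obtain h where h: "arr h" "dom h = b" "cod h = dom f" "f*h = w" "g*h = v"
   using pullback_lift[OF pb w(1) v(1)] w v dc by metis
  have "?d*t*h = ?d*f*h" by (rule Cmp_reassoc[OF t(4)]) (use t(1-3) h(1-3) dc D(1-8) in metis)+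
  moreover have "?c*t*h = ?c*g*h" by (rule Cmp_reassoc[OF t(5)]) (use t(1-3) h(1-3) dc D(1-8) in metis)+
  ultimately show ?thesis unfolding arr_step_def using t(1-3) h w v dc(3) by (intro exI[of _ "t*h"]) simp
 qed
 from e show ?thesis
 proof (induction rule: equivclp_induct_step)
  case refl
  have "?d*z*u = u" "?c*z*u = u"
   using Cmp_reassoc1[OF dz(1), of u] Cmp_reassoc1[OF dz(2), of u] u z(1-3) dc by (simp_all add: Hom_iff del: assoc)
  thus ?case unfolding arr_step_def using u z(1-3) dc(3) by (intro exI[of _ "z*u"]) simp
 qed (use sym trans in blast)+
qed

text \<open>An equivalence relation generates nothing beyond itself, so each element of
  \<open>N\<close> names a unique arrow into \<open>dom r\<close>. Universality turns this into an
  arrow from the kernel pair of \<open>e\<close> to \<open>dom r\<close>, which identifies the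
  two.\<close>

lemma equivalence_kernel_pair:
 assumes eq: "equivalence_relation C X P p q r"
 shows "EX f. is_pullback C f f (p*r) (q*r)"
proof -
 obtain z where z: "arr z" "dom z = X" "cod z = dom r" "p*r*z = idt X" "q*r*z = idt X"
  and rel: "relation_on C X P p q r" and X: "ob X" by (rule reflexiveD) (use eq in \<open>auto simp: equivalence_relation_def\<close>)
 note R = relationD[OF rel]
 let ?d = "p*r" and ?c = "q*r"
 have dc: "arr ?d" "arr ?c" "dom ?d = dom r" "dom ?c = dom r" "cod ?d = X" "cod ?c = X" using R(1-8) by simp_all
 have dz: "?d*z = idt X" "?c*z = idt X" using z R(1-8) by simp_all
 obtain e k k' N th where ker: "kernel_rep ?d ?c e k k' N th"
  using ex_kernel_rep[of ?d ?c z] dc dz z(1-3) by metis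
 note K = kernel_repD[OF ker]
 have eX: "dom e = X" using K(2) dc by simp
 note D = pullbackD[OF K(1)] and N = cnatD[OF univ_cnat[OF K(4)]]
 note KX = K(5)[unfolded dc(5)]
 have joint: "w = w'" if "arr w" "arr w'" "cod w = dom r" "cod w' = dom r" "?d*w = ?d*w'" "?c*w = ?c*w'" for w w'
  by (rule relation_cancel[OF rel]) (use that R(1-8) in simp_all)
 have kt: "k*th b x:hom b X" "k'*th b x:hom b X" if "ob b" "x:fob N b" for b x
  using that N D(1-8) eX by simp_all
 have "EX w. arr w & dom w = b & cod w = dom r & k*th b x = ?d*w & k'*th b x = ?c*w" if b: "ob b" "x:fob N b" for b x
 proof -
  have "equivclp (arr_step ?d ?c b) (k*th b x) (k'*th b x)" using KX[OF b(1) kt[OF b]] b(2) by blast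
  hence "arr_step ?d ?c b (k*th b x) (k'*th b x)" by (rule arr_step_equivalence[OF eq kt(1)[OF b]])
  thus ?thesis unfolding arr_step_def dc(3) .
 qed
 then obtain ps where ps: "!!b x. ob b ==> x:fob N b ==>arr (
  ps b x) & dom (ps b x) = b & cod (ps b x) = dom r & k*th b x = ?d*ps b x & k'*th b x = ?c*ps b x" by metis
 have "cnat N (dom r) ps"
  unfolding cnat_def
 proof (intro conjI ballI)
  fix f x assume f: "arr f" "x:fob N (cod f)"
  have fx: "act N f x:fob N (dom f)" using pshD(2)[OF T_psh[OF K(3)] f] .
  note V1 = ps[OF Cod_Ob[OF f(1)] f(2)] and V2 = ps[OF Dom_Ob[OF f(1)] fx]
  have ass: "?d*ps (cod f) x*f = (k*th (cod f) x)*f" "?c*ps (cod f) x*f = (k'*th (cod f) x)*f"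
   using V1 f dc assoc by metis+
  show "ps (dom f) (act N f x) = ps (cod f) x*f"
  proof (rule joint)
   show "?d*ps (dom f) (act N f x) = ?d*ps (cod f) x*f"
    using V2 ass(1) N(5)[OF f] N(2-4)[OF Cod_Ob[OF f(1)] f(2)] f(1) D(1-8) by (metis assoc)
   show "?c*ps (dom f) (act N f x) = ?c*ps (cod f) x*f"
    using V2 ass(2) N(5)[OF f] N(2-4)[OF Cod_Ob[OF f(1)] f(2)] f(1) D(1-8) by (metis assoc)
  qed (use V1 V2 f in auto)
 qed (use ps R(3) in auto)
 from univ_lift[OF K(4) this] obtain m where m: "arr m" "dom m = dom k" "cod m = dom r"
  "!!b x. ob b ==> x:fob N b ==> m*th b x = ps b x" by metis
 have km: "?d*m = k" "?c*m = k'"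
 proof -
  show "?d*m = k"
  proof (rule univ_eq[OF K(4)])
   fix b x assume b: "ob b" "x:fob N b"
   thus "(?d*m)*th b x = k*th b x" using m ps[OF b] N dc by (metis assoc)
  qed (use m dc D(1-8) eX in simp_all)
  show "?c*m = k'"
  proof (rule univ_eq[OF K(4)])
   fix b x assume b: "ob b" "x:fob N b"
   thus "(?c*m)*th b x = k'*th b x" using m ps[OF b] N dc by (metis assoc)
  qed (use m dc D(1-8) eX in simp_all)
 qed
 have RO: "ob (dom r)" using R(3) by simp
 have "is_pullback C e e ?d ?c"
 proof (rule pullbackI[OF D(1,1) dc(1,2)])
  have "arr_step ?d ?c (dom r) ?d ?c" unfolding arr_step_def using dc RO by (intro exI[of _ "idt (dom r)"]) simp
  hence "equivclp (arr_step ?d ?c (dom r)) ?d ?c" by (rule equivclp_step)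
  then obtain x where x: "x:fob N (dom r)" "k*th (dom r) x = ?d" "k'*th (dom r) x = ?c"
   using KX[OF RO, of ?d ?c] dc by auto
  thus "e*?d = e*?c" using pullback_comm[OF K(1), of "th (dom r) x"] N RO by metis
 next
  fix a b assume a: "arr a" "arr b" "dom b = dom a" "cod a = dom e" "cod b = dom e" "e*a = e*b"
  obtain h where h: "arr h" "dom h = dom a" "cod h = dom k" "k*h = a" "k'*h = b" using pullback_lift[OF K(1) a] by metis
  have "?d*m*h = a" "?c*m*h = b"
   using Cmp_reassoc1[OF km(1), of h] Cmp_reassoc1[OF km(2), of h] h m dc by metis+
  thus "EX h. arr h & dom h = dom a & cod h = dom ?d & ?d*h = a & ?c*h = b"
   using h m dc(3) by (intro exI[of _ "m*h"]) simp
 next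
  fix h l assume "arr h" "arr l" "cod h = dom ?d" "cod l = dom ?d" "?d*h = ?d*l" "?c*h = ?c*l"
  thus "h = l" using joint dc(3) by metis
 qed (use dc eX in metis)+
 thus ?thesis by blast
qed

lemma Barr_exact_univ: "Barr_exact C"
 unfolding Barr_exact_def using regular_category_univ equivalence_kernel_pair by blast

text \<open>\<open>A\<close> consists of generalised elements of \<open>t\<close> that realise the
  relation \<open>rh\<close>, and reflects to \<open>dom t\<close>. In general \<open>rh\<close> is
  smaller than the relation given by all generalised elements of \<open>t\<close>.\<close>

definition rel_rep where
 "rel_rep p q t A al rh <-> A:T & univ A (dom t) al &
  (ALL b:Ob C. ALL u v. (EX x:fob A b. p*t*al b x = u & q*t*al b x = v) <-> rh b u v)"

lemma rel_repD:
 assumes "rel_rep p q t A al rh"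
 shows "A:T" "univ A (dom t) al" "!!b u v. ob b ==> rh b u v <-> (EX x:fob A b. p*t*al b x = u & q*t*al b x = v)"
 using assms unfolding rel_rep_def by blast+

text \<open>The composite in \<open>C\<close> is the image of a pullback, and the pointwise
  composite is the pointwise image of the pointwise pullback; the reflection respects both
  operations.\<close>

lemma composite_rep:
 assumes co: "composite_relation C X P p q r s t" and A: "rel_rep p q r A al rh" and B: "rel_rep p q s B bt si"
 shows "EX E ep. rel_rep p q t E ep (%b u v. EX y. rh b u y & si b y v)"
proof -
 have rel: "relation_on C X P p q r" "relation_on C X P p q s" "relation_on C X P p q t" using co unfolding composite_relation_def by blast+
 note R = relationD[OF rel(1)] and S = relationD[OF rel(2)] and Tr = relationD[OF rel(3)]
 obtain f g e where pb: "is_pullback C (q*r) (p*s) f g" and e: "arr e" "dom e = dom f" "cod e = dom t" "regular_epi C e"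
  and te: "(p*t)*e = (p*r)*f" "(q*t)*e = (q*s)*g"
  using co unfolding composite_relation_def by auto
 note A = rel_repD[OF A] and B = rel_repD[OF B] and D = pullbackD[OF pb]
 have fg: "dom (q*r) = dom r" "dom (p*s) = dom s" using R(1-8) S(1-8) by simp_all
 obtain H p1 p2 th where hp: "yo_pullback A al (q*r) B bt (p*s) f g H p1 p2 th"
  using T_pullback_yo[OF A(1) B(1) _ _ pb] A(2) B(2) fg by metis
 note H = yo_pullbackD(1-4)[OF hp] and Hth = yo_pullbackD(5)[OF hp] and Hex = yo_pullbackD(6)[OF hp]
 have uH: "univ H (dom e) th" using H(4) e(2) by simp
 obtain I io where im: "image_in H th e I io" using univ_image[OF H(1) uH e(4)] by blast
 note I = image_inD[OF im]
 note cA = cnatD[OF univ_cnat[OF A(2)]] and cB = cnatD[OF univ_cnat[OF B(2)]] and cH = cnatD[OF univ_cnat[OF uH]]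
 have val: "p*t*e*th b x = p*r*al b (p1 b x)" "q*t*e*th b x = q*s*bt b (p2 b x)"
  "q*r*al b (p1 b x) = p*s*bt b (p2 b x)" if b: "ob b" "x:fob H b" for b x
 proof -
  note tH = cH(2-4)[OF b] and E = Hth[OF b]
  have px: "p1 b x:fob A b" "p2 b x:fob B b" using naturalD(1)[OF H(2) b] naturalD(1)[OF H(3) b] by auto
  note pA = cA(2-4)[OF b(1) px(1)] and pB = cB(2-4)[OF b(1) px(2)]
  show "p*t*e*th b x = p*r*al b (p1 b x)"
   using Cmp_reassoc[OF te(1), of "th b x"] tH E pA e(1-3) D(1-8) R(1-8) Tr(1-8) by simp
  show "q*t*e*th b x = q*s*bt b (p2 b x)"
   using Cmp_reassoc[OF te(2), of "th b x"] tH E pB e(1-3) D(1-8) S(1-8) Tr(1-8) by simp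
  show "q*r*al b (p1 b x) = p*s*bt b (p2 b x)"
   using pullback_comm[OF pb tH(1)] tH E pA pB e(1-3) D(1-8) R(1-8) S(1-8) by simp
 qed
 have "rel_rep p q t I io (%b u v. EX y. rh b u y & si b y v)"
  unfolding rel_rep_def
 proof (intro conjI ballI allI)
  show "univ I (dom t) io" using I(2) e(3) by simp
  fix b u v assume b: "ob b"
  show "(EX x:fob I b. p*t*io b x = u & q*t*io b x = v) <-> (EX y. rh b u y & si b y v)"
  proof
   assume "EX x:fob I b. p*t*io b x = u & q*t*io b x = v"
   then obtain z where z: "z:fob I b" "p*t*io b z = u" "q*t*io b z = v" by blast
   obtain x where x: "x:fob H b" "io b z = e*th b x" using I(5)[OF b z(1)] by blast
   have px: "p1 b x:fob A b" "p2 b x:fob B b" using naturalD(1)[OF H(2) b x(1)] naturalD(1)[OF H(3) b x(1)] by auto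
   show "EX y. rh b u y & si b y v"
    by (intro exI[of _ "q*r*al b (p1 b x)"]) (use A(3)[OF b] B(3)[OF b] val[OF b x(1)] x z px in auto)
  next
   assume "EX y. rh b u y & si b y v"
   then obtain y x1 x2 where x: "x1:fob A b" "p*r*al b x1 = u" "q*r*al b x1 = y"
    "x2:fob B b" "p*s*bt b x2 = y" "q*s*bt b x2 = v" using A(3)[OF b] B(3)[OF b] by auto
   have "(q*r)*al b x1 = (p*s)*bt b x2" using x b cA cB R(1-8) S(1-8) by simp
   then obtain h where h: "h:fob H b" "p1 b h = x1" "p2 b h = x2" using Hex[OF b x(1,4)] by blast
   obtain z where z: "z:fob I b" "io b z = e*th b h" using I(4)[OF b h(1)] by blast
   show "EX x:fob I b. p*t*io b x = u & q*t*io b x = v"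
    using z val[OF b h(1)] h x by (intro bexI[of _ z]) simp_all
  qed
 qed (rule I(1))
 thus ?thesis by blast
qed

text \<open>The representable at \<open>dom r\<close> presents both the relation and its opposite,
  with the legs exchanged; composites give the rest.\<close>

lemma zigzag_rep:
 assumes zc: "zigzag_chain C X P p q r m"
 shows "EX E ep. rel_rep p q (m n) E ep (zz (p*r) (q*r) n)"
proof -
 obtain r' s where op: "opposite_relation C X P p q r r'" and s: "composite_relation C X P p q r r' s"
  and c: "!!n. composite_relation C X P p q s (m n) (m (Suc n))" and m0: "m 0 = r"
  using zc unfolding zigzag_chain_def by blast
 have r': "dom r' = dom r" "p*r' = q*r" "q*r' = p*r" "relation_on C X P p q r'" "relation_on C X P p q r"
  using op unfolding opposite_relation_def by auto
 note R = relationD[OF r'(5)] and R' = relationD[OF r'(4)]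
 let ?R = "dom r"
 have RO: "ob ?R" using R(3) by simp
 have el: "(EX x:fob (yo ?R) b. Q (dc b ?R x)) <-> (EX w. arr w & dom w = b & cod w = ?R & Q w)" for b Q
  by (metis cd_yo dc_cd dc_yo)
 have 0: "rel_rep p q r (yo ?R) (%b u. dc b ?R u) (arr_step (p*r) (q*r))"
  unfolding rel_rep_def
 proof (intro conjI ballI allI T_yo univ_yo RO)
  fix b u v assume "ob b"
  show "(EX x:fob (yo ?R) b. p*r*dc b ?R x = u & q*r*dc b ?R x = v) = arr_step (p*r) (q*r) b u v"
   unfolding arr_step_def el[of b "%w. p*r*w = u & q*r*w = v"] by (intro ex_cong1) (use R(1-8) in auto)
 qed
 have 1: "rel_rep p q r' (yo ?R) (%b u. dc b ?R u) (%b u v. arr_step (p*r) (q*r) b v u)"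
  unfolding rel_rep_def r'(1)
 proof (intro conjI ballI allI T_yo univ_yo RO)
  fix b u v assume "ob b"
  have "p*r'*w = (q*r)*w & q*r'*w = (p*r)*w" if "arr w" "cod w = ?R" for w
   using Cmp_reassoc[OF r'(2), of w] Cmp_reassoc[OF r'(3), of w] R(1-8) R'(1-8) r'(1) that by simp
  thus "(EX x:fob (yo ?R) b. p*r'*dc b ?R x = u & q*r'*dc b ?R x = v) = arr_step (p*r) (q*r) b v u"
   unfolding arr_step_def el[of b "%w. p*r'*w = u & q*r'*w = v"] by (intro ex_cong1) (use R(1-8) in auto)
 qed
 obtain S si where S: "rel_rep p q s S si (%b u v. EX y. arr_step (p*r) (q*r) b u y & arr_step (p*r) (q*r) b v y)"
  using composite_rep[OF s 0 1] by blast
 show ?thesis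
 proof (induction n)
  case 0
  have "zz (p*r) (q*r) 0 = arr_step (p*r) (q*r)" by (intro ext) simp
  thus ?case using \<open>rel_rep p q r (yo ?R) _ _\<close> unfolding m0 by metis
 next
  case (Suc n)
  then obtain E ep where "rel_rep p q (m n) E ep (zz (p*r) (q*r) n)" by blast
  note E = composite_rep[OF c S this]
  have "zz (p*r) (q*r) (Suc n) = (%b u v. EX y. (EX y'. arr_step (p*r) (q*r) b u y' & arr_step (p*r) (q*r) b y y') & zz (p*r) (q*r) n b y v)"
   by (intro ext) simp
  thus ?case using E by simp
 qed
qed

end

lemma (in category) pullback_monic:
 assumes pb: "is_pullback C g j b l" and m: "monic C j" shows "monic C b"
proof -
 note D = pullbackD[OF pb]
 show ?thesis unfolding monic_def
 proof (intro conjI D(3) allI ballI impI)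
  fix Z x y assume "x:hom Z (dom b)" "y:hom Z (dom b)" and eq: "b*x = b*y"
  hence xy: "arr x" "arr y" "cod x = dom b" "cod y = dom b" by auto
  have "j*l*x = j*l*y" using pullback_comm[OF pb xy(1,3)] pullback_comm[OF pb xy(2,4)] eq by simp
  hence "l*x = l*y" using monic_cancel[OF m, of "l*x" "l*y"] D(1-8) xy by simp
  thus "x = y" using pullback_unique[OF pb xy eq] by blast
 qed
qed

lemma (in category) monic_of_comp:
 assumes "monic C (u*j)" "arr u" "arr j" "dom u = cod j" shows "monic C j"
 unfolding monic_def
proof (intro conjI allI ballI impI)
 fix Z x y assume "x:hom Z (dom j)" "y:hom Z (dom j)" and eq: "j*x = j*y"
 hence xy: "arr x" "arr y" "cod x = dom j" "cod y = dom j" by auto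
 hence "(u*j)*x = (u*j)*y" using eq assms(2-4) by simp
 thus "x = y" using monic_cancel[OF assms(1) xy(1,2)] xy assms(2-4) by simp
qed (rule assms(3))

lemma (in category) pullback_id:
 assumes "arr g" shows "is_pullback C g (idt (cod g)) (idt (dom g)) g"
 by (rule pullbackI) (use assms in auto)

context univ_class
begin

text \<open>The colimit is the kernel pair \<open>dom k\<close>. It is the reflection of
  \<open>N\<close>, the pointwise union of the zigzags, and each zigzag presheaf \<open>E n\<close>
  reflects to \<open>dom (m n)\<close>. Pulling all of them back along \<open>g\<close> respects the
  reflections, so the same argument gives stability.\<close>

lemma zigzag_colimit_univ:
 assumes re: "reflexive_relation C X P p q r" and zc: "zigzag_chain C X P p q r m"
 shows "EX Q j. is_stable_chain_colimit C (%n. dom (m n)) (transition C m) Q j"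
proof -
 obtain z where z: "arr z" "dom z = X" "cod z = dom r" "p*r*z = idt X" "q*r*z = idt X"
  and rel: "relation_on C X P p q r" and X: "ob X" by (rule reflexiveD[OF re])
 note R = relationD[OF rel]
 let ?d = "p*r" and ?c = "q*r"
 have dc: "arr ?d" "arr ?c" "dom ?d = dom r" "dom ?c = dom r" "cod ?d = X" "cod ?c = X" using R(1-8) by simp_all
 have dz: "?d*z = idt X" "?c*z = idt X" using z R(1-8) by simp_all
 obtain e k k' N th where ker: "kernel_rep ?d ?c e k k' N th"
  using ex_kernel_rep[of ?d ?c z] dc dz z(1-3) by metis
 note K = kernel_repD[OF ker]
 have eX: "dom e = X" using K(2) dc by simp
 note D = pullbackD[OF K(1)] and cN = cnatD[OF univ_cnat[OF K(4)]]
 note KX = K(5)[unfolded dc(5)]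
 have "EX E ep. rel_rep p q (m n) E ep (zz ?d ?c n)" for n by (rule zigzag_rep[OF zc])
 then obtain E ep where Er: "!!n. rel_rep p q (m n) (E n) (ep n) (zz ?d ?c n)" by metis
 note E = rel_repD[OF Er]
 have M: "arr (m n)" "cod (m n) = P" "dom (p*m n) = dom (m n)" "cod (p*m n) = X" "arr (p*m n)"
  "dom (q*m n) = dom (m n)" "cod (q*m n) = X" "arr (q*m n)" for n
  using relationD(1-8)[OF zigzag_relation[OF zc, of n]] by auto
 have cE: "arr (ep n b x)" "dom (ep n b x) = b" "cod (ep n b x) = dom (m n)" if "ob b" "x:fob (E n) b" for n b x
  using cnatD[OF univ_cnat[OF E(2)]] that by auto
 have pairs: "EX y:fob N b. k*th b y = p*m n*ep n b x & k'*th b y = q*m n*ep n b x" if b: "ob b" "x:fob (E n) b" for n b x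
 proof -
  have "zz ?d ?c n b (p*m n*ep n b x) (q*m n*ep n b x)" unfolding E(3)[OF b(1)] using b(2) by blast
  hence "equivclp (arr_step ?d ?c b) (p*m n*ep n b x) (q*m n*ep n b x)" by (rule zz_equivclp)
  moreover have "p*m n*ep n b x:hom b X" "q*m n*ep n b x:hom b X"
   using cE[OF b] M[of n] R(1-8) by auto
  ultimately show ?thesis using KX[OF b(1)] by blast
 qed
 \<comment> \<open>The members of the chain lie in the kernel pair: this is tested on the elements
   of \<open>E n\<close>, which are genuine zigzags.\<close>
 have em: "e*p*m n = e*q*m n" for n
 proof (rule univ_eq[OF E(2)])
  fix b x assume b: "ob b" "x:fob (E n) b"
  obtain y where y: "y:fob N b" "k*th b y = p*m n*ep n b x" "k'*th b y = q*m n*ep n b x" using pairs[OF b] by blast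
  have "e*k*th b y = e*k'*th b y" using pullback_comm[OF K(1)] cN b y(1) by blast
  thus "(e*p*m n)*ep n b x = (e*q*m n)*ep n b x" unfolding y(2,3) using cE[OF b] M[of n] R(1-8) D(1) eX by simp
 qed (use M[of n] R(1-8) D(1) eX in simp_all)
 have "EX h. arr h & dom h = dom (m n) & cod h = dom k & k*h = p*m n & k'*h = q*m n" for n
  by (rule pullback_lift[OF K(1) M(5) M(8) _ _ _ em[of n]]) (use M eX in auto)
 then obtain j where j: "!!n. arr (j n) & dom (j n) = dom (m n) & cod (j n) = dom k & k*j n = p*m n & k'*j n = q*m n"
  by metis
 have ja: "arr (j n)" "dom (j n) = dom (m n)" "cod (j n) = dom k" and kj: "k*j n = p*m n" "k'*j n = q*m n" for n
  using j by auto
 have kj': "k*j n*a = p*m n*a" "k'*j n*a = q*m n*a" if "arr a" "cod a = dom (m n)" for n a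
  using Cmp_reassoc[OF kj(1)[of n], of a] Cmp_reassoc[OF kj(2)[of n], of a] that ja[of n] M[of n] R(1-8) D(1-8) by simp_all
 have jmono: "monic C (j n)" for n
  unfolding monic_def
 proof (intro conjI ja allI ballI impI)
  fix Z x y assume xy: "x:hom Z (dom (j n))" "y:hom Z (dom (j n))" "j n*x = j n*y"
  have a: "arr x" "cod x = dom (m n)" "arr y" "cod y = dom (m n)" using xy ja by auto
  show "x = y" by (rule relation_cancel[OF zigzag_relation[OF zc, of n] a(1,3,2,4)])
    (use kj'[OF a(1,2)] kj'[OF a(3,4)] xy(3) in simp_all)
 qed
 have tr: "arr (transition C m n)" "dom (transition C m n) = dom (m n)" "cod (transition C m n) = dom (m (Suc n))"
   "m (Suc n)*transition C m n = m n" for n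
  using zigzag_transition[OF re zc, of n] by auto
 have cocone: "is_chain_cocone C (%n. dom (m n)) (transition C m) (dom k) j"
  unfolding is_chain_cocone_def
 proof (intro conjI allI)
  fix n
  show "j (Suc n)*transition C m n = j n"
  proof (rule pullback_unique[OF K(1)])
   show "k*j (Suc n)*transition C m n = k*j n" "k'*j (Suc n)*transition C m n = k'*j n"
    unfolding kj'[OF tr(1,3)] kj tr(4) by simp_all
  qed (use ja tr in simp_all)
 qed (use ja tr D in auto)
 have thj: "EX y:fob N b. th b y = j n*ep n b x" if b: "ob b" "x:fob (E n) b" for n b x
 proof -
  obtain y where y: "y:fob N b" "k*th b y = p*m n*ep n b x" "k'*th b y = q*m n*ep n b x" using pairs[OF b] by blast
  have "th b y = j n*ep n b x"
   by (rule pullback_unique[OF K(1)]) (use y kj'[OF cE(1)[OF b] cE(3)[OF b]] cN(2-4)[OF b(1) y(1)] cE[OF b] ja in simp_all)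
  thus ?thesis using y(1) by blast
 qed
 \<comment> \<open>An element of \<open>N\<close> is a finite zigzag, which after padding occurs in
   some member of the chain.\<close>
 have cov: "EX n a. arr a & cod a = dom (m n) & th b y = j n*a" if b: "ob b" "y:fob N b" for b y
 proof -
  note t = cN(2-4)[OF b]
  have H: "k*th b y:hom b X" "k'*th b y:hom b X" using t D(1-8) eX by auto
  have "equivclp (arr_step ?d ?c b) (k*th b y) (k'*th b y)" using KX[OF b(1) H] b(2) by blast
  hence "equivclp (arr_step ?d ?c b) (k'*th b y) (k*th b y)" by (rule equivclp_sym)
  then obtain n where "zz ?d ?c n b (k*th b y) (k'*th b y)"
   using equivclp_zz[of ?d ?c z "k'*th b y" b] dc dz z(1-3) H(2) by metis
  then obtain x where x: "x:fob (E n) b" "p*m n*ep n b x = k*th b y" "q*m n*ep n b x = k'*th b y"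
   using E(3)[OF b(1)] by blast
  have "th b y = j n*ep n b x"
   by (rule pullback_unique[OF K(1)]) (use x kj'[OF cE(1)[OF b(1) x(1)] cE(3)[OF b(1) x(1)]] t cE[OF b(1) x(1)] ja in simp_all)
  thus ?thesis using cE[OF b(1) x(1)] by blast
 qed
 have "is_stable_chain_colimit C (%n. dom (m n)) (transition C m) (dom k) j"
  unfolding is_stable_chain_colimit_def
 proof (intro conjI allI ballI impI)
  show "is_chain_colimit C (%n. dom (m n)) (transition C m) (dom k) j"
   by (rule chain_colimit_univ[OF cocone jmono T_psh[OF K(3)] K(4) E(2) thj cov])
  fix Z g b l t assume g: "g:hom Z (dom k)"
   and a: "(ALL n. is_pullback C g (j n) (b n) (l n)) &
    (ALL n. t n:hom (dom (b n)) (dom (b (Suc n))) & b (Suc n)*t n = b n & l (Suc n)*t n = transition C m n*l n)"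
  have ga: "arr g" "dom g = Z" "cod g = dom k" "ob Z" using g by auto
  have pb: "is_pullback C g (j n) (b n) (l n)" for n using a by blast
  note B = pullbackD[OF pb]
  have uyZ: "univ (yo Z) (dom g) (%b u. dc b Z u)" using univ_yo[OF ga(4)] ga by simp
  \<comment> \<open>\<open>N\<close> reflects to all of \<open>cod g\<close>, so its pullback along
    \<open>g\<close> lies over a trivial pullback in \<open>C\<close> and reflects to
    \<open>Z\<close>.\<close>
  have uN: "univ N (dom (idt (cod g))) th" using K(4) ga Dom_Ob[OF D(3)] by simp
  obtain H p1 p2 thH where hp: "yo_pullback (yo Z) (%b u. dc b Z u) g N th (idt (cod g)) (idt (dom g)) g H p1 p2 thH"
   using T_pullback_yo[OF T_yo[OF ga(4)] K(3) uyZ uN pullback_id[OF ga(1)]] by blast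
  note H = yo_pullbackD(1-4)[OF hp] and Hth = yo_pullbackD(5)[OF hp] and Hex = yo_pullbackD(6)[OF hp]
  have uH: "univ H Z thH" using H(4) ga by simp
  have "EX G p1 p2 gm. yo_pullback (yo Z) (%b u. dc b Z u) g (E n) (ep n) (j n) (b n) (l n) G p1 p2 gm" for n
  proof -
   have "univ (E n) (dom (j n)) (ep n)" using E(2) ja by simp
   thus ?thesis using T_pullback_yo[OF T_yo[OF ga(4)] E(1) uyZ _ pb] by blast
  qed
  then obtain G p1n p2n gm where "!!n. yo_pullback (yo Z) (%b u. dc b Z u) g (E n) (ep n) (j n) (b n) (l n) (G n) (p1n n) (p2n n) (gm n)"
   by metis
  note gp = this
  note Gn = yo_pullbackD(1-4)[OF gp] and Ggm = yo_pullbackD(5)[OF gp] and Gex = yo_pullbackD(6)[OF gp]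
  note cG = cnatD[OF univ_cnat[OF Gn(4)]] and cH = cnatD[OF univ_cnat[OF uH]]
  show "is_chain_colimit C (%n. dom (b n)) t Z b"
  proof (rule chain_colimit_univ[OF _ _ T_psh[OF H(1)] uH Gn(4)])
   show "is_chain_cocone C (%n. dom (b n)) t Z b"
    unfolding is_chain_cocone_def using a B ga by auto
   show "monic C (b n)" for n by (rule pullback_monic[OF pb jmono])
   fix n c x assume c: "ob c" "x:fob (G n) c"
   have px: "p1n n c x:fob (yo Z) c" "p2n n c x:fob (E n) c" using naturalD(1)[OF Gn(2) c] naturalD(1)[OF Gn(3) c] by auto
   obtain w where w: "w:fob N c" "th c w = j n*ep n c (p2n n c x)" using thj[OF c(1) px(2)] by blast
   have eq: "g*dc c Z (p1n n c x) = idt (cod g)*th c w"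
    using pullback_comm[OF pb[of n], of "gm n c x"] cG(2-4)[OF c] Ggm[OF c] w cN(2-4)[OF c(1) w(1)] ga by simp
   obtain y where y: "y:fob H c" "p1 c y = p1n n c x" using Hex[OF c(1) px(1) w(1) eq] by blast
   have "thH c y = b n*gm n c x" using Hth[OF c(1) y(1)] y(2) Ggm[OF c] cH(2-4)[OF c(1) y(1)] ga by simp
   thus "EX y:fob H c. thH c y = b n*gm n c x" using y(1) by blast
  next
   fix c y assume c: "ob c" "y:fob H c"
   have py: "p1 c y:fob (yo Z) c" "p2 c y:fob N c" using naturalD(1)[OF H(2) c] naturalD(1)[OF H(3) c] by auto
   obtain n h where h: "arr h" "cod h = dom (m n)" "th c (p2 c y) = j n*h" using cov[OF c(1) py(2)] by blast
   note T = cH(2-4)[OF c]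
   have eq: "g*thH c y = j n*h" using Hth[OF c] h(3) by simp
   have "dom h = c" using h cN(3)[OF c(1) py(2)] ja by simp
   then obtain v where "arr v" "cod v = dom (b n)" "b n*v = thH c y"
    using pullback_lift[OF pb[of n] T(1) h(1) _ _ _ eq] T ga h ja by metis
   thus "EX n a. arr a & cod a = dom (b n) & thH c y = b n*a" by metis
  qed
 qed
 thus ?thesis by blast
qed

end

section \<open>Stable colimits and stable effective unions\<close>

context lex_category
begin

lemma chain_cocone_mono:
 assumes "is_chain_cocone C A i Z j" shows "!!n. i n:hom (A n) (A (Suc n))" "!!n. j n:hom (A n) Z" "!!n. j (Suc n)*i n = j n" "ob Z"
 using assms unfolding is_chain_cocone_def by blast+

lemma chain_colimit_cancel:
 assumes c: "is_chain_colimit C A i Q j" and f: "f:hom Q Y" "f':hom Q Y" and eq: "!!n. f*j n = f'*j n"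
 shows "f = f'"
proof -
 have cc: "is_chain_cocone C A i Q j" using c unfolding is_chain_colimit_def by blast
 note D = chain_cocone_mono[OF cc]
 have "is_chain_cocone C A i Y (%n. f*j n)"
  unfolding is_chain_cocone_def
 proof (intro conjI allI)
  fix n
  show "(f*j (Suc n))*i n = f*j n" using D(1)[of n] D(2)[of "Suc n"] D(3)[of n] f(1) by simp
 qed (use D f in auto)
 hence "EX! h. h:hom Q Y & (ALL n. h*j n = f*j n)" using c unfolding is_chain_colimit_def by blast
 thus ?thesis using f eq by metis
qed

lemma chain_pullback_maps:
 assumes cc: "is_chain_cocone C A i Q j" and pb: "!!n. is_pullback C g (j n) (b n) (l n)"
 shows "EX t. ALL n. t n:hom (dom (b n)) (dom (b (Suc n))) & b (Suc n)*t n = b n & l (Suc n)*t n = i n*l n"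
proof -
 note D = chain_cocone_mono[OF cc] and B = pullbackD[OF pb]
 have ja: "arr (j n)" "dom (j n) = A n" "cod (j n) = Q" "arr (i n)" "dom (i n) = A n" "cod (i n) = A (Suc n)" for n
  using D(1,2) by auto
 have "EX t. t:hom (dom (b n)) (dom (b (Suc n))) & b (Suc n)*t = b n & l (Suc n)*t = i n*l n" for n
 proof -
  have "j (Suc n)*i n*l n = j n*l n" using Cmp_reassoc1[OF D(3)[of n], of "l n"] ja B by simp
  hence eq: "g*b n = j (Suc n)*i n*l n" using B(9)[of n] by simp
  obtain h where "arr h" "dom h = dom (b n)" "cod h = dom (b (Suc n))" "b (Suc n)*h = b n" "l (Suc n)*h = i n*l n"
   by (rule pullback_lift[OF pb[of "Suc n"] B(3)[of n] _ _ _ _ eq]) (use ja B(1) B(2-8)[of n] B(7,8)[of "Suc n"] in simp_all)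
  thus ?thesis by (intro exI[of _ h]) simp
 qed
 thus ?thesis by metis
qed

text \<open>By stability the pullbacks of the stages along \<open>g\<close> form a colimit cocone on
  \<open>Z\<close>, so equality of arrows out of \<open>Z\<close> may be tested where
  \<open>g\<close> factors through a stage.\<close>

lemma stable_chain_cancel:
 assumes st: "is_stable_chain_colimit C A i Q j" and g: "g:hom Z Q" and f: "f:hom Z Y" "f':hom Z Y"
  and eq: "!!n a l. arr a ==> arr l ==> cod a = Z ==> cod l = A n ==> g*a = j n*l ==> f*a = f'*a"
 shows "f = f'"
proof -
 have cc: "is_chain_cocone C A i Q j" using st unfolding is_stable_chain_colimit_def is_chain_colimit_def by blast
 note D = chain_cocone_mono[OF cc]
 have ga: "arr g" "dom g = Z" "cod g = Q" using g by auto
 have ja: "arr (j n)" "dom (j n) = A n" "cod (j n) = Q" for n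
  using D(2) by auto
 have "EX b l. is_pullback C g (j n) b l" for n using ex_pullback[OF ga(1) ja(1)] ga ja by metis
 then obtain b l where pb: "!!n. is_pullback C g (j n) (b n) (l n)" by metis
 note B = pullbackD[OF pb]
 obtain t where "ALL n. t n:hom (dom (b n)) (dom (b (Suc n))) & b (Suc n)*t n = b n & l (Suc n)*t n = i n*l n"
  using chain_pullback_maps[OF cc pb] by blast
 hence col: "is_chain_colimit C (%n. dom (b n)) t Z b" using st g pb unfolding is_stable_chain_colimit_def by blast
 show ?thesis
  by (rule chain_colimit_cancel[OF col f]) (use eq[OF B(3) B(4) _ _ B(9)] B ga ja in simp)
qed

text \<open>Another upper bound \<open>v\<close> receives a cocone from the chain, since
  \<open>v\<close> is monic, and therefore an arrow from the colimit; so a colimit that is a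
  subobject is the union.\<close>

lemma effective_unionI:
 assumes col: "is_chain_colimit C (%n. dom (m n)) t Q j" and u: "monic C u" "dom u = Q" "cod u = P" "!!n. u*j n = m n"
  and m: "!!n. monic C (m n)" "!!n. m (Suc n)*t n = m n"
 shows "is_effective_union C P m u" "inclusion C (m n) u = j n" "transition C m n = t n"
proof -
 have cc: "is_chain_cocone C (%n. dom (m n)) t Q j" using col unfolding is_chain_colimit_def by blast
 note D = chain_cocone_mono[OF cc]
 have inc: "inclusion C (m n) u = j n" for n by (rule inclusion_eq[OF u(1) _ u(4)]) (use D u in simp)
 have tra: "transition C m n = t n" for n unfolding transition_def by (rule inclusion_eq[OF m(1) D(1) m(2)])
 have "is_union C P m u"
  unfolding is_union_def
 proof (intro conjI allI impI u(1,3))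
  show "subobject_le C (m n) u" for n unfolding subobject_le_def using D(2)[of n] u(2,4) by blast
  fix v assume v: "monic C v & cod v = P & (ALL n. subobject_le C (m n) v)"
  have va: "arr v" using v monicD by blast
  obtain w where w: "!!n. w n:hom (dom (m n)) (dom v) & v*w n = m n" using v unfolding subobject_le_def by metis
  have "is_chain_cocone C (%n. dom (m n)) t (dom v) w"
   unfolding is_chain_cocone_def
  proof (intro conjI allI)
   fix n
   have a: "arr (w n)" "cod (w n) = dom v" "arr (w (Suc n))" "dom (w (Suc n)) = dom (m (Suc n))" "cod (w (Suc n)) = dom v"
    "arr (t n)" "cod (t n) = dom (m (Suc n))" using w[of n] w[of "Suc n"] D(1)[of n] by auto
   have "v*w (Suc n)*t n = m (Suc n)*t n" using Cmp_reassoc1[of v "w (Suc n)" _ "t n"] w[of "Suc n"] a va by simp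
   hence "v*w (Suc n)*t n = v*w n" using w m(2) by simp
   thus "w (Suc n)*t n = w n" using monic_cancel[of v "w (Suc n)*t n" "w n"] v a by simp
  qed (use w D va in auto)
  then obtain h where h: "h:hom Q (dom v)" "!!n. h*j n = w n" using col unfolding is_chain_colimit_def by blast
  have "v*h = u"
  proof (rule chain_colimit_cancel[OF col])
   show "v*h:hom Q P" "u:hom Q P" using v va h u monicD[OF u(1)] by auto
   fix n show "(v*h)*j n = u*j n" using h va D(2)[of n] w[of n] u(4) by simp
  qed
  thus "subobject_le C u v" unfolding subobject_le_def using h u by auto
 qed
 thus "is_effective_union C P m u" unfolding is_effective_union_def inc using col u(2)
  by (simp add: ext[of "transition C m" t, OF tra])
 show "inclusion C (m n) u = j n" "transition C m n = t n" by (fact inc tra)+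
qed

text \<open>The members of the chain are subobjects of \<open>P\<close> and induce an arrow
  \<open>u\<close> from the colimit. The point is that \<open>u\<close> is monic, which uses
  stability of the colimit.\<close>

lemma stable_colimit_effective_union:
 assumes st: "is_stable_chain_colimit C (%n. dom (m n)) (transition C m) Q j"
  and m: "!!n. monic C (m n)" "!!n. cod (m n) = P" and tr: "!!n. m (Suc n)*transition C m n = m n"
 shows "EX u. is_stable_effective_union C P m u"
proof -
 have col: "is_chain_colimit C (%n. dom (m n)) (transition C m) Q j" using st unfolding is_stable_chain_colimit_def by blast
 hence cc: "is_chain_cocone C (%n. dom (m n)) (transition C m) Q j" unfolding is_chain_colimit_def by blast
 note D = chain_cocone_mono[OF cc]
 have ma: "arr (m n)" for n using monicD[OF m(1)] .
 have ja: "arr (j n)" "dom (j n) = dom (m n)" "cod (j n) = Q" for n using D(2)[of n] by auto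
 have mc: "is_chain_cocone C (%n. dom (m n)) (transition C m) P m"
  unfolding is_chain_cocone_def using D ma m(2) tr Cod_Ob[OF ma[of 0]] by auto
 then obtain u where u: "u:hom Q P" "!!n. u*j n = m n" using col unfolding is_chain_colimit_def by blast
 have ua: "arr u" "dom u = Q" "cod u = P" using u by auto
 have um: "u*j n*a = m n*a" if "arr a" "cod a = dom (m n)" for n a
  using Cmp_reassoc1[OF u(2)[of n], of a] that ja[of n] ua by simp
 have mono: "monic C u"
  unfolding monic_def
 proof (intro conjI ua allI ballI impI)
  fix Z x y assume "x:hom Z (dom u)" "y:hom Z (dom u)" and eq: "u*x = u*y"
  hence xy: "x:hom Z Q" "y:hom Z Q" and xa: "arr x" "arr y" "dom x = Z" "dom y = Z" "cod x = Q" "cod y = Q"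
   using ua by auto
  \<comment> \<open>Testing along \<open>x\<close> and then along \<open>y\<close> reaches a place
    where both factor through stages of the chain; there \<open>u\<close> restricts to the monic
    \<open>m\<close>, and equal images force equality.\<close>
  show "x = y"
  proof (rule stable_chain_cancel[OF st xy(1) xy])
   fix n a l assume a: "arr a" "arr l" "cod a = Z" "cod l = dom (m n)" "x*a = j n*l"
   show "x*a = y*a"
   proof (rule stable_chain_cancel[OF st, of "y*a" "dom a"])
    show "y*a:hom (dom a) Q" "y*a:hom (dom a) Q" "x*a:hom (dom a) Q" using a(1-4) xa by auto
    fix k a' l' assume a': "arr a'" "arr l'" "cod a' = dom a" "cod l' = dom (m k)" "(y*a)*a' = j k*l'"
    have dl: "dom l = dom a" using Cmp_eqD(1)[OF a(5)] a xa ja by simp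
    have x1: "(x*a)*a' = j n*l*a'" unfolding a(5) using a a' dl ja by simp
    have "(u*x)*a*a' = (u*y)*a*a'" using eq by simp
    hence "u*(x*a)*a' = u*(y*a)*a'" using a(1-4) a'(1-4) xa ua by simp
    hence "m n*l*a' = m k*l'" unfolding x1 a'(5) using um[of "l*a'" n] um[of l' k] a(1-4) a'(1-4) dl by simp
    hence "j n*l*a' = j k*l'"
     by (intro monic_chain_eq[OF mc m(1) cc]) (use a a' dl in simp_all)
    thus "(x*a)*a' = (y*a)*a'" using x1 a'(5) by simp
   qed
  qed
 qed
 note eff = effective_unionI[OF col mono ua(2,3) u(2) m(1) tr]
 have "is_stable_effective_union C P m u"
  unfolding is_stable_effective_union_def
 proof (intro conjI eff(1) allI ballI impI)
  fix Z g b l assume g: "g:hom Z (dom u)" and pb: "ALL n. is_pullback C g (inclusion C (m n) u) (b n) (l n)"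
  hence pb: "!!n. is_pullback C g (j n) (b n) (l n)" unfolding eff(2) by blast
  note B = pullbackD[OF pb]
  have gq: "g:hom Z Q" and ga: "arr g" "dom g = Z" "ob Z" using g ua by auto
  obtain t where t: "ALL n. t n:hom (dom (b n)) (dom (b (Suc n))) & b (Suc n)*t n = b n & l (Suc n)*t n = transition C m n*l n"
   using chain_pullback_maps[OF cc pb] by blast
  hence bc: "is_chain_colimit C (%n. dom (b n)) t Z b" using st gq pb unfolding is_stable_chain_colimit_def by blast
  have jm: "monic C (j n)" for n by (rule monic_of_comp[of u]) (use u(2) m(1) ua ja in simp_all)
  show "is_effective_union C Z b (idt Z)"
  proof (rule effective_unionI(1)[OF bc])
   show "monic C (b n)" for n by (rule pullback_monic[OF pb jm])
   show "monic C (idt Z)" unfolding monic_def using ga by auto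
  qed (use ga B t in auto)
 qed
 thus ?thesis by blast
qed

text \<open>Over the maximal subobject of \<open>Z\<close> the inclusions of the pulled back chain
  are the legs \<open>b n\<close> themselves, so effectiveness of their union is the colimit
  property.\<close>

lemma effective_union_stable_colimit:
 assumes un: "is_stable_effective_union C P m u" and m: "!!n. monic C (m n)"
 shows "is_stable_chain_colimit C (%n. dom (m n)) (transition C m) (dom u) (%n. inclusion C (m n) u)"
proof -
 have eff: "is_effective_union C P m u" using un unfolding is_stable_effective_union_def by blast
 hence u: "monic C u" "!!n. subobject_le C (m n) u" unfolding is_effective_union_def is_union_def by auto
 note ua = monicD[OF u(1)] and I = inclusionD[OF u(1) u(2)]
 let ?j = "%n. inclusion C (m n) u"
 have ja: "arr (?j n)" "dom (?j n) = dom (m n)" "cod (?j n) = dom u" for n using I(1)[of n] by auto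
 have jm: "monic C (?j n)" for n by (rule monic_of_comp[of u]) (use I(2) m ua ja in simp_all)
 show ?thesis
  unfolding is_stable_chain_colimit_def
 proof (intro conjI allI ballI impI)
  show "is_chain_colimit C (%n. dom (m n)) (transition C m) (dom u) ?j" using eff unfolding is_effective_union_def by blast
  fix Z g b l t assume g: "g:hom Z (dom u)"
   and a: "(ALL n. is_pullback C g (?j n) (b n) (l n)) &
    (ALL n. t n:hom (dom (b n)) (dom (b (Suc n))) & b (Suc n)*t n = b n & l (Suc n)*t n = transition C m n*l n)"
  have ga: "arr g" "dom g = Z" "ob Z" using g by auto
  have pb: "is_pullback C g (?j n) (b n) (l n)" for n using a by blast
  note B = pullbackD[OF pb]
  have bm: "monic C (b n)" for n by (rule pullback_monic[OF pb jm])
  have "is_effective_union C Z b (idt Z)" using un g a unfolding is_stable_effective_union_def by blast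
  hence "is_chain_colimit C (%n. dom (b n)) (transition C b) (dom (idt Z)) (%n. inclusion C (b n) (idt Z))"
   unfolding is_effective_union_def by blast
  moreover have "transition C b = t"
   unfolding transition_def using a bm by (intro ext inclusion_eq) auto
  moreover have "inclusion C (b n) (idt Z) = b n" for n
   by (rule inclusion_eq) (use ga B in \<open>auto simp: monic_def\<close>)
  ultimately show "is_chain_colimit C (%n. dom (b n)) t Z b" using ga by simp
 qed
qed

lemma stable_colimits_iff_unions: "zigzags_have_stable_colimits C <-> zigzags_have_stable_effective_unions C"
proof -
 have "(EX Q j. is_stable_chain_colimit C (%n. dom (m n)) (transition C m) Q j) <-> (EX u. is_stable_effective_union C P m u)"
  if re: "reflexive_relation C X P p q r" and zc: "zigzag_chain C X P p q r m" for X P p q r m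
 proof -
  have m: "monic C (m n)" "cod (m n) = P" for n using relationD(8,9)[OF zigzag_relation[OF zc]] by auto
  show ?thesis
   using stable_colimit_effective_union[where m = m and P = P] effective_union_stable_colimit[where m = m] m zigzag_transition(2)[OF re zc] by metis
 qed
 thus ?thesis unfolding zigzags_have_stable_colimits_def zigzags_have_stable_effective_unions_def by blast
qed

end

lemma (in univ_class) zigzags_have_stable_colimits_univ: "zigzags_have_stable_colimits C"
 unfolding zigzags_have_stable_colimits_def using zigzag_colimit_univ by blast

section \<open>Coverings\<close>

lemma (in category) pullback_paste:
 assumes p: "is_pullback C f j b l" and q: "is_pullback C g b b' l'"
 shows "is_pullback C (f*g) j b' (l*l')"
proof -
 note P = pullbackD[OF p] and Q = pullbackD[OF q]
 show ?thesis
 proof (rule pullbackI)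
  show "(f*g)*b' = j*l*l'"
  proof -
   have "(f*g)*b' = f*b*l'" using Q P(1-8) by simp
   thus ?thesis using pullback_comm[OF p Q(4)] Q(8) P(1-8) by simp
  qed
 next
  fix a c assume a: "arr a" "arr c" "dom c = dom a" "cod a = dom (f*g)" "cod c = dom j" "(f*g)*a = j*c"
  have a4: "cod a = dom g" using a(4) P(1-8) Q(1-8) by simp
  have "f*g*a = j*c" using a(6) a(1) a4 P(1-8) Q(1-8) by simp
  then obtain h where h: "arr h" "dom h = dom a" "cod h = dom b" "b*h = g*a" "l*h = c"
   using pullback_lift[OF p, of "g*a" c] a(1-3,5) a4 P(1-8) Q(1-8) by (metis Cmp_simps)
  obtain k where k: "arr k" "dom k = dom a" "cod k = dom b'" "b'*k = a" "l'*k = h"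
   using pullback_lift[OF q a(1) h(1,2) a4 h(3)] h(4) by metis
  show "EX h. arr h & dom h = dom a & cod h = dom b' & b'*h = a & (l*l')*h = c"
   using k h P(1-8) Q(1-8) by (intro exI[of _ k]) simp
 next
  fix h k assume h: "arr h" "arr k" "cod h = dom b'" "cod k = dom b'" "b'*h = b'*k" "(l*l')*h = (l*l')*k"
  have "b*l'*h = b*l'*k" using pullback_comm[OF q h(1,3)] pullback_comm[OF q h(2,4)] h(5) by simp
  moreover have "l*l'*h = l*l'*k" using h P(1-8) Q(1-8) by simp
  ultimately have "l'*h = l'*k" using pullback_unique[OF p, of "l'*h" "l'*k"] h(1-4) P(1-8) Q(1-8) by simp
  thus "h = k" using pullback_unique[OF q h(1,2,3,4,5)] by blast
 qed (use P(1-8) Q(1-8) in simp_all)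
qed

text \<open>A pullback of a stable chain colimit is again stable, by pasting pullback
  squares.\<close>

lemma (in lex_category) stable_chain_pullback:
 assumes st: "is_stable_chain_colimit C A i Q j" and f: "arr f" "cod f = Q"
 shows "EX b l t. (ALL n. is_pullback C f (j n) (b n) (l n)) & is_stable_chain_colimit C (%n. dom (b n)) t (dom f) b"
proof -
 have cc: "is_chain_cocone C A i Q j" using st unfolding is_stable_chain_colimit_def is_chain_colimit_def by blast
 note D = chain_cocone_mono[OF cc]
 have ja: "arr (j n)" "cod (j n) = Q" "arr (i n)" "dom (i n) = A n" "dom (j n) = A n" "cod (i n) = A (Suc n)" for n using D(1)[of n] D(2)[of n] by auto
 have "EX b l. is_pullback C f (j n) b l" for n using ex_pullback[OF f(1) ja(1)] f ja by metis
 then obtain b l where pb: "!!n. is_pullback C f (j n) (b n) (l n)" by metis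
 note B = pullbackD[OF pb]
 obtain t where t: "ALL n. t n:hom (dom (b n)) (dom (b (Suc n))) & b (Suc n)*t n = b n & l (Suc n)*t n = i n*l n"
  using chain_pullback_maps[OF cc pb] by blast
 have "is_stable_chain_colimit C (%n. dom (b n)) t (dom f) b"
  unfolding is_stable_chain_colimit_def
 proof (intro conjI allI ballI impI)
  have fQ: "f:hom (dom f) Q" using f by simp
  thus "is_chain_colimit C (%n. dom (b n)) t (dom f) b" using st pb t unfolding is_stable_chain_colimit_def by blast
  fix Z g b' l' t' assume g: "g:hom Z (dom f)" and a: "(ALL n. is_pullback C g (b n) (b' n) (l' n)) &
   (ALL n. t' n:hom (dom (b' n)) (dom (b' (Suc n))) & b' (Suc n)*t' n = b' n & l' (Suc n)*t' n = t n*l' n)"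
  have fg: "f*g:hom Z Q" using f g by auto
  have pb': "!!n. is_pullback C g (b n) (b' n) (l' n)" using a by blast
  note B' = pullbackD[OF pb']
  have paste: "is_pullback C (f*g) (j n) (b' n) (l n*l' n)" for n by (rule pullback_paste[OF pb pb'])
  have "(l (Suc n)*l' (Suc n))*t' n = i n*l n*l' n" for n
  proof -
   have ty: "arr (t' n)" "cod (t' n) = dom (b' (Suc n))" "arr (t n)" "dom (t n) = dom (b n)" "cod (t n) = dom (b (Suc n))"
    using a t by auto
   have "l (Suc n)*l' (Suc n)*t' n = l (Suc n)*t n*l' n" using a by simp
   also have "... = i n*l n*l' n"
    by (rule Cmp_reassoc) (use t ty B B' ja in auto)
   finally show ?thesis using B B' ty by simp
  qed
  hence H: "(ALL n. is_pullback C (f*g) (j n) (b' n) (l n*l' n)) &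
    (ALL n. t' n:hom (dom (b' n)) (dom (b' (Suc n))) & b' (Suc n)*t' n = b' n & (l (Suc n)*l' (Suc n))*t' n = i n*l n*l' n)"
   using paste a by blast
  show "is_chain_colimit C (%n. dom (b' n)) t' Z b'"
   using st[unfolded is_stable_chain_colimit_def, THEN conjunct2, THEN spec, THEN bspec, OF fg, THEN spec, of b', THEN spec, of "%n. l n*l' n", THEN spec, of t', THEN mp, OF H] .
 qed
 thus ?thesis using pb by blast
qed

context lex_category
begin

text \<open>The topology generated by regular epimorphisms and stable chain colimits: \<open>cov b ph\<close> says that
 \<open>ph\<close> holds locally on \<open>b\<close>.\<close>

inductive cov :: "'o => ('a => bool) => bool" where
 cov_id: "ob b ==> (!!f. arr f ==> cod f = b ==> ph f) ==> cov b ph"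
| cov_epi: "regular_epi C e ==> cov (dom e) (%g. ph (e*g)) ==> cov (cod e) ph"
| cov_chain: "is_stable_chain_colimit C A i b j ==> (!!n. cov (A n) (%g. ph (j n*g))) ==> cov b ph"

lemma stable_chainD:
 assumes "is_stable_chain_colimit C A i Q j"
 shows "is_chain_colimit C A i Q j" "is_chain_cocone C A i Q j" "!!n. arr (j n)" "!!n. dom (j n) = A n" "!!n. cod (j n) = Q"
  "!!n. arr (i n)" "!!n. dom (i n) = A n" "!!n. cod (i n) = A (Suc n)" "!!n. j (Suc n)*i n = j n" "ob Q"
 using assms unfolding is_stable_chain_colimit_def is_chain_colimit_def is_chain_cocone_def by auto

lemma cov_mono:
 assumes "cov b ph" "!!f. arr f ==> cod f = b ==> ph f ==> ps f" shows "cov b ps"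
 using assms
proof (induction arbitrary: ps rule: cov.induct)
 case (cov_id b ph)
 thus ?case by (intro cov.cov_id) auto
next
 case (cov_epi e ph)
 thus ?case using regular_epi_Arr[OF cov_epi(1)] by (intro cov.cov_epi[OF cov_epi(1)]) auto
next
 case (cov_chain A i b j ph)
 thus ?case using stable_chainD[OF cov_chain(1)] by (intro cov.cov_chain[OF cov_chain(1)]) auto
qed

lemma cov_true: "ob b ==> ph ==> cov b (%_. ph)"
 by (rule cov_id)

lemma cov_trans:
 assumes "cov b ph" "!!f. arr f ==> cod f = b ==> ph f ==> cov (dom f) (%g. ps (f*g))" shows "cov b ps"
 using assms
proof (induction arbitrary: ps rule: cov.induct)
 case (cov_id b ph)
 have "cov (dom (idt b)) (%g. ps (idt b*g))" by (rule cov_id(3)) (use cov_id(1,2) in simp_all)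
 thus ?case using cov_id(1) by (auto elim!: cov_mono)
next
 case (cov_epi e ph)
 note e = regular_epi_Arr[OF cov_epi(1)]
 show ?case
 proof (rule cov.cov_epi[OF cov_epi(1)], rule cov_epi(3))
  fix f assume f: "arr f" "cod f = dom e" "ph (e*f)"
  have "cov (dom (e*f)) (%g. ps ((e*f)*g))" by (rule cov_epi(4)) (use f e in simp_all)
  thus "cov (dom f) (%g. ps (e*f*g))" using f e by (auto elim!: cov_mono)
 qed
next
 case (cov_chain A i b j ph)
 note j = stable_chainD[OF cov_chain(1)]
 show ?case
 proof (rule cov.cov_chain[OF cov_chain(1)], rule cov_chain(3))
  fix n f assume f: "arr f" "cod f = A n" "ph (j n*f)"
  have "cov (dom (j n*f)) (%g. ps ((j n*f)*g))" by (rule cov_chain(4)) (use f j in simp_all)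
  thus "cov (dom f) (%g. ps (j n*f*g))" using f j by (auto elim!: cov_mono)
 qed
qed

text \<open>Representables are separated presheaves: regular epimorphisms are epic and the legs of a
  colimit cocone are jointly epic.\<close>

lemma cov_sep:
 assumes "cov b ph" "s:hom b y" "s':hom b y" "!!f. arr f ==> cod f = b ==> ph f ==> s*f = s'*f"
 shows "s = s'"
 using assms
proof (induction arbitrary: s s' rule: cov.induct)
 case (cov_id b ph)
 have "s*idt b = s'*idt b" by (rule cov_id(5)) (use cov_id(1,2) in simp_all)
 thus ?case using cov_id(3,4) by simp
next
 case (cov_epi e ph)
 note e = regular_epi_Arr[OF cov_epi(1)]
 have s: "arr s" "dom s = cod e" "cod s = y" "arr s'" "dom s' = cod e" "cod s' = y" using cov_epi(4,5) by auto
 have "s*e = s'*e"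
 proof (rule cov_epi(3))
  show "s*e:hom (dom e) y" "s'*e:hom (dom e) y" using s e by auto
  fix f assume f: "arr f" "cod f = dom e" "ph (e*f)"
  thus "(s*e)*f = (s'*e)*f" using cov_epi(6)[of "e*f"] s e by simp
 qed
 thus ?case using regular_epi_cancel[OF cov_epi(1)] s by metis
next
 case (cov_chain A i b j ph)
 note j = stable_chainD[OF cov_chain(1)]
 have s: "arr s" "dom s = b" "cod s = y" "arr s'" "dom s' = b" "cod s' = y" using cov_chain(4,5) by auto
 have "s*j n = s'*j n" for n
 proof (rule cov_chain(3))
  show "s*j n:hom (A n) y" "s'*j n:hom (A n) y" using s j by auto
  fix f assume f: "arr f" "cod f = A n" "ph (j n*f)"
  thus "(s*j n)*f = (s'*j n)*f" using cov_chain(6)[of "j n*f"] s j by simp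
 qed
 thus ?case by (rule chain_colimit_cancel[OF j(1) cov_chain(4,5)])
qed

end

section \<open>Pullback of covers and the sheaf property of representables\<close>

locale regular_lex = lex_category C for C :: "('o, 'a) cat" +
 assumes regular: "regular_category C"
begin

lemma regular_epi_stable: "regular_epi C e ==> is_pullback C g e p q ==> regular_epi C p"
 using regular unfolding regular_category_def by blast

text \<open>Both kinds of generating covers are stable, the first by regularity and the second by
  the stability built into the chain colimits.\<close>

lemma cov_stable:
 assumes "cov b ph" "arr f" "cod f = b" shows "cov (dom f) (%g. ph (f*g))"
 using assms
proof (induction arbitrary: f rule: cov.induct)
 case (cov_id b ph)
 thus ?case by (intro cov.cov_id) auto
next
 case (cov_epi e ph)
 note e = regular_epi_Arr[OF cov_epi(1)]
 obtain p q where pb: "is_pullback C f e p q" using ex_pullback[OF cov_epi(4) e cov_epi(5)] .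
 note D = pullbackD[OF pb]
 have "cov (dom q) (%g. ph (e*q*g))" by (rule cov_epi(3)) (use D in simp_all)
 hence "cov (dom p) (%g. ph (f*p*g))" unfolding D(6) by (rule cov_mono) (use pullback_comm[OF pb] in simp)
 thus ?case using cov.cov_epi[OF regular_epi_stable[OF cov_epi(1) pb], of "%g. ph (f*g)"] D(7) by simp
next
 case (cov_chain A i b j ph)
 note j = stable_chainD[OF cov_chain(1)]
 obtain b' l t where pb: "!!n. is_pullback C f (j n) (b' n) (l n)" and st: "is_stable_chain_colimit C (%n. dom (b' n)) t (dom f) b'"
  using stable_chain_pullback[OF cov_chain(1,4,5)] by blast
 show ?case
 proof (rule cov.cov_chain[OF st])
  fix n
  note D = pullbackD[OF pb[of n]]
  have "cov (dom (l n)) (%g. ph (j n*l n*g))" by (rule cov_chain(3)) (use D j in simp_all)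
  thus "cov (dom (b' n)) (%g. ph (f*b' n*g))" unfolding D(6) by (rule cov_mono) (use pullback_comm[OF pb] in simp)
 qed
qed

lemma cov_conj:
 assumes "cov b ph" "cov b ps" shows "cov b (%f. ph f & ps f)"
proof -
 txt \<open>\<open>ph\<close> need not be closed under precomposition, hence the detour through the sieve it contains.\<close>
 have "cov b (%f. ALL g:Arr C. cod g = dom f --> ph (f*g))" using assms(1)
 proof (induction rule: cov.induct)
  case (cov_id b ph)
  thus ?case by (intro cov.cov_id) auto
 next
  case (cov_epi e ph)
  show ?case by (rule cov.cov_epi[OF cov_epi(1)], rule cov_mono[OF cov_epi(3)]) (use regular_epi_Arr[OF cov_epi(1)] in auto)
 next
  case (cov_chain A i b j ph)
  show ?case by (rule cov.cov_chain[OF cov_chain(1)], rule cov_mono[OF cov_chain(3)]) (use stable_chainD[OF cov_chain(1)] in auto)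
 qed
 thus ?thesis
 proof (rule cov_trans)
  fix f assume f: "arr f" "cod f = b" "ALL g:Arr C. cod g = dom f --> ph (f*g)"
  show "cov (dom f) (%g. ph (f*g) & ps (f*g))" by (rule cov_mono[OF cov_stable[OF assms(2) f(1,2)]]) (use f in simp)
 qed
qed

lemma cov_finite:
 assumes "finite I" "ob b" "!!i. i:I ==> cov b (ph i)" shows "cov b (%f. ALL i:I. ph i f)"
 using assms(1,3)
proof (induction I rule: finite_induct)
 case empty
 thus ?case using assms(2) by (auto intro: cov_true)
next
 case (insert i I)
 hence "cov b (%f. ph i f & (ALL i:I. ph i f))" by (intro cov_conj) auto
 thus ?case by simp
qed

text \<open>Representables are sheaves: a matching family descends along a regular epimorphism by
  its coequaliser property and along a chain by its colimit property.\<close>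

lemma cov_glue:
 assumes "cov b ph" and "ob y"
  and "!!f. arr f ==> cod f = b ==> ph f ==> si f:hom (dom f) y"
  and "!!f g. arr f ==> cod f = b ==> ph f ==> arr g ==> cod g = dom f ==> ph (f*g) & si (f*g) = si f*g"
 shows "EX s:hom b y. ALL f:Arr C. cod f = b --> ph f --> s*f = si f"
 using assms
proof (induction arbitrary: si rule: cov.induct)
 case (cov_id b ph)
 have "si (idt b):hom b y" using cov_id(4)[of "idt b"] cov_id(1,2) by simp
 moreover have "si (idt b)*f = si f" if "arr f" "cod f = b" for f
  using cov_id(5)[of "idt b" f] cov_id(1,2) that by simp
 ultimately show ?case by blast
next
 case (cov_epi e ph)
 note e = regular_epi_Arr[OF cov_epi(1)]
 have "EX s:hom (dom e) y. ALL f:Arr C. cod f = dom e --> ph (e*f) --> s*f = si (e*f)"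
 proof (rule cov_epi(3)[OF cov_epi(4)])
  fix f assume f: "arr f" "cod f = dom e" "ph (e*f)"
  thus "si (e*f):hom (dom f) y" using cov_epi(5)[of "e*f"] e by simp
  fix g assume g: "arr g" "cod g = dom f"
  thus "ph (e*f*g) & si (e*f*g) = si (e*f)*g" using cov_epi(6)[of "e*f" g] f e by simp
 qed
 then obtain s where s: "s:hom (dom e) y" "!!f. arr f ==> cod f = dom e ==> ph (e*f) ==> s*f = si (e*f)" by blast
 have sa: "arr s" "dom s = dom e" "cod s = y" using s(1) by auto
 obtain k k' where co: "is_coequaliser C k k' e" using cov_epi(1) unfolding regular_epi_def by blast
 note K = coequaliserD[OF co]
 have eq: "e*k*f = e*k'*f" if "arr f" "cod f = dom k" for f using Cmp_reassoc[OF K(7), of f] K(1-6) that by simp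
 \<comment> \<open>The two sides are compared on a cover of \<open>dom k\<close> on which both are
   values of the same matching family.\<close>
 have "s*k = s*k'"
 proof (rule cov_sep[OF cov_stable[OF cov_epi(2) K(1) K(6)[symmetric]]])
  show "s*k:hom (dom k) y" "s*k':hom (dom k) y" using sa K by auto
  fix f assume f: "arr f" "cod f = dom k" "ph (e*k*f)"
  have "s*k*f = s*k'*f" using s(2)[of "k*f"] s(2)[of "k'*f"] f eq[OF f(1,2)] K(1-6) by simp
  thus "(s*k)*f = (s*k')*f" using f sa K(1-6) by simp
 qed
 then obtain u where u: "arr u" "dom u = cod e" "cod u = y" "u*e = s"
  using coequaliser_factor[OF co sa(1)] sa K(6) by metis
 have "u*f = si f" if f: "arr f" "cod f = cod e" "ph f" for f
 proof -
  \<comment> \<open>The glued arrow is known only on arrows through \<open>e\<close>; for a general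
    \<open>f\<close> the equation is tested after pulling \<open>e\<close> back along
    \<open>f\<close>, which is again epic.\<close>
  obtain p q where pb: "is_pullback C f e p q" using ex_pullback[OF f(1) e f(2)] .
  note D = pullbackD[OF pb]
  have F: "si f:hom (dom f) y" using cov_epi(5)[OF f] .
  have fp: "ph (f*p)" "si (f*p) = si f*p" using cov_epi(6)[OF f, of p] D by auto
  have "s*q = si (e*q)" by (rule s(2)) (use D fp(1) in simp_all)
  moreover have "u*f*p = s*q" using Cmp_reassoc1[OF u(4), of q] D u(1,2) e by simp
  ultimately have "u*f*p = si f*p" using fp D(9) by simp
  thus ?thesis
   using regular_epi_cancel[OF regular_epi_stable[OF cov_epi(1) pb], of "u*f" "si f"] u(1-3) f F D(1-8) by simp
 qed
 thus ?case using u by (intro bexI[of _ u]) auto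
next
 case (cov_chain A i b j ph)
 note j = stable_chainD[OF cov_chain(1)]
 have "EX s:hom (A n) y. ALL f:Arr C. cod f = A n --> ph (j n*f) --> s*f = si (j n*f)" for n
 proof (rule cov_chain(3)[OF cov_chain(4)])
  fix f assume f: "arr f" "cod f = A n" "ph (j n*f)"
  thus "si (j n*f):hom (dom f) y" using cov_chain(5)[of "j n*f"] j(3-5)[of n] by simp
  fix g assume g: "arr g" "cod g = dom f"
  thus "ph (j n*f*g) & si (j n*f*g) = si (j n*f)*g" using cov_chain(6)[of "j n*f" g] f j(3-5)[of n] by simp
 qed
 then obtain s where s: "!!n. s n:hom (A n) y" "!!n f. arr f ==> cod f = A n ==> ph (j n*f) ==> s n*f = si (j n*f)" by metis
 have sa: "arr (s n)" "dom (s n) = A n" "cod (s n) = y" for n using s(1) by auto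
 have ij: "j (Suc n)*i n*f = j n*f" if "arr f" "cod f = A n" for n f using Cmp_reassoc1[OF j(9)[of n], of f] j(3-8) that by simp
 have "s (Suc n)*i n = s n" for n
 proof (rule cov_sep[OF cov_chain(2)[of n]])
  show "s (Suc n)*i n:hom (A n) y" "s n:hom (A n) y" using sa j by auto
  fix f assume f: "arr f" "cod f = A n" "ph (j n*f)"
  show "(s (Suc n)*i n)*f = s n*f" using s(2)[of "i n*f" "Suc n"] s(2)[OF f] f ij[OF f(1,2)] sa j(3-8) by simp
 qed
 hence "is_chain_cocone C A i y s" unfolding is_chain_cocone_def using s(1) j cov_chain(4) by auto
 then obtain u where u: "u:hom b y" "!!n. u*j n = s n" using j(1) unfolding is_chain_colimit_def by blast
 have ua: "arr u" "dom u = b" "cod u = y" using u(1) by auto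
 have "u*f = si f" if f: "arr f" "cod f = b" "ph f" for f
 proof (rule stable_chain_cancel[OF cov_chain(1)])
  show "f:hom (dom f) b" "u*f:hom (dom f) y" "si f:hom (dom f) y" using f ua cov_chain(5)[OF f] by auto
  fix n a l assume a: "arr a" "arr l" "cod a = dom f" "cod l = A n" "f*a = j n*l"
  have fp: "ph (f*a)" "si (f*a) = si f*a" using cov_chain(6)[OF f a(1,3)] by auto
  have "s n*l = si (j n*l)" by (rule s(2)) (use a fp in simp_all)
  moreover have "u*j n*l = s n*l" using Cmp_reassoc1[OF u(2)[of n], of l] a(2,4) ua j(3-5) by simp
  ultimately show "(u*f)*a = si f*a" using fp(2) a ua f by simp
 qed
 thus ?case using u(1) by blast
qed

text \<open>Membership in a subobject is a local property: local factorisations through a monic are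
  unique, hence match and glue.\<close>

lemma cov_monic_factor:
 assumes u: "monic C u" and g: "arr g" "cod g = cod u"
  and cv: "cov (dom g) (%f. EX h. arr h & cod h = dom u & u*h = g*f)"
 shows "EX h. arr h & dom h = dom g & cod h = dom u & u*h = g"
proof -
 define si where "si f = (SOME h. arr h & cod h = dom u & u*h = g*f)" for f
 note ua = monicD[OF u]
 have si: "arr (si f) & cod (si f) = dom u & u*si f = g*f" if "EX h. arr h & cod h = dom u & u*h = g*f" for f
  unfolding si_def using someI_ex[OF that] .
 have dom: "dom (si f) = dom f" if f: "arr f" "cod f = dom g" "EX h. arr h & cod h = dom u & u*h = g*f" for f
  using Cmp_eqD(1)[of u "si f" g f] si[OF f(3)] f(1,2) g ua by simp
 have "EX s:hom (dom g) (dom u). ALL f:Arr C. cod f = dom g --> (EX h. arr h & cod h = dom u & u*h = g*f) --> s*f = si f"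
 proof (rule cov_glue[OF cv])
  fix f assume f: "arr f" "cod f = dom g" "EX h. arr h & cod h = dom u & u*h = g*f"
  note S = si[OF f(3)] and d = dom[OF f]
  show "si f:hom (dom f) (dom u)" using S d by simp
  fix k assume k: "arr k" "cod k = dom f"
  have e: "u*si f*k = g*f*k" using Cmp_reassoc[of u "si f" g f k] S d k f(1,2) g ua by simp
  hence x: "EX h. arr h & cod h = dom u & u*h = g*f*k" using S d k by (intro exI[of _ "si f*k"]) simp
  have "si (f*k) = si f*k" using monic_cancel[OF u, of "si (f*k)" "si f*k"] si[OF x] S d k e by simp
  thus "(EX h. arr h & cod h = dom u & u*h = g*f*k) & si (f*k) = si f*k" using x by blast
 qed (use ua in simp)
 then obtain s where s: "arr s" "dom s = dom g" "cod s = dom u"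
  "!!f. arr f ==> cod f = dom g ==> EX h. arr h & cod h = dom u & u*h = g*f ==> s*f = si f" by auto
 have "u*s = g"
 proof (rule cov_sep[OF cv])
  show "u*s:hom (dom g) (cod u)" "g:hom (dom g) (cod u)" using s ua g by auto
  fix f assume f: "arr f" "cod f = dom g" "EX h. arr h & cod h = dom u & u*h = g*f"
  show "(u*s)*f = g*f" using s(4)[OF f] si[OF f(3)] f(1,2) s(1-3) ua by simp
 qed
 thus ?thesis using s by blast
qed

end

section \<open>Quotients of reflexive pairs\<close>

text \<open>A pointwise zigzag is an honest generalised element of the corresponding member of the
  chain, as composites contain all composable pairs.\<close>

lemma (in category) zz_lift:
 assumes zc: "zigzag_chain C X P p q r m" and z: "zz (p*r) (q*r) n b u v"
 shows "EX h:hom b (dom (m n)). p*m n*h = u & q*m n*h = v"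
 using z
proof (induction n arbitrary: u)
 case 0
 have m0: "m 0 = r" using zc unfolding zigzag_chain_def by blast
 note R = relationD[OF zigzag_relation[OF zc, of 0]]
 obtain w where "arr w" "dom w = b" "cod w = dom r" "u = (p*r)*w" "v = (q*r)*w"
  using 0 R(1-8) unfolding m0 arr_step_def zz.simps by (metis Cmp_simps(2))
 thus ?case using R(1-8) unfolding m0 by (intro bexI[of _ w]) simp_all
next
 case (Suc n)
 obtain r' s where op: "opposite_relation C X P p q r r'" and s: "composite_relation C X P p q r r' s"
  and c: "composite_relation C X P p q s (m n) (m (Suc n))"
  using zc unfolding zigzag_chain_def by blast
 have r': "dom r' = dom r" "p*r' = q*r" "q*r' = p*r" "relation_on C X P p q r'" "relation_on C X P p q r"
  using op unfolding opposite_relation_def by auto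
 note R = relationD[OF r'(5)] and R' = relationD[OF r'(4)]
 obtain y y' where y: "arr_step (p*r) (q*r) b u y'" "arr_step (p*r) (q*r) b y y'" "zz (p*r) (q*r) n b y v" using Suc(2) by auto
 have DD: "dom (p*r) = dom r" using R(1-8) by simp
 obtain w w' where w: "arr w" "dom w = b" "cod w = dom r" "u = (p*r)*w" "y' = (q*r)*w"
  and w': "arr w'" "dom w' = b" "cod w' = dom r" "y = (p*r)*w'" "y' = (q*r)*w'"
  using y(1,2) unfolding arr_step_def DD by blast
 have "q*r*w = p*r'*w'"
 proof -
  have "(q*r)*w = (p*r')*w'" using w(5) w'(5) r'(2) by simp
  thus ?thesis using w(1-3) w'(1-3) R(1-8) R'(1-8) r'(1) by simp
 qed
 then obtain h where h: "h:hom b (dom s)" "p*s*h = p*r*w" "q*s*h = q*r'*w'"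
  using composite_lift[OF s, of w b w'] w w' r'(1) by auto
 have y': "y = q*r'*w'"
 proof -
  have "y = (q*r')*w'" using w'(4) r'(3) by simp
  thus ?thesis using w'(1-3) R'(1-8) r'(1) by simp
 qed
 obtain h' where h': "h':hom b (dom (m n))" "p*m n*h' = y" "q*m n*h' = v" using Suc.IH[OF y(3)] by blast
 have "u = p*r*w" using w R(1-8) by simp
 thus ?case using composite_lift[OF c h(1) h'(1)] h h' y' by simp
qed

context regular_lex
begin

text \<open>The image is the coequaliser of the kernel pair of \<open>h\<close>; stability of
  regular epimorphisms makes the remaining factor monic.\<close>

lemma image_factorisation:
 assumes h: "arr h"
 shows "EX e m. regular_epi C e & monic C m & dom e = dom h & cod e = dom m & cod m = cod h & m*e = h"
proof -
 obtain k k' where pb: "is_pullback C h h k k'" using ex_pullback[OF h h refl] .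
 note K = pullbackD[OF pb]
 obtain e where co: "is_coequaliser C k k' e" using regular pb unfolding regular_category_def by blast
 note E = coequaliserD[OF co]
 have re: "regular_epi C e" using co unfolding regular_epi_def by blast
 obtain m where m: "arr m" "dom m = cod e" "cod m = cod h" "m*e = h"
  using coequaliser_factor[OF co h] K by metis
 have eD: "dom e = dom h" using E K by simp
 have me: "m*e*f = h*f" if "arr f" "cod f = dom h" for f using Cmp_reassoc1[OF m(4), of f] E(3) eD m that by simp
 have "monic C m"
  unfolding monic_def
 proof (intro conjI m allI ballI impI)
  fix Z a b assume "a:hom Z (dom m)" "b:hom Z (dom m)" and eq: "m*a = m*b"
  hence ab: "arr a" "arr b" "dom a = Z" "dom b = Z" "cod a = cod e" "cod b = cod e" using m(2) by auto
  \<comment> \<open>Two successive pullbacks of \<open>e\<close> cover the common domain of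
    \<open>a\<close> and \<open>b\<close> by an object on which both lift to \<open>dom h\<close>;
    the lifts have equal images under \<open>h\<close> and so lie in its kernel pair.\<close>
  obtain e1 a1 where p1: "is_pullback C a e e1 a1" using ex_pullback[OF ab(1) E(3) ab(5)] .
  note A = pullbackD[OF p1]
  have be: "arr (b*e1)" "cod (b*e1) = cod e" using A(1-8) ab by simp_all
  obtain e2 b2 where p2: "is_pullback C (b*e1) e e2 b2" using ex_pullback[OF be(1) E(3) be(2)] .
  note B = pullbackD[OF p2]
  have DB: "dom (b*e1) = dom e1" using A(1-8) ab by simp
  have ae: "a*e1*e2 = e*a1*e2" using pullback_comm[OF p1 B(3)] B(7) DB by simp
  have bee: "b*e1*e2 = e*b2" using B(9) A(1-8) B(1-8) ab DB by simp
  have "m*a*e1*e2 = m*b*e1*e2" using Cmp_reassoc[OF eq, of "e1*e2"] ab m A(1-8) B(1-8) DB by simp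
  hence "h*a1*e2 = h*b2" unfolding ae bee using me[of "a1*e2"] me[of b2] A(1-8) B(1-8) DB eD by simp
  then obtain t where t: "arr t" "cod t = dom k" "k*t = a1*e2" "k'*t = b2"
   using pullback_lift[OF pb, of "a1*e2" b2] A(1-8) B(1-8) DB eD by (metis Cmp_simps)
  have "e*k*t = e*k'*t" using Cmp_reassoc[OF E(7), of t] t(1,2) E(1-6) by simp
  hence "(a*e1)*e2 = (b*e1)*e2" using ae bee t A(1-8) B(1-8) ab DB by simp
  hence "a*e1 = b*e1"
   using regular_epi_cancel[OF regular_epi_stable[OF re p2], of "a*e1" "b*e1"] A(1-8) B(1-8) ab DB by simp
  thus "a = b" using regular_epi_cancel[OF regular_epi_stable[OF re p1], of a b] A(1-8) ab by simp
 qed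
 thus ?thesis using re m eD by metis
qed

lemma ex_composite:
 assumes r: "relation_on C X P p q r" and s: "relation_on C X P p q s"
 shows "EX t. composite_relation C X P p q r s t"
proof -
 note R = relationD[OF r] and S = relationD[OF s]
 obtain a b where pb: "is_pullback C (q*r) (p*s) a b" using ex_pullback[of "q*r" "p*s"] R(1-8) S(1-8) by auto
 note D = pullbackD[OF pb]
 have D': "cod a = dom r" "cod b = dom s" using D(7,8) R(1-8) S(1-8) by simp_all
 obtain h where h: "arr h" "dom h = dom a" "cod h = P" "p*h = p*r*a" "q*h = q*s*b"
  by (rule product_pair[OF R(10), of "p*r*a" "q*s*b"]) (use D(3,4,6) D' R(1-8) S(1-8) in auto)
 obtain e m where e: "regular_epi C e" "monic C m" "dom e = dom h" "cod e = dom m" "cod m = cod h" "m*e = h"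
  using image_factorisation[OF h(1)] by blast
 have ea: "arr e" "arr m" using regular_epi_Arr[OF e(1)] monicD[OF e(2)] by auto
 have rt: "relation_on C X P p q m" unfolding relation_on_def using R(10) e h by simp
 have "(p*m)*e = (p*r)*a" "(q*m)*e = (q*s)*b"
  using h e ea D(3,4) D' R(1-8) S(1-8) by simp_all
 thus ?thesis unfolding composite_relation_def using r s rt pb e ea h by auto
qed

lemma ex_zigzag_chain:
 assumes r: "relation_on C X P p q r"
 shows "EX m. zigzag_chain C X P p q r m"
proof -
 note R = relationD[OF r]
 obtain r' where r': "arr r'" "dom r' = dom r" "cod r' = P" "p*r' = q*r" "q*r' = p*r"
  by (rule product_pair[OF R(10), of "q*r" "p*r"]) (use R(1-8) in auto)
 have "monic C r'"
  unfolding monic_def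
 proof (intro conjI r' allI ballI impI)
  fix Z x y assume "x:hom Z (dom r')" "y:hom Z (dom r')" and eq: "r'*x = r'*y"
  hence xy: "arr x" "arr y" "cod x = dom r" "cod y = dom r" using r'(2) by auto
  have "(p*r')*x = (p*r')*y" "(q*r')*x = (q*r')*y" using eq xy r'(1-3) R(1-8) by simp_all
  thus "x = y" unfolding r'(4,5) by (intro relation_cancel[OF r xy]) (use xy R(1-8) in simp_all)
 qed
 hence op: "opposite_relation C X P p q r r'" unfolding opposite_relation_def relation_on_def using r r' R(10) unfolding relation_on_def by simp
 hence rr': "relation_on C X P p q r'" unfolding opposite_relation_def by blast
 obtain s where s: "composite_relation C X P p q r r' s" using ex_composite[OF r rr'] by blast
 hence rs: "relation_on C X P p q s" unfolding composite_relation_def by blast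
 define m where "m = rec_nat r (%_ v. SOME t. composite_relation C X P p q s v t)"
 have "relation_on C X P p q (m n)" "composite_relation C X P p q s (m n) (m (Suc n))" for n
 proof -
  have st: "composite_relation C X P p q s v (SOME t. composite_relation C X P p q s v t)" if "relation_on C X P p q v" for v
   using ex_composite[OF rs that] by (rule someI_ex)
  show rel: "relation_on C X P p q (m n)"
  proof (induction n)
   case (Suc n)
   have "composite_relation C X P p q s (m n) (m (Suc n))" using st[OF Suc] by (simp add: m_def)
   thus ?case unfolding composite_relation_def by blast
  qed (simp add: m_def r)
  show "composite_relation C X P p q s (m n) (m (Suc n))" using st[OF rel] unfolding m_def by simp
 qed
 thus ?thesis unfolding zigzag_chain_def using op s by (intro exI[of _ m]) (auto simp: m_def)
qed

lemma cov_regular_epi: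
 assumes e: "regular_epi C e" and v: "arr v" "cod v = cod e"
 shows "cov (dom v) (%f. EX g. arr g & cod g = dom e & v*f = e*g)"
proof -
 have "cov (cod e) (%f. EX g. arr g & cod g = dom e & f = e*g)"
  by (rule cov_epi[OF e], rule cov_id) (use regular_epi_Arr[OF e] in auto)
 from cov_stable[OF this v] show ?thesis .
qed

text \<open>The equivalence relation that the pair generates on generalised elements, made local for
  the topology.\<close>

definition loc_equiv where
 "loc_equiv d c b a a' <-> cov b (%f. equivclp (arr_step d c (dom f)) (a*f) (a'*f))"

lemma loc_equiv_refl: "ob b ==> loc_equiv d c b a a"
 unfolding loc_equiv_def by (rule cov_id) (auto intro: equivclp_refl)

lemma loc_equiv_sym: "loc_equiv d c b a a' ==> loc_equiv d c b a' a"
 unfolding loc_equiv_def by (erule cov_mono) (rule equivclp_sym)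

lemma loc_equiv_trans: "loc_equiv d c b a a' ==> loc_equiv d c b a' a'' ==> loc_equiv d c b a a''"
 unfolding loc_equiv_def by (drule (1) cov_conj, erule cov_mono, elim conjE) (rule equivclp_trans)

lemma loc_equiv_local:
 assumes "cov b ph" and a: "a:hom b y" "a':hom b y"
  and "!!f. arr f ==> cod f = b ==> ph f ==> loc_equiv d c (dom f) (a*f) (a'*f)"
 shows "loc_equiv d c b a a'"
 unfolding loc_equiv_def
proof (rule cov_trans[OF assms(1)])
 fix f assume f: "arr f" "cod f = b" "ph f"
 show "cov (dom f) (%g. equivclp (arr_step d c (dom (f*g))) (a*f*g) (a'*f*g))"
  using assms(4)[OF f] unfolding loc_equiv_def by (rule cov_mono) (use f a in simp)
qed

lemma equivclp_arr_step_comp: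
 assumes "equivclp (arr_step d c b) u v" and f: "arr f" "cod f = b" and d: "arr d" "arr c" "dom c = dom d"
 shows "equivclp (arr_step d c (dom f)) (u*f) (v*f)"
 using assms(1)
proof (rule equivclp_map[where f = "%u. u*f"])
 fix u v assume "arr_step d c b u v"
 then obtain w where w: "arr w" "dom w = b" "cod w = dom d" "u = d*w" "v = c*w" unfolding arr_step_def by blast
 hence "arr_step d c (dom f) (u*f) (v*f)" unfolding arr_step_def using f d by (intro exI[of _ "w*f"]) simp
 thus "equivclp (arr_step d c (dom f)) (u*f) (v*f)" by (rule equivclp_step)
qed

lemma loc_equivI:
 assumes e: "equivclp (arr_step d c b) u v" and b: "ob b" and d: "arr d" "arr c" "dom c = dom d"
 shows "loc_equiv d c b u v"
 unfolding loc_equiv_def by (rule cov_id[OF b], rule equivclp_arr_step_comp[OF e _ _ d])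

end

locale exact_unions = lex_category C for C :: "('o, 'a) cat" +
 assumes exact: "Barr_exact C" and unions: "zigzags_have_stable_effective_unions C"

sublocale exact_unions \<subseteq> regular_lex
 by unfold_locales (use exact in \<open>simp add: Barr_exact_def\<close>)

context exact_unions
begin

text \<open>The union \<open>u\<close> of the zigzag chain is shown to contain exactly the locally
  equivalent pairs of generalised elements. It is then an internal equivalence relation, and its
  quotient \<open>k\<close> exists and has \<open>u\<close> as kernel pair by
  Barr-exactness.\<close>

lemma reflexive_pair_quotient_local:
 assumes d: "arr d" "arr c" "dom d = dom c" "cod d = cod c" "arr z" "dom z = cod d" "cod z = dom d"
  "d*z = idt (cod d)" "c*z = idt (cod d)"
 shows "EX k. regular_epi C k & dom k = cod d &
  (ALL b. ALL a:hom b (cod d). ALL a':hom b (cod d). k*a = k*a' <-> loc_equiv d c b a a')"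
proof -
 let ?y = "cod d"
 have yO: "ob ?y" using d by simp
 obtain P p q where P: "is_product C ?y ?y P p q" using ex_product[OF yO yO] .
 note PD = productD[OF P]
 obtain h where h: "arr h" "dom h = dom d" "cod h = P" "p*h = d" "q*h = c"
  using product_pair[OF P d(1,2)] d by metis
 \<comment> \<open>The pair need not be jointly monic, while zigzag chains are formed for relations;
   it is replaced by its image, which agrees with it locally.\<close>
 obtain e r where e: "regular_epi C e" "monic C r" "dom e = dom h" "cod e = dom r" "cod r = cod h" "r*e = h"
  using image_factorisation[OF h(1)] by blast
 have ea: "arr e" "arr r" using regular_epi_Arr[OF e(1)] monicD[OF e(2)] by auto
 have rel: "relation_on C ?y P p q r" unfolding relation_on_def using P e h by simp
 let ?D = "p*r" and ?C = "q*r"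
 have DC: "arr ?D" "arr ?C" "dom ?D = dom r" "dom ?C = dom r" "cod ?D = ?y" "cod ?C = ?y" using ea PD e h by simp_all
 have De: "?D*e = d" "?C*e = c" using ea e h PD by simp_all
 have Dz: "?D*e*z = idt ?y" "?C*e*z = idt ?y"
  using Cmp_reassoc1[OF De(1), of z] Cmp_reassoc1[OF De(2), of z] DC ea e h d by metis+
 have ez: "arr (e*z)" "dom (e*z) = ?y" "cod (e*z) = dom r" using ea e(3,4) h d by simp_all
 have re: "reflexive_relation C ?y P p q r"
  unfolding reflexive_relation_def using rel Dz ez by (auto simp: simp del: assoc)
 obtain m where zc: "zigzag_chain C ?y P p q r m" using ex_zigzag_chain[OF rel] by blast
 note M = relationD[OF zigzag_relation[OF zc]]
 obtain u where un: "is_stable_effective_union C P m u" using unions re zc unfolding zigzags_have_stable_effective_unions_def by blast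
 hence u: "monic C u" "cod u = P" "!!n. subobject_le C (m n) u"
  unfolding is_stable_effective_union_def is_effective_union_def is_union_def by auto
 note ua = monicD[OF u(1)]
 let ?j = "%n. inclusion C (m n) u"
 have st: "is_stable_chain_colimit C (%n. dom (m n)) (transition C m) (dom u) ?j"
  by (rule effective_union_stable_colimit[OF un M(9)])
 have j: "arr (?j n)" "dom (?j n) = dom (m n)" "cod (?j n) = dom u" "u*?j n = m n" for n
  using inclusionD[OF u(1) u(3)] by auto
 have uj: "u*?j n*f = m n*f" if "arr f" "cod f = dom (m n)" for n f
  using Cmp_reassoc1[OF j(4)[of n], of f] j(1-3) ua that by simp
 have ru: "relation_on C ?y P p q u" unfolding relation_on_def using P u by simp

 define W where "W a a' <-> (EX h. arr h & dom h = dom a & cod h = dom u & p*u*h = a & q*u*h = a')" for a a'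
 \<comment> \<open>Locally the equivalence is a zigzag of some finite length, hence an element of
   some \<open>m n\<close> and of \<open>u\<close>; factoring through \<open>u\<close> is a local
   property.\<close>
 have LW: "W a a'" if a: "a:hom b ?y" "a':hom b ?y" and L: "loc_equiv d c b a a'" for b a a'
 proof -
  have aa: "arr a" "dom a = b" "cod a = ?y" "arr a'" "dom a' = b" "cod a' = ?y" using a by auto
  obtain g where g: "arr g" "dom g = b" "cod g = P" "p*g = a" "q*g = a'"
   using product_pair[OF P aa(1,4)] aa by metis
  have "cov (dom g) (%f. EX h. arr h & cod h = dom u & u*h = g*f)"
   unfolding g(2)
  proof (rule cov_mono[OF L[unfolded loc_equiv_def]])
   fix f assume f: "arr f" "cod f = b" and eq: "equivclp (arr_step d c (dom f)) (a*f) (a'*f)"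
   have "equivclp (arr_step ?D ?C (dom f)) (a*f) (a'*f)"
   proof (rule equivclp_map[OF eq, where f = "%x. x"])
    fix v v' assume "arr_step d c (dom f) v v'"
    then obtain w where w: "arr w" "dom w = dom f" "cod w = dom d" "v = d*w" "v' = c*w" unfolding arr_step_def by blast
    have "?D*e*w = v" "?C*e*w = v'" using Cmp_reassoc1[OF De(1), of w] Cmp_reassoc1[OF De(2), of w] DC ea e h w by metis+
    hence "arr_step ?D ?C (dom f) v v'" unfolding arr_step_def using w ea e(3,4) h(2) DC(3) by (intro exI[of _ "e*w"]) simp
    thus "equivclp (arr_step ?D ?C (dom f)) v v'" by (rule equivclp_step)
   qed
   hence "equivclp (arr_step ?D ?C (dom f)) (a'*f) (a*f)" by (rule equivclp_sym)
   moreover have "a'*f:hom (dom f) (cod ?D)" unfolding DC(5) using aa f by simp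
   ultimately obtain n where "zz ?D ?C n (dom f) (a*f) (a'*f)"
    using equivclp_zz[of ?D ?C "e*z" "a'*f"] DC ez Dz by metis
   then obtain l where l: "arr l" "dom l = dom f" "cod l = dom (m n)" "p*m n*l = a*f" "q*m n*l = a'*f"
    using zz_lift[OF zc, of n "dom f" "a*f" "a'*f"] by (metis Hom_iff)
   have gf: "p*g*f = a*f" "q*g*f = a'*f" using Cmp_reassoc1[OF g(4), of f] Cmp_reassoc1[OF g(5), of f] g(1-3) f PD by simp_all
   have "m n*l = g*f"
   proof (rule product_unique[OF P])
    show "p*m n*l = p*g*f" "q*m n*l = q*g*f" using l(4,5) gf by simp_all
   qed (use l(1-3) g(1-3) f M(3,8)[of n] in simp_all)
   thus "EX h. arr h & cod h = dom u & u*h = g*f"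
    using uj[OF l(1,3)] l j by (intro exI[of _ "?j n*l"]) simp
  qed
  from cov_monic_factor[OF u(1) g(1) _ this] obtain l where "arr l" "dom l = b" "cod l = dom u" "u*l = g" using g u(2) by auto
  thus "W a a'" unfolding W_def using g aa by (intro exI[of _ l]) simp
 qed

 \<comment> \<open>The opposite inclusion, as a property of a relation \<open>t\<close> that passes
   from \<open>r\<close> to its opposite, to composites and finally to the union of the
   chain.\<close>
 define I where "I t <-> (ALL v:Arr C. cod v = dom t --> loc_equiv d c (dom v) (p*t*v) (q*t*v))" for t
 have tv: "p*t*v:hom (dom v) ?y" "q*t*v:hom (dom v) ?y" if "relation_on C ?y P p q t" "arr v" "cod v = dom t" for t v
  using relationD(1-8)[OF that(1)] that(2,3) by auto
 have tvf: "(p*t*v)*f = p*t*v*f" "(q*t*v)*f = q*t*v*f"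
  if "relation_on C ?y P p q t" "arr v" "cod v = dom t" "arr f" "cod f = dom v" for t v f
  using relationD(1-8)[OF that(1)] that(2-) by simp_all
 have Ir: "I r"
  unfolding I_def
 proof (intro ballI impI)
  fix v assume v: "arr v" "cod v = dom r"
  show "loc_equiv d c (dom v) (p*r*v) (q*r*v)"
  proof (rule loc_equiv_local[OF cov_regular_epi[OF e(1) v(1)] tv[OF rel v]])
   fix f assume f: "arr f" "cod f = dom v" and "EX g. arr g & cod g = dom e & v*f = e*g"
   then obtain g where g: "arr g" "cod g = dom e" "v*f = e*g" by blast
   have dg: "dom g = dom f" using Cmp_eqD(1)[OF g(3)] f v ea g e by simp
   have "p*r*e*g = d*g" "q*r*e*g = c*g"
    using Cmp_reassoc1[OF De(1), of g] Cmp_reassoc1[OF De(2), of g] DC ea e(3-5) h g(1,2) PD by simp_all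
   hence "arr_step d c (dom f) (p*r*v*f) (q*r*v*f)"
    unfolding arr_step_def g(3) using g dg e(3) h(2) by (intro exI[of _ g]) simp
   thus "loc_equiv d c (dom f) ((p*r*v)*f) ((q*r*v)*f)"
    unfolding tvf[OF rel v f] by (intro loc_equivI equivclp_step) (use f d in simp_all)
  qed (use v e in simp)
 qed
 have Icomp: "I t" if co: "composite_relation C ?y P p q r1 r2 t" and I: "I r1" "I r2" for r1 r2 t
  unfolding I_def
 proof (intro ballI impI)
  have rels: "relation_on C ?y P p q r1" "relation_on C ?y P p q r2" "relation_on C ?y P p q t" using co unfolding composite_relation_def by blast+
  note R1 = relationD[OF rels(1)] and R2 = relationD[OF rels(2)] and T = relationD[OF rels(3)]
  obtain a b k where pb: "is_pullback C (q*r1) (p*r2) a b" and k: "arr k" "dom k = dom a" "cod k = dom t" "regular_epi C k"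
   and tk: "(p*t)*k = (p*r1)*a" "(q*t)*k = (q*r2)*b"
   using co unfolding composite_relation_def by auto
  note D = pullbackD[OF pb]
  fix v assume v: "arr v" "cod v = dom t"
  show "loc_equiv d c (dom v) (p*t*v) (q*t*v)"
  proof (rule loc_equiv_local[OF cov_regular_epi[OF k(4) v(1)] tv[OF rels(3) v]])
   fix f assume f: "arr f" "cod f = dom v" and "EX g. arr g & cod g = dom k & v*f = k*g"
   then obtain g where g: "arr g" "cod g = dom k" "v*f = k*g" by blast
   have dg: "dom g = dom f" using Cmp_eqD(1)[OF g(3)] f v k g by simp
   have 1: "p*t*k*g = p*r1*a*g" "q*t*k*g = q*r2*b*g"
    using Cmp_reassoc[OF tk(1), of g] Cmp_reassoc[OF tk(2), of g] g(1,2) k(1-3) D(1-8) R1(1-8) R2(1-8) T(1-8) by simp_all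
   have ab: "cod (a*g) = dom r1" "cod (b*g) = dom r2" "arr (a*g)" "arr (b*g)" "dom (a*g) = dom f" "dom (b*g) = dom f"
    using g(1,2) k(2) D(1-8) R1(1-8) R2(1-8) dg by simp_all
   have 2: "q*r1*a*g = p*r2*b*g" using pullback_comm[OF pb g(1)] g(1,2) k(2) D(1-8) R1(1-8) R2(1-8) by simp
   have "loc_equiv d c (dom f) (p*r1*a*g) (q*r1*a*g)" "loc_equiv d c (dom f) (p*r2*b*g) (q*r2*b*g)"
    using I ab unfolding I_def by auto
   hence "loc_equiv d c (dom f) (p*t*v*f) (q*t*v*f)"
    unfolding g(3) 1 unfolding 2 by (rule loc_equiv_trans)
   thus "loc_equiv d c (dom f) ((p*t*v)*f) ((q*t*v)*f)" unfolding tvf[OF rels(3) v f] .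
  qed (use v k in simp)
 qed
 have Im: "I (m n)" for n
 proof -
  obtain r' s where op: "opposite_relation C ?y P p q r r'" and s: "composite_relation C ?y P p q r r' s"
   and c: "!!n. composite_relation C ?y P p q s (m n) (m (Suc n))" and m0: "m 0 = r"
   using zc unfolding zigzag_chain_def by blast
  have r': "dom r' = dom r" "p*r' = q*r" "q*r' = p*r" "relation_on C ?y P p q r'"
   using op unfolding opposite_relation_def by auto
  note R' = relationD[OF r'(4)] and R = relationD[OF rel]
  have "I r'"
   unfolding I_def
  proof (intro ballI impI)
   fix v assume v: "arr v" "cod v = dom r'"
   have "p*r'*v = q*r*v" "q*r'*v = p*r*v"
    using Cmp_reassoc[OF r'(2), of v] Cmp_reassoc[OF r'(3), of v] v R(1-8) R'(1-8) r'(1) by simp_all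
   thus "loc_equiv d c (dom v) (p*r'*v) (q*r'*v)" using Ir v r'(1) unfolding I_def by (simp add: loc_equiv_sym)
  qed
  hence "I s" by (rule Icomp[OF s Ir])
  show ?thesis by (induction n) (use m0 Ir Icomp[OF c \<open>I s\<close>] in auto)
 qed
 \<comment> \<open>By stability of the union every generalised element of \<open>u\<close> is
   locally one of some \<open>m n\<close>.\<close>
 have Iu: "I u"
  unfolding I_def
 proof (intro ballI impI)
  fix v assume v: "arr v" "cod v = dom u"
  have "cov (dom u) (%f. EX n g. arr g & cod g = dom (m n) & f = ?j n*g)"
   by (rule cov_chain[OF st], rule cov_id) (use M(3) in auto)
  note cv = cov_stable[OF this v]
  show "loc_equiv d c (dom v) (p*u*v) (q*u*v)"
  proof (rule loc_equiv_local[OF cv tv[OF ru v]])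
   fix f assume f: "arr f" "cod f = dom v" and "EX n g. arr g & cod g = dom (m n) & v*f = ?j n*g"
   then obtain n g where g: "arr g" "cod g = dom (m n)" "v*f = ?j n*g" by blast
   have dg: "dom g = dom f" using Cmp_eqD(1)[OF g(3)] f v j g by simp
   have "loc_equiv d c (dom f) (p*u*v*f) (q*u*v*f)"
    unfolding g(3) uj[OF g(1,2)] using Im[of n] g(1,2) dg unfolding I_def by auto
   thus "loc_equiv d c (dom f) ((p*u*v)*f) ((q*u*v)*f)" unfolding tvf[OF ru v f] .
  qed
 qed
 have WL: "loc_equiv d c b a a'" if a: "a:hom b ?y" and W: "W a a'" for b a a'
  using W Iu a unfolding W_def I_def by auto

 let ?p = "p*u" and ?q = "q*u" and ?i = "idt (dom u)"
 have pq: "arr ?p" "arr ?q" "dom ?p = dom u" "dom ?q = dom u" "cod ?p = ?y" "cod ?q = ?y" using ua PD u by simp_all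
 have uO: "ob (dom u)" using ua by simp
 have Wpq: "loc_equiv d c b (?p*a) (?q*a)" if "arr a" "dom a = b" "cod a = dom u" for a b
  using Iu that ua PD u(2) unfolding I_def by auto
 \<comment> \<open>Local equivalence is reflexive, symmetric and transitive; applying
   \<open>LW\<close> to generic generalised elements makes these properties internal.\<close>
 have eq: "equivalence_relation C ?y P p q u"
  unfolding equivalence_relation_def
 proof (intro conjI)
  have "W (idt ?y) (idt ?y)" using LW[OF _ _ loc_equiv_refl[OF yO]] yO by simp
  thus "reflexive_relation C ?y P p q u"
   unfolding reflexive_relation_def W_def using ru ua PD u(2) yO by auto
  have "W ?q ?p"
   by (rule LW[where b = "dom u"]) (use loc_equiv_sym[OF Wpq[of ?i]] pq uO in \<open>simp_all add: Hom_iff del: assoc\<close>)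
  thus "symmetric_relation C ?y P p q u"
   unfolding symmetric_relation_def W_def using ru ua PD u(2) pq by auto
  show "transitive_relation C ?y P p q u"
   unfolding transitive_relation_def
  proof (intro conjI ru allI impI)
   fix a b assume pb: "is_pullback C ?q ?p a b"
   note D = pullbackD[OF pb]
   have "W (?p*a) (?q*b)"
   proof (rule LW[where b = "dom a"])
    show "loc_equiv d c (dom a) (?p*a) (?q*b)"
     using loc_equiv_trans[OF Wpq[of a] Wpq[of b, folded D(9)]] D pq by simp
   qed (use D pq in \<open>auto simp: simp del: assoc\<close>)
   then obtain t where t: "arr t" "dom t = dom (?p*a)" "cod t = dom u" "p*u*t = ?p*a" "q*u*t = ?q*b" unfolding W_def by blast
   have "dom (?p*a) = dom a" using D(1-8) pq by (simp del: assoc)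
   thus "EX t:hom (dom a) (dom u). ?p*t = ?p*a & ?q*t = ?q*b"
    using t ua PD u(2) by (intro bexI[of _ t]) auto
  qed
 qed
 then obtain f where pb: "is_pullback C f f ?p ?q" using exact unfolding Barr_exact_def by blast
 obtain k where co: "is_coequaliser C ?p ?q k" using regular pb unfolding regular_category_def by blast
 note K = coequaliserD[OF co] and F = pullbackD[OF pb]
 obtain g where g: "arr g" "dom g = cod k" "g*k = f"
  using coequaliser_factor[OF co F(1)] F(7,9) by metis
 have ky: "dom k = ?y" using K(6) pq by simp
 have "k*a = k*a' <-> loc_equiv d c b a a'" if a: "a:hom b ?y" "a':hom b ?y" for b a a'
 proof
  have aa: "arr a" "dom a = b" "cod a = ?y" "arr a'" "dom a' = b" "cod a' = ?y" using a by auto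
  assume "k*a = k*a'"
  hence "(g*k)*a = (g*k)*a'" using g(1,2) K(3) ky aa by simp
  hence fa: "f*a = f*a'" using g by simp
  have fy: "dom f = ?y" using F(7) pq by simp
  obtain l where l: "arr l" "dom l = b" "cod l = dom ?p" "?p*l = a" "?q*l = a'"
   by (rule pullback_lift[OF pb aa(1,4) _ _ _ fa]) (use aa fy in simp_all)
  hence "W a a'" unfolding W_def using pq(3) aa ua PD u(2) by (intro exI[of _ l]) auto
  thus "loc_equiv d c b a a'" by (rule WL[OF a(1)])
 next
  assume "loc_equiv d c b a a'"
  then obtain l where l: "arr l" "dom l = dom a" "cod l = dom u" "p*u*l = a" "q*u*l = a'" using LW[OF a] unfolding W_def by blast
  hence "?p*l = a" "?q*l = a'" using ua PD u(2) by simp_all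
  thus "k*a = k*a'" using Cmp_reassoc[OF K(7), of l] l(1,3) pq K(3,6) by metis
 qed
 thus ?thesis using ky co unfolding regular_epi_def by blast
qed

end

section \<open>Local isomorphisms to representables\<close>

locale exact_site = lex_loc_small C U + exact_unions C for C :: "('o, 'a) cat" and U :: "'u set set"
begin

text \<open>The map from \<open>F\<close> to the representable at \<open>c\<close> is locally
  injective and locally surjective, which says that it becomes invertible on associated
  sheaves.\<close>

definition loc_iso where
 "loc_iso F c ta <-> psh F & cnat F c ta &
  (ALL b:Ob C. ALL x:fob F b. ALL x':fob F b. ta b x = ta b x' --> cov b (%f. act F f x = act F f x')) &
  (ALL a:Arr C. cod a = c --> cov (dom a) (%f. EX x:fob F (dom f). ta (dom f) x = a*f))"

lemma loc_isoD:
 assumes "loc_iso F c ta"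
 shows "psh F" "cnat F c ta" "!!b x x'. ob b ==> x:fob F b ==> x':fob F b ==> ta b x = ta b x' ==> cov b (%f. act F f x = act F f x')"
  "!!a. arr a ==> cod a = c ==> cov (dom a) (%f. EX x:fob F (dom f). ta (dom f) x = a*f)"
 using assms unfolding loc_iso_def by blast+

text \<open>Representables are sheaves, so a map from \<open>F\<close> to one extends uniquely along
  a local isomorphism: separatedness handles the local kernel and gluing the local lifts.\<close>

lemma loc_iso_univ:
 assumes li: "loc_iso F c ta" shows "univ F c ta"
proof (rule univI)
 note L = loc_isoD[OF li]
 show "cnat F c ta" by (rule L(2))
 note t = cnatD[OF L(2)]
 have cover: "cov c (%f. EX x:fob F (dom f). ta (dom f) x = f)"
  using L(4)[of "idt c"] t(1) by (auto elim!: cov_mono)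
 {
  fix d si assume si: "cnat F d si"
  note s = cnatD[OF si]
  have agree: "si b x = si b x'" if b: "ob b" "x:fob F b" "x':fob F b" "ta b x = ta b x'" for b x x'
  proof (rule cov_sep[OF L(3)[OF b]])
   show "si b x:hom b d" "si b x':hom b d" using s b by auto
   fix f assume "arr f" "cod f = b" "act F f x = act F f x'"
   thus "si b x*f = si b x'*f" using s(5)[of f x] s(5)[of f x'] b by simp
  qed
  \<comment> \<open>On arrows that lift to \<open>F\<close> the extension is dictated by any lift;
    \<open>agree\<close> makes the choice immaterial, and these arrows cover
    \<open>c\<close>.\<close>
  define S where "S f = si (dom f) (SOME x. x:fob F (dom f) & ta (dom f) x = f)" for f
  have S: "S f = si (dom f) x" if f: "arr f" "x:fob F (dom f)" "ta (dom f) x = f" for f x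
  proof -
   let ?x = "SOME x. x:fob F (dom f) & ta (dom f) x = f"
   have e: "?x:fob F (dom f) & ta (dom f) ?x = f"
    by (rule someI[of "%x. x:fob F (dom f) & ta (dom f) x = f" x]) (use f in blast)
   show ?thesis unfolding S_def
    by (rule agree[OF Dom_Ob[OF f(1)] conjunct1[OF e] f(2) trans[OF conjunct2[OF e] f(3)[symmetric]]])
  qed
  have "EX g:hom c d. ALL f:Arr C. cod f = c --> (EX x:fob F (dom f). ta (dom f) x = f) --> g*f = S f"
  proof (rule cov_glue[OF cover s(1)])
   fix f assume f: "arr f" "cod f = c" "EX x:fob F (dom f). ta (dom f) x = f"
   then obtain x where x: "x:fob F (dom f)" "ta (dom f) x = f" by blast
   note Sf = S[OF f(1) x]
   show "S f:hom (dom f) d" unfolding Sf using s f(1) x(1) by simp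
   fix g assume g: "arr g" "cod g = dom f"
   have gx: "act F g x:fob F (dom (f*g))" using pshD(2)[OF L(1) g(1)] x(1) g f(1) by simp
   moreover have e: "ta (dom (f*g)) (act F g x) = f*g" using t(5)[OF g(1)] x g f(1) by simp
   ultimately have "EX x:fob F (dom (f*g)). ta (dom (f*g)) x = f*g" by blast
   moreover have "S (f*g) = S f*g"
    using S[OF _ gx e] Sf s(5)[OF g(1)] x g f(1) by simp
   ultimately show "(EX x:fob F (dom (f*g)). ta (dom (f*g)) x = f*g) & S (f*g) = S f*g" by blast
  qed
  then obtain g where g: "g:hom c d" "!!f. arr f ==> cod f = c ==> EX x:fob F (dom f). ta (dom f) x = f ==> g*f = S f" by blast
  have "g*ta b x = si b x" if b: "ob b" "x:fob F b" for b x
   using g(2)[of "ta b x"] S[of "ta b x" x] t(2-4)[OF b] b by auto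
  thus "EX g. arr g & dom g = c & cod g = d & (ALL b:Ob C. ALL x:fob F b. g*ta b x = si b x)"
   using g(1) by auto
 }
 fix g h assume g: "arr g" "arr h" "dom g = c" "dom h = c" "cod g = cod h"
  and eq: "ALL b:Ob C. ALL x:fob F b. g*ta b x = h*ta b x"
 show "g = h"
 proof (rule cov_sep[OF cover])
  show "g:hom c (cod g)" "h:hom c (cod g)" using g by auto
  fix f assume "arr f" "EX x:fob F (dom f). ta (dom f) x = f"
  thus "g*f = h*f" using eq by (metis Dom_Ob)
 qed
qed

lemma loc_iso_yo: assumes c: "ob c" shows "loc_iso (yo c) c (%b u. dc b c u)"
 unfolding loc_iso_def
proof (intro conjI ballI impI psh_yo c)
 show "cnat (yo c) c (%b u. dc b c u)" by (rule univ_cnat[OF univ_yo[OF c]])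
 fix b x x' assume "ob b" "x:fob (yo c) b" "x':fob (yo c) b" "dc b c x = dc b c x'"
 hence "x = x'" "ob b" using dc_inj by blast+
 thus "cov b (%f. act (yo c) f x = act (yo c) f x')" by (auto intro: cov_true)
next
 fix a assume a: "arr a" "cod a = c"
 show "cov (dom a) (%f. EX x:fob (yo c) (dom f). dc (dom f) c x = a*f)"
 proof (rule cov_id)
  fix f assume "arr f" "cod f = dom a"
  thus "EX x:fob (yo c) (dom f). dc (dom f) c x = a*f" using a by (intro bexI[of _ "cd (dom f) c (a*f)"]) simp_all
 qed (use a in simp)
qed

lemma loc_iso_transport:
 assumes li: "loc_iso F c ta" and F': "psh F'" and k: "natural C F F' k" "natural C F' F k'"
  and inv: "!!b x. ob b ==> x:fob F b ==> k' b (k b x) = x" "!!b x. ob b ==> x:fob F' b ==> k b (k' b x) = x"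
 shows "loc_iso F' c (%b x. ta b (k' b x))"
 unfolding loc_iso_def
proof (intro conjI ballI impI F' cnat_precomp[OF k(2)])
 note L = loc_isoD[OF li]
 show "cnat F c ta" by (rule L(2))
 fix b x x' assume b: "ob b" "x:fob F' b" "x':fob F' b" "ta b (k' b x) = ta b (k' b x')"
 have kx: "k' b x:fob F b" "k' b x':fob F b" using naturalD(1)[OF k(2)] b by auto
 show "cov b (%f. act F' f x = act F' f x')"
 proof (rule cov_mono[OF L(3)[OF b(1) kx b(4)]])
  fix f assume f: "arr f" "cod f = b" and e: "act F f (k' b x) = act F f (k' b x')"
  have "act F' f z = k (dom f) (act F f (k' b z))" if "z:fob F' b" for z
   using naturalD(2)[OF k(1) f(1), of "k' b z"] inv(2)[OF b(1) that] naturalD(1)[OF k(2) b(1) that] f by simp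
  thus "act F' f x = act F' f x'" using e b by simp
 qed
next
 note L = loc_isoD[OF li]
 fix a assume a: "arr a" "cod a = c"
 show "cov (dom a) (%f. EX x:fob F' (dom f). ta (dom f) (k' (dom f) x) = a*f)"
 proof (rule cov_mono[OF L(4)[OF a]])
  fix f assume f: "arr f" and "EX x:fob F (dom f). ta (dom f) x = a*f"
  then obtain x where x: "x:fob F (dom f)" "ta (dom f) x = a*f" by blast
  thus "EX x:fob F' (dom f). ta (dom f) (k' (dom f) x) = a*f"
   using naturalD(1)[OF k(1) _ x(1)] inv(1)[OF _ x(1)] f by (intro bexI[of _ "k (dom f) x"]) simp_all
 qed
qed

text \<open>Local isomorphisms are universal, so the objects \<open>c j\<close> inherit the arrows
  of the diagram, and uniqueness gives functoriality. The shape may be any category.\<close>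

lemma loc_iso_diagram:
 assumes D: "is_functor J (PV V) D" and li: "!!j. j:Ob J ==> loc_iso (fob D j) (c j) (ta j)"
 shows "EX D'. is_functor J C D' & fob D' = c &
  (ALL ph:Arr J. ALL b:Ob C. ALL u:fob (fob D (Dom J ph)) b. farr D' ph*ta (Dom J ph) b u = ta (Cod J ph) b (ev (farr D ph) b u))"
proof -
 interpret J: category J by (rule functorD(1)[OF D])
 note n = functor_PV(4)[OF D]
 have u: "univ (fob D j) (c j) (ta j)" if "j:Ob J" for j by (rule loc_iso_univ[OF li[OF that]])
 note t = cnatD[OF univ_cnat[OF u]]
 have ex: "EX g. arr g & dom g = c (Dom J ph) & cod g = c (Cod J ph) &
   (ALL b:Ob C. ALL u:fob (fob D (Dom J ph)) b. g*ta (Dom J ph) b u = ta (Cod J ph) b (ev (farr D ph) b u))" if ph: "ph:Arr J" for ph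
  by (rule univ_lift[OF u[OF J.Dom_Ob[OF ph]] cnat_precomp[OF n[OF ph] univ_cnat[OF u[OF J.Cod_Ob[OF ph]]]]]) blast
 define G where "G ph = (SOME g. arr g & dom g = c (Dom J ph) & cod g = c (Cod J ph) &
   (ALL b:Ob C. ALL u:fob (fob D (Dom J ph)) b. g*ta (Dom J ph) b u = ta (Cod J ph) b (ev (farr D ph) b u)))" for ph
 have G: "arr (G ph)" "dom (G ph) = c (Dom J ph)" "cod (G ph) = c (Cod J ph)"
  "!!b u. ob b ==> u:fob (fob D (Dom J ph)) b ==> G ph*ta (Dom J ph) b u = ta (Cod J ph) b (ev (farr D ph) b u)" if ph: "ph:Arr J" for ph
  using someI_ex[OF ex[OF ph], folded G_def] by auto
 note H = functor_PV(3)[OF D]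
 have "is_functor J C \<lparr>fob = c, farr = G\<rparr>"
 proof (rule functorI[OF J.category_axioms category_axioms])
  fix x assume x: "x:Ob J"
  have "G (Idt J x) = idt (c x)"
  proof (rule univ_eq[OF u[OF x]])
   fix b v assume b: "ob b" "v:fob (fob D x) b"
   have "farr D (Idt J x) = Idt PC (fob D x)" using functorD(7)[OF D x] by simp
   hence "ev (farr D (Idt J x)) b v = v" using b by simp
   thus "G (Idt J x)*ta x b v = idt (c x)*ta x b v" using G(4)[of "Idt J x" b v] x b t[OF x] by simp
  qed (use G[of "Idt J x"] x t(1)[OF x] in simp_all)
  thus "farr \<lparr>fob = c, farr = G\<rparr> (Idt J x) = idt (fob \<lparr>fob = c, farr = G\<rparr> x)" by simp
 next
  fix f g assume f: "f:Arr J" "g:Arr J" "Dom J g = Cod J f"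
  have gf: "Cmp J g f:Arr J" "Dom J (Cmp J g f) = Dom J f" "Cod J (Cmp J g f) = Cod J g" using f by simp_all
  have "G (Cmp J g f) = G g*G f"
  proof (rule univ_eq[OF u[OF J.Dom_Ob[OF f(1)]]])
   fix b v assume b: "ob b" "v:fob (fob D (Dom J f)) b"
   have "farr D (Cmp J g f) = Cmp PC (farr D g) (farr D f)" using functorD(8)[OF D f] by simp
   hence e: "ev (farr D (Cmp J g f)) b v = ev (farr D g) b (ev (farr D f) b v)" using H[OF f(1)] b by simp
   have fv: "ev (farr D f) b v:fob (fob D (Dom J g)) b" using naturalD(1)[OF n[OF f(1)] b] f(3) by simp
   have "(G g*G f)*ta (Dom J f) b v = G g*ta (Cod J f) b (ev (farr D f) b v)"
    using G[OF f(1)] G(1,2)[OF f(2)] t(2-4)[OF J.Dom_Ob[OF f(1)] b] b f(3) by simp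
   thus "G (Cmp J g f)*ta (Dom J f) b v = (G g*G f)*ta (Dom J f) b v"
    using G(4)[OF gf(1), of b v] G(4)[OF f(2) b(1) fv] b e gf f(3) by simp
  qed (use G[OF gf(1)] G[OF f(1)] G[OF f(2)] gf f(3) in simp_all)
  thus "farr \<lparr>fob = c, farr = G\<rparr> (Cmp J g f) = farr \<lparr>fob = c, farr = G\<rparr> g*farr \<lparr>fob = c, farr = G\<rparr> f" by simp
 qed (use G t(1) in simp_all)
 thus ?thesis using G(4) by (intro exI[of _ "\<lparr>fob = c, farr = G\<rparr>"]) simp
qed

text \<open>A finite limit involves finitely many coordinates and finitely many compatibility
  equations, and finitely many covers have a common refinement.\<close>

lemma loc_iso_limit:
 assumes fin: "finite_diagram J (PV V) D" and V: "yo ` Ob C <= V" and lim: "is_limit J (PV V) D x l"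
  and li: "!!j. j:Ob J ==> loc_iso (fob D j) (c j) (ta j)"
  and D': "is_functor J C D'" "!!j. j:Ob J ==> fob D' j = c j"
  and D'ta: "!!ph b u. ph:Arr J ==> ob b ==> u:fob (fob D (Dom J ph)) b ==>
   farr D' ph*ta (Dom J ph) b u = ta (Cod J ph) b (ev (farr D ph) b u)"
  and lim': "is_limit J C D' z m"
 shows "EX th. loc_iso x z th & (ALL j:Ob J. ALL b:Ob C. ALL u:fob x b. m j*th b u = ta j b (ev (l j) b u))"
proof -
 have D: "is_functor J (PV V) D" and J: "finite (Ob J)" "finite (Arr J)" using fin unfolding finite_diagram_def by auto
 interpret J: category J by (rule functorD(1)[OF D])
 note el = limit_elements[OF V D lim, unfolded el_limit_def]
 have x: "psh x" and lH: "!!j. j:Ob J ==> l j:Hom PC x (fob D j)"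
  and lc: "!!ph b u. ph:Arr J ==> ob b ==> u:fob x b ==> ev (farr D ph) b (ev (l (Dom J ph)) b u) = ev (l (Cod J ph)) b u"
  using limitD(1)[OF lim] unfolding cone_PV[OF D] by auto
 note ln = ev_natural[OF lH] and dn = functor_PV(4)[OF D] and Dp = functor_PV(1)[OF D]
 note t = cnatD[OF loc_isoD(2)[OF li]]
 note M = limitD[OF lim'] and F = functorD[OF D'(1)]
 have "EX h. arr h & dom h = b & cod h = z & (ALL j:Ob J. m j*h = ta j b (ev (l j) b u))" if b: "ob b" "u:fob x b" for b u
 proof -
  have "is_cone J C D' b (%j. ta j b (ev (l j) b u))"
   unfolding cone_iff
  proof (intro conjI ballI b(1))
   fix j assume j: "j:Ob J"
   show "arr (ta j b (ev (l j) b u))" "dom (ta j b (ev (l j) b u)) = b" "cod (ta j b (ev (l j) b u)) = fob D' j"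
    using t(2-4)[OF j b(1) naturalD(1)[OF ln[OF j] b]] D'(2)[OF j] by auto
  next
   fix ph assume ph: "ph:Arr J"
   show "farr D' ph*ta (Dom J ph) b (ev (l (Dom J ph)) b u) = ta (Cod J ph) b (ev (l (Cod J ph)) b u)"
    using D'ta[OF ph b(1) naturalD(1)[OF ln[OF J.Dom_Ob[OF ph]] b]] lc[OF ph b] by simp
  qed
  from limit_lift[OF lim' this] show ?thesis by metis
 qed
 then obtain th where th: "!!b u. ob b ==> u:fob x b ==> arr (th b u) & dom (th b u) = b & cod (th b u) = z &
  (ALL j:Ob J. m j*th b u = ta j b (ev (l j) b u))" by metis
 have "loc_iso x z th"
  unfolding loc_iso_def
 proof (intro conjI x ballI impI)
  show "cnat x z th"
   unfolding cnat_def
  proof (intro conjI ballI M(2))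
   fix f u assume f: "arr f" "u:fob x (cod f)"
   note T = th[OF Cod_Ob[OF f(1)] f(2)] and T' = th[OF Dom_Ob[OF f(1)] pshD(2)[OF x f]]
   show "th (dom f) (act x f u) = th (cod f) u*f"
   proof (rule limit_unique[OF lim' D'(1)])
    fix j assume j: "j:Ob J"
    have "m j*th (cod f) u*f = (m j*th (cod f) u)*f" using T f(1) M(3,4)[OF j] by simp
    also have "... = ta j (cod f) (ev (l j) (cod f) u)*f" using T j by simp
    also have "... = ta j (dom f) (ev (l j) (dom f) (act x f u))"
     using t(5)[OF j f(1) naturalD(1)[OF ln[OF j] Cod_Ob[OF f(1)] f(2)]] naturalD(2)[OF ln[OF j] f] by simp
    finally show "m j*th (dom f) (act x f u) = m j*th (cod f) u*f" using T' j by simp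
   qed (use T T' f in simp_all)
  qed (use th in auto)
  fix b u v assume b: "ob b" "u:fob x b" "v:fob x b" "th b u = th b v"
  have "cov b (%f. ALL j:Ob J. act (fob D j) f (ev (l j) b u) = act (fob D j) f (ev (l j) b v))"
  proof (rule cov_finite[OF J(1) b(1)])
   fix j assume j: "j:Ob J"
   have "ta j b (ev (l j) b u) = ta j b (ev (l j) b v)" using th[OF b(1,2)] th[OF b(1,3)] b(4) j by metis
   thus "cov b (%f. act (fob D j) f (ev (l j) b u) = act (fob D j) f (ev (l j) b v))"
    using loc_isoD(3)[OF li[OF j] b(1)] naturalD(1)[OF ln[OF j]] b by blast
  qed
  thus "cov b (%f. act x f u = act x f v)"
  proof (rule cov_mono)
   fix f assume f: "arr f" "cod f = b" "ALL j:Ob J. act (fob D j) f (ev (l j) b u) = act (fob D j) f (ev (l j) b v)"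
   have uv: "act x f u:fob x (dom f)" "act x f v:fob x (dom f)" using pshD(2)[OF x f(1)] b f(2) by auto
   have "ALL j:Ob J. ev (l j) (dom f) (act x f u) = ev (l j) (dom f) (act x f v)"
    using naturalD(2)[OF ln f(1)] b f by simp
   thus "act x f u = act x f v"
    by (rule el[THEN conjunct2, THEN bspec, OF Dom_Ob[OF f(1)], THEN bspec, OF uv(1), THEN bspec, OF uv(2), THEN mp])
  qed
 next
  fix a assume a: "arr a" "cod a = z"
  have ma: "arr (m j*a)" "dom (m j*a) = dom a" "cod (m j*a) = c j" if "j:Ob J" for j
   using M(3-5)[OF that] a D'(2)[OF that] by simp_all
  \<comment> \<open>An arrow into the limit in \<open>C\<close> has all of its coordinates lifted on
    a common cover, but the lifts need not be compatible.\<close>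
  have cv: "cov (dom a) (%f. ALL j:Ob J. EX y:fob (fob D j) (dom f). ta j (dom f) y = (m j*a)*f)"
  proof (rule cov_finite[OF J(1) Dom_Ob[OF a(1)]])
   fix j assume j: "j:Ob J"
   show "cov (dom a) (%f. EX y:fob (fob D j) (dom f). ta j (dom f) y = (m j*a)*f)"
    using loc_isoD(4)[OF li[OF j] ma(1,3)[OF j]] unfolding ma(2)[OF j] .
  qed
  show "cov (dom a) (%f. EX u:fob x (dom f). th (dom f) u = a*f)"
  proof (rule cov_trans[OF cv])
   fix f assume f: "arr f" "cod f = dom a" and "ALL j:Ob J. EX y:fob (fob D j) (dom f). ta j (dom f) y = (m j*a)*f"
   then obtain w where w: "!!j. j:Ob J ==> w j:fob (fob D j) (dom f) & ta j (dom f) (w j) = (m j*a)*f" by metis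
   let ?b = "dom f"
   have bO: "ob ?b" using f by simp
   \<comment> \<open>The two sides of each compatibility equation have the same image in
     \<open>C\<close>, so they agree on a further cover by local injectivity.\<close>
   have "cov ?b (%g. ALL ph:Arr J. act (fob D (Cod J ph)) g (ev (farr D ph) ?b (w (Dom J ph))) = act (fob D (Cod J ph)) g (w (Cod J ph)))"
   proof (rule cov_finite[OF J(2) bO])
    fix ph assume ph: "ph:Arr J"
    note w1 = w[OF J.Dom_Ob[OF ph]] and w2 = w[OF J.Cod_Ob[OF ph]]
    have "ta (Cod J ph) ?b (ev (farr D ph) ?b (w (Dom J ph))) = farr D' ph*(m (Dom J ph)*a)*f"
     using D'ta[OF ph bO, of "w (Dom J ph)"] w1 by simp
    also have "... = m (Cod J ph)*a*f"
     using Cmp_reassoc1[OF M(6)[OF ph], of "a*f"] M(3-5)[OF J.Dom_Ob[OF ph]] F(4,5)[OF ph] a f by simp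
    also have "... = ta (Cod J ph) ?b (w (Cod J ph))" using w2 M(3,4)[OF J.Cod_Ob[OF ph]] a f by simp
    finally show "cov ?b (%g. act (fob D (Cod J ph)) g (ev (farr D ph) ?b (w (Dom J ph))) = act (fob D (Cod J ph)) g (w (Cod J ph)))"
     using loc_isoD(3)[OF li[OF J.Cod_Ob[OF ph]] bO] naturalD(1)[OF dn[OF ph] bO] w1 w2 by blast
   qed
   thus "cov ?b (%g. EX u:fob x (dom (f*g)). th (dom (f*g)) u = a*f*g)"
   proof (rule cov_mono)
    fix g assume g: "arr g" "cod g = ?b"
     and eq: "ALL ph:Arr J. act (fob D (Cod J ph)) g (ev (farr D ph) ?b (w (Dom J ph))) = act (fob D (Cod J ph)) g (w (Cod J ph))"
    let ?w = "%j. act (fob D j) g (w j)"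
    have "compat J D (dom g) ?w"
     unfolding compat_def
    proof (intro conjI ballI)
     fix j assume "j:Ob J"
     thus "?w j:fob (fob D j) (dom g)" using pshD(2)[OF Dp g(1)] w g(2) by simp
    next
     fix ph assume ph: "ph:Arr J"
     thus "ev (farr D ph) (dom g) (?w (Dom J ph)) = ?w (Cod J ph)"
      using naturalD(2)[OF dn[OF ph] g(1), of "w (Dom J ph)"] w[OF J.Dom_Ob[OF ph]] g(2) eq by simp
    qed
    then obtain u where u: "u:fob x (dom g)" "!!j. j:Ob J ==> ev (l j) (dom g) u = ?w j" using el Dom_Ob[OF g(1)] by blast
    note T = th[OF Dom_Ob[OF g(1)] u(1)]
    have "th (dom g) u = a*f*g"
    proof (rule limit_unique[OF lim' D'(1)])
     fix j assume j: "j:Ob J"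
     have "m j*th (dom g) u = ta j (dom g) (?w j)" using T j u(2) by simp
     also have "... = ta j ?b (w j)*g" using t(5)[OF j g(1), of "w j"] w[OF j] g(2) by simp
     finally show "m j*th (dom g) u = m j*a*f*g" using w[OF j] M(3,4)[OF j] a f g by simp
    qed (use T a f g in simp_all)
    thus "EX u:fob x (dom (f*g)). th (dom (f*g)) u = a*f*g" using u(1) f g by auto
   qed
  qed
 qed
 thus ?thesis using th by blast
qed

end

context exact_site
begin

text \<open>The reflecting objects carry a reflexive pair \<open>d\<close>, \<open>c\<close>, and
  \<open>Q\<close> reflects to the codomain of its local quotient \<open>k\<close>. Local
  surjectivity combines those of \<open>k\<close> and \<open>bt\<close>. For local injectivity, a
  zigzag of arrows in \<open>C\<close> is followed step by step, each step lifting locally to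
  \<open>F\<close>.\<close>

lemma loc_iso_coequaliser:
 assumes Q: "reflexive_coequaliser F G s t r Q q" and F: "loc_iso F x al" and G: "loc_iso G y bt"
 shows "EX w kg. loc_iso Q w kg"
proof -
 have n: "psh F" "psh G" "psh Q" "natural C F G s" "natural C F G t" "natural C G F r" "natural C G Q q"
  and sr: "!!b u. ob b ==> u:fob G b ==> s b (r b u) = u & t b (r b u) = u"
  and qs: "!!b. ob b ==> q b ` fob G b = fob Q b"
  and qe: "!!b u v. ob b ==> u:fob G b ==> v:fob G b ==> q b u = q b v <-> equivclp (step F s t b) u v"
  using Q unfolding reflexive_coequaliser_def by blast+
 note A = loc_isoD[OF F] and B = loc_isoD[OF G]
 note uA = loc_iso_univ[OF F] and uB = loc_iso_univ[OF G]
 note cA = cnatD[OF A(2)] and cB = cnatD[OF B(2)]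
 note sn = naturalD[OF n(4)] and tn = naturalD[OF n(5)] and rn = naturalD[OF n(6)] and qn = naturalD[OF n(7)]
 obtain d where d: "arr d" "dom d = x" "cod d = y" "!!b u. ob b ==> u:fob F b ==> d*al b u = bt b (s b u)"
  using univ_lift[OF uA cnat_precomp[OF n(4) B(2)]] by metis
 obtain c where c: "arr c" "dom c = x" "cod c = y" "!!b u. ob b ==> u:fob F b ==> c*al b u = bt b (t b u)"
  using univ_lift[OF uA cnat_precomp[OF n(5) B(2)]] by metis
 obtain z where z: "arr z" "dom z = y" "cod z = x" "!!b u. ob b ==> u:fob G b ==> z*bt b u = al b (r b u)"
  using univ_lift[OF uB cnat_precomp[OF n(6) A(2)]] by metis
 have dz: "d*z = idt y"
 proof (rule univ_eq[OF uB])
  fix b u assume b: "ob b" "u:fob G b"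
  show "(d*z)*bt b u = idt y*bt b u" using z d(1,2) d(4)[OF b(1) rn(1)[OF b]] sr[OF b] cB(2-4)[OF b] b by simp
 qed (use d z cB(1) in simp_all)
 have cz: "c*z = idt y"
 proof (rule univ_eq[OF uB])
  fix b u assume b: "ob b" "u:fob G b"
  show "(c*z)*bt b u = idt y*bt b u" using z c(1,2) c(4)[OF b(1) rn(1)[OF b]] sr[OF b] cB(2-4)[OF b] b by simp
 qed (use c z cB(1) in simp_all)
 obtain k where k: "regular_epi C k" "dom k = y"
  and kL: "!!b a a'. a:hom b y ==> a':hom b y ==> k*a = k*a' <-> loc_equiv d c b a a'"
  using reflexive_pair_quotient_local[of d c z] d c z dz cz by auto
 note ka = regular_epi_Arr[OF k(1)]
 have kdc: "k*d = k*c"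
 proof -
  have "arr_step d c x d c" unfolding arr_step_def using d c cA(1) by (intro exI[of _ "idt x"]) simp
  hence "loc_equiv d c x d c" using d c cA(1) by (intro loc_equivI equivclp_step) simp_all
  thus ?thesis using kL[of d x c] d c by simp
 qed

 \<comment> \<open>All lifts of \<open>a\<close> and \<open>a'\<close> to \<open>G\<close>, over any
   restriction, become locally equal in \<open>Q\<close>. Quantifying over all lifts avoids choosing
   any, as lifts exist only locally.\<close>
 define L where "L b a a' <-> (ALL f:Arr C. cod f = b --> (ALL g:fob G (dom f). ALL g':fob G (dom f).
  bt (dom f) g = a*f --> bt (dom f) g' = a'*f -->
  cov (dom f) (%h. act Q h (q (dom f) g) = act Q h (q (dom f) g'))))" for b a a'
 have LI: "L b a a'" if "!!f g g'. arr f ==> cod f = b ==> g:fob G (dom f) ==> g':fob G (dom f) ==>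
  bt (dom f) g = a*f ==> bt (dom f) g' = a'*f ==> cov (dom f) (%h. act Q h (q (dom f) g) = act Q h (q (dom f) g'))" for b a a'
  unfolding L_def using that by blast
 have LD: "cov (dom f) (%h. act Q h (q (dom f) g) = act Q h (q (dom f) g'))"
  if "L b a a'" "arr f" "cod f = b" "g:fob G (dom f)" "g':fob G (dom f)" "bt (dom f) g = a*f" "bt (dom f) g' = a'*f" for b a a' f g g'
  using that unfolding L_def by blast
 have Lrefl: "L b a a" for b a
 proof (rule LI)
  fix f g g' assume f: "arr f" "g:fob G (dom f)" "g':fob G (dom f)" "bt (dom f) g = a*f" "bt (dom f) g' = a*f"
  have "cov (dom f) (%h. act G h g = act G h g')" by (rule B(3)) (use f in simp_all)
  thus "cov (dom f) (%h. act Q h (q (dom f) g) = act Q h (q (dom f) g'))"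
  proof (rule cov_mono)
   fix h assume "arr h" "cod h = dom f" "act G h g = act G h g'"
   thus "act Q h (q (dom f) g) = act Q h (q (dom f) g')" using qn(2)[of h g] qn(2)[of h g'] f by simp
  qed
 qed
 have Lsym: "L b a' a" if "L b a a'" for b a a'
 proof (rule LI)
  fix f g g' assume "arr f" "cod f = b" "g:fob G (dom f)" "g':fob G (dom f)" "bt (dom f) g = a'*f" "bt (dom f) g' = a*f"
  hence "cov (dom f) (%h. act Q h (q (dom f) g') = act Q h (q (dom f) g))" using LD[OF that] by blast
  thus "cov (dom f) (%h. act Q h (q (dom f) g) = act Q h (q (dom f) g'))" by (rule cov_mono) simp
 qed
 have restr: "act G h g:fob G (dom (f*h)) & bt (dom (f*h)) (act G h g) = a*f*h &
   act Q l (q (dom (f*h)) (act G h g)) = act Q (h*l) (q (dom f) g)"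
  if "arr f" "arr h" "arr l" "cod h = dom f" "cod l = dom h" "g:fob G (dom f)" "bt (dom f) g = a*f" "arr a" "cod f = dom a" for f h g a l
 proof -
  have "q (dom f) g:fob Q (dom f)" using qn(1) that by simp
  hence "act Q (h*l) (q (dom f) g) = act Q l (act Q h (q (dom f) g))" using pshD(4)[OF n(3), of l h "q (dom f) g"] that by simp
  thus ?thesis using that pshD(2)[OF n(2), of h g] cB(5)[of h g] qn(2)[of h g] by simp
 qed
 \<comment> \<open>A lift of the middle arrow exists on a cover; there both hypotheses apply to
   it.\<close>
 have Ltrans: "L b a a''" if L: "L b a a'" "L b a' a''" and a: "a:hom b y" "a':hom b y" "a'':hom b y" for b a a' a''
 proof (rule LI)
  fix f g g'' assume f: "arr f" "cod f = b" and g: "g:fob G (dom f)" "g'':fob G (dom f)" "bt (dom f) g = a*f" "bt (dom f) g'' = a''*f"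
  have aa: "arr a" "dom a = b" "arr a'" "dom a' = b" "cod a' = y" "arr a''" "dom a'' = b" using a by auto
  have cv: "cov (dom (a'*f)) (%h. EX u:fob G (dom h). bt (dom h) u = (a'*f)*h)"
   by (rule B(4)) (use aa f in simp_all)
  have cv: "cov (dom f) (%h. EX u:fob G (dom h). bt (dom h) u = (a'*f)*h)" using cv aa f by simp
  show "cov (dom f) (%h. act Q h (q (dom f) g) = act Q h (q (dom f) g''))"
  proof (rule cov_trans[OF cv])
   fix h assume h: "arr h" "cod h = dom f" and "EX u:fob G (dom h). bt (dom h) u = (a'*f)*h"
   then obtain u where u: "u:fob G (dom h)" "bt (dom h) u = a'*f*h" using aa f by auto
   have fh: "arr (f*h)" "cod (f*h) = b" "dom (f*h) = dom h" using f h by simp_all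
   have i: "arr (idt (dom h))" "cod (idt (dom h)) = dom h" using h by simp_all
   have af: "cod f = dom a" "cod f = dom a''" using aa f by simp_all
   note g1 = restr[OF f(1) h(1) i(1) h(2) i(2) g(1,3) aa(1) af(1)] and g2 = restr[OF f(1) h(1) i(1) h(2) i(2) g(2,4) aa(6) af(2)]
   have u': "u:fob G (dom (f*h))" "bt (dom (f*h)) u = a'*f*h" using u fh by simp_all
   have "cov (dom h) (%k. act Q k (q (dom (f*h)) (act G h g)) = act Q k (q (dom (f*h)) u))"
    using LD[OF L(1) fh(1,2) _ u'(1) _ u'(2)] g1 fh(3) by simp
   moreover have "cov (dom h) (%k. act Q k (q (dom (f*h)) u) = act Q k (q (dom (f*h)) (act G h g'')))"
    using LD[OF L(2) fh(1,2) u'(1) _ u'(2)] g2 fh(3) by simp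
   ultimately have "cov (dom h) (%k. act Q k (q (dom (f*h)) (act G h g)) = act Q k (q (dom (f*h)) u) &
     act Q k (q (dom (f*h)) u) = act Q k (q (dom (f*h)) (act G h g'')))" by (rule cov_conj)
   thus "cov (dom h) (%k. act Q (h*k) (q (dom f) g) = act Q (h*k) (q (dom f) g''))"
   proof (rule cov_mono)
    fix l assume l: "arr l" "cod l = dom h" and e: "act Q l (q (dom (f*h)) (act G h g)) = act Q l (q (dom (f*h)) u) &
     act Q l (q (dom (f*h)) u) = act Q l (q (dom (f*h)) (act G h g''))"
    show "act Q (h*l) (q (dom f) g) = act Q (h*l) (q (dom f) g'')"
     using restr[OF f(1) h(1) l(1) h(2) l(2) g(1,3) aa(1) af(1)] restr[OF f(1) h(1) l(1) h(2) l(2) g(2,4) aa(6) af(2)] e by metis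
   qed
  qed
 qed
 \<comment> \<open>Lifting the step locally to \<open>u\<close> in \<open>F\<close> yields lifts
   \<open>s u\<close> and \<open>t u\<close> of its two ends, which \<open>q\<close> identifies; the
   given lifts agree with these on a further cover.\<close>
 have Lstep: "L b a a'" if st: "arr_step d c b a a'" for b a a'
 proof (rule LI)
  obtain w where w: "arr w" "dom w = b" "cod w = x" "a = d*w" "a' = c*w" using st d(2) unfolding arr_step_def by blast
  fix f g g' assume f: "arr f" "cod f = b" and g: "g:fob G (dom f)" "g':fob G (dom f)" "bt (dom f) g = a*f" "bt (dom f) g' = a'*f"
  have aa: "arr a" "arr a'" "cod f = dom a" "cod f = dom a'" using w d(1-3) c(1-3) f by simp_all
  have cv: "cov (dom (w*f)) (%h. EX u:fob F (dom h). al (dom h) u = (w*f)*h)"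
   by (rule A(4)) (use w f in simp_all)
  have cv: "cov (dom f) (%h. EX u:fob F (dom h). al (dom h) u = (w*f)*h)" using cv w f by simp
  show "cov (dom f) (%h. act Q h (q (dom f) g) = act Q h (q (dom f) g'))"
  proof (rule cov_trans[OF cv])
   fix h assume h: "arr h" "cod h = dom f" and "EX u:fob F (dom h). al (dom h) u = (w*f)*h"
   then obtain u where u: "u:fob F (dom h)" "al (dom h) u = w*f*h" using w f by auto
   let ?b = "dom h"
   have bO: "ob ?b" using h by simp
   have dom: "dom (f*h) = ?b" using f h by simp
   have su: "s ?b u:fob G ?b" "t ?b u:fob G ?b" using sn(1)[OF bO u(1)] tn(1)[OF bO u(1)] by auto
   have i: "arr (idt (dom h))" "cod (idt (dom h)) = dom h" using h by simp_all
   note g1 = restr[OF f(1) h(1) i(1) h(2) i(2) g(1,3) aa(1,3)] and g2 = restr[OF f(1) h(1) i(1) h(2) i(2) g(2,4) aa(2,4)]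
   have "bt ?b (s ?b u) = a*f*h" "bt ?b (t ?b u) = a'*f*h"
    using d(4)[OF bO u(1)] c(4)[OF bO u(1)] u(2) w d(1,2) c(1,2) f h by simp_all
   hence "cov ?b (%k. act G k (act G h g) = act G k (s ?b u))" "cov ?b (%k. act G k (t ?b u) = act G k (act G h g'))"
    using g1 g2 su dom by (auto intro!: B(3)[OF bO])
   hence "cov ?b (%k. act G k (act G h g) = act G k (s ?b u) & act G k (t ?b u) = act G k (act G h g'))" by (rule cov_conj)
   thus "cov ?b (%k. act Q (h*k) (q (dom f) g) = act Q (h*k) (q (dom f) g'))"
   proof (rule cov_mono)
    fix l assume l: "arr l" "cod l = ?b" and e: "act G l (act G h g) = act G l (s ?b u) & act G l (t ?b u) = act G l (act G h g')"
    have qst: "q ?b (s ?b u) = q ?b (t ?b u)"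
     unfolding qe[OF bO su] by (rule equivclp_step) (use u(1) in \<open>auto simp: step_def\<close>)
    have G: "act G h g:fob G ?b" "act G h g':fob G ?b" using g1 g2 dom by auto
    have "act Q l (q ?b (act G h g)) = act Q l (q ?b (s ?b u))"
     using qn(2)[OF l(1), of "act G h g"] qn(2)[OF l(1), of "s ?b u"] G su e l(2) by simp
    moreover have "act Q l (q ?b (t ?b u)) = act Q l (q ?b (act G h g'))"
     using qn(2)[OF l(1), of "act G h g'"] qn(2)[OF l(1), of "t ?b u"] G su e l(2) by simp
    ultimately show "act Q (h*l) (q (dom f) g) = act Q (h*l) (q (dom f) g')"
     using restr[OF f(1) h(1) l(1) h(2) l(2) g(1,3) aa(1,3)] restr[OF f(1) h(1) l(1) h(2) l(2) g(2,4) aa(2,4)] qst dom by simp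
   qed
  qed
 qed
 have Lequiv: "a':hom b y & L b a a'" if a: "a:hom b y" and e: "equivclp (arr_step d c b) a a'" for b a a'
  using e
 proof (induction rule: equivclp_induct_step)
  case refl
  show ?case using a Lrefl by blast
 next
  case (forward u v)
  have "v:hom b y" using forward(1) c d unfolding arr_step_def by auto
  thus ?case using Ltrans[OF _ Lstep[OF forward(1)] a] forward(2) by blast
 next
  case (backward u v)
  have "v:hom b y" using backward(1) c d unfolding arr_step_def by auto
  thus ?case using Ltrans[OF _ Lsym[OF Lstep[OF backward(1)]] a] backward(2) by blast
 qed
 have inj: "cov b (%f. act Q f (q b g) = act Q f (q b g'))" if b: "ob b" "g:fob G b" "g':fob G b" "k*bt b g = k*bt b g'" for b g g'
 proof -
  have H: "bt b g:hom b y" "bt b g':hom b y" using cB b by auto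
  have "loc_equiv d c b (bt b g) (bt b g')" using kL[OF H] b(4) by simp
  thus ?thesis
   unfolding loc_equiv_def
  proof (rule cov_trans)
   fix f assume f: "arr f" "cod f = b" and e: "equivclp (arr_step d c (dom f)) (bt b g*f) (bt b g'*f)"
   have Hf: "bt b g*f:hom (dom f) y" using H f by auto
   have bf: "bt (dom f) (act G f g) = bt b g*f" "bt (dom f) (act G f g') = bt b g'*f"
    using cB(5)[OF f(1)] b f(2) by simp_all
   have gf: "act G f g:fob G (dom f)" "act G f g':fob G (dom f)" using pshD(2)[OF n(2) f(1)] b f(2) by auto
   have i: "arr (idt (dom f))" "cod (idt (dom f)) = dom f" "dom (idt (dom f)) = dom f" using f by simp_all
   have bi: "bt b g*f = (bt b g*f)*idt (dom f)" "bt b g'*f = (bt b g'*f)*idt (dom f)"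
    using H f by simp_all
   have "cov (dom f) (%h. act Q h (q (dom f) (act G f g)) = act Q h (q (dom f) (act G f g')))"
    using LD[OF conjunct2[OF Lequiv[OF Hf e]] i(1,2), unfolded i(3), OF gf trans[OF bf(1) bi(1)] trans[OF bf(2) bi(2)]] .
   thus "cov (dom f) (%h. act Q (f*h) (q b g) = act Q (f*h) (q b g'))"
   proof (rule cov_mono)
    fix h assume h: "arr h" "cod h = dom f" and e: "act Q h (q (dom f) (act G f g)) = act Q h (q (dom f) (act G f g'))"
    have "act Q (f*h) (q b v) = act Q h (q (dom f) (act G f v))" if v: "v:fob G b" for v
     using pshD(4)[OF n(3) h(1) f(1) h(2)[symmetric], of "q b v"] qn(1)[OF b(1) v] qn(2)[OF f(1), of v] v f(2) by simp
    thus "act Q (f*h) (q b g) = act Q (f*h) (q b g')" using e b by simp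
   qed
  qed
 qed
 \<comment> \<open>The map to the representable is read off any preimage under \<open>q\<close>; it
   is well defined since \<open>k\<close> identifies \<open>d\<close> with \<open>c\<close>.\<close>
 define kg where "kg b v = k*bt b (inv_into (fob G b) (q b) v)" for b v
 have kgq: "kg b (q b g) = k*bt b g" if b: "ob b" "g:fob G b" for b g
 proof -
  have i: "q b g:q b ` fob G b" using b by blast
  define g0 where "g0 = inv_into (fob G b) (q b) (q b g)"
  have "equivclp (step F s t b) g0 g" unfolding g0_def using qe[OF b(1) inv_into_into[OF i] b(2)] f_inv_into_f[OF i] by blast
  moreover have "k*bt b u = k*bt b v" if st: "step F s t b u v" for u v
  proof -
   obtain w where w: "w:fob F b" "u = s b w" "v = t b w" using st unfolding step_def by blast
   have "k*d*al b w = k*c*al b w" by (rule Cmp_reassoc[OF kdc]) (use d(1-3) c(1-3) ka k(2) cA(2-4)[OF b(1) w(1)] in simp_all)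
   thus ?thesis using d(4)[OF b(1) w(1)] c(4)[OF b(1) w(1)] w by simp
  qed
  ultimately have "k*bt b g0 = k*bt b g" by (induction rule: equivclp_induct_step) auto
  thus ?thesis unfolding kg_def g0_def .
 qed
 have Qel: "EX g:fob G b. v = q b g" if "ob b" "v:fob Q b" for b v using qs that by blast
 have "loc_iso Q (cod k) kg"
  unfolding loc_iso_def
 proof (intro conjI n(3) ballI impI)
  show "cnat Q (cod k) kg"
   unfolding cnat_def
  proof (intro conjI ballI)
   fix b v assume b: "ob b" "v:fob Q b"
   obtain g where g: "g:fob G b" "v = q b g" using Qel[OF b] by blast
   thus "arr (kg b v)" "dom (kg b v) = b" "cod (kg b v) = cod k" using kgq[OF b(1) g(1)] cB(2-4)[OF b(1) g(1)] ka k(2) by simp_all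
  next
   fix f v assume f: "arr f" "v:fob Q (cod f)"
   obtain g where g: "g:fob G (cod f)" "v = q (cod f) g" using Qel[OF Cod_Ob[OF f(1)] f(2)] by blast
   show "kg (dom f) (act Q f v) = kg (cod f) v*f"
    using kgq[OF Dom_Ob[OF f(1)] pshD(2)[OF n(2) f(1) g(1)]] kgq[OF Cod_Ob[OF f(1)] g(1)] g(2) qn(2)[OF f(1) g(1)]
     cB(5)[OF f(1) g(1)] cB(2-4)[OF Cod_Ob[OF f(1)] g(1)] ka k(2) f(1) by simp
  qed (use ka in simp)
  fix b v v' assume b: "ob b" "v:fob Q b" "v':fob Q b" "kg b v = kg b v'"
  obtain g g' where "g:fob G b" "v = q b g" "g':fob G b" "v' = q b g'" using Qel[OF b(1,2)] Qel[OF b(1,3)] by blast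
  thus "cov b (%f. act Q f v = act Q f v')" using inj[OF b(1)] b(4) kgq[OF b(1)] by simp
 next
  fix a assume a: "arr a" "cod a = cod k"
  show "cov (dom a) (%f. EX v:fob Q (dom f). kg (dom f) v = a*f)"
  proof (rule cov_trans[OF cov_regular_epi[OF k(1) a]])
   fix f assume f: "arr f" "cod f = dom a" and "EX g. arr g & cod g = dom k & a*f = k*g"
   then obtain g where g: "arr g" "cod g = y" "a*f = k*g" using k(2) by auto
   have dg: "dom g = dom f" using Cmp_eqD(1)[OF g(3)] f a g ka k(2) by simp
   have "cov (dom f) (%h. EX u:fob G (dom h). bt (dom h) u = g*h)" using B(4)[OF g(1,2)] dg by simp
   thus "cov (dom f) (%h. EX v:fob Q (dom (f*h)). kg (dom (f*h)) v = a*f*h)"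
   proof (rule cov_mono)
    fix h assume h: "arr h" "cod h = dom f" "EX u:fob G (dom h). bt (dom h) u = g*h"
    then obtain u where u: "u:fob G (dom h)" "bt (dom h) u = g*h" by blast
    have "a*f*h = k*g*h" by (rule Cmp_reassoc[OF g(3)]) (use a f g(1,2) h ka k(2) dg in simp_all)
    thus "EX v:fob Q (dom (f*h)). kg (dom (f*h)) v = a*f*h"
     using kgq[OF Dom_Ob[OF h(1)] u(1)] u(2) qn(1)[OF Dom_Ob[OF h(1)] u(1)] f h(1,2) by (intro bexI[of _ "q (dom h) u"]) simp_all
   qed
  qed
 qed
 thus ?thesis by blast
qed

end

section \<open>The reflection\<close>

context exact_site
begin

lemma iso_PV:
 assumes f: "is_iso (PV V) f"
 obtains g where "f:Hom PC (fst f) (fst (snd f))" "g:Hom PC (fst (snd f)) (fst f)"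
  "!!b x. ob b ==> x:fob (fst f) b ==> ev g b (ev f b x) = x"
  "!!b x. ob b ==> x:fob (fst (snd f)) b ==> ev f b (ev g b x) = x"
proof -
 obtain g where g: "is_inverse_pair (PV V) f g" using f unfolding is_iso_def by blast
 have H: "f:Hom PC (fst f) (fst (snd f))" "g:Hom PC (fst (snd f)) (fst f)"
  and e: "Cmp PC g f = Idt PC (fst f)" "Cmp PC f g = Idt PC (fst (snd f))"
  using g unfolding is_inverse_pair_def by auto
 have "ev g b (ev f b x) = x" if "ob b" "x:fob (fst f) b" for b x
 proof -
  have "ev (Cmp PC g f) b x = x" unfolding e using that by simp
  thus ?thesis using H that by simp
 qed
 moreover have "ev f b (ev g b x) = x" if "ob b" "x:fob (fst (snd f)) b" for b x
 proof -
  have "ev (Cmp PC f g) b x = x" unfolding e using that by simp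
  thus ?thesis using H that by simp
 qed
 ultimately show thesis using that H by blast
qed

text \<open>As the smallest closed class, \<open>Phi_l\<close> then contains only presheaves that
  are locally isomorphic to representables.\<close>

lemma Phi_closed_loc_iso:
 assumes rc: "is_Phi_rc U \<Phi>"
 shows "Phi_closed U \<Phi> C {F:Sm. EX c ta. loc_iso F c ta}" (is "Phi_closed U \<Phi> C ?S")
 unfolding Phi_closed_def P_cat_PV
proof (intro conjI allI impI ballI, goal_cases)
 case 1
 thus ?case using Sm_psh by auto
next
 case (2 f)
 hence f: "is_iso (PV Sm) f" and S: "Dom (PV Sm) f:?S" by blast+
 obtain g where g: "f:Hom PC (fst f) (fst (snd f))" "g:Hom PC (fst (snd f)) (fst f)"
  "!!b x. ob b ==> x:fob (fst f) b ==> ev g b (ev f b x) = x"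
  "!!b x. ob b ==> x:fob (fst (snd f)) b ==> ev f b (ev g b x) = x" by (rule iso_PV[OF f]) blast
 have sm: "fst (snd f):Sm" using f unfolding is_iso_def is_inverse_pair_def by auto
 obtain c ta where "loc_iso (fst f) c ta" using S by auto
 from loc_iso_transport[OF this Sm_psh[OF sm] ev_natural[OF g(1)] ev_natural[OF g(2)] g(3,4)]
 show ?case using sm by auto
next
 case (3 c)
 thus ?case using small_yo loc_iso_yo by blast
next
 case (4 J F x l)
 hence fin: "finite_diagram J (PV Sm) F" and S: "fob F ` Ob J <= ?S" and lim: "is_limit J (PV Sm) F x l" by blast+
 have D: "is_functor J (PV Sm) F" using fin unfolding finite_diagram_def by blast
 have "EX c ta. loc_iso (fob F j) c ta" if "j:Ob J" for j using S that by auto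
 then obtain c ta where li: "!!j. j:Ob J ==> loc_iso (fob F j) (c j) (ta j)" by metis
 have "EX D'. is_functor J C D' & fob D' = c &
  (ALL ph:Arr J. ALL b:Ob C. ALL u:fob (fob F (Dom J ph)) b. farr D' ph*ta (Dom J ph) b u = ta (Cod J ph) b (ev (farr F ph) b u))"
  by (rule loc_iso_diagram[OF D]) (rule li)
 then obtain D' where D': "is_functor J C D'" "fob D' = c"
  "!!ph b u. ph:Arr J ==> ob b ==> u:fob (fob F (Dom J ph)) b ==> farr D' ph*ta (Dom J ph) b u = ta (Cod J ph) b (ev (farr F ph) b u)"
  by blast
 have "finite_diagram J C D'" using fin D'(1) unfolding finite_diagram_def by blast
 then obtain z m where lim': "is_limit J C D' z m" using ex_limit by blast
 have "yo ` Ob C <= Sm" using small_yo by blast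
 from loc_iso_limit[OF fin this lim li D'(1) fun_cong[OF D'(2)] D'(3) lim']
 have "EX c ta. loc_iso x c ta" by blast
 moreover have "x:Sm" using limitD(2)[OF lim] by simp
 ultimately show ?case by simp
next
 case (5 p)
 obtain K w where p: "p = (K, w)" by fastforce
 show ?case unfolding p prod.case
 proof (intro allI impI)
  fix D z io assume *: "lex_functor K (PV Sm) D & fob D ` Ob K <= ?S & is_weighted_colimit U K w (PV Sm) D z io"
  hence D: "lex_functor K (PV Sm) D" and S: "fob D ` Ob K <= ?S" and z: "is_weighted_colimit U K w (PV Sm) D z io" by blast+
  obtain X Y s t r q where rq: "X:Ob K" "Y:Ob K" "reflexive_coequaliser (fob D X) (fob D Y) s t r z q"
   using weighted_colimit_rc[OF rc 5[unfolded p] D z] by blast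
  obtain c ta c' ta' where "loc_iso (fob D X) c ta" "loc_iso (fob D Y) c' ta'"
   using subsetD[OF S imageI[OF rq(1)]] subsetD[OF S imageI[OF rq(2)]] by auto
  from loc_iso_coequaliser[OF rq(3) this] have "EX c ta. loc_iso z c ta" by blast
  moreover have "z:Sm" using z by (simp add: is_weighted_colimit_def is_weighted_cocone_def)
  ultimately show "z:?S" by simp
 qed
qed

text \<open>The chosen reflecting objects assemble to the left adjoint \<open>L\<close>, with unit
  \<open>et\<close>. It is lex because the limit in \<open>C\<close> of a reflected diagram is again
  a reflecting object of the limit presheaf, by \<open>loc_iso_limit\<close>.\<close>

lemma exact_of_loc_isos:
 assumes T: "T = \<Inter>{S. Phi_closed U \<Phi> C S}" and ex: "!!F. F:T ==> EX c ta. loc_iso F c ta"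
 shows "Phi_exact U \<Phi> C"
proof -
 note Tp = Phi_l_PV[OF T]
 have cl: "Phi_closed U \<Phi> C T" by (rule Phi_closed_Inter[OF T])
 note yoT = Phi_closedD(2)[OF cl]
 interpret V: category "PV T" by (rule category_PV)
 have Tpsh: "psh F" if "F:T" for F using that Tp(2) Sm_psh by blast
 have ObT: "F:Ob (PV T) <-> F:T" for F using Tpsh by auto
 obtain c ta where li: "!!F. F:T ==> loc_iso F (c F) (ta F)" using ex by metis
 note u = loc_iso_univ[OF li] and cn = loc_isoD(2)[OF li]
 note t = cnatD[OF cn]
 have idf: "is_functor (PV T) (PV T) id_fctr"
  by (rule functorI[OF V.category_axioms V.category_axioms]) (simp_all only: id_fctr_def fctr.simps V.Idt_simps V.Cmp_simps)
 \<comment> \<open>\<open>L\<close> is the diagram of reflecting objects of the identity functor,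
   the category of presheaves serving as its own shape.\<close>
 have "EX L. is_functor (PV T) C L & fob L = c &
  (ALL ph:Arr (PV T). ALL b:Ob C. ALL v:fob (Dom (PV T) ph) b.
   farr L ph*ta (Dom (PV T) ph) b v = ta (Cod (PV T) ph) b (ev (ph) b v))"
  by (rule loc_iso_diagram[where c = c and ta = ta, OF idf, unfolded id_fctr_def fctr.select_convs])
   (use li ObT in blast)
 then obtain L where L: "is_functor (PV T) C L" "fob L = c"
  "ALL ph:Arr (PV T). ALL b:Ob C. ALL v:fob (Dom (PV T) ph) b.
   farr L ph*ta (Dom (PV T) ph) b v = ta (Cod (PV T) ph) b (ev (ph) b v)"
  by (elim exE conjE)
 note LF = functorD[OF L(1)]
 have LA: "arr (farr L ph)" "dom (farr L ph) = c F" "cod (farr L ph) = c G"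
  "!!b v. ob b ==> v:fob F b ==> farr L ph*ta F b v = ta G b (ev ph b v)"
  if ph: "ph:Hom PC F G" "F:T" "G:T" for ph F G
 proof -
  have a: "ph:Arr (PV T)" "Dom (PV T) ph = F" "Cod (PV T) ph = G" using ph by auto
  show "arr (farr L ph)" "dom (farr L ph) = c F" "cod (farr L ph) = c G" using LF(4-6)[OF a(1)] unfolding a L(2) by auto
  show "!!b v. ob b ==> v:fob F b ==> farr L ph*ta F b v = ta G b (ev ph b v)"
   using bspec[OF L(3) a(1)] unfolding a by simp
 qed
 define et where "et = (\<lambda>F\<in>Ob (PV T). psh_map C F (yo (c F)) (%b v. cd b (c F) (ta F b v)))"
 have et: "et F:Hom PC F (yo (c F))" "!!b v. ob b ==> v:fob F b ==> ev (et F) b v = cd b (c F) (ta F b v)" if F: "F:T" for F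
 proof -
  have e: "et F = psh_map C F (yo (c F)) (%b v. cd b (c F) (ta F b v))" unfolding et_def using F Tpsh[OF F] by simp
  show "et F:Hom PC F (yo (c F))" unfolding e
   by (rule psh_map_Hom[OF Tpsh[OF F] psh_yo[OF t(1)[OF F]] cnat_natural[OF Tpsh[OF F] cn[OF F]]])
  show "!!b v. ob b ==> v:fob F b ==> ev (et F) b v = cd b (c F) (ta F b v)" unfolding e by simp
 qed
 have cT: "yo (c F):T" if "F:T" for F using yoT t(1)[OF that] by blast
 have yet: "Cmp PC (farr (yoneda U C) g) (et F):Hom PC F (yo (cod g))"
  "!!b v. ob b ==> v:fob F b ==> ev (Cmp PC (farr (yoneda U C) g) (et F)) b v = cd b (cod g) (g*ta F b v)"
  if F: "F:T" and g: "arr g" "dom g = c F" for F g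
 proof -
  note y = yoneda_arr[OF g(1), unfolded g(2)]
  show "Cmp PC (farr (yoneda U C) g) (et F):Hom PC F (yo (cod g))" by (rule category.Cmp_in[OF category_PC et(1)[OF F] y(1)])
  fix b v assume b: "ob b" "v:fob F b"
  have "cd b (c F) (ta F b v):fob (yo (c F)) b" "dc b (c F) (cd b (c F) (ta F b v)) = ta F b v" using t[OF F] b by simp_all
  thus "ev (Cmp PC (farr (yoneda U C) g) (et F)) b v = cd b (cod g) (g*ta F b v)"
   using y(2)[OF b(1), of "cd b (c F) (ta F b v)"] et[OF F] b by simp
 qed
 have adj: "is_adjunction (PV T) C L (yoneda U C) et"
  unfolding is_adjunction_def
 proof (intro conjI ballI L(1) yoneda_functor_PV[OF yoT])
  show "nat_trans (PV T) (PV T) id_fctr (comp_fctr (yoneda U C) L) et"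
   unfolding nat_trans_iff
  proof (intro conjI ballI idf functor_comp[OF L(1) yoneda_functor_PV[OF yoT]])
   show "et:extensional (Ob (PV T))" unfolding et_def by simp
   fix F assume "F:Ob (PV T)"
   hence F: "F:T" using ObT by simp
   show "et F:Arr (PV T)" "Dom (PV T) (et F) = fob id_fctr F" "Cod (PV T) (et F) = fob (comp_fctr (yoneda U C) L) F"
    using et(1)[OF F] cT[OF F] F by (auto simp: id_fctr_def comp_fctr_def L(2))
  next
   fix f assume f: "f:Arr (PV T)"
   let ?F = "Dom (PV T) f" and ?G = "Cod (PV T) f"
   have F: "?F:T" "?G:T" using V.Dom_Ob[OF f] V.Cod_Ob[OF f] ObT by auto
   have fH: "f:Hom PC ?F ?G" using f by auto
   note A = LA[OF fH F] and Y = yet[OF F(1) LA(1,2)[OF fH F]]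
   have "Cmp PC (et ?G) f = Cmp PC (farr (yoneda U C) (farr L f)) (et ?F)"
   proof (rule psh_map_eqI)
    show "Cmp PC (et ?G) f:Hom PC ?F (yo (c ?G))" by (rule category.Cmp_in[OF category_PC fH et(1)[OF F(2)]])
    show "Cmp PC (farr (yoneda U C) (farr L f)) (et ?F):Hom PC ?F (yo (c ?G))" using Y(1) A(3) by simp
    fix b v assume b: "ob b" "v:fob ?F b"
    have "ev f b v:fob ?G b" using naturalD(1)[OF ev_natural[OF fH] b] .
    hence "ev (Cmp PC (et ?G) f) b v = cd b (c ?G) (ta ?G b (ev f b v))"
     using b fH et[OF F(2)] by simp
    thus "ev (Cmp PC (et ?G) f) b v = ev (Cmp PC (farr (yoneda U C) (farr L f)) (et ?F)) b v"
     using Y(2)[OF b] A(3) A(4)[OF b] by simp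
   qed
   thus "Cmp (PV T) (et ?G) (farr id_fctr f) = Cmp (PV T) (farr (comp_fctr (yoneda U C) L) f) (et ?F)"
    by (simp add: id_fctr_def comp_fctr_def)
  qed
  fix F y f assume "F:Ob (PV T)" and y: "ob y" and "f:Hom (PV T) F (fob (yoneda U C) y)"
  hence F: "F:T" and f: "f:Hom PC F (yo y)" using ObT Hom_PV by auto
  note fn = ev_natural[OF f]
  have si: "cnat F y (%b v. dc b y (ev f b v))" by (rule natural_cnat[OF Tpsh[OF F] y fn])
  have ex1: "EX! g. g:hom (c F) y & (ALL b:Ob C. ALL v:fob F b. dc b y (ev f b v) = g*ta F b v)"
   using u[OF F] si unfolding univ_def by blast
  have "Cmp (PV T) (farr (yoneda U C) g) (et F) = f <-> (ALL b:Ob C. ALL v:fob F b. dc b y (ev f b v) = g*ta F b v)"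
   if g: "g:hom (c F) y" for g
  proof -
   have g': "arr g" "dom g = c F" "cod g = y" using g by auto
   note Y = yet[OF F g'(1,2), unfolded g'(3)]
   have e: "ev (Cmp PC (farr (yoneda U C) g) (et F)) b v = ev f b v <-> dc b y (ev f b v) = g*ta F b v"
    if b: "ob b" "v:fob F b" for b v
   proof -
    have gt: "arr (g*ta F b v)" "dom (g*ta F b v) = b" "cod (g*ta F b v) = y" using g' t(2-4)[OF F b] by simp_all
    have "cd b y (g*ta F b v):fob (yo y) b" "dc b y (cd b y (g*ta F b v)) = g*ta F b v" using gt by simp_all
    thus ?thesis unfolding Y(2)[OF b] using dc_inj[of "ev f b v" y b] naturalD(1)[OF fn b] by metis
   qed
   show ?thesis
   proof
    assume "Cmp (PV T) (farr (yoneda U C) g) (et F) = f"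
    hence "Cmp PC (farr (yoneda U C) g) (et F) = f" by simp
    thus "ALL b:Ob C. ALL v:fob F b. dc b y (ev f b v) = g*ta F b v" using e by blast
   next
    assume "ALL b:Ob C. ALL v:fob F b. dc b y (ev f b v) = g*ta F b v"
    hence "Cmp PC (farr (yoneda U C) g) (et F) = f" using e by (intro psh_map_eqI[OF Y(1) f]) blast
    thus "Cmp (PV T) (farr (yoneda U C) g) (et F) = f" by simp
   qed
  qed
  hence "(g:hom (fob L F) y & Cmp (PV T) (farr (yoneda U C) g) (et F) = f) <->
    (g:hom (c F) y & (ALL b:Ob C. ALL v:fob F b. dc b y (ev f b v) = g*ta F b v))" for g unfolding L(2) by blast
  thus "EX! g. g:hom (fob L F) y & Cmp (PV T) (farr (yoneda U C) g) (et F) = f" using ex1 by (simp only:)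
 qed
 have "lex_functor (PV T) C L"
  unfolding lex_functor_def
 proof (intro conjI allI impI finitely_complete_PV[OF cl] fincomp L(1))
  fix J :: "(nat, nat) cat" and D x l
  assume "finite_diagram J (PV T) D & is_limit J (PV T) D x l"
  hence fin: "finite_diagram J (PV T) D" and lim: "is_limit J (PV T) D x l" by auto
  have D: "is_functor J (PV T) D" using fin unfolding finite_diagram_def by blast
  interpret J: category J by (rule functorD(1)[OF D])
  note DT = functor_PV(2)[OF D] and DH = functor_PV(3)[OF D]
  have LD: "is_functor J C (comp_fctr L D)" by (rule functor_comp[OF D L(1)])
  have "finite_diagram J C (comp_fctr L D)" using fin LD unfolding finite_diagram_def by blast
  then obtain z m where lim': "is_limit J C (comp_fctr L D) z m" using ex_limit by blast
  have xT: "x:T" using limitD(2)[OF lim] by simp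
  have lH: "!!j. j:Ob J ==> l j:Hom PC x (fob D j)" using limitD(1)[OF lim] unfolding cone_PV[OF D] by auto
  have liD: "loc_iso (fob D j) (c (fob D j)) (ta (fob D j))" if "j:Ob J" for j using li[OF DT[OF that]] .
  have fobLD: "fob (comp_fctr L D) j = c (fob D j)" for j by (simp add: comp_fctr_def L(2))
  have Dta: "farr (comp_fctr L D) ph*ta (fob D (Dom J ph)) b v = ta (fob D (Cod J ph)) b (ev (farr D ph) b v)"
   if "ph:Arr J" "ob b" "v:fob (fob D (Dom J ph)) b" for ph b v
   using LA(4)[OF DH[OF that(1)] DT[OF J.Dom_Ob[OF that(1)]] DT[OF J.Cod_Ob[OF that(1)]] that(2,3)] by (simp add: comp_fctr_def)
  obtain th where th: "loc_iso x z th" "!!j b v. j:Ob J ==> ob b ==> v:fob x b ==> m j*th b v = ta (fob D j) b (ev (l j) b v)"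
   using loc_iso_limit[where c = "%j. c (fob D j)" and ta = "%j. ta (fob D j)", OF fin yoT lim liD LD fobLD Dta lim'] by blast
  \<comment> \<open>The chosen reflecting object of \<open>x\<close> and the limit vertex
    \<open>z\<close> are both universal for \<open>x\<close>, so they are isomorphic;
    \<open>k\<close> carries the images under \<open>L\<close> of the projections to the limit
    cone.\<close>
  obtain k k' where k: "is_inverse_pair C k k'" "dom k = c x" "cod k = z" "!!b v. ob b ==> v:fob x b ==> k*ta x b v = th b v"
   using univ_iso[OF u[OF xT] loc_iso_univ[OF th(1)]] by metis
  have ka: "arr k" using k(1) unfolding is_inverse_pair_def by blast
  note M = limitD[OF lim'] and Ll = LA[OF lH xT DT]
  have mk: "m j*k = farr L (l j)" if j: "j:Ob J" for j
  proof (rule univ_eq[OF u[OF xT]])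
   fix b v assume b: "ob b" "v:fob x b"
   show "(m j*k)*ta x b v = farr L (l j)*ta x b v"
    using Ll(4)[OF j j b] th(2)[OF j b] k(4)[OF b] M(3,4)[OF j] ka k(2,3) t(2-4)[OF xT b] by simp
  qed (use M(3-5)[OF j] ka k(2,3) Ll(1-3)[OF j j] fobLD in simp_all)
  have "is_cone J C (comp_fctr L D) (c x) (%j. farr L (l j))"
   unfolding cone_iff
  proof (intro conjI ballI t(1)[OF xT])
   fix j assume j: "j:Ob J"
   show "arr (farr L (l j))" "dom (farr L (l j)) = c x" "cod (farr L (l j)) = fob (comp_fctr L D) j"
    using Ll(1-3)[OF j j] fobLD by simp_all
  next
   fix ph assume ph: "ph:Arr J"
   show "farr (comp_fctr L D) ph*farr L (l (Dom J ph)) = farr L (l (Cod J ph))"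
    using Cmp_reassoc1[OF M(6)[OF ph], of k] M(3-5)[OF J.Dom_Ob[OF ph]] functorD(4,5)[OF LD ph] ka k(3)
     mk[OF J.Dom_Ob[OF ph]] mk[OF J.Cod_Ob[OF ph]] by simp
  qed
  from limit_of_iso[OF lim' LD this k(1-3) mk]
  show "is_limit J C (comp_fctr L D) (fob L x) (%j. farr L (l j))" unfolding L(2) by blast
 qed
 thus ?thesis unfolding Phi_exact_def Tp(1) using adj fincomp by blast
qed

lemma Phi_exact_rc:
 assumes rc: "is_Phi_rc U \<Phi>" shows "Phi_exact U \<Phi> C"
 by (rule exact_of_loc_isos[OF refl]) (use Phi_closed_loc_iso[OF rc] in blast)

end

theorem proposition5p12:
  fixes U :: "'u set set" and C :: "('o, 'a) cat" and \<Phi> :: "'u weights"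
  assumes "universe U"
    and "is_Phi_rc U \<Phi>"
    and "finitely_complete C"
    and "locally_small U C"
  shows "(Phi_exact U \<Phi> C \<longleftrightarrow> Barr_exact C \<and> zigzags_have_stable_colimits C) \<and>
    (Barr_exact C \<and> zigzags_have_stable_colimits C \<longleftrightarrow>
     Barr_exact C \<and> zigzags_have_stable_effective_unions C)"
proof -
 interpret lex_category C using assms(3) by unfold_locales
 interpret lex_loc_small C U using assms(1,4) by unfold_locales
 have "Barr_exact C & zigzags_have_stable_colimits C" if ex: "Phi_exact U \<Phi> C"
 proof -
  interpret univ_class C U "\<Inter>{S. Phi_closed U \<Phi> C S}" by (rule exact_univ_class[OF ex assms(2)])
  show ?thesis using Barr_exact_univ zigzags_have_stable_colimits_univ by blast
 qed
 moreover have "Phi_exact U \<Phi> C" if "Barr_exact C" "zigzags_have_stable_effective_unions C"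
 proof -
  interpret exact_site C U using that by unfold_locales
  show ?thesis by (rule Phi_exact_rc[OF assms(2)])
 qed
 ultimately show ?thesis using stable_colimits_iff_unions by blast
qed

end
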